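(* Let $n\ge 1$, and fix one of the following classes of subsets of $\mathbb{R}^n$: piecewise linear sets; semialgebraic sets; finitely subanalytic sets; or, more generally, the subsets of $\mathbb{R}^n$ belonging to some fixed o-minimal structure on $\mathbb{R}$. Let $\mathfrak X$ be the subset of the powerset of $\mathbb{R}^n$ generated under complement and finite union by the topologically closed upsets of $\mathbb{R}^n$ which belong to this class. Let $\mathrm{PerM}(\mathbb{R}^n)=\mathrm{Vect}^{\mathbb{R}^n}$ be the category of all $n$-parameter persistence modules over a fixed field $\mathbb{F}$, and let $\mathrm{PerM}_{\mathfrak X}(\mathbb{R}^n)$ be its full subcategory of those modules which are finitely encodable by an encoding map $e\colon\mathbb{R}^n\to\mathcal P$ all of whose fibers lie in $\mathfrak X$. Then the inclusion $\mathrm{PerM}_{\mathfrak X}(\mathbb{R}^n)\hookrightarrow \mathrm{PerM}(\mathbb{R}^n)$ makes $\mathrm{PerM}_{\mathfrak X}(\mathbb{R}^n)$ a full abelian subcategory of $\mathrm{PerM}(\mathbb{R}^n)$.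
   Context: $\mathbb{R}^n$ is a poset with the product (componentwise) order and carries its usual topology. An upset $U$ of a poset is a subset such that $p\in U$, $p\le q$ implies $q\in U$. $\mathrm{Vect}$ is the category of vector spaces over the fixed field $\mathbb{F}$. For a poset $\mathcal P$ (viewed as a category with a unique morphism $p\to q$ iff $p\le q$), $\mathrm{Vect}^{\mathcal P}$ is the category of functors $\mathcal P\to\mathrm{Vect}$; its objects are called persistence modules over $\mathcal P$. For a poset map $e$, $e^*$ denotes precomposition with $e$. Finite encoding: a persistence module $M\in\mathrm{Vect}^{\mathbb{R}^n}$ is finitely encodable by $e\colon\mathbb{R}^n\to\mathcal P$ if $\mathcal P$ is a finite poset, $e$ is a map of posets, and there are a pointwise finite dimensional $M'\in\mathrm{Vect}^{\mathcal P}$ and an isomorphism $M\cong e^*M'$. The fibers of $e$ are the sets $e^{-1}(p)$, $p\in\mathcal P$. O-minimal structure on $\mathbb{R}$ (van den Dries): a sequence $(\mathcal S_m)_{m\ge 0}$ where each $\mathcal S_m$ is a Boolean algebra of subsets of $\mathbb{R}^m$ such that: $A\in\mathcal S_m$ implies $\mathbb{R}\times A, A\times\mathbb{R}\in\mathcal S_{m+1}$; $\{x\in\mathbb{R}^m: x_1=x_m\}\in\mathcal S_m$; $A\in\mathcal S_{m+1}$ implies its projection to the first $m$ coordinates is in $\mathcal S_m$; $\{(x,y):x<y\}\in\mathcal S_2$; and $\mathcal S_1$ consists exactly of the finite unions of points and open intervals (possibly unbounded). Piecewise linear sets are finite unions of sets defined by finitely many affine-linear equations and strict inequalities; these, the semialgebraic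 sets and the finitely (i.e. globally) subanalytic sets are special cases of sets in an o-minimal structure. Full abelian subcategory: a full additive subcategory $\mathcal B$ of an abelian category $\mathcal A$ such that the kernel and cokernel, taken in $\mathcal A$, of every morphism of $\mathcal B$ are (up to isomorphism) in $\mathcal B$; equivalently $\mathcal B$ is abelian and the inclusion is exact. *)

theory Defs
  imports "HOL-Analysis.Analysis" "Jordan_Normal_Form.Missing_VectorSpace"
begin

section \<open>Abelian categories and full abelian subcategories\<close>

text \<open>
  Hom-sets are indexed by source and target and need not be disjoint;
  \<open>cmp C X Y Z g f\<close> is the composite of \<open>f : X \<rightarrow> Y\<close> followed by \<open>g : Y \<rightarrow> Z\<close>.
\<close>

record ('o, 'm) cat =
  ob :: "'o set"
  mor :: "'o \<Rightarrow> 'o \<Rightarrow> 'm set"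
  cmp :: "'o \<Rightarrow> 'o \<Rightarrow> 'o \<Rightarrow> 'm \<Rightarrow> 'm \<Rightarrow> 'm"
  idm :: "'o \<Rightarrow> 'm"
  zerom :: "'o \<Rightarrow> 'o \<Rightarrow> 'm"
  addm :: "'o \<Rightarrow> 'o \<Rightarrow> 'm \<Rightarrow> 'm \<Rightarrow> 'm"

definition category :: "('o, 'm) cat \<Rightarrow> bool" where
  "category C \<longleftrightarrow>
     (\<forall>X\<in>ob C. idm C X \<in> mor C X X) \<and>
     (\<forall>X\<in>ob C. \<forall>Y\<in>ob C. \<forall>Z\<in>ob C. \<forall>f\<in>mor C X Y. \<forall>g\<in>mor C Y Z. cmp C X Y Z g f \<in> mor C X Z) \<and>
     (\<forall>X\<in>ob C. \<forall>Y\<in>ob C. \<forall>f\<in>mor C X Y. cmp C X Y Y (idm C Y) f = f \<and> cmp C X X Y f (idm C X) = f) \<and>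
     (\<forall>W\<in>ob C. \<forall>X\<in>ob C. \<forall>Y\<in>ob C. \<forall>Z\<in>ob C. \<forall>f\<in>mor C W X. \<forall>g\<in>mor C X Y. \<forall>h\<in>mor C Y Z.
        cmp C W Y Z h (cmp C W X Y g f) = cmp C W X Z (cmp C X Y Z h g) f)"

definition isomorphic :: "('o, 'm) cat \<Rightarrow> 'o \<Rightarrow> 'o \<Rightarrow> bool" where
  "isomorphic C X Y \<longleftrightarrow> X \<in> ob C \<and> Y \<in> ob C \<and>
     (\<exists>f\<in>mor C X Y. \<exists>g\<in>mor C Y X. cmp C X Y X g f = idm C X \<and> cmp C Y X Y f g = idm C Y)"

definition preadditive :: "('o, 'm) cat \<Rightarrow> bool" where
  "preadditive C \<longleftrightarrow> category C \<and>
     (\<forall>X\<in>ob C. \<forall>Y\<in>ob C.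
        comm_group \<lparr>carrier = mor C X Y, monoid.mult = addm C X Y, one = zerom C X Y\<rparr>) \<and>
     (\<forall>X\<in>ob C. \<forall>Y\<in>ob C. \<forall>Z\<in>ob C.
        \<forall>f\<in>mor C X Y. \<forall>f'\<in>mor C X Y. \<forall>g\<in>mor C Y Z. \<forall>g'\<in>mor C Y Z.
          cmp C X Y Z g (addm C X Y f f') = addm C X Z (cmp C X Y Z g f) (cmp C X Y Z g f') \<and>
          cmp C X Y Z (addm C Y Z g g') f = addm C X Z (cmp C X Y Z g f) (cmp C X Y Z g' f))"

definition zero_object :: "('o, 'm) cat \<Rightarrow> 'o \<Rightarrow> bool" where
  "zero_object C Z \<longleftrightarrow> Z \<in> ob C \<and>
     (\<forall>X\<in>ob C. (\<exists>!f. f \<in> mor C Z X) \<and> (\<exists>!f. f \<in> mor C X Z))"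

definition biproduct :: "('o, 'm) cat \<Rightarrow> 'o \<Rightarrow> 'o \<Rightarrow> 'o \<Rightarrow> bool" where
  "biproduct C X Y B \<longleftrightarrow> B \<in> ob C \<and>
     (\<exists>i\<in>mor C X B. \<exists>j\<in>mor C Y B. \<exists>p\<in>mor C B X. \<exists>q\<in>mor C B Y.
        cmp C X B X p i = idm C X \<and> cmp C Y B Y q j = idm C Y \<and>
        cmp C Y B X p j = zerom C Y X \<and> cmp C X B Y q i = zerom C X Y \<and>
        addm C B B (cmp C B X B i p) (cmp C B Y B j q) = idm C B)"

definition additive_category :: "('o, 'm) cat \<Rightarrow> bool" where
  "additive_category C \<longleftrightarrow> preadditive C \<and> (\<exists>Z. zero_object C Z) \<and>
     (\<forall>X\<in>ob C. \<forall>Y\<in>ob C. \<exists>B. biproduct C X Y B)"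

definition is_kernel :: "('o, 'm) cat \<Rightarrow> 'o \<Rightarrow> 'o \<Rightarrow> 'm \<Rightarrow> 'o \<Rightarrow> 'm \<Rightarrow> bool" where
  "is_kernel C X Y f N k \<longleftrightarrow> N \<in> ob C \<and> k \<in> mor C N X \<and> cmp C N X Y f k = zerom C N Y \<and>
     (\<forall>W\<in>ob C. \<forall>g\<in>mor C W X. cmp C W X Y f g = zerom C W Y \<longrightarrow>
        (\<exists>!h. h \<in> mor C W N \<and> cmp C W N X k h = g))"

definition is_cokernel :: "('o, 'm) cat \<Rightarrow> 'o \<Rightarrow> 'o \<Rightarrow> 'm \<Rightarrow> 'o \<Rightarrow> 'm \<Rightarrow> bool" where
  "is_cokernel C X Y f Q c \<longleftrightarrow> Q \<in> ob C \<and> c \<in> mor C Y Q \<and> cmp C X Y Q c f = zerom C X Q \<and>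
     (\<forall>W\<in>ob C. \<forall>g\<in>mor C Y W. cmp C X Y W g f = zerom C X W \<longrightarrow>
        (\<exists>!h. h \<in> mor C Q W \<and> cmp C Y Q W h c = g))"

definition monic :: "('o, 'm) cat \<Rightarrow> 'o \<Rightarrow> 'o \<Rightarrow> 'm \<Rightarrow> bool" where
  "monic C X Y f \<longleftrightarrow> f \<in> mor C X Y \<and>
     (\<forall>W\<in>ob C. \<forall>g\<in>mor C W X. \<forall>h\<in>mor C W X. cmp C W X Y f g = cmp C W X Y f h \<longrightarrow> g = h)"

definition epic :: "('o, 'm) cat \<Rightarrow> 'o \<Rightarrow> 'o \<Rightarrow> 'm \<Rightarrow> bool" where
  "epic C X Y f \<longleftrightarrow> f \<in> mor C X Y \<and>
     (\<forall>W\<in>ob C. \<forall>g\<in>mor C Y W. \<forall>h\<in>mor C Y W. cmp C X Y W g f = cmp C X Y W h f \<longrightarrow> g = h)"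

definition abelian_category :: "('o, 'm) cat \<Rightarrow> bool" where
  "abelian_category C \<longleftrightarrow> additive_category C \<and>
     (\<forall>X\<in>ob C. \<forall>Y\<in>ob C. \<forall>f\<in>mor C X Y.
        (\<exists>N k. is_kernel C X Y f N k) \<and> (\<exists>Q c. is_cokernel C X Y f Q c)) \<and>
     (\<forall>X\<in>ob C. \<forall>Y\<in>ob C. \<forall>f. monic C X Y f \<longrightarrow>
        (\<exists>Z\<in>ob C. \<exists>g\<in>mor C Y Z. is_kernel C Y Z g X f)) \<and>
     (\<forall>X\<in>ob C. \<forall>Y\<in>ob C. \<forall>f. epic C X Y f \<longrightarrow>
        (\<exists>Z\<in>ob C. \<exists>g\<in>mor C Z X. is_cokernel C Z X g Y f))"

definition full_subcategory :: "('o, 'm) cat \<Rightarrow> ('o, 'm) cat \<Rightarrow> bool" where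
  "full_subcategory B A \<longleftrightarrow> ob B \<subseteq> ob A \<and> B = A\<lparr>ob := ob B\<rparr>"

text \<open>
  Kernels and cokernels are those of the ambient category \<open>A\<close>: their universal property is
  tested against all objects of \<open>A\<close>.
\<close>

definition full_abelian_subcategory :: "('o, 'm) cat \<Rightarrow> ('o, 'm) cat \<Rightarrow> bool" where
  "full_abelian_subcategory B A \<longleftrightarrow>
     abelian_category A \<and> full_subcategory B A \<and> additive_category B \<and>
     (\<forall>X\<in>ob B. \<forall>Y\<in>ob B. \<forall>f\<in>mor B X Y.
        (\<forall>N k. is_kernel A X Y f N k \<longrightarrow> (\<exists>N'\<in>ob B. isomorphic A N N')) \<and>
        (\<forall>Q c. is_cokernel A X Y f Q c \<longrightarrow> (\<exists>Q'\<in>ob B. isomorphic A Q Q')))"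


section \<open>Vector spaces and functors on posets\<close>

text \<open>
  \<open>Vect K\<close> consists of the \<open>K\<close>-vector spaces carried by an arbitrary subset of the type \<open>'u\<close>,
  which plays the role of the universe. If \<open>'u\<close> is infinite, then \<open>'u \<times> 'u\<close> injects into \<open>'u\<close> and
  binary direct sums exist up to isomorphism. Linear maps are taken extensional, so that they are
  equal as soon as they agree on the carrier of their source.
\<close>

definition Vect ::
  "('k, 'z) ring_scheme \<Rightarrow> (('k, 'u) module, 'u \<Rightarrow> 'u) cat" where
  "Vect K = \<lparr>
     ob = {V. vectorspace K V},
     mor = (\<lambda>V W. module_hom K V W \<inter> extensional (carrier V)),
     cmp = (\<lambda>U V W g f. compose (carrier U) g f),
     idm = (\<lambda>V. \<lambda>v\<in>carrier V. v),
     zerom = (\<lambda>V W. \<lambda>v\<in>carrier V. \<zero>\<^bsub>W\<^esub>),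
     addm = (\<lambda>V W f g. \<lambda>v\<in>carrier V. f v \<oplus>\<^bsub>W\<^esub> g v)\<rparr>"

record ('p, 'o, 'm) diagram =
  obj_at :: "'p \<Rightarrow> 'o"
  map_at :: "'p \<Rightarrow> 'p \<Rightarrow> 'm"

text \<open>
  The category of functors from the poset \<open>(P, r)\<close> to \<open>C\<close>. Only the values of a diagram on \<open>P\<close>
  and on pairs in \<open>r\<close> matter. Zero and sum of natural transformations are pointwise.
\<close>

definition functor_cat ::
  "'p set \<Rightarrow> 'p rel \<Rightarrow> ('o, 'm) cat \<Rightarrow> (('p, 'o, 'm) diagram, 'p \<Rightarrow> 'm) cat" where
  "functor_cat P r C = \<lparr>
     ob = {F. (\<forall>p\<in>P. obj_at F p \<in> ob C) \<and>
              (\<forall>(p, q)\<in>r. map_at F p q \<in> mor C (obj_at F p) (obj_at F q)) \<and>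
              (\<forall>p\<in>P. map_at F p p = idm C (obj_at F p)) \<and>
              (\<forall>p q s. (p, q) \<in> r \<longrightarrow> (q, s) \<in> r \<longrightarrow>
                 map_at F p s =
                   cmp C (obj_at F p) (obj_at F q) (obj_at F s) (map_at F q s) (map_at F p q))},
     mor = (\<lambda>F G. {\<eta> \<in> (\<Pi>\<^sub>E p\<in>P. mor C (obj_at F p) (obj_at G p)).
              \<forall>(p, q)\<in>r.
                cmp C (obj_at F p) (obj_at F q) (obj_at G q) (\<eta> q) (map_at F p q) =
                cmp C (obj_at F p) (obj_at G p) (obj_at G q) (map_at G p q) (\<eta> p)}),
     cmp = (\<lambda>F G H \<theta> \<eta>. \<lambda>p\<in>P. cmp C (obj_at F p) (obj_at G p) (obj_at H p) (\<theta> p) (\<eta> p)),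
     idm = (\<lambda>F. \<lambda>p\<in>P. idm C (obj_at F p)),
     zerom = (\<lambda>F G. \<lambda>p\<in>P. zerom C (obj_at F p) (obj_at G p)),
     addm = (\<lambda>F G \<eta> \<theta>. \<lambda>p\<in>P. addm C (obj_at F p) (obj_at G p) (\<eta> p) (\<theta> p))\<rparr>"

definition pullback :: "('p \<Rightarrow> 'q) \<Rightarrow> ('q, 'o, 'm) diagram \<Rightarrow> ('p, 'o, 'm) diagram" where
  "pullback e M = \<lparr>obj_at = (\<lambda>p. obj_at M (e p)), map_at = (\<lambda>p q. map_at M (e p) (e q))\<rparr>"


section \<open>Multiparameter persistence modules and finite encodings\<close>

text \<open>
  The \<open>n\<close>-dimensional real space is the library's \<^const>\<open>Euclidean_space\<close>: its points are the
  \<open>x :: nat \<Rightarrow> real\<close> with \<open>x i = 0\<close> for \<open>i \<ge> n\<close>, with coordinates numbered from 0. On such points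
  the pointwise order of functions is the componentwise order.
\<close>

abbreviation Rn :: "nat \<Rightarrow> (nat \<Rightarrow> real) set" where
  "Rn n \<equiv> topspace (Euclidean_space n)"

definition Rn_le :: "nat \<Rightarrow> (nat \<Rightarrow> real) rel" where
  "Rn_le n = {(x, y). x \<in> Rn n \<and> y \<in> Rn n \<and> x \<le> y}"

type_synonym ('p, 'k, 'u) pers_module = "('p, ('k, 'u) module, 'u \<Rightarrow> 'u) diagram"

definition PerM ::
  "('k, 'z) ring_scheme \<Rightarrow> nat \<Rightarrow>
   ((nat \<Rightarrow> real, 'k, 'u) pers_module, (nat \<Rightarrow> real) \<Rightarrow> 'u \<Rightarrow> 'u) cat" where
  "PerM K n = functor_cat (Rn n) (Rn_le n) (Vect K)"

definition finitely_encodable_by ::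
  "('k, 'z) ring_scheme \<Rightarrow> nat \<Rightarrow> 'q set \<Rightarrow> 'q rel \<Rightarrow> ((nat \<Rightarrow> real) \<Rightarrow> 'q) \<Rightarrow>
   (nat \<Rightarrow> real, 'k, 'u) pers_module \<Rightarrow> bool" where
  "finitely_encodable_by K n P r e M \<longleftrightarrow>
     finite P \<and> partial_order_on P r \<and>
     e \<in> Rn n \<rightarrow> P \<and> monotone_on (Rn n) (\<le>) (\<lambda>p q. (p, q) \<in> r) e \<and>
     (\<exists>M' \<in> ob (functor_cat P r (Vect K)).
        (\<forall>p\<in>P. vectorspace.fin_dim K (obj_at M' p)) \<and>
        isomorphic (PerM K n) M (pullback e M'))"

text \<open>
  Posets on subsets of \<^typ>\<open>nat\<close> suffice, as every finite poset is isomorphic to one of these.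
\<close>

definition PerM_sub ::
  "('k, 'z) ring_scheme \<Rightarrow> nat \<Rightarrow> (nat \<Rightarrow> real) set set \<Rightarrow>
   ((nat \<Rightarrow> real, 'k, 'u) pers_module, (nat \<Rightarrow> real) \<Rightarrow> 'u \<Rightarrow> 'u) cat" where
  "PerM_sub K n \<XX> = (PerM K n)\<lparr>ob := {M \<in> ob (PerM K n).
     \<exists>(P :: nat set) r e. finitely_encodable_by K n P r e M \<and>
       (\<forall>p\<in>P. {x \<in> Rn n. e x = p} \<in> \<XX>)}\<rparr>"


section \<open>O-minimal structures and the algebra generated by closed upsets\<close>

definition interval_or_point :: "real set \<Rightarrow> bool" where
  "interval_or_point I \<longleftrightarrow> (\<exists>a. I = {a}) \<or>
     (\<exists>a b. I = {a<..<b}) \<or> (\<exists>a. I = {a<..}) \<or> (\<exists>b. I = {..<b}) \<or> I = UNIV"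

text \<open>
  With coordinates numbered from 0 and padded by zeros, \<open>\<lambda>i. x (Suc i)\<close> drops the first
  coordinate of \<open>x \<in> Rn (Suc m)\<close> and \<open>x(m := 0)\<close> drops the last one.
  No arithmetic operation is required to be definable, so that the piecewise linear sets are an
  instance, besides the semialgebraic and the finitely subanalytic ones.
\<close>

locale o_minimal_structure =
  fixes S :: "nat \<Rightarrow> (nat \<Rightarrow> real) set set"
  assumes boolean_algebra: "Sigma_Algebra.algebra (Rn m) (S m)"
    and times_left: "A \<in> S m \<Longrightarrow> {x \<in> Rn (Suc m). (\<lambda>i. x (Suc i)) \<in> A} \<in> S (Suc m)"
    and times_right: "A \<in> S m \<Longrightarrow> {x \<in> Rn (Suc m). x(m := 0) \<in> A} \<in> S (Suc m)"
    and diagonal: "m \<ge> 1 \<Longrightarrow> {x \<in> Rn m. x 0 = x (m - 1)} \<in> S m"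
    and projection: "A \<in> S (Suc m) \<Longrightarrow> (\<lambda>x. x(m := 0)) ` A \<in> S m"
    and order: "{x \<in> Rn 2. x 0 < x 1} \<in> S 2"
    and one_dim: "S 1 = {{x \<in> Rn 1. x 0 \<in> \<Union>F} | F. finite F \<and> (\<forall>I\<in>F. interval_or_point I)}"

definition upset_of :: "'a::order set \<Rightarrow> 'a set \<Rightarrow> bool" where
  "upset_of X U \<longleftrightarrow> U \<subseteq> X \<and> (\<forall>p\<in>U. \<forall>q\<in>X. p \<le> q \<longrightarrow> q \<in> U)"

inductive_set closed_upset_algebra ::
  "nat \<Rightarrow> (nat \<Rightarrow> real) set set \<Rightarrow> (nat \<Rightarrow> real) set set"
  for n :: nat and D :: "(nat \<Rightarrow> real) set set" where
  generator: "closedin (Euclidean_space n) U \<Longrightarrow> upset_of (Rn n) U \<Longrightarrow> U \<in> D \<Longrightarrow>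
      U \<in> closed_upset_algebra n D"
| empty: "{} \<in> closed_upset_algebra n D"
| union: "A \<in> closed_upset_algebra n D \<Longrightarrow> B \<in> closed_upset_algebra n D \<Longrightarrow>
      A \<union> B \<in> closed_upset_algebra n D"
| complement: "A \<in> closed_upset_algebra n D \<Longrightarrow> Rn n - A \<in> closed_upset_algebra n D"

end

theory Submission
  imports Defs
begin

text \<open>
  Kernels and cokernels of persistence modules are computed pointwise, and if a morphism is the
  pullback of a morphism of modules over a finite poset, then so are its kernel and cokernel. Two
  encodable modules have a common encoding \<open>e\<close>, but a morphism between them need not be constant on
  the fibres of \<open>e\<close>. By naturality it is constant on the classes of the equivalence relation
  generated by the pairs \<open>x \<le> y\<close> with \<open>e x = e y\<close>, and it remains to encode both modules by these classes.

  A Boolean combination of closed upsets is locally constant to the right. Hence the classes are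
  unions of connected pieces of the fibres, and by o-minimality the fibres have finitely many
  definable connected pieces. This decomposition comes with uniform bounds for the cardinality of finite
  fibres. As no field operations are assumed to be definable, the proof avoids metrics and curve
  selection. It uses instead that a countable definable subset of the line is finite, together with
  Baire category arguments over boxes with rational corners.
\<close>

section \<open>Definable predicates\<close>

text \<open>The obstacle: a fibre of an encoding may have several components that no chain of
  comparable points links inside it, and a morphism may act differently on each of them, so its
  kernel need not be encoded by the same map. Cell decomposition enters in a weak form, without
  cells bounded by continuous functions. Bounds on finite fibres (\<open>uniformly_finite j\<close>
  for all \<open>j < m\<close>) give pieces that are order-convex in one coordinate, these give
  connected pieces of sets in \<open>m\<close> coordinates, and connected pieces give
  \<open>uniformly_finite m\<close>; all three statements hold by one induction. Connectedness is
  tested with arbitrary locally constant predicates. Definable ones would not suffice, because the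
  equivalence classes to be propagated along a piece are only known to be definable once the
  decomposition is available. The classes are ordered by a transitive closure. It is antisymmetric
  because the old encoding is monotone and constant on classes, and a comparable pair with equal old
  value never leaves its class.\<close>

definition depends :: "nat \<Rightarrow> ((nat \<Rightarrow> real) \<Rightarrow> bool) \<Rightarrow> bool" where
  "depends n P \<longleftrightarrow> (\<forall>x y. (\<forall>i<n. x i = y i) \<longrightarrow> P x = P y)"

lemma dependsD: "depends n P \<Longrightarrow> (\<And>i. i < n \<Longrightarrow> x i = y i) \<Longrightarrow> P x = P y"
  unfolding depends_def by blast

lemma depends_mono: "depends n P \<Longrightarrow> n \<le> m \<Longrightarrow> depends m P"
  unfolding depends_def by (meson less_le_trans)

text \<open>No arithmetic is assumed to be definable, so only coordinates and real constants can be
  substituted. The constants allow real parameters in definable predicates, such as the corners of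
  rational boxes.\<close>

definition flat_term :: "((nat \<Rightarrow> real) \<Rightarrow> real) \<Rightarrow> bool" where
  "flat_term t \<longleftrightarrow> (\<exists>i. t = (\<lambda>x. x i)) \<or> (\<exists>c. t = (\<lambda>_. c))"

definition env_term :: "((nat \<Rightarrow> nat \<Rightarrow> real) \<Rightarrow> real) \<Rightarrow> bool" where
  "env_term t \<longleftrightarrow> (\<exists>b i. t = (\<lambda>\<rho>. \<rho> b i)) \<or> (\<exists>c. t = (\<lambda>_. c))"

lemma env_term_var: "env_term (\<lambda>\<rho>. \<rho> b i)" and env_term_const: "env_term (\<lambda>_. c)"
  unfolding env_term_def by blast+

lemma env_term_if: "env_term t \<Longrightarrow> env_term u \<Longrightarrow> env_term (\<lambda>\<rho>. if b then t \<rho> else u \<rho>)"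
  by (cases b) auto

lemma env_term_upd: "env_term (\<lambda>\<rho>. f \<rho> i) \<Longrightarrow> env_term v \<Longrightarrow> env_term (\<lambda>\<rho>. ((f \<rho>)(m := v \<rho>)) i)"
  by (cases "i = m") auto

context o_minimal_structure
begin

text \<open>
  A subset of \<open>\<real>\<^sup>n\<close> is represented by a predicate on all sequences that depends only on the
  first \<open>n\<close> coordinates. This makes the notion of definability independent of the dimension.
\<close>

definition dim_definable :: "nat \<Rightarrow> ((nat \<Rightarrow> real) \<Rightarrow> bool) \<Rightarrow> bool" where
  "dim_definable n P \<longleftrightarrow> depends n P \<and> {x \<in> Rn n. P x} \<in> S n"

definition definable :: "((nat \<Rightarrow> real) \<Rightarrow> bool) \<Rightarrow> bool" where
  "definable P \<longleftrightarrow> (\<exists>n. dim_definable n P)"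

lemma dim_definable_Suc: "dim_definable n P \<Longrightarrow> dim_definable (Suc n) P"
proof -
  assume P: "dim_definable n P"
  have "{x \<in> Rn (Suc n). x(n := 0) \<in> {x \<in> Rn n. P x}} = {x \<in> Rn (Suc n). P x}"
  proof -
    have "x(n := 0) \<in> Rn n" if "x \<in> Rn (Suc n)" for x
      using that by (auto simp: topspace_Euclidean_space)
    moreover have "P (x(n := 0)) = P x" for x
      using P by (intro dependsD[of n]) (auto simp: dim_definable_def)
    ultimately show ?thesis by auto
  qed
  then show ?thesis
    using P times_right[of "{x \<in> Rn n. P x}" n] depends_mono[of n P "Suc n"]
    by (simp add: dim_definable_def)
qed

lemma dim_definable_mono: "n \<le> m \<Longrightarrow> dim_definable n P \<Longrightarrow> dim_definable m P"
  by (induction m rule: dec_induct) (auto intro: dim_definable_Suc)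

text \<open>Iterates \<open>times_left\<close>, which puts dummy coordinates in front. Combined with
  padding on the right, this moves a predicate to coordinates that are not in use elsewhere.\<close>

lemma dim_definable_shift:
  "dim_definable n P \<Longrightarrow> dim_definable (n + k) (\<lambda>x. P (\<lambda>i. x (i + k)))"
proof (induction k)
  case (Suc k)
  let ?P = "\<lambda>x. P (\<lambda>i. x (i + k))"
  have P: "dim_definable (n + k) ?P" using Suc by simp
  have "depends (n + Suc k) (\<lambda>x. P (\<lambda>i. x (i + Suc k)))"
    unfolding depends_def
  proof (intro allI impI)
    fix x y :: "nat \<Rightarrow> real" assume "\<forall>i<n + Suc k. x i = y i"
    then show "P (\<lambda>i. x (i + Suc k)) = P (\<lambda>i. y (i + Suc k))"
      using Suc.prems by (intro dependsD[of n]) (auto simp: dim_definable_def)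
  qed
  moreover have "{x \<in> Rn (Suc (n + k)). (\<lambda>i. x (Suc i)) \<in> {x \<in> Rn (n + k). ?P x}} =
      {x \<in> Rn (Suc (n + k)). P (\<lambda>i. x (i + Suc k))}"
    by (auto simp: topspace_Euclidean_space)
  ultimately show ?case
    using P times_left[of "{x \<in> Rn (n + k). ?P x}" "n + k"] by (simp add: dim_definable_def)
qed simp

lemma dim_definable_not: "dim_definable n P \<Longrightarrow> dim_definable n (\<lambda>x. \<not> P x)"
proof -
  assume P: "dim_definable n P"
  interpret B: Sigma_Algebra.algebra "Rn n" "S n" by (rule boolean_algebra)
  have "{x \<in> Rn n. \<not> P x} = Rn n - {x \<in> Rn n. P x}" by auto
  then show ?thesis using P B.compl_sets
    by (auto simp: dim_definable_def depends_def)
qed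

lemma dim_definable_conj:
  "dim_definable n P \<Longrightarrow> dim_definable n Q \<Longrightarrow> dim_definable n (\<lambda>x. P x \<and> Q x)"
proof -
  assume P: "dim_definable n P" and Q: "dim_definable n Q"
  interpret B: Sigma_Algebra.algebra "Rn n" "S n" by (rule boolean_algebra)
  have "{x \<in> Rn n. P x \<and> Q x} = {x \<in> Rn n. P x} \<inter> {x \<in> Rn n. Q x}" by auto
  moreover have "depends n (\<lambda>x. P x \<and> Q x)"
    using P Q unfolding dim_definable_def depends_def by (metis (no_types, lifting))
  ultimately show ?thesis using P Q B.Int
    by (simp add: dim_definable_def)
qed

lemma definable_not: "definable P \<Longrightarrow> definable (\<lambda>x. \<not> P x)"
  unfolding definable_def by (blast intro: dim_definable_not)

lemma definable_conj: "definable P \<Longrightarrow> definable Q \<Longrightarrow> definable (\<lambda>x. P x \<and> Q x)"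
proof -
  assume "definable P" and "definable Q"
  then obtain n m where "dim_definable n P" "dim_definable m Q" unfolding definable_def by blast
  then have "dim_definable (max n m) P" "dim_definable (max n m) Q"
    using dim_definable_mono[of n "max n m" P] dim_definable_mono[of m "max n m" Q] by simp_all
  then show ?thesis unfolding definable_def by (blast intro: dim_definable_conj)
qed

lemma definable_True: "definable (\<lambda>_. True)"
proof -
  interpret B: Sigma_Algebra.algebra "Rn 0" "S 0" by (rule boolean_algebra)
  show ?thesis unfolding definable_def dim_definable_def depends_def
    by (intro exI[of _ 0]) (use B.top in auto)
qed

lemma definable_all_less:
  "(\<And>i. i < k \<Longrightarrow> definable (P i)) \<Longrightarrow> definable (\<lambda>x. \<forall>i<k. P i x)" for k :: nat
proof (induction k)
  case (Suc k)
  have "definable (\<lambda>x. (\<forall>i<k. P i x) \<and> P k x)"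
    by (rule definable_conj) (simp_all add: Suc)
  then show ?case by (simp only: All_less_Suc conj_commute)
qed (simp add: definable_True)

text \<open>Iterates \<open>projection\<close>, removing the last coordinate each time. The
  quantified \<open>y\<close> replaces all coordinates from \<open>n\<close> on, not just
  \<open>k\<close> of them; the surplus is harmless because \<open>P\<close> reads only the first
  \<open>n + k\<close>.\<close>

lemma dim_definable_proj:
  "dim_definable (n + k) P \<Longrightarrow> dim_definable n (\<lambda>x. \<exists>y. P (\<lambda>i. if n \<le> i then y i else x i))"
proof (induction k arbitrary: P)
  case 0
  have "(\<exists>y. P (\<lambda>i. if n \<le> i then y i else x i)) = P x" for x
  proof -
    have "P (\<lambda>i. if n \<le> i then y i else x i) = P x" for y
      using 0 by (intro dependsD[of n]) (auto simp: dim_definable_def)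
    then show ?thesis by simp
  qed
  then show ?case using 0 by simp
next
  case (Suc k)
  let ?m = "n + k"
  let ?Q = "\<lambda>x. \<exists>v. P (x(?m := v))"
  have dep: "depends (Suc ?m) P" using Suc.prems by (simp add: dim_definable_def)
  have dQ: "depends ?m ?Q"
    unfolding depends_def
  proof (intro allI impI)
    fix x y :: "nat \<Rightarrow> real" assume "\<forall>i<?m. x i = y i"
    then have "P (x(?m := v)) = P (y(?m := v))" for v
      by (intro dependsD[OF dep]) (auto simp: less_Suc_eq)
    then show "?Q x = ?Q y" by simp
  qed
  have "(\<lambda>x. x(?m := 0)) ` {x \<in> Rn (Suc ?m). P x} = {x \<in> Rn ?m. ?Q x}"
  proof (intro equalityI subsetI)
    fix z assume "z \<in> {x \<in> Rn ?m. ?Q x}"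
    then obtain v where z: "z \<in> Rn ?m" "P (z(?m := v))" by auto
    then have "z(?m := v) \<in> {x \<in> Rn (Suc ?m). P x}" "z = (z(?m := v))(?m := 0)"
      by (auto simp: topspace_Euclidean_space)
    then show "z \<in> (\<lambda>x. x(?m := 0)) ` {x \<in> Rn (Suc ?m). P x}" by blast
  next
    fix z assume "z \<in> (\<lambda>x. x(?m := 0)) ` {x \<in> Rn (Suc ?m). P x}"
    then obtain x where x: "x \<in> Rn (Suc ?m)" "P x" "z = x(?m := 0)" by auto
    then have "P (x(?m := x ?m))" by (simp only: fun_upd_triv)
    then have "\<exists>v. P (x(?m := v))" by blast
    then show "z \<in> {x \<in> Rn ?m. ?Q x}" using x by (auto simp: topspace_Euclidean_space)
  qed
  then have "dim_definable ?m ?Q"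
    using dQ Suc.prems projection[of "{x \<in> Rn (Suc ?m). P x}" ?m]
    by (simp add: dim_definable_def)
  from Suc.IH[OF this]
  have IH: "dim_definable n (\<lambda>x. \<exists>y v. P ((\<lambda>i. if n \<le> i then y i else x i)(?m := v)))" .
  let ?ext = "\<lambda>y x i. if n \<le> i then y i else x i :: real"
  have ext_upd: "(?ext y x)(?m := v) = ?ext (y(?m := v)) x" for x y v by (simp add: fun_eq_iff)
  have eq: "(\<exists>y v. P ((?ext y x)(?m := v))) = (\<exists>y. P (?ext y x))" for x
  proof (intro iffI; elim exE)
    fix y v assume "P ((?ext y x)(?m := v))"
    then show "\<exists>y. P (?ext y x)" unfolding ext_upd by (rule exI[of "\<lambda>y. P (?ext y x)"])
  next
    fix y assume "P (?ext y x)"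
    then have "P ((?ext y x)(?m := y ?m))" unfolding ext_upd fun_upd_triv .
    then show "\<exists>y v. P ((?ext y x)(?m := v))" by (intro exI)
  qed
  show ?case using IH by (simp only: eq)
qed

text \<open>The axiom \<open>diagonal\<close> compares only the first and the last coordinate of a
  space. In dimension \<open>j - i + 1\<close>, a shift by \<open>i\<close> turns them into the
  coordinates \<open>i\<close> and \<open>j\<close>.\<close>

lemma definable_eq_le: "i \<le> j \<Longrightarrow> definable (\<lambda>x. x i = x j)"
proof -
  assume "i \<le> j"
  have "dim_definable (Suc (j - i)) (\<lambda>x. x 0 = x (j - i))"
    using diagonal[of "Suc (j - i)"] by (auto simp: dim_definable_def depends_def)
  from dim_definable_shift[OF this, of i] show ?thesis
    using \<open>i \<le> j\<close> by (auto simp: definable_def)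
qed

lemma definable_eq: "definable (\<lambda>x. x i = x j)"
proof (cases "i \<le> j")
  case False
  then have "definable (\<lambda>x. x j = x i)" by (intro definable_eq_le) simp
  then show ?thesis by (simp only: eq_commute)
qed (rule definable_eq_le)

lemma dim_definable_1:
  "finite F \<Longrightarrow> \<forall>I\<in>F. interval_or_point I \<Longrightarrow> dim_definable 1 (\<lambda>x. x 0 \<in> \<Union>F)"
  unfolding dim_definable_def one_dim by (auto simp: depends_def)

lemma definable_eq_const: "definable (\<lambda>x. x i = c)"
proof -
  have "dim_definable 1 (\<lambda>x. x 0 \<in> \<Union>{{c}})"
    by (rule dim_definable_1) (auto simp: interval_or_point_def)
  from dim_definable_shift[OF this, of i] show ?thesis by (auto simp: definable_def)
qed

lemma definable_eq_term: "flat_term t \<Longrightarrow> definable (\<lambda>x. x i = t x)"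
  unfolding flat_term_def using definable_eq definable_eq_const by auto

text \<open>Substitution as a projection: the arguments of \<open>P\<close> are placed at the fresh
  coordinates from \<open>m\<close> on, equated with the terms, and quantified away. Only the first
  \<open>n\<close> arguments matter, and \<open>m\<close> exceeds every coordinate read by their
  terms, so nothing clashes.\<close>

lemma definable_subst:
  assumes P: "definable P" and t: "\<And>j. flat_term (t j)"
  shows "definable (\<lambda>x. P (\<lambda>j. t j x))"
proof -
  obtain n where n: "dim_definable n P" using P by (auto simp: definable_def)
  have "\<exists>k. \<forall>x y. (\<forall>i<k. x i = y i) \<longrightarrow> t j x = t j y" for j
    using t[of j] unfolding flat_term_def
  proof
    assume "\<exists>i. t j = (\<lambda>x. x i)"
    then obtain i where "t j = (\<lambda>x. x i)" ..
    then show ?thesis by (intro exI[of _ "Suc i"]) auto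
  qed auto
  then obtain k where k: "\<And>j x y. (\<forall>i<k j. x i = y i) \<Longrightarrow> t j x = t j y"
    by metis
  define m where "m = Max (k ` {..<n} \<union> {0})"
  have km: "j < n \<Longrightarrow> k j \<le> m" for j unfolding m_def by (intro Max_ge) auto
  let ?R = "\<lambda>x. P (\<lambda>i. x (i + m)) \<and> (\<forall>j<n. x (m + j) = t j x)"
  have "definable (\<lambda>x. P (\<lambda>i. x (i + m)))"
    using dim_definable_shift[OF n] by (auto simp: definable_def)
  then have "definable ?R"
    by (intro definable_conj definable_all_less definable_eq_term t)
  then obtain N where "dim_definable N ?R" by (auto simp: definable_def)
  then have "dim_definable (m + N) ?R" by (rule dim_definable_mono[rotated]) simp
  from dim_definable_proj[OF this]
  have "definable (\<lambda>x. \<exists>y. ?R (\<lambda>i. if m \<le> i then y i else x i))"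
    unfolding definable_def by blast
  moreover have eq: "(\<exists>y. ?R (\<lambda>i. if m \<le> i then y i else x i)) = P (\<lambda>j. t j x)" for x
  proof -
    have tj: "t j (\<lambda>i. if m \<le> i then y i else x i) = t j x" if "j < n" for j and y :: "nat \<Rightarrow> real"
      by (rule k) (use km[OF that] in auto)
    show ?thesis
    proof
      assume "\<exists>y. ?R (\<lambda>i. if m \<le> i then y i else x i)"
      then obtain y where y: "P (\<lambda>i. y (i + m))" "\<forall>j<n. y (m + j) = t j x"
        by (auto simp: tj)
      have "P (\<lambda>i. y (i + m)) = P (\<lambda>j. t j x)"
        using n y(2) by (intro dependsD[of n]) (auto simp: dim_definable_def add.commute)
      then show "P (\<lambda>j. t j x)" using y by simp
    next
      assume "P (\<lambda>j. t j x)"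
      then show "\<exists>y. ?R (\<lambda>i. if m \<le> i then y i else x i)"
        by (intro exI[of _ "\<lambda>i. t (i - m) x"]) (simp add: tj)
    qed
  qed
  ultimately show ?thesis by (simp only: eq)
qed

lemma flat_term_var: "flat_term (\<lambda>x. x i)" and flat_term_const: "flat_term (\<lambda>_. c)"
  unfolding flat_term_def by blast+

lemma definable_less: "definable (\<lambda>x. x 0 < x (Suc 0))"
  using order unfolding definable_def dim_definable_def
  by (intro exI[of _ 2]) (auto simp: depends_def)

text \<open>The coordinates in \<open>J\<close> may be scattered. They are renamed from
  \<open>j\<close> to \<open>n + j\<close>, beyond everything \<open>P\<close> reads, so that they
  belong to the final block that \<open>dim_definable_proj\<close> quantifies.\<close>

lemma definable_ex_block:
  assumes "definable P"
  shows "definable (\<lambda>x. \<exists>y. P (\<lambda>j. if j \<in> J then y j else x j))"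
proof -
  obtain n where n: "dim_definable n P" using assms by (auto simp: definable_def)
  define P' where "P' = (\<lambda>x. P (\<lambda>j. x (if j \<in> J then n + j else j)))"
  have "definable P'"
    unfolding P'_def by (rule definable_subst[OF assms]) (rule flat_term_var)
  then obtain m where "dim_definable m P'" by (auto simp: definable_def)
  then have "dim_definable (n + m) P'" by (rule dim_definable_mono[rotated]) simp
  from dim_definable_proj[OF this]
  have "definable (\<lambda>x. \<exists>y. P' (\<lambda>i. if n \<le> i then y i else x i))"
    unfolding definable_def by blast
  moreover have eq: "(\<exists>y. P' (\<lambda>i. if n \<le> i then y i else x i)) =
      (\<exists>y. P (\<lambda>j. if j \<in> J then y j else x j))" for x
  proof -
    have eq: "P' (\<lambda>i. if n \<le> i then y i else x i) = P (\<lambda>j. if j \<in> J then y (n + j) else x j)" for y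
      unfolding P'_def using n by (intro dependsD[of n]) (auto simp: dim_definable_def)
    show ?thesis unfolding eq
    proof
      assume "\<exists>y. P (\<lambda>j. if j \<in> J then y j else x j)"
      then obtain y where "P (\<lambda>j. if j \<in> J then y j else x j)" by blast
      then show "\<exists>y. P (\<lambda>j. if j \<in> J then y (n + j) else x j)"
        by (intro exI[of _ "\<lambda>i. y (i - n)"]) (simp cong: if_cong)
    next
      assume "\<exists>y. P (\<lambda>j. if j \<in> J then y (n + j) else x j)"
      then obtain y where "P (\<lambda>j. if j \<in> J then y (n + j) else x j)" by blast
      then show "\<exists>y. P (\<lambda>j. if j \<in> J then y j else x j)"
        by (intro exI[of _ "\<lambda>j. y (n + j)"])
    qed
  qed
  ultimately show ?thesis by (simp only: eq)
qed

text \<open>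
  Formulas are evaluated in environments \<open>\<rho>\<close> of countably many vectors, addressed by de Bruijn
  indices: a quantifier turns the variable \<open>\<rho> b\<close> into \<open>\<rho> (Suc b)\<close> and binds \<open>\<rho> 0\<close>.
\<close>

definition env_definable :: "((nat \<Rightarrow> nat \<Rightarrow> real) \<Rightarrow> bool) \<Rightarrow> bool" where
  "env_definable Q \<longleftrightarrow> definable (\<lambda>x. Q (\<lambda>b i. x (prod_encode (b, i))))"

text \<open>Entry point of the formula calculus: substituting the same sequence for every vector of
  the environment turns an environment predicate back into a predicate on sequences.\<close>

lemma definableI:
  assumes "env_definable (\<lambda>\<rho>. A (\<rho> 0))" shows "definable A"
proof -
  have "definable (\<lambda>x. (\<lambda>x. A (\<lambda>i. x (prod_encode (0, i)))) (\<lambda>j. x (snd (prod_decode j))))"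
    by (rule definable_subst[where t = "\<lambda>j x. x (snd (prod_decode j))"])
      (use assms in \<open>auto simp: env_definable_def flat_term_var\<close>)
  then show ?thesis by simp
qed

text \<open>The atomic case. The argument may be assembled coordinate by coordinate from variables
  and constants, which covers updated vectors such as \<open>x(m := t)\<close>.\<close>

lemma env_definable_app:
  assumes "definable A" and "\<And>i. env_term (\<lambda>\<rho>. T \<rho> i)"
  shows "env_definable (\<lambda>\<rho>. A (T \<rho>))"
  unfolding env_definable_def
proof -
  have "flat_term (\<lambda>x. T (\<lambda>b i. x (prod_encode (b, i))) i)" for i
  proof -
    from assms(2)[of i] consider b j where "(\<lambda>\<rho>. T \<rho> i) = (\<lambda>\<rho>. \<rho> b j)" | c where "(\<lambda>\<rho>. T \<rho> i) = (\<lambda>_. c)"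
      unfolding env_term_def by blast
    then show ?thesis by cases (auto simp: fun_eq_iff flat_term_def)
  qed
  from definable_subst[OF assms(1) this]
  show "definable (\<lambda>x. A (T (\<lambda>b i. x (prod_encode (b, i)))))" by simp
qed

lemma env_definable_not: "env_definable P \<Longrightarrow> env_definable (\<lambda>\<rho>. \<not> P \<rho>)"
  and env_definable_conj: "env_definable P \<Longrightarrow> env_definable Q \<Longrightarrow> env_definable (\<lambda>\<rho>. P \<rho> \<and> Q \<rho>)"
  unfolding env_definable_def by (rule definable_not, assumption) (rule definable_conj)

lemma env_definable_disj:
  "env_definable P \<Longrightarrow> env_definable Q \<Longrightarrow> env_definable (\<lambda>\<rho>. P \<rho> \<or> Q \<rho>)"
  using env_definable_not[OF env_definable_conj[OF env_definable_not[of P] env_definable_not[of Q]]]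
  by simp

lemma env_definable_imp:
  "env_definable P \<Longrightarrow> env_definable Q \<Longrightarrow> env_definable (\<lambda>\<rho>. P \<rho> \<longrightarrow> Q \<rho>)"
  using env_definable_disj[OF env_definable_not[of P], of Q] by simp

lemma env_definable_iff:
  "env_definable P \<Longrightarrow> env_definable Q \<Longrightarrow> env_definable (\<lambda>\<rho>. P \<rho> = Q \<rho>)"
  unfolding iff_conv_conj_imp by (intro env_definable_conj env_definable_imp)

lemma env_definable_bool: "env_definable (\<lambda>_. b)"
proof -
  have "definable (\<lambda>_. b)" using definable_True definable_not[OF definable_True] by (cases b) auto
  then show ?thesis by (simp add: env_definable_def)
qed

lemma env_definable_all_less:
  "(\<And>i. i < k \<Longrightarrow> env_definable (P i)) \<Longrightarrow> env_definable (\<lambda>\<rho>. \<forall>i<k. P i \<rho>)" for k :: nat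
  unfolding env_definable_def by (rule definable_all_less)

lemma env_definable_less:
  assumes "env_term t" "env_term u" shows "env_definable (\<lambda>\<rho>. t \<rho> < u \<rho>)"
proof -
  have "env_definable (\<lambda>\<rho>. (if (0::nat) = 0 then t \<rho> else u \<rho>) < (if Suc 0 = 0 then t \<rho> else u \<rho>))"
    by (rule env_definable_app[OF definable_less, of "\<lambda>\<rho> i. if i = 0 then t \<rho> else u \<rho>"])
      (intro env_term_if assms)
  then show ?thesis by simp
qed

lemma env_definable_le:
  assumes "env_term t" "env_term u" shows "env_definable (\<lambda>\<rho>. t \<rho> \<le> u \<rho>)"
  using env_definable_not[OF env_definable_less[OF assms(2,1)]] by (simp add: not_less)

lemma env_definable_eq:
  assumes "env_term t" "env_term u" shows "env_definable (\<lambda>\<rho>. t \<rho> = u \<rho>)"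
  using env_definable_conj[OF env_definable_le[OF assms] env_definable_le[OF assms(2,1)]]
  by (simp add: eq_iff)

text \<open>The vector with index 0 occupies the codes \<open>prod_encode (0, i)\<close>. These form
  one block to be quantified; afterwards the remaining indices have to be lowered by one.\<close>

lemma env_definable_ex:
  assumes "env_definable (\<lambda>\<rho>. Q (\<lambda>b. \<rho> (Suc b)) (\<rho> 0))"
  shows "env_definable (\<lambda>\<rho>. \<exists>y. Q \<rho> y)"
proof -
  let ?P = "\<lambda>x. Q (\<lambda>b i. x (prod_encode (Suc b, i))) (\<lambda>i. x (prod_encode (0, i)))"
  let ?J = "range (\<lambda>i. prod_encode (0, i))"
  have "definable ?P" using assms by (simp add: env_definable_def)
  from definable_ex_block[OF this, of ?J]
  have "definable (\<lambda>x. \<exists>y. Q (\<lambda>b i. x (prod_encode (Suc b, i))) (\<lambda>i. y (prod_encode (0, i))))"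
    by (simp add: image_iff)
  moreover have eq: "(\<exists>y. Q r (\<lambda>i. y (prod_encode (0, i)))) = (\<exists>y. Q r y)" for r
  proof
    assume "\<exists>y. Q r y"
    then obtain y where "Q r y" by blast
    then show "\<exists>y. Q r (\<lambda>i. y (prod_encode (0, i)))"
      by (intro exI[of _ "\<lambda>j. y (snd (prod_decode j))"]) simp
  qed blast
  ultimately have "definable (\<lambda>x. \<exists>y. Q (\<lambda>b i. x (prod_encode (Suc b, i))) y)"
    by (simp only: eq)
  \<comment> \<open>The predecessor undoes the \<open>Suc\<close> of the binder. At index 0 the
    truncated subtraction yields 0 again, but those coordinates are no longer read.\<close>
  from definable_subst[OF this flat_term_var, of "\<lambda>j. prod_encode (fst (prod_decode j) - 1, snd (prod_decode j))"]
  show ?thesis by (simp add: env_definable_def)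
qed

text \<open>A real variable is represented by coordinate 0 of a bound vector.\<close>

lemma env_definable_ex_real:
  assumes "env_definable (\<lambda>\<rho>. Q (\<lambda>b. \<rho> (Suc b)) (\<rho> 0 0))"
  shows "env_definable (\<lambda>\<rho>. \<exists>v::real. Q \<rho> v)"
proof -
  have eq: "(\<exists>v. Q \<rho> v) = (\<exists>y::nat \<Rightarrow> real. Q \<rho> (y 0))" for \<rho>
  proof
    assume "\<exists>v. Q \<rho> v"
    then obtain v where "Q \<rho> v" ..
    then show "\<exists>y::nat \<Rightarrow> real. Q \<rho> (y 0)" by (intro exI[of _ "\<lambda>_. v"])
  qed blast
  show ?thesis unfolding eq by (rule env_definable_ex) (rule assms)
qed

lemma env_definable_all:
  assumes "env_definable (\<lambda>\<rho>. Q (\<lambda>b. \<rho> (Suc b)) (\<rho> 0))"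
  shows "env_definable (\<lambda>\<rho>. \<forall>y. Q \<rho> y)"
  using env_definable_not[OF env_definable_ex[OF env_definable_not[OF assms]]] by simp

lemma env_definable_all_real:
  assumes "env_definable (\<lambda>\<rho>. Q (\<lambda>b. \<rho> (Suc b)) (\<rho> 0 0))"
  shows "env_definable (\<lambda>\<rho>. \<forall>v::real. Q \<rho> v)"
  using env_definable_not[OF env_definable_ex_real[OF env_definable_not[OF assms]]] by simp

text \<open>With these rules definability follows from the shape of a formula; only the definable
  predicates occurring in it have to be supplied through \<open>env_definable_app\<close>.\<close>

lemmas env_definable_intros =
  env_definable_not env_definable_conj env_definable_disj env_definable_imp env_definable_iff
  env_definable_bool env_definable_all_less env_definable_less env_definable_le env_definable_eq
  env_definable_ex env_definable_ex_real env_definable_all env_definable_all_real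
  env_term_var env_term_const env_term_if env_term_upd

text \<open>Here o-minimality enters: after fixing all coordinates but one as real parameters, what
  is left is a definable subset of the line.\<close>

lemma definable_section:
  assumes "definable A"
  obtains F where "finite F" "\<forall>I\<in>F. interval_or_point I" "{t. A (s(k := t))} = \<Union>F"
proof -
  have "flat_term (\<lambda>x. (s(k := x 0)) j)" for j
    by (cases "j = k") (simp_all add: flat_term_var flat_term_const)
  from definable_subst[OF assms this, of "\<lambda>j. j"]
  obtain n where n: "dim_definable n (\<lambda>x. A (s(k := x 0)))" unfolding definable_def by blast
  then have n': "dim_definable (1 + n) (\<lambda>x. A (s(k := x 0)))" by (rule dim_definable_mono[rotated]) simp
  \<comment> \<open>The predicate reads only coordinate 0, so quantifying the other coordinates is
    vacuous and merely lowers the dimension to 1, where \<open>one_dim\<close> applies.\<close>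
  from dim_definable_proj[OF this] have "dim_definable 1 (\<lambda>x. A (s(k := x 0)))"
    by (simp cong: if_cong)
  then have "{x \<in> Rn 1. A (s(k := x 0))} \<in> S 1" by (simp add: dim_definable_def)
  then obtain F where F: "{x \<in> Rn 1. A (s(k := x 0))} = {x \<in> Rn 1. x 0 \<in> \<Union>F}"
    "finite F" "\<forall>I\<in>F. interval_or_point I"
    unfolding one_dim by (elim CollectE exE conjE)
  have "A (s(k := t)) \<longleftrightarrow> t \<in> \<Union>F" for t
  proof -
    let ?x = "(\<lambda>i. if i = 0 then t else 0) :: nat \<Rightarrow> real"
    have "?x \<in> Rn 1" by (auto simp: topspace_Euclidean_space)
    moreover have "?x \<in> {x \<in> Rn 1. A (s(k := x 0))} \<longleftrightarrow> ?x \<in> {x \<in> Rn 1. x 0 \<in> \<Union>F}"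
      by (simp only: F(1))
    ultimately have "A (s(k := ?x 0)) \<longleftrightarrow> ?x 0 \<in> \<Union>F" by (simp only: mem_Collect_eq simp_thms)
    then show ?thesis by simp
  qed
  then have "{t. A (s(k := t))} = \<Union>F" by auto
  then show ?thesis by (rule that[OF F(2,3)])
qed

end

section \<open>Generic points\<close>

definition tame :: "real set \<Rightarrow> bool" where
  "tame X \<longleftrightarrow> (\<exists>F. finite F \<and> (\<forall>I\<in>F. interval_or_point I) \<and> X = \<Union>F)"

lemma interval_or_point_cases:
  assumes "interval_or_point I" "infinite I"
  obtains c d where "c < d" "{c<..<d} \<subseteq> I"
proof -
  consider a where "I = {a}" | a b where "I = {a<..<b}" | a where "I = {a<..}"
    | b where "I = {..<b}" | "I = UNIV"
    using assms(1) unfolding interval_or_point_def by auto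
  then show thesis
  proof cases
    case (2 a b)
    then have "a < b" using assms(2) by (metis finite.emptyI greaterThanLessThan_empty_iff not_less)
    then show ?thesis using 2 by (intro that[of a b]) auto
  next
    case (3 a) then show ?thesis by (intro that[of a "a + 1"]) auto
  next
    case (4 b) then show ?thesis by (intro that[of "b - 1" b]) auto
  next
    case 5 then show ?thesis by (intro that[of 0 1]) auto
  qed (use assms(2) in auto)
qed

lemma tame_infinite:
  assumes "tame X" "infinite X"
  obtains c d where "c < d" "{c<..<d} \<subseteq> X"
proof -
  obtain F where F: "finite F" "\<forall>I\<in>F. interval_or_point I" "X = \<Union>F"
    using assms(1) unfolding tame_def by auto
  then obtain I where "I \<in> F" "infinite I" using assms(2) by auto
  with F interval_or_point_cases[of I] obtain c d where "c < d" "{c<..<d} \<subseteq> I" by metis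
  with \<open>I \<in> F\<close> F show thesis by (intro that[of c d]) auto
qed

lemma tame_countable: "tame X \<Longrightarrow> countable X \<Longrightarrow> finite X"
  by (metis countable_subset tame_infinite uncountable_open_interval)

text \<open>The topological boundary on the line, expressed with the order alone, so that the same
  formula can be written with definable predicates.\<close>

definition boundary_pt :: "(real \<Rightarrow> bool) \<Rightarrow> real \<Rightarrow> bool" where
  "boundary_pt X t \<longleftrightarrow> \<not> (\<exists>c d. c < t \<and> t < d \<and> (\<forall>u. c < u \<and> u < d \<longrightarrow> X u = X t))"

lemma not_boundary_ptI:
  "c < t \<Longrightarrow> t < d \<Longrightarrow> (\<And>u. c < u \<Longrightarrow> u < d \<Longrightarrow> X u = X t) \<Longrightarrow> \<not> boundary_pt X t"
  unfolding boundary_pt_def by blast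

lemma finite_boundary_interval:
  assumes "interval_or_point I" shows "finite {t. boundary_pt (\<lambda>u. u \<in> I) t}"
proof -
  have "\<exists>a b. \<forall>t. t \<noteq> a \<and> t \<noteq> b \<longrightarrow> \<not> boundary_pt (\<lambda>u. u \<in> I) t"
  proof -
    consider a where "I = {a}" | a b where "I = {a<..<b}" | a where "I = {a<..}"
      | b where "I = {..<b}" | "I = UNIV"
      using assms(1) unfolding interval_or_point_def by auto
    \<comment> \<open>Membership in an interval or a point depends only on the position relative to
      two numbers \<open>a\<close> and \<open>b\<close>. Any other \<open>t\<close> has a
      neighbourhood avoiding both, so only these two can be boundary points.\<close>
    then have "\<exists>a b. \<forall>t u. (t < a \<longleftrightarrow> u < a) \<and> (a < t \<longleftrightarrow> a < u) \<and> (t < b \<longleftrightarrow> u < b) \<and> (b < t \<longleftrightarrow> b < u) \<longrightarrow>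
        (u \<in> I) = (t \<in> I)"
    proof cases
      case (1 a) then show ?thesis by (intro exI[of _ a]) (auto simp: not_less_iff_gr_or_eq)
    next
      case (2 a b) then show ?thesis by (intro exI[of _ a] exI[of _ b]) auto
    next
      case (3 a) then show ?thesis by (intro exI[of _ a]) auto
    next
      case (4 a) then show ?thesis by (intro exI[of _ a]) auto
    qed auto
    then obtain a b where ab: "\<And>t u. (t < a \<longleftrightarrow> u < a) \<Longrightarrow> (a < t \<longleftrightarrow> a < u) \<Longrightarrow> (t < b \<longleftrightarrow> u < b) \<Longrightarrow>
        (b < t \<longleftrightarrow> b < u) \<Longrightarrow> (u \<in> I) = (t \<in> I)" by blast
    have "\<not> boundary_pt (\<lambda>u. u \<in> I) t" if "t \<noteq> a" "t \<noteq> b" for t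
    proof (rule not_boundary_ptI)
      let ?c = "max (if a < t then a else t - 1) (if b < t then b else t - 1)"
      let ?d = "min (if t < a then a else t + 1) (if t < b then b else t + 1)"
      show "?c < t" "t < ?d" by auto
      fix u assume "?c < u" "u < ?d"
      then show "(u \<in> I) = (t \<in> I)" using that by (intro ab) (auto split: if_splits)
    qed
    then show ?thesis by blast
  qed
  then obtain a b where "{t. boundary_pt (\<lambda>u. u \<in> I) t} \<subseteq> {a, b}" by blast
  then show ?thesis by (rule finite_subset) simp
qed

lemma tame_finite_boundary:
  assumes "tame X" shows "finite {t. boundary_pt (\<lambda>u. u \<in> X) t}"
proof -
  obtain F where F: "finite F" "\<forall>I\<in>F. interval_or_point I" "X = \<Union>F"
    using assms(1) unfolding tame_def by auto
  have "finite {t. boundary_pt (\<lambda>u. u \<in> \<Union>F) t}" using F(1,2)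
  proof (induction F)
    case empty
    have "\<not> boundary_pt (\<lambda>u. False) t" for t by (rule not_boundary_ptI[of "t - 1" _ "t + 1"]) auto
    then show ?case by simp
  next
    case (insert I F)
    have "{t. boundary_pt (\<lambda>u. u \<in> \<Union>(insert I F)) t} \<subseteq>
        {t. boundary_pt (\<lambda>u. u \<in> I) t} \<union> {t. boundary_pt (\<lambda>u. u \<in> \<Union>F) t}"
    proof (rule ccontr)
      assume "\<not> ?thesis"
      then obtain t where t: "boundary_pt (\<lambda>u. u \<in> \<Union>(insert I F)) t"
        "\<not> boundary_pt (\<lambda>u. u \<in> I) t" "\<not> boundary_pt (\<lambda>u. u \<in> \<Union>F) t" by auto
      from t(2) obtain c d where 1: "c < t" "t < d" "\<forall>u. c < u \<and> u < d \<longrightarrow> (u \<in> I) = (t \<in> I)"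
        unfolding boundary_pt_def by blast
      from t(3) obtain c' d' where 2: "c' < t" "t < d'" "\<forall>u. c' < u \<and> u < d' \<longrightarrow> (u \<in> \<Union>F) = (t \<in> \<Union>F)"
        unfolding boundary_pt_def by blast
      have "\<not> boundary_pt (\<lambda>u. u \<in> \<Union>(insert I F)) t"
      proof (rule not_boundary_ptI[of "max c c'" _ "min d d'"])
        fix u assume "max c c' < u" "u < min d d'"
        then have "(u \<in> I) = (t \<in> I)" "(u \<in> \<Union>F) = (t \<in> \<Union>F)"
          using 1(3) 2(3) by (simp_all only: max_less_iff_conj min_less_iff_conj)
        then show "(u \<in> \<Union>(insert I F)) = (t \<in> \<Union>(insert I F))" by simp
      qed (use 1 2 in auto)
      then show False using t(1) by contradiction
    qed
    then show ?case using insert finite_boundary_interval by (auto intro: finite_subset)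
  qed
  then show ?thesis using F(3) by simp
qed

lemma interval_locally_constant:
  fixes q :: "real \<Rightarrow> 'b"
  assumes conv: "\<And>c d u. c \<in> I \<Longrightarrow> d \<in> I \<Longrightarrow> c < u \<Longrightarrow> u < d \<Longrightarrow> u \<in> I"
    and loc: "\<And>t. t \<in> I \<Longrightarrow> \<exists>c d. c < t \<and> t < d \<and> (\<forall>u\<in>I. c < u \<and> u < d \<longrightarrow> q u = q t)"
    and "t \<in> I" "u \<in> I"
  shows "q t = q u"
proof (rule connected_local_const[OF _ \<open>t \<in> I\<close> \<open>u \<in> I\<close>])
  have "is_interval I" unfolding is_interval_1 using conv by (metis order_less_le)
  then show "connected I" by (rule is_interval_connected)
  show "\<forall>a\<in>I. \<forall>\<^sub>F b in at a within I. q a = q b"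
  proof
    fix a assume "a \<in> I"
    from loc[OF this] obtain c d where cd: "c < a" "a < d" "\<And>u. u \<in> I \<Longrightarrow> c < u \<Longrightarrow> u < d \<Longrightarrow> q u = q a"
      by blast
    show "\<forall>\<^sub>F b in at a within I. q a = q b"
      unfolding eventually_at_topological
      by (rule exI[of _ "{c<..<d}"]) (use cd in auto)
  qed
qed

section \<open>Open boxes and a Baire principle for definable sets\<close>

definition inbox :: "nat \<Rightarrow> (nat \<Rightarrow> real) \<Rightarrow> (nat \<Rightarrow> real) \<Rightarrow> (nat \<Rightarrow> real) \<Rightarrow> bool" where
  "inbox m a b x \<longleftrightarrow> (\<forall>i<m. a i < x i \<and> x i < b i)"

definition agree :: "nat \<Rightarrow> (nat \<Rightarrow> real) \<Rightarrow> (nat \<Rightarrow> real) \<Rightarrow> bool" where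
  "agree m x y \<longleftrightarrow> (\<forall>i<m. x i = y i)"

text \<open>States that \<open>x\<close> does not lie on the topological boundary of
  \<open>A\<close>, taken in the first \<open>m\<close> coordinates.\<close>

definition loc_const_at :: "nat \<Rightarrow> ((nat \<Rightarrow> real) \<Rightarrow> bool) \<Rightarrow> (nat \<Rightarrow> real) \<Rightarrow> bool" where
  "loc_const_at m A x \<longleftrightarrow> (\<exists>a b. inbox m a b x \<and> (\<forall>y. inbox m a b y \<longrightarrow> A y = A x))"

text \<open>Sets with empty interior in the first \<open>m\<close> coordinates.\<close>

definition thin :: "nat \<Rightarrow> ((nat \<Rightarrow> real) \<Rightarrow> bool) \<Rightarrow> bool" where
  "thin m D \<longleftrightarrow> \<not> (\<exists>a b. (\<forall>i<m. a i < b i) \<and> (\<forall>x. inbox m a b x \<longrightarrow> D x))"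

lemma inbox_nonempty:
  assumes "\<forall>i<m. a i < b i" obtains x where "inbox m a b x"
  by (rule that[of "\<lambda>i. (a i + b i) / 2"]) (use assms in \<open>auto simp: inbox_def field_simps\<close>)

lemma inbox_mono:
  "inbox m a' b' x \<Longrightarrow> (\<And>i. i < m \<Longrightarrow> a i \<le> a' i \<and> b' i \<le> b i) \<Longrightarrow> inbox m a b x"
  unfolding inbox_def by (meson le_less_trans less_le_trans)

lemma inbox_Int:
  "inbox m (\<lambda>i. max (a i) (a' i)) (\<lambda>i. min (b i) (b' i)) x \<longleftrightarrow> inbox m a b x \<and> inbox m a' b' x"
  unfolding inbox_def by auto

text \<open>Corners are coded as lists of rationals, a countable type, so the boxes found here can
  index a countable union.\<close>

lemma inbox_rat:
  assumes "inbox m a b x"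
  obtains ps qs :: "rat list" where "inbox m (\<lambda>i. of_rat (ps ! i)) (\<lambda>i. of_rat (qs ! i)) x"
    "\<And>i. i < m \<Longrightarrow> a i \<le> of_rat (ps ! i) \<and> of_rat (qs ! i) \<le> b i"
proof -
  have "\<exists>p q. i < m \<longrightarrow> a i < of_rat p \<and> of_rat p < x i \<and> x i < of_rat q \<and> of_rat q < b i" for i
    using assms of_rat_dense[of "a i" "x i"] of_rat_dense[of "x i" "b i"]
    unfolding inbox_def by metis
  then obtain p q where pq: "\<And>i. i < m \<Longrightarrow> a i < of_rat (p i) \<and> of_rat (p i) < x i \<and> x i < of_rat (q i) \<and> of_rat (q i) < b i"
    by metis
  show thesis
    by (rule that[of "map p [0..<m]" "map q [0..<m]"]) (use pq in \<open>auto simp: inbox_def less_imp_le\<close>)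
qed

context o_minimal_structure
begin

lemma tame_section: "definable A \<Longrightarrow> tame {t. A (s(k := t))}"
  using definable_section[of A s k] unfolding tame_def by metis

lemma definable_loc_const_at:
  assumes "definable A" shows "definable (loc_const_at m A)"
  unfolding inbox_def loc_const_at_def
  by (rule definableI) (intro env_definable_intros env_definable_app[OF assms])

lemma depends_loc_const_at:
  assumes "depends m A" shows "depends m (loc_const_at m A)"
  unfolding depends_def
proof (intro allI impI)
  fix x y :: "nat \<Rightarrow> real" assume "\<forall>i<m. x i = y i"
  then have "A x = A y" by (intro dependsD[OF assms]) simp
  moreover have "inbox m a b x = inbox m a b y" for a b
    using \<open>\<forall>i<m. x i = y i\<close> by (simp add: inbox_def)
  ultimately show "loc_const_at m A x = loc_const_at m A y" unfolding loc_const_at_def by simp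
qed

text \<open>Definability replaces the closedness of the classical theorem. Over a point of the first
  \<open>m\<close> coordinates, countably many tame sets cover an uncountable interval, so one of
  them is infinite and contains an interval, which can be shrunk to rational endpoints. There are
  countably many choices of set and endpoints, and the induction hypothesis makes one choice valid
  on a whole box.\<close>

lemma baire:
  fixes A :: "nat \<Rightarrow> (nat \<Rightarrow> real) \<Rightarrow> bool"
  assumes "\<And>k. definable (A k)" "\<And>k. depends m (A k)"
    and "\<forall>i<m. a i < b i" and "\<And>x. inbox m a b x \<Longrightarrow> \<exists>k. A k x"
  shows "\<exists>k a' b'. (\<forall>i<m. a i \<le> a' i \<and> a' i < b' i \<and> b' i \<le> b i) \<and> (\<forall>x. inbox m a' b' x \<longrightarrow> A k x)"
  using assms
proof (induction m arbitrary: A)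
  case 0
  then obtain k where "A k a" unfolding inbox_def by blast
  then have "A k x" for x using 0(2) dependsD[of 0 "A k" x a] by simp
  then show ?case by auto
next
  case (Suc m)
  \<comment> \<open>A countable family in one dimension less: the index records which set
    \<open>A k\<close> contains the vertical rational segment from \<open>p\<close> to
    \<open>q\<close> over \<open>x\<close>. The bounds on \<open>p\<close> and \<open>q\<close> keep
    the segment inside the given box.\<close>
  define B where "B = (\<lambda>(k, p :: rat, q :: rat) x. (a m \<le> of_rat p \<and> p < q \<and> of_rat q \<le> b m) \<and>
    (\<forall>t. of_rat p < t \<and> t < of_rat q \<longrightarrow> A k (x(m := t))))"
  have B_def': "B w x \<longleftrightarrow> (a m \<le> of_rat (fst (snd w)) \<and> fst (snd w) < snd (snd w) \<and> of_rat (snd (snd w)) \<le> b m) \<and>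
    (\<forall>t. of_rat (fst (snd w)) < t \<and> t < of_rat (snd (snd w)) \<longrightarrow> A (fst w) (x(m := t)))" for w x
    unfolding B_def by (cases w) simp
  have defB: "definable (B w)" for w
    unfolding B_def' by (rule definableI) (intro env_definable_intros env_definable_app[OF Suc.prems(1)])
  have depB: "depends m (B w)" for w
    unfolding depends_def
  proof (intro allI impI)
    fix x y :: "nat \<Rightarrow> real" assume xy: "\<forall>i<m. x i = y i"
    have "A (fst w) (x(m := t)) = A (fst w) (y(m := t))" for t
      by (rule dependsD[OF Suc.prems(2)]) (use xy in \<open>auto simp: less_Suc_eq\<close>)
    then show "B w x = B w y" unfolding B_def' by simp
  qed
  have cover: "\<exists>w. B w x" if x: "inbox m a b x" for x
  proof -
    \<comment> \<open>The sections are cut down to the interval from \<open>a m\<close> to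
      \<open>b m\<close>. Rational numbers chosen inside an interval contained in \<open>X k\<close>
      then respect the box automatically.\<close>
    define X where "X k = {t. (\<lambda>x. A k x \<and> a m < x m \<and> x m < b m) (x(m := t))}" for k
    have "definable (\<lambda>x. A k x \<and> a m < x m \<and> x m < b m)" for k
      by (rule definableI) (intro env_definable_intros env_definable_app[OF Suc.prems(1)])
    then have tX: "tame (X k)" for k unfolding X_def by (rule tame_section)
    have "t \<in> (\<Union>k. X k)" if "a m < t" "t < b m" for t
    proof -
      have "inbox (Suc m) a b (x(m := t))" using x that by (auto simp: inbox_def less_Suc_eq)
      from Suc.prems(4)[OF this] obtain k where "A k (x(m := t))" ..
      then show ?thesis using that by (auto simp: X_def)
    qed
    then have "{a m<..<b m} \<subseteq> (\<Union>k. X k)" by auto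
    moreover have "uncountable {a m<..<b m}"
      using Suc.prems(3) by (simp add: uncountable_open_interval)
    ultimately obtain k where "infinite (X k)"
      by (metis countable_UN countable_finite countable_subset uncountable_infinite countableI_type)
    from tame_infinite[OF tX this] obtain c d where cd: "c < d" "{c<..<d} \<subseteq> X k" .
    obtain p q :: rat where pq: "c < of_rat p" "of_rat p < (of_rat q :: real)" "of_rat q < d"
      using of_rat_dense[OF cd(1)] of_rat_dense by metis
    have Xab: "a m < t \<and> t < b m \<and> A k (x(m := t))" if "c < t" "t < d" for t
      using cd(2) that by (auto simp: X_def)
    have "c < of_rat q" "of_rat p < d" using pq by linarith+
    then have "a m \<le> of_rat p" "of_rat q \<le> b m"
      using Xab[of "of_rat p"] Xab[of "of_rat q"] pq by linarith+
    then have "B (k, p, q) x"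
      unfolding B_def using pq Xab by (auto simp: of_rat_less)
    then show ?thesis by blast
  qed
  have "\<exists>j a' b'. (\<forall>i<m. a i \<le> a' i \<and> a' i < b' i \<and> b' i \<le> b i) \<and>
      (\<forall>x. inbox m a' b' x \<longrightarrow> B (from_nat j) x)"
  proof (rule Suc.IH)
    show "\<exists>j. B (from_nat j) x" if "inbox m a b x" for x
      using cover[OF that] by (metis from_nat_to_nat)
  qed (use Suc.prems(3) defB depB in auto)
  then obtain j a' b' where ab: "\<forall>i<m. a i \<le> a' i \<and> a' i < b' i \<and> b' i \<le> b i"
    "\<forall>x. inbox m a' b' x \<longrightarrow> B (from_nat j) x" by blast
  obtain k p q where kpq: "(from_nat j :: nat \<times> rat \<times> rat) = (k, p, q)" by (cases "from_nat j :: nat \<times> rat \<times> rat")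
  obtain x0 where "inbox m a' b' x0" using ab(1) inbox_nonempty[of m a' b'] by blast
  then have "B (k, p, q) x0" using ab(2) kpq by auto
  then have pq: "a m \<le> of_rat p" "p < q" "of_rat q \<le> b m" by (auto simp: B_def)
  let ?a = "a'(m := of_rat p)" and ?b = "b'(m := of_rat q)"
  have "A k x" if x: "inbox (Suc m) ?a ?b x" for x
  proof -
    have "inbox m a' b' x" using x unfolding inbox_def by (metis fun_upd_apply less_Suc_eq nat_neq_iff)
    then have "B (k, p, q) x" using ab(2) kpq by auto
    moreover have "of_rat p < x m" "x m < of_rat q" using x unfolding inbox_def by auto
    ultimately have "A k (x(m := x m))" unfolding B_def by blast
    then show ?thesis by simp
  qed
  moreover have "\<forall>i<Suc m. a i \<le> ?a i \<and> ?a i < ?b i \<and> ?b i \<le> b i"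
    using ab(1) pq by (auto simp: less_Suc_eq of_rat_less)
  ultimately show ?case by blast
qed

text \<open>Two applications of \<open>baire\<close>. If every point of the box were a boundary
  point of some \<open>A k\<close>, a single \<open>k\<close> would serve on a smaller box; there,
  however, \<open>A k\<close> or its negation holds throughout some subbox, and \<open>A k\<close>
  is locally constant at its points.\<close>

lemma generic_point:
  fixes A :: "nat \<Rightarrow> (nat \<Rightarrow> real) \<Rightarrow> bool"
  assumes "\<And>k. definable (A k)" "\<And>k. depends m (A k)" "\<forall>i<m. a i < b i"
  shows "\<exists>x. inbox m a b x \<and> (\<forall>k. loc_const_at m (A k) x)"
proof (rule ccontr)
  assume neg: "\<not> ?thesis"
  then have bad: "\<exists>k. \<not> loc_const_at m (A k) x" if "inbox m a b x" for x
    using that neg by blast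
  moreover have "definable (\<lambda>x. \<not> loc_const_at m (A k) x)" for k
    by (intro definable_not definable_loc_const_at assms)
  moreover have "depends m (\<lambda>x. \<not> loc_const_at m (A k) x)" for k
    using depends_loc_const_at[OF assms(2)[of k]] unfolding depends_def by simp
  ultimately have "\<exists>k a' b'. (\<forall>i<m. a i \<le> a' i \<and> a' i < b' i \<and> b' i \<le> b i) \<and>
      (\<forall>x. inbox m a' b' x \<longrightarrow> \<not> loc_const_at m (A k) x)"
    by (intro baire[of "\<lambda>k x. \<not> loc_const_at m (A k) x"] assms(3))
  then obtain k a' b' where ab: "\<forall>i<m. a i \<le> a' i \<and> a' i < b' i \<and> b' i \<le> b i"
    "\<forall>x. inbox m a' b' x \<longrightarrow> \<not> loc_const_at m (A k) x" by blast
  \<comment> \<open>Index 0 stands for \<open>A k\<close> and every other index for its negation;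
    together they cover everything.\<close>
  let ?B = "\<lambda>j x. A k x = (j = (0::nat))"
  have "\<exists>j a'' b''. (\<forall>i<m. a' i \<le> a'' i \<and> a'' i < b'' i \<and> b'' i \<le> b' i) \<and>
      (\<forall>x. inbox m a'' b'' x \<longrightarrow> ?B j x)"
  proof (rule baire)
    show "definable (?B j)" for j
      by (rule definableI) (intro env_definable_intros env_definable_app[OF assms(1)])
    show "depends m (?B j)" for j
      unfolding depends_def
    proof (intro allI impI)
      fix x y :: "nat \<Rightarrow> real" assume "\<forall>i<m. x i = y i"
      then have "A k x = A k y" by (intro dependsD[OF assms(2)]) simp
      then show "?B j x = ?B j y" by simp
    qed
    show "\<exists>j. ?B j x" for x by (cases "A k x") auto
  qed (use ab(1) in auto)
  then obtain j a'' b'' where *: "\<forall>i<m. a' i \<le> a'' i \<and> a'' i < b'' i \<and> b'' i \<le> b' i"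
    "\<forall>x. inbox m a'' b'' x \<longrightarrow> ?B j x" by blast
  obtain x where x: "inbox m a'' b'' x" using * inbox_nonempty[of m a'' b''] by blast
  then have "loc_const_at m (A k) x" unfolding loc_const_at_def using *(2) by blast
  moreover have "inbox m a' b' x" using inbox_mono[OF x] * by blast
  ultimately show False using ab(2) by blast
qed

end

section \<open>Finite decompositions into connected definable sets\<close>

text \<open>Connectedness in the relative topology, in the form "locally constant predicates are
  constant". \<open>Q\<close> is arbitrary, hence usable for predicates that are not known to be
  definable.\<close>

definition box_connected :: "nat \<Rightarrow> ((nat \<Rightarrow> real) \<Rightarrow> bool) \<Rightarrow> bool" where
  "box_connected N A \<longleftrightarrow>
     (\<forall>Q :: (nat \<Rightarrow> real) \<Rightarrow> bool. (\<forall>x. A x \<longrightarrow> (\<exists>a b. inbox N a b x \<and> (\<forall>y. A y \<longrightarrow> inbox N a b y \<longrightarrow> Q y = Q x))) \<longrightarrow>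
        (\<forall>x y. A x \<longrightarrow> A y \<longrightarrow> Q x = Q y))"

lemma box_connectedD:
  fixes Q :: "(nat \<Rightarrow> real) \<Rightarrow> bool"
  assumes "box_connected N A" "A x" "A y"
    and "\<And>x. A x \<Longrightarrow> \<exists>a b. inbox N a b x \<and> (\<forall>y. A y \<longrightarrow> inbox N a b y \<longrightarrow> Q y = Q x)"
  shows "Q x = Q y"
proof -
  have "(\<forall>x. A x \<longrightarrow> (\<exists>a b. inbox N a b x \<and> (\<forall>y. A y \<longrightarrow> inbox N a b y \<longrightarrow> Q y = Q x))) \<longrightarrow>
      (\<forall>x y. A x \<longrightarrow> A y \<longrightarrow> Q x = Q y)"
    using assms(1) unfolding box_connected_def by (rule spec)
  moreover have "\<forall>x. A x \<longrightarrow> (\<exists>a b. inbox N a b x \<and> (\<forall>y. A y \<longrightarrow> inbox N a b y \<longrightarrow> Q y = Q x))"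
    using assms(4) by (intro allI impI)
  ultimately have "\<forall>x y. A x \<longrightarrow> A y \<longrightarrow> Q x = Q y" by (rule mp)
  then show ?thesis using assms(2,3) by (elim allE impE)
qed

lemma depends_conj:
  assumes "depends m A" "depends m B" shows "depends m (\<lambda>x. A x \<and> B x)"
  unfolding depends_def
proof (intro allI impI)
  fix x y :: "nat \<Rightarrow> real" assume "\<forall>i<m. x i = y i"
  then have "A x = A y" "B x = B y"
    using dependsD[OF assms(1), of x y] dependsD[OF assms(2), of x y] by simp_all
  then show "(A x \<and> B x) = (A y \<and> B y)" by simp
qed

lemma depends_upd: assumes "depends m A" shows "A (x(m := t)) = A x"
  by (rule dependsD[OF assms]) simp

context o_minimal_structure
begin

text \<open>What remains of cell decomposition here: the pieces meet each line in direction
  \<open>m\<close> in an order-convex set. Nothing is required of the endpoints as functions of the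
  other coordinates, and the pieces may overlap.\<close>

definition convex_decomposable :: "nat \<Rightarrow> bool" where
  "convex_decomposable m \<longleftrightarrow> (\<forall>A. definable A \<longrightarrow> depends (Suc m) A \<longrightarrow>
     (\<exists>\<B>. finite \<B> \<and> (\<forall>x. A x \<longleftrightarrow> (\<exists>B\<in>\<B>. B x)) \<and>
        (\<forall>B\<in>\<B>. definable B \<and> depends (Suc m) B \<and>
          (\<forall>s c d u. B (s(m := c)) \<longrightarrow> B (s(m := d)) \<longrightarrow> c < u \<longrightarrow> u < d \<longrightarrow> B (s(m := u))))))"

text \<open>The first \<open>k\<close> coordinates are parameters: one finite family of pieces works
  for all their values, and each piece is connected after fixing them. Only the case
  \<open>k = 0\<close> is wanted in the end; the parameters carry the induction on
  \<open>l\<close>.\<close>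

definition connected_decomposable :: "nat \<Rightarrow> nat \<Rightarrow> bool" where
  "connected_decomposable k l \<longleftrightarrow> (\<forall>A. definable A \<longrightarrow> depends (k + l) A \<longrightarrow>
     (\<exists>\<B>. finite \<B> \<and> (\<forall>x. A x \<longleftrightarrow> (\<exists>B\<in>\<B>. B x)) \<and>
        (\<forall>B\<in>\<B>. definable B \<and> depends (k + l) B \<and>
          (\<forall>s. box_connected (k + l) (\<lambda>x. B x \<and> agree k x s)))))"

definition uniformly_finite :: "nat \<Rightarrow> bool" where
  "uniformly_finite m \<longleftrightarrow> (\<forall>Y. definable Y \<longrightarrow> depends (Suc m) Y \<longrightarrow> (\<forall>s. finite {t. Y (s(m := t))}) \<longrightarrow>
     (\<exists>K. \<forall>s. card {t. Y (s(m := t))} \<le> K))"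

lemma convex_decomposableE:
  assumes "convex_decomposable m" "definable A" "depends (Suc m) A"
  obtains \<B> where "finite \<B>" "\<forall>x. A x \<longleftrightarrow> (\<exists>B\<in>\<B>. B x)"
    "\<forall>B\<in>\<B>. definable B" "\<forall>B\<in>\<B>. depends (Suc m) B"
    "\<forall>B\<in>\<B>. \<forall>s c d u. B (s(m := c)) \<longrightarrow> B (s(m := d)) \<longrightarrow> c < u \<longrightarrow> u < d \<longrightarrow> B (s(m := u))"
  using assms unfolding convex_decomposable_def ball_conj_distrib
  by (elim allE[of _ A] impE exE conjE) assumption+

lemma connected_decomposableE:
  assumes "connected_decomposable k l" "definable A" "depends (k + l) A"
  obtains \<B> where "finite \<B>" "\<forall>x. A x \<longleftrightarrow> (\<exists>B\<in>\<B>. B x)"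
    "\<forall>B\<in>\<B>. definable B" "\<forall>B\<in>\<B>. depends (k + l) B"
    "\<forall>B\<in>\<B>. \<forall>s. box_connected (k + l) (\<lambda>x. B x \<and> agree k x s)"
  using assms unfolding connected_decomposable_def ball_conj_distrib
  by (elim allE[of _ A] impE exE conjE) assumption+

lemma finite_section: "definable A \<Longrightarrow> countable {t. A (s(k := t))} \<Longrightarrow> finite {t. A (s(k := t))}"
  by (rule tame_countable[OF tame_section])

text \<open>
  A slice of \<open>B\<close> is continuous at \<open>t\<close> if one of its points is a limit of points of the
  neighbouring slices. This property is definable, and it can fail only for countably many \<open>t\<close>,
  namely for the boundary points of the sets of those \<open>t\<close> whose slice meets a given rational box.
\<close>

definition slice_continuous :: "nat \<Rightarrow> nat \<Rightarrow> ((nat \<Rightarrow> real) \<Rightarrow> bool) \<Rightarrow> (nat \<Rightarrow> real) \<Rightarrow> bool" where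
  "slice_continuous k N B x \<longleftrightarrow> (\<exists>y. (B y \<and> agree (Suc k) y x) \<and> (\<forall>c d. inbox N c d y \<longrightarrow>
     (\<exists>u v. u < x k \<and> x k < v \<and> (\<forall>t. u < t \<and> t < v \<longrightarrow>
        (\<exists>z. B z \<and> agree k z x \<and> z k = t \<and> inbox N c d z)))))"

definition slice_nonempty :: "nat \<Rightarrow> ((nat \<Rightarrow> real) \<Rightarrow> bool) \<Rightarrow> (nat \<Rightarrow> real) \<Rightarrow> bool" where
  "slice_nonempty k B x \<longleftrightarrow> (\<exists>y. B y \<and> agree (Suc k) y x)"

lemma definable_slice_continuous:
  assumes "definable B" shows "definable (slice_continuous k N B)"
  unfolding slice_continuous_def inbox_def agree_def
  by (rule definableI) (intro env_definable_intros env_definable_app[OF assms])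

lemma definable_slice_nonempty:
  assumes "definable B" shows "definable (slice_nonempty k B)"
  unfolding slice_nonempty_def agree_def
  by (rule definableI) (intro env_definable_intros env_definable_app[OF assms])

lemma depends_slice: "depends (Suc k) (slice_continuous k N B)" "depends (Suc k) (slice_nonempty k B)"
proof -
  have "slice_continuous k N B x = slice_continuous k N B x' \<and> slice_nonempty k B x = slice_nonempty k B x'"
    if "\<forall>i<Suc k. x i = x' i" for x x'
  proof -
    have "agree (Suc k) y x = agree (Suc k) y x'" "agree k y x = agree k y x'" "x k = x' k" for y
      using that by (auto simp: agree_def)
    then show ?thesis unfolding slice_continuous_def slice_nonempty_def by simp
  qed
  then show "depends (Suc k) (slice_continuous k N B)" "depends (Suc k) (slice_nonempty k B)"
    unfolding depends_def by blast+
qed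

text \<open>Away from the countable exceptional set, every point of a nonempty slice is a witness
  for continuity: a box around it contains a rational box around it, and the set of parameters whose
  slice meets the latter is constant near \<open>t\<close>. The failure set is definable, so being
  countable makes it finite.\<close>

lemma slice_continuous_cofinite:
  assumes B: "definable B" "depends N B" "k < N"
  shows "finite {t. slice_nonempty k B (s(k := t)) \<and> \<not> slice_continuous k N B (s(k := t))}"
proof -
  define H where "H c d t \<longleftrightarrow> (\<exists>z. B z \<and> agree k z s \<and> z k = t \<and> inbox N c d z)" for c d t
  have tame_H: "tame {t. H c d t}" for c d
  proof -
    have "definable (\<lambda>x. \<exists>z. B z \<and> agree k z s \<and> z k = x k \<and> inbox N c d z)"
      unfolding inbox_def agree_def
      by (rule definableI) (intro env_definable_intros env_definable_app[OF B(1)])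
    from tame_section[OF this, of s k] show ?thesis by (simp add: H_def)
  qed
  let ?c = "\<lambda>(ps :: rat list) i. real_of_rat (ps ! i)"
  define Z where "Z = (\<Union>(ps, qs). {t. boundary_pt (H (?c ps) (?c qs)) t})"
  have "countable Z"
    unfolding Z_def
  proof (intro countable_UN)
    fix w :: "rat list \<times> rat list"
    have "finite {t. boundary_pt (H (?c ps) (?c qs)) t}" for ps qs
      using tame_finite_boundary[OF tame_H[of "?c ps" "?c qs"]] by simp
    then show "countable (case w of (ps, qs) \<Rightarrow> {t. boundary_pt (H (?c ps) (?c qs)) t})"
      by (auto split: prod.split intro: countable_finite)
  qed simp
  have sub: "{t. slice_nonempty k B (s(k := t)) \<and> \<not> slice_continuous k N B (s(k := t))} \<subseteq> Z"
  proof (rule subsetI, rule ccontr)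
    fix t assume t: "t \<in> {t. slice_nonempty k B (s(k := t)) \<and> \<not> slice_continuous k N B (s(k := t))}"
      and nZ: "t \<notin> Z"
    from t obtain y where y: "B y" "agree (Suc k) y (s(k := t))"
      unfolding slice_nonempty_def by blast
    have "\<exists>u v. u < t \<and> t < v \<and> (\<forall>t'. u < t' \<and> t' < v \<longrightarrow> H c d t')" if cd: "inbox N c d y" for c d
    proof -
      obtain ps qs where pq: "inbox N (?c ps) (?c qs) y"
        "\<And>i. i < N \<Longrightarrow> c i \<le> ?c ps i \<and> ?c qs i \<le> d i"
        using inbox_rat[OF cd] by metis
      have Ht: "H (?c ps) (?c qs) t"
        unfolding H_def using y pq(1) by (intro exI[of _ y]) (auto simp: agree_def less_Suc_eq)
      have "\<not> boundary_pt (H (?c ps) (?c qs)) t" using nZ unfolding Z_def by blast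
      then obtain u v where uv: "u < t" "t < v" "\<forall>t'. u < t' \<and> t' < v \<longrightarrow> H (?c ps) (?c qs) t' = H (?c ps) (?c qs) t"
        unfolding boundary_pt_def by blast
      have "H c d t'" if h: "H (?c ps) (?c qs) t'" for t'
      proof -
        obtain z where z: "B z" "agree k z s" "z k = t'" "inbox N (?c ps) (?c qs) z"
          using h unfolding H_def by blast
        have "inbox N c d z" using inbox_mono[OF z(4)] pq(2) by blast
        then show ?thesis unfolding H_def using z by blast
      qed
      then show ?thesis using uv Ht by blast
    qed
    moreover have "agree k z (s(k := t)) = agree k z s" for z by (auto simp: agree_def)
    ultimately have "slice_continuous k N B (s(k := t))"
      unfolding slice_continuous_def H_def using y by (intro exI[of _ y]) simp
    then show False using t by simp
  qed
  have "definable (\<lambda>x. slice_nonempty k B x \<and> \<not> slice_continuous k N B x)"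
    by (intro definable_conj definable_not definable_slice_nonempty definable_slice_continuous B)
  from finite_section[OF this, of s k] sub \<open>countable Z\<close> show ?thesis
    using countable_subset by blast
qed

text \<open>One coordinate at a time changes from parameter to variable. Pieces that are connected
  for fixed first \<open>k + 1\<close> coordinates are cut along coordinate \<open>k\<close> into
  convex ranges on which the slices are continuous or discontinuous throughout. Continuous slices
  glue over an interval, and a discontinuous range is a single value.\<close>

lemma connected_decomposable:
  assumes "\<And>j. j < k + l \<Longrightarrow> convex_decomposable j"
  shows "connected_decomposable k l"
  using assms
proof (induction l arbitrary: k)
  case 0
  \<comment> \<open>With every coordinate fixed, any two points of the set lie in the same
    boxes.\<close>
  have "box_connected k (\<lambda>x. A x \<and> agree k x s)" if "depends k A" for A s
    unfolding box_connected_def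
  proof (intro allI impI)
    fix Q x y
    assume loc: "\<forall>x. A x \<and> agree k x s \<longrightarrow> (\<exists>a b. inbox k a b x \<and> (\<forall>y. A y \<and> agree k y s \<longrightarrow> inbox k a b y \<longrightarrow> Q y = Q x))"
      and x: "A x \<and> agree k x s" and y: "A y \<and> agree k y s"
    from loc x obtain a b where ab: "inbox k a b x" "\<forall>y. A y \<and> agree k y s \<longrightarrow> inbox k a b y \<longrightarrow> Q y = Q x"
      by blast
    have "inbox k a b y" using ab(1) x y by (simp add: inbox_def agree_def)
    then show "Q x = Q y" using ab(2) y by simp
  qed
  then show ?case unfolding connected_decomposable_def
    by (intro allI impI, rule_tac x = "{A}" in exI) simp
next
  case (Suc l)
  let ?N = "k + Suc l"
  have Nk: "k < ?N" by simp
  have IH: "connected_decomposable (Suc k) l" using Suc.prems by (intro Suc.IH) simp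
  have step: "\<exists>\<C>. finite \<C> \<and> (\<forall>x. B x \<longleftrightarrow> (\<exists>C\<in>\<C>. C x)) \<and>
        (\<forall>C\<in>\<C>. definable C \<and> depends ?N C \<and> (\<forall>s. box_connected ?N (\<lambda>x. C x \<and> agree k x s)))"
    if B: "definable B" "depends ?N B" and conn: "\<And>s. box_connected ?N (\<lambda>x. B x \<and> agree (Suc k) x s)"
    for B
  proof -
    let ?G = "slice_continuous k ?N B"
    let ?D = "\<lambda>x. slice_nonempty k B x \<and> \<not> ?G x"
    have cd: "convex_decomposable k" using Suc.prems by simp
    have defD: "definable ?D"
      by (intro definable_conj definable_not definable_slice_nonempty definable_slice_continuous B)
    have depD: "depends (Suc k) ?D"
      unfolding depends_def
    proof (intro allI impI)
      fix x y :: "nat \<Rightarrow> real" assume "\<forall>i<Suc k. x i = y i"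
      then have "?G x = ?G y" "slice_nonempty k B x = slice_nonempty k B y"
        using dependsD[OF depends_slice(1), of k x y ?N B] dependsD[OF depends_slice(2), of k x y B] by auto
      then show "?D x = ?D y" by simp
    qed
    obtain \<G> where G: "finite \<G>" "\<forall>x. ?G x \<longleftrightarrow> (\<exists>J\<in>\<G>. J x)"
      "\<forall>J\<in>\<G>. definable J" "\<forall>J\<in>\<G>. depends (Suc k) J"
      "\<forall>J\<in>\<G>. \<forall>s c d u. J (s(k := c)) \<longrightarrow> J (s(k := d)) \<longrightarrow> c < u \<longrightarrow> u < d \<longrightarrow> J (s(k := u))"
      using convex_decomposableE[OF cd definable_slice_continuous[OF B(1), of k ?N] depends_slice(1)] .
    obtain \<D> where D: "finite \<D>" "\<forall>x. ?D x \<longleftrightarrow> (\<exists>J\<in>\<D>. J x)"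
      "\<forall>J\<in>\<D>. definable J" "\<forall>J\<in>\<D>. depends (Suc k) J"
      "\<forall>J\<in>\<D>. \<forall>s c d u. J (s(k := c)) \<longrightarrow> J (s(k := d)) \<longrightarrow> c < u \<longrightarrow> u < d \<longrightarrow> J (s(k := u))"
      using convex_decomposableE[OF cd defD depD] .
    note G = G[rule_format] and D = D[rule_format]
    \<comment> \<open>\<open>\<G>\<close> splits the continuity locus into ranges convex in
      coordinate \<open>k\<close>, and \<open>\<D>\<close> does the same for the nonempty slices
      outside it.\<close>
    define \<C> where "\<C> = (\<lambda>J x. B x \<and> J x) ` (\<G> \<union> \<D>)"
    have "finite \<C>" unfolding \<C>_def using G(1) D(1) by simp
    moreover have "B x \<longleftrightarrow> (\<exists>C\<in>\<C>. C x)" for x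
    proof -
      have "B x \<Longrightarrow> slice_nonempty k B x" unfolding slice_nonempty_def agree_def by blast
      then have "B x \<Longrightarrow> ?G x \<or> ?D x" by blast
      then have "B x \<longleftrightarrow> (\<exists>J\<in>\<G> \<union> \<D>. B x \<and> J x)" using G(2)[of x] D(2)[of x] by blast
      then show ?thesis unfolding \<C>_def by simp
    qed
    moreover have "definable C \<and> depends ?N C" if "C \<in> \<C>" for C
    proof -
      obtain J where J: "J \<in> \<G> \<union> \<D>" "C = (\<lambda>x. B x \<and> J x)" using \<open>C \<in> \<C>\<close> unfolding \<C>_def by blast
      then have "definable J" "depends (Suc k) J" using G D by auto
      then show ?thesis unfolding J(2) using B
        by (auto intro!: definable_conj depends_conj elim: depends_mono)
    qed
    moreover have "box_connected ?N (\<lambda>x. C x \<and> agree k x s)" if "C \<in> \<C>" for C s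
    proof -
      obtain J where J: "J \<in> \<G> \<union> \<D>" "C = (\<lambda>x. B x \<and> J x)" using \<open>C \<in> \<C>\<close> unfolding \<C>_def by blast
      then have depJ: "depends (Suc k) J" using G D by auto
      have JI: "J x = J (s(k := x k))" if "agree k x s" for x
        by (rule dependsD[OF depJ]) (use that in \<open>auto simp: agree_def less_Suc_eq\<close>)
      show ?thesis unfolding box_connected_def J(2)
      proof (intro allI impI)
        fix Q :: "(nat \<Rightarrow> real) \<Rightarrow> bool" and x y
        let ?F = "\<lambda>x. (B x \<and> J x) \<and> agree k x s"
        assume loc: "\<forall>x. ?F x \<longrightarrow> (\<exists>a b. inbox ?N a b x \<and> (\<forall>y. ?F y \<longrightarrow> inbox ?N a b y \<longrightarrow> Q y = Q x))"
          and x: "?F x" and y: "?F y"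
        \<comment> \<open>Since \<open>J\<close> depends only on the first \<open>k + 1\<close>
          coordinates, a piece contains each slice of \<open>B\<close> entirely or not at all. The
          connectedness of that slice therefore applies to \<open>Q\<close>.\<close>
        have slice: "Q z = Q z'" if z: "?F z" "B z'" "agree (Suc k) z' z" for z z'
        proof (rule box_connectedD[OF conn[of z], where x = z and y = z' and Q = Q])
          have F: "?F w" if "B w \<and> agree (Suc k) w z" for w
          proof -
            have "J w = J z" by (rule dependsD[OF depJ]) (use that in \<open>auto simp: agree_def\<close>)
            moreover have "agree k w s" using that z by (auto simp: agree_def)
            ultimately show ?thesis using that z by blast
          qed
          fix w assume w: "B w \<and> agree (Suc k) w z"
          obtain a b where ab: "inbox ?N a b w" "\<forall>y. ?F y \<longrightarrow> inbox ?N a b y \<longrightarrow> Q y = Q w"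
            using loc[rule_format, OF F[OF w]] by (elim exE conjE)
          have "Q y = Q w" if "B y \<and> agree (Suc k) y z" "inbox ?N a b y" for y
            using ab(2) F[OF that(1)] that(2) by (elim allE[of _ y] impE)
          then show "\<exists>a b. inbox ?N a b w \<and> (\<forall>y. B y \<and> agree (Suc k) y z \<longrightarrow> inbox ?N a b y \<longrightarrow> Q y = Q w)"
            using ab(1) by (intro exI conjI allI impI)
        qed (use z in \<open>auto simp: agree_def\<close>)
        have slice': "Q z = Q z'" if z: "?F z" "?F z'" "z k = z' k" for z z'
          by (rule slice[OF z(1)]) (use z in \<open>auto simp: agree_def less_Suc_eq\<close>)
        show "Q x = Q y"
        proof (cases "J \<in> \<D>")
          case True
          \<comment> \<open>A convex range containing two values contains an interval, but for fixed
            parameters there are only finitely many discontinuous nonempty slices.\<close>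
          have "x k = y k"
          proof (rule ccontr)
            assume "x k \<noteq> y k"
            moreover have J2: "J (s(k := x k))" "J (s(k := y k))" using x y JI by auto
            ultimately obtain c d where cd: "c < d" "J (s(k := c))" "J (s(k := d))"
              by (intro that[of "min (x k) (y k)" "max (x k) (y k)"]) (simp_all add: min_def max_def)
            have "\<exists>J\<in>\<D>. J (s(k := t))" if "c < t" "t < d" for t
              using D(5)[OF True cd(2,3) that] True by (rule bexI)
            then have "?D (s(k := t))" if "c < t" "t < d" for t
              using that by (simp only: D(2))
            then have "{c<..<d} \<subseteq> {t. ?D (s(k := t))}" by (intro subsetI) simp
            then have "finite {c<..<d}"
              using slice_continuous_cofinite[OF B Nk, of s] by (rule finite_subset)
            then show False using cd(1) infinite_Ioo by blast
          qed
          then show ?thesis using slice'[OF x y] by simp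
        next
          case False
          then have JG: "J \<in> \<G>" using J(1) by blast
          let ?I = "{t. J (s(k := t))}"
          \<comment> \<open>The common value of \<open>Q\<close> on the slice over \<open>t\<close>;
            by \<open>slice'\<close> the choice of the point does not matter.\<close>
          define q where "q t = Q (SOME z. ?F z \<and> z k = t)" for t
          have q: "q (z k) = Q z" if "?F z" for z
          proof -
            have "?F (SOME w. ?F w \<and> w k = z k) \<and> (SOME w. ?F w \<and> w k = z k) k = z k"
              by (rule someI[of "\<lambda>w. ?F w \<and> w k = z k" z]) (use that in simp)
            then show ?thesis unfolding q_def by (intro slice'[OF _ that]) (simp_all only: simp_thms)
          qed
          have "q (x k) = q (y k)"
          proof (rule interval_locally_constant[of ?I])
            show "u \<in> ?I" if "c \<in> ?I" "d \<in> ?I" "c < u" "u < d" for c d u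
              using G(5)[OF JG, of s c d u] that by simp
            show "x k \<in> ?I" "y k \<in> ?I" using x y JI by auto
            fix t assume t: "t \<in> ?I"
            then have "?G (s(k := t))" unfolding G(2) using JG by (intro bexI) simp_all
            \<comment> \<open>\<open>w\<close> is the point of the slice over \<open>t\<close> that
              is a limit of the neighbouring slices. A box around it on which \<open>Q\<close> is
              constant meets all those slices, so \<open>q\<close> is locally constant at
              \<open>t\<close>.\<close>
            then obtain w where w: "B w" "agree (Suc k) w (s(k := t))"
              "\<forall>c d. inbox ?N c d w \<longrightarrow> (\<exists>u v. u < (s(k := t)) k \<and> (s(k := t)) k < v \<and>
                (\<forall>t'. u < t' \<and> t' < v \<longrightarrow> (\<exists>z. B z \<and> agree k z (s(k := t)) \<and> z k = t' \<and> inbox ?N c d z)))"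
              unfolding slice_continuous_def by (elim exE conjE)
            have agk: "agree k z (s(k := t)) = agree k z s" for z by (auto simp: agree_def)
            have wk: "w k = t" "agree k w s" using w(2) by (auto simp: agree_def less_Suc_eq)
            then have Fw: "?F w" using JI[of w] w(1) t by simp
            obtain c d where cd: "inbox ?N c d w" "\<forall>y. ?F y \<longrightarrow> inbox ?N c d y \<longrightarrow> Q y = Q w"
              using loc[rule_format, OF Fw] by (elim exE conjE)
            have "\<exists>u v. u < t \<and> t < v \<and>
                (\<forall>t'. u < t' \<and> t' < v \<longrightarrow> (\<exists>z. B z \<and> agree k z s \<and> z k = t' \<and> inbox ?N c d z))"
              using w(3)[rule_format, OF cd(1)] unfolding agk by (simp only: fun_upd_same)
            then obtain u v where uv: "u < t" "t < v"
              "\<And>t'. u < t' \<Longrightarrow> t' < v \<Longrightarrow> \<exists>z. B z \<and> agree k z s \<and> z k = t' \<and> inbox ?N c d z"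
              by blast
            have "q t' = q t" if t': "t' \<in> ?I" "u < t'" "t' < v" for t'
            proof -
              obtain z where z: "B z" "agree k z s" "z k = t'" "inbox ?N c d z" using uv(3)[OF t'(2,3)] by (elim exE conjE)
              then have Fz: "?F z" using JI[of z] t' by simp
              then have "Q z = Q w" using cd(2) z(4) by (elim allE[of _ z] impE)
              then show ?thesis using q[OF Fz] q[OF Fw] z wk by simp
            qed
            then show "\<exists>c d. c < t \<and> t < d \<and> (\<forall>u\<in>?I. c < u \<and> u < d \<longrightarrow> q u = q t)"
              using uv by blast
          qed
          then show ?thesis using q x y by simp
        qed
      qed
    qed
    ultimately show ?thesis by (intro exI[of _ \<C>]) simp
  qed
  show ?case
    unfolding connected_decomposable_def
  proof (intro allI impI)
    fix A assume A: "definable A" "depends ?N A"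
    obtain \<B> where B: "finite \<B>" "\<forall>x. A x \<longleftrightarrow> (\<exists>B\<in>\<B>. B x)"
      "\<forall>B\<in>\<B>. definable B" "\<forall>B\<in>\<B>. depends (Suc k + l) B"
      "\<forall>B\<in>\<B>. \<forall>s. box_connected (Suc k + l) (\<lambda>x. B x \<and> agree (Suc k) x s)"
      by (rule connected_decomposableE[OF IH A(1)]) (use A(2) in \<open>simp_all\<close>)
    have "\<forall>B\<in>\<B>. \<exists>\<C>. finite \<C> \<and> (\<forall>x. B x \<longleftrightarrow> (\<exists>C\<in>\<C>. C x)) \<and>
        (\<forall>C\<in>\<C>. definable C \<and> depends ?N C \<and> (\<forall>s. box_connected ?N (\<lambda>x. C x \<and> agree k x s)))"
      using step B(3,4,5) by simp
    from bchoice[OF this] obtain f where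
      f: "\<forall>B\<in>\<B>. finite (f B) \<and> (\<forall>x. B x \<longleftrightarrow> (\<exists>C\<in>f B. C x)) \<and>
        (\<forall>C\<in>f B. definable C \<and> depends ?N C \<and> (\<forall>s. box_connected ?N (\<lambda>x. C x \<and> agree k x s)))" ..
    show "\<exists>\<C>. finite \<C> \<and> (\<forall>x. A x \<longleftrightarrow> (\<exists>C\<in>\<C>. C x)) \<and>
        (\<forall>C\<in>\<C>. definable C \<and> depends ?N C \<and> (\<forall>s. box_connected ?N (\<lambda>x. C x \<and> agree k x s)))"
    proof (intro exI[of _ "\<Union>(f ` \<B>)"] conjI)
      show "finite (\<Union>(f ` \<B>))" using f B(1) by simp
      have "A x \<longleftrightarrow> (\<exists>B\<in>\<B>. \<exists>C\<in>f B. C x)" for x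
        unfolding B(2)[rule_format] by (intro bex_cong refl) (simp add: f)
      then show "\<forall>x. A x \<longleftrightarrow> (\<exists>C\<in>\<Union>(f ` \<B>). C x)" by simp
      show "\<forall>C\<in>\<Union>(f ` \<B>). definable C \<and> depends ?N C \<and> (\<forall>s. box_connected ?N (\<lambda>x. C x \<and> agree k x s))"
        using f by simp
    qed
  qed
qed

end

section \<open>Finite fibres, convex pieces and sets with empty interior\<close>

definition ins_coord :: "nat \<Rightarrow> real \<Rightarrow> (nat \<Rightarrow> real) \<Rightarrow> nat \<Rightarrow> real" where
  "ins_coord k v z = (\<lambda>i. if i < k then z i else if i = k then v else z (i - 1))"

text \<open>No element of \<open>R\<close> is at least \<open>p\<close> and less than
  \<open>c\<close>, so a real lower bound can be relaxed to a rational one without admitting further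
  elements of \<open>R\<close>.\<close>

lemma finite_rat_below:
  assumes "finite (R :: real set)" obtains p :: rat where "of_rat p < c" "\<forall>r\<in>R. of_rat p \<le> r \<longrightarrow> c \<le> r"
proof -
  let ?R = "insert (c - 1) {r \<in> R. r < c}"
  have fin: "finite ?R" using assms by simp
  have "Max ?R < c" using fin by simp
  then obtain p where p: "Max ?R < of_rat p" "of_rat p < c" using of_rat_dense by blast
  have "c \<le> r" if "r \<in> R" "of_rat p \<le> r" for r
  proof (rule ccontr)
    assume "\<not> c \<le> r"
    then have "r \<in> ?R" using that by simp
    then have "r \<le> Max ?R" by (rule Max_ge[OF fin])
    then show False using p that by linarith
  qed
  then show thesis using p(2) that by blast
qed

lemma finite_rat_above:
  assumes "finite (R :: real set)" obtains q :: rat where "c < of_rat q" "\<forall>r\<in>R. r \<le> of_rat q \<longrightarrow> r \<le> c"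
proof -
  have "finite (uminus ` R)" using assms by simp
  then obtain p :: rat where p: "of_rat p < - c" "\<forall>r\<in>uminus ` R. of_rat p \<le> r \<longrightarrow> - c \<le> r"
    using finite_rat_below[of "uminus ` R" "- c"] by metis
  show thesis
  proof (rule that[of "- p"])
    show "c < of_rat (- p)" using p(1) by (simp add: of_rat_minus)
    show "\<forall>r\<in>R. r \<le> of_rat (- p) \<longrightarrow> r \<le> c"
      using p(2) by (force simp: of_rat_minus)
  qed
qed

lemma inbox_finite_Int:
  assumes "finite R" "\<And>r. r \<in> R \<Longrightarrow> \<exists>a b. inbox m a b x \<and> (\<forall>y. inbox m a b y \<longrightarrow> P r y)"
  shows "\<exists>a b. inbox m a b x \<and> (\<forall>y. inbox m a b y \<longrightarrow> (\<forall>r\<in>R. P r y))"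
  using assms
proof (induction R)
  case empty
  then show ?case by (intro exI[of _ "\<lambda>i. x i - 1"] exI[of _ "\<lambda>i. x i + 1"]) (simp add: inbox_def)
next
  case (insert r R)
  obtain a b where ab: "inbox m a b x" "\<forall>y. inbox m a b y \<longrightarrow> (\<forall>r\<in>R. P r y)"
    using insert by auto
  obtain a' b' where ab': "inbox m a' b' x" "\<forall>y. inbox m a' b' y \<longrightarrow> P r y"
    using insert.prems[of r] by auto
  show ?case
    by (rule exI[of _ "\<lambda>i. max (a i) (a' i)"], rule exI[of _ "\<lambda>i. min (b i) (b' i)"])
      (simp add: inbox_Int ab ab')
qed

context o_minimal_structure
begin

text \<open>Turns a lower bound on a cardinality into a first-order condition. A single vector
  \<open>y\<close> carries all \<open>j\<close> witnesses, so one quantifier suffices.\<close>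

lemma card_ge_iff:
  assumes "finite F"
  shows "j \<le> card F \<longleftrightarrow> (\<exists>y :: nat \<Rightarrow> real. (\<forall>i<j. y i \<in> F) \<and> (\<forall>i<j. \<forall>i'<i. y i' \<noteq> y i))"
proof
  assume "j \<le> card F"
  then obtain G where G: "G \<subseteq> F" "card G = j" "finite G" by (rule obtain_subset_with_card_n)
  obtain y where "bij_betw y {0..<card G} G" using ex_bij_betw_nat_finite[OF G(3)] by blast
  then have y: "inj_on y {0..<j}" "y ` {0..<j} = G" using G by (auto simp: bij_betw_def)
  have "\<forall>i<j. \<forall>i'<i. y i' \<noteq> y i"
  proof (intro allI impI)
    fix i i' assume "i < j" "i' < i"
    then show "y i' \<noteq> y i" using inj_onD[OF y(1), of i' i] by auto
  qed
  moreover have "\<forall>i<j. y i \<in> F" using y(2) G(1) by auto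
  ultimately show "\<exists>y. (\<forall>i<j. y i \<in> F) \<and> (\<forall>i<j. \<forall>i'<i. y i' \<noteq> y i)" by blast
next
  assume "\<exists>y. (\<forall>i<j. y i \<in> F) \<and> (\<forall>i<j. \<forall>i'<i. y i' \<noteq> y i)"
  then obtain y where y: "\<forall>i<j. y i \<in> F" "\<forall>i<j. \<forall>i'<i. y i' \<noteq> y i" by blast
  have "inj_on y {0..<j}"
  proof (rule inj_onI)
    fix i i' assume "i \<in> {0..<j}" "i' \<in> {0..<j}" "y i = y i'"
    then show "i = i'" using y(2)[rule_format, of i i'] y(2)[rule_format, of i' i]
      by (cases i i' rule: linorder_cases) auto
  qed
  moreover have "y ` {0..<j} \<subseteq> F" using y(1) by auto
  ultimately show "j \<le> card F" using card_inj_on_le[of y "{0..<j}" F] assms by simp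
qed

text \<open>Each point of \<open>A\<close> is labelled by whether it is a boundary point of its
  section in direction \<open>m\<close> and by the number of boundary points below it. The uniform
  bound \<open>K\<close> leaves finitely many labels, and two points of a section with equal labels
  enclose no change of \<open>A\<close>.\<close>

lemma uniformly_finite_imp_convex_decomposable:
  assumes UF: "uniformly_finite m" shows "convex_decomposable m"
  unfolding convex_decomposable_def
proof (intro allI impI)
  fix A assume A: "definable A" "depends (Suc m) A"
  define bd where "bd x \<longleftrightarrow> \<not> (\<exists>c d. c < x m \<and> x m < d \<and> (\<forall>u. c < u \<and> u < d \<longrightarrow> A (x(m := u)) = A x))" for x
  have bd_iff: "bd (x(m := t)) \<longleftrightarrow> boundary_pt (\<lambda>u. A (x(m := u))) t" for x t
    unfolding bd_def boundary_pt_def by simp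
  have def_bd: "definable bd"
    unfolding bd_def by (rule definableI) (intro env_definable_intros env_definable_app[OF A(1)])
  have agr: "A (x(m := t)) = A (y(m := t))" if "\<forall>i<m. x i = y i" for x y t
    by (rule dependsD[OF A(2)]) (use that in \<open>auto simp: less_Suc_eq\<close>)
  have bd_agr: "bd (x(m := t)) = bd (y(m := t))" if "\<forall>i<m. x i = y i" for x y t
    unfolding bd_iff using agr[OF that] by simp
  have bd_self: "bd x = bd (x(m := x m))" for x by simp
  have dep_bd: "depends (Suc m) bd"
    unfolding depends_def
  proof (intro allI impI)
    fix x y :: "nat \<Rightarrow> real" assume "\<forall>i<Suc m. x i = y i"
    then have "bd (x(m := x m)) = bd (y(m := x m))" and m: "x m = y m" by (intro bd_agr, simp, simp)
    then have "bd (x(m := x m)) = bd (y(m := y m))" by (simp only: m)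
    then show "bd x = bd y" by (simp only: fun_upd_triv)
  qed
  have fin_bd: "finite {t. bd (s(m := t))}" for s
    unfolding bd_iff using tame_finite_boundary[OF tame_section[OF A(1), of s m]] by simp
  obtain K where K: "\<And>s. card {t. bd (s(m := t))} \<le> K"
    using UF def_bd dep_bd fin_bd unfolding uniformly_finite_def by metis
  define F where "F x = {t. bd (x(m := t)) \<and> t < x m}" for x
  have fin_F: "finite (F x)" for x
    unfolding F_def by (rule finite_subset[OF _ fin_bd[of x]]) auto
  have F_upd: "F (s(m := t)) = {u. bd (s(m := u)) \<and> u < t}" for s t unfolding F_def by simp
  have F_le: "card (F x) \<le> K" for x
    using card_mono[OF fin_bd[of x], of "F x"] K[of x] unfolding F_def by fastforce
  define E where "E j w x \<longleftrightarrow> A x \<and> bd x = w \<and> card (F x) = j" for j :: nat and w x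
  have def_ge: "definable (\<lambda>x. j \<le> card (F x))" for j
  proof -
    have "definable (\<lambda>x. \<exists>y. (\<forall>i<j. bd (x(m := y i)) \<and> y i < x m) \<and> (\<forall>i<j. \<forall>i'<i. y i' \<noteq> y i))"
      by (rule definableI) (intro env_definable_intros env_definable_app[OF def_bd])
    then show ?thesis unfolding card_ge_iff[OF fin_F] unfolding F_def by simp
  qed
  have def_E: "definable (E j w)" for j w
  proof -
    have eq: "E j w = (\<lambda>x. (A x \<and> bd x = w) \<and> (j \<le> card (F x) \<and> \<not> Suc j \<le> card (F x)))"
      unfolding E_def by auto
    have "definable (\<lambda>x. A x \<and> bd x = w)"
      by (rule definableI) (intro env_definable_intros env_definable_app[OF def_bd] env_definable_app[OF A(1)])
    then show ?thesis
      unfolding eq by (rule definable_conj) (intro definable_conj definable_not def_ge)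
  qed
  have dep_E: "depends (Suc m) (E j w)" for j w
    unfolding depends_def
  proof (intro allI impI)
    fix x y :: "nat \<Rightarrow> real" assume xy: "\<forall>i<Suc m. x i = y i"
    then have "A x = A y" "bd x = bd y" using dependsD[OF A(2), of x y] dependsD[OF dep_bd, of x y] by simp_all
    moreover have "F x = F y" unfolding F_def using bd_agr[of x y] xy by simp
    ultimately show "E j w x = E j w y" unfolding E_def by simp
  qed
  have conv: "E j w (s(m := u))" if E: "E j w (s(m := c))" "E j w (s(m := d))" "c < u" "u < d" for j w s c d u
  proof -
    \<comment> \<open>A boundary point from \<open>c\<close> up to but excluding \<open>d\<close>
      would be counted at \<open>d\<close> but not at \<open>c\<close>, while both counts are
      \<open>j\<close>.\<close>
    have nbd: "\<not> bd (s(m := v))" if v: "c \<le> v" "v < d" for v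
    proof
      assume "bd (s(m := v))"
      then have "insert v (F (s(m := c))) \<subseteq> F (s(m := d))" "v \<notin> F (s(m := c))"
        using v unfolding F_upd by auto
      then have "card (F (s(m := c))) < card (F (s(m := d)))"
        using fin_F card_mono[of "F (s(m := d))" "insert v (F (s(m := c)))"] by fastforce
      then show False using E(1,2) unfolding E_def by simp
    qed
    \<comment> \<open>In particular \<open>c\<close> is no boundary point. Pieces with
      \<open>w\<close> true thus have at most one point on each such line, and convexity is a
      question only for \<open>w\<close> false.\<close>
    have w: "\<not> w" using nbd[of c] E unfolding E_def by simp
    have nbd': "\<not> bd (s(m := v))" if "v \<in> {c..d}" for v
      using nbd[of v] E(2) w that unfolding E_def by (cases "v = d") auto
    have "F (s(m := u)) = F (s(m := c))" unfolding F_upd using nbd E(3,4) by (auto simp: not_less intro: ccontr)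
    then have "card (F (s(m := u))) = j" using E(1) unfolding E_def by simp
    moreover have "A (s(m := c)) = A (s(m := u))"
    proof (rule interval_locally_constant[of "{c..d}"])
      fix t assume "t \<in> {c..d}"
      from nbd'[OF this] show "\<exists>c' d'. c' < t \<and> t < d' \<and> (\<forall>u\<in>{c..d}. c' < u \<and> u < d' \<longrightarrow> A (s(m := u)) = A (s(m := t)))"
        unfolding bd_iff boundary_pt_def not_not by blast
    qed (use E in auto)
    moreover have "\<not> bd (s(m := u))" using nbd[of u] E by simp
    ultimately show ?thesis using E(1) w unfolding E_def by simp
  qed
  show "\<exists>\<B>. finite \<B> \<and> (\<forall>x. A x \<longleftrightarrow> (\<exists>B\<in>\<B>. B x)) \<and>
        (\<forall>B\<in>\<B>. definable B \<and> depends (Suc m) B \<and>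
          (\<forall>s c d u. B (s(m := c)) \<longrightarrow> B (s(m := d)) \<longrightarrow> c < u \<longrightarrow> u < d \<longrightarrow> B (s(m := u))))"
  proof (intro exI[of _ "(\<lambda>(j, w). E j w) ` ({..K} \<times> UNIV)"] conjI ballI)
    show "\<forall>x. A x \<longleftrightarrow> (\<exists>B\<in>(\<lambda>(j, w). E j w) ` ({..K} \<times> UNIV). B x)"
    proof
      fix x
      have "A x \<longleftrightarrow> (\<exists>j\<le>K. \<exists>w. E j w x)" unfolding E_def using F_le by auto
      then show "A x \<longleftrightarrow> (\<exists>B\<in>(\<lambda>(j, w). E j w) ` ({..K} \<times> UNIV). B x)" by auto
    qed
    fix B assume "B \<in> (\<lambda>(j, w). E j w) ` ({..K} \<times> UNIV)"
    then obtain j w where B: "B = E j w" by auto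
    show "definable B" "depends (Suc m) B" unfolding B by (fact def_E, fact dep_E)
    show "\<forall>s c d u. B (s(m := c)) \<longrightarrow> B (s(m := d)) \<longrightarrow> c < u \<longrightarrow> u < d \<longrightarrow> B (s(m := u))"
      unfolding B by (intro allI impI) (rule conv)
  qed simp
qed

definition determined_by_rest :: "nat \<Rightarrow> nat \<Rightarrow> ((nat \<Rightarrow> real) \<Rightarrow> bool) \<Rightarrow> bool" where
  "determined_by_rest m k B \<longleftrightarrow>
     (\<forall>x y. B x \<longrightarrow> B y \<longrightarrow> (\<forall>i<m. i \<noteq> k \<longrightarrow> x i = y i) \<longrightarrow> x k = y k)"

text \<open>A set with empty interior is split by whether the section in the last coordinate
  contains an interval. The base \<open>E\<close> of the first part has empty interior itself and is
  treated by induction; the second part has finite sections, whose convex pieces are single points,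
  so there the last coordinate is determined.\<close>

lemma thin_decomposition:
  assumes "\<And>j. j < m \<Longrightarrow> convex_decomposable j" "definable D" "depends m D" "thin m D"
  shows "\<exists>\<B>. finite \<B> \<and> (\<forall>x. D x \<longrightarrow> (\<exists>B\<in>\<B>. B x)) \<and>
    (\<forall>B\<in>\<B>. definable B \<and> depends m B \<and> (\<exists>k<m. determined_by_rest m k B))"
  using assms
proof (induction m arbitrary: D)
  case 0
  have "\<not> D x" for x
  proof
    assume "D x"
    then have "D y" for y using dependsD[OF 0(3), of y x] by simp
    then show False using 0(4) unfolding thin_def by simp
  qed
  then show ?case by (intro exI[of _ "{}"]) simp
next
  case (Suc m)
  have D: "definable D" "depends (Suc m) D" by fact+
  have agr: "D (x(m := t)) = D (y(m := t))" if "\<forall>i<m. x i = y i" for x y t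
    by (rule dependsD[OF D(2)]) (use that in \<open>auto simp: less_Suc_eq\<close>)
  define E where "E x \<longleftrightarrow> (\<exists>c d. c < d \<and> (\<forall>t. c < t \<and> t < d \<longrightarrow> D (x(m := t))))" for x
  have defE: "definable E"
    unfolding E_def by (rule definableI) (intro env_definable_intros env_definable_app[OF D(1)])
  have depE: "depends m E"
    unfolding depends_def
  proof (intro allI impI)
    fix x y :: "nat \<Rightarrow> real" assume "\<forall>i<m. x i = y i"
    then have "D (x(m := t)) = D (y(m := t))" for t by (rule agr)
    then show "E x = E y" unfolding E_def by simp
  qed
  \<comment> \<open>If \<open>E\<close> held on a box, \<open>baire\<close> would select one
    rational interval common to all sections over a smaller box, and the product would be a box
    inside \<open>D\<close>.\<close>
  have thinE: "thin m E"
    unfolding thin_def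
  proof
    assume "\<exists>a b. (\<forall>i<m. a i < b i) \<and> (\<forall>x. inbox m a b x \<longrightarrow> E x)"
    then obtain a b where ab: "\<forall>i<m. a i < b i" "\<And>x. inbox m a b x \<Longrightarrow> E x" by blast
    define H where "H w x \<longleftrightarrow> fst w < snd w \<and> (\<forall>t. of_rat (fst w) < t \<and> t < of_rat (snd w) \<longrightarrow> D (x(m := t)))"
      for w :: "rat \<times> rat" and x
    have "\<exists>j a' b'. (\<forall>i<m. a i \<le> a' i \<and> a' i < b' i \<and> b' i \<le> b i) \<and>
      (\<forall>x. inbox m a' b' x \<longrightarrow> H (from_nat j) x)"
    proof (rule baire)
      show "definable (H (from_nat j))" for j
        unfolding H_def by (rule definableI) (intro env_definable_intros env_definable_app[OF D(1)])
      show "depends m (H (from_nat j))" for j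
        unfolding depends_def
      proof (intro allI impI)
        fix x y :: "nat \<Rightarrow> real" assume "\<forall>i<m. x i = y i"
        then have "D (x(m := t)) = D (y(m := t))" for t by (rule agr)
        then show "H (from_nat j) x = H (from_nat j) y" unfolding H_def by simp
      qed
      show "\<exists>j. H (from_nat j) x" if x: "inbox m a b x" for x
      proof -
        obtain c d where cd: "c < d" "\<forall>t. c < t \<and> t < d \<longrightarrow> D (x(m := t))"
          using ab(2)[OF x] unfolding E_def by blast
        obtain p where p: "c < real_of_rat p" "real_of_rat p < d" using of_rat_dense[OF cd(1)] by blast
        obtain q where q: "real_of_rat p < real_of_rat q" "real_of_rat q < d" using of_rat_dense[OF p(2)] by blast
        have "H (p, q) x" unfolding H_def using p q cd(2) by (auto simp: of_rat_less)
        then have "H (from_nat (to_nat (p, q))) x" by simp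
        then show ?thesis ..
      qed
    qed (fact ab(1))
    then obtain j a' b' where j: "\<forall>i<m. a i \<le> a' i \<and> a' i < b' i \<and> b' i \<le> b i"
      "\<forall>x. inbox m a' b' x \<longrightarrow> H (from_nat j) x" by blast
    obtain p q where pq: "(from_nat j :: rat \<times> rat) = (p, q)" by (cases "from_nat j :: rat \<times> rat")
    obtain x0 where "inbox m a' b' x0" using j(1) inbox_nonempty[of m a' b'] by blast
    then have "H (p, q) x0" using j(2) pq by auto
    then have "p < q" unfolding H_def by simp
    let ?a = "a'(m := of_rat p)" and ?b = "b'(m := of_rat q)"
    have "D x" if x: "inbox (Suc m) ?a ?b x" for x
    proof -
      have "inbox m a' b' x" using x by (auto simp: inbox_def less_Suc_eq)
      then have "H (p, q) x" using j(2) pq by auto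
      moreover have "of_rat p < x m" "x m < of_rat q" using x by (auto simp: inbox_def)
      ultimately have "D (x(m := x m))" unfolding H_def fst_conv snd_conv by blast
      then show ?thesis by simp
    qed
    moreover have "\<forall>i<Suc m. ?a i < ?b i" using j(1) \<open>p < q\<close> by (simp add: less_Suc_eq of_rat_less)
    ultimately show False using Suc.prems(4) unfolding thin_def by blast
  qed
  have "\<exists>\<B>. finite \<B> \<and> (\<forall>x. E x \<longrightarrow> (\<exists>B\<in>\<B>. B x)) \<and>
    (\<forall>B\<in>\<B>. definable B \<and> depends m B \<and> (\<exists>k<m. determined_by_rest m k B))"
    by (rule Suc.IH[OF _ defE depE thinE]) (simp add: Suc.prems(1))
  then obtain \<E> where \<E>: "finite \<E>" "\<forall>x. E x \<longrightarrow> (\<exists>B\<in>\<E>. B x)"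
    "\<forall>B\<in>\<E>. definable B \<and> depends m B \<and> (\<exists>k<m. determined_by_rest m k B)" by (elim exE conjE)
  define D1 where "D1 x \<longleftrightarrow> D x \<and> \<not> E x" for x
  have defD1: "definable D1" unfolding D1_def by (intro definable_conj definable_not D defE)
  have depD1: "depends (Suc m) D1"
    unfolding depends_def
  proof (intro allI impI)
    fix x y :: "nat \<Rightarrow> real" assume "\<forall>i<Suc m. x i = y i"
    then have "D x = D y" "E x = E y" using dependsD[OF D(2), of x y] dependsD[OF depE, of x y] by simp_all
    then show "D1 x = D1 y" unfolding D1_def by simp
  qed
  have finD1: "finite {t. D1 (s(m := t))}" for s
  proof (rule ccontr)
    assume "infinite {t. D1 (s(m := t))}"
    from tame_infinite[OF tame_section[OF defD1] this] obtain c d where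
      cd: "c < d" "{c<..<d} \<subseteq> {t. D1 (s(m := t))}" .
    have D1: "D1 (s(m := t))" if "c < t" "t < d" for t using cd(2) that by auto
    then have "E s" unfolding E_def D1_def using cd(1) by blast
    obtain t where t: "c < t" "t < d" using dense[OF cd(1)] by blast
    have "\<not> E (s(m := t))" using D1[OF t] unfolding D1_def by simp
    then show False using \<open>E s\<close> depends_upd[OF depE] by simp
  qed
  have "convex_decomposable m" by (simp add: Suc.prems(1))
  from convex_decomposableE[OF this defD1 depD1] obtain \<J> where J: "finite \<J>"
    "\<forall>x. D1 x \<longleftrightarrow> (\<exists>B\<in>\<J>. B x)" "\<forall>B\<in>\<J>. definable B" "\<forall>B\<in>\<J>. depends (Suc m) B"
    "\<forall>B\<in>\<J>. \<forall>s c d u. B (s(m := c)) \<longrightarrow> B (s(m := d)) \<longrightarrow> c < u \<longrightarrow> u < d \<longrightarrow> B (s(m := u))" .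
  \<comment> \<open>Two points of a convex piece on the same line would force a whole interval into
    a finite section of \<open>D1\<close>.\<close>
  have detJ: "determined_by_rest (Suc m) m B" if B: "B \<in> \<J>" for B
    unfolding determined_by_rest_def
  proof (intro allI impI)
    fix x y assume xy: "B x" "B y" "\<forall>i<Suc m. i \<noteq> m \<longrightarrow> x i = y i"
    have "B (x(m := y m)) = B y"
      by (rule dependsD[OF J(4)[rule_format, OF B]]) (use xy(3) in \<open>auto simp: less_Suc_eq\<close>)
    then have By: "B (x(m := y m))" using xy(2) by simp
    have Bx: "B (x(m := x m))" using xy(1) by simp
    have "\<not> c < d" if "B (x(m := c))" "B (x(m := d))" for c d
    proof
      assume "c < d"
      have "B (x(m := t))" if "c < t" "t < d" for t
        using J(5)[rule_format, OF B \<open>B (x(m := c))\<close> \<open>B (x(m := d))\<close> that] .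
      then have "\<exists>B\<in>\<J>. B (x(m := t))" if "c < t" "t < d" for t using that B by (intro bexI)
      then have "D1 (x(m := t))" if "c < t" "t < d" for t using J(2) that by simp
      then have "{c<..<d} \<subseteq> {t. D1 (x(m := t))}" by (intro subsetI) simp
      then have "finite {c<..<d}" using finD1 by (rule finite_subset)
      then show False using \<open>c < d\<close> infinite_Ioo by blast
    qed
    from this[OF Bx By] this[OF By Bx] show "x m = y m" by linarith
  qed
  show ?case
  proof (intro exI[of _ "\<J> \<union> (\<lambda>B x. D x \<and> B x) ` \<E>"] conjI)
    show "finite (\<J> \<union> (\<lambda>B x. D x \<and> B x) ` \<E>)" using J(1) \<E>(1) by simp
    show "\<forall>x. D x \<longrightarrow> (\<exists>B\<in>\<J> \<union> (\<lambda>B x. D x \<and> B x) ` \<E>. B x)"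
    proof (intro allI impI)
      fix x assume x: "D x"
      show "\<exists>B\<in>\<J> \<union> (\<lambda>B x. D x \<and> B x) ` \<E>. B x"
      proof (cases "E x")
        case True
        then obtain B where "B \<in> \<E>" "B x" using \<E>(2) by blast
        then show ?thesis using x by (intro bexI[of _ "\<lambda>x. D x \<and> B x"]) simp_all
      next
        case False
        then have "D1 x" using x unfolding D1_def by simp
        then obtain B where "B \<in> \<J>" "B x" using J(2) by auto
        then show ?thesis by (intro bexI[of _ B]) simp_all
      qed
    qed
    show "\<forall>B\<in>\<J> \<union> (\<lambda>B x. D x \<and> B x) ` \<E>. definable B \<and> depends (Suc m) B \<and> (\<exists>k<Suc m. determined_by_rest (Suc m) k B)"
    proof
      fix B assume "B \<in> \<J> \<union> (\<lambda>B x. D x \<and> B x) ` \<E>"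
      then consider "B \<in> \<J>" | B' where "B' \<in> \<E>" "B = (\<lambda>x. D x \<and> B' x)" by auto
      then show "definable B \<and> depends (Suc m) B \<and> (\<exists>k<Suc m. determined_by_rest (Suc m) k B)"
      proof cases
        case 1
        then show ?thesis using J(3,4) detJ by blast
      next
        case (2 B')
        then obtain k where B': "definable B'" "depends m B'" "k < m" "determined_by_rest m k B'"
          using \<E>(3) by blast
        have "determined_by_rest (Suc m) k B"
          unfolding determined_by_rest_def 2(2)
        proof (intro allI impI)
          fix x y assume "D x \<and> B' x" "D y \<and> B' y" "\<forall>i<Suc m. i \<noteq> k \<longrightarrow> x i = y i"
          then show "x k = y k" using B'(4)[unfolded determined_by_rest_def, rule_format, of x y] by simp
        qed
        moreover have "definable B" unfolding 2(2) by (intro definable_conj D B')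
        moreover have "depends (Suc m) B"
          unfolding 2(2) using depends_mono[OF B'(2), of "Suc m"] by (intro depends_conj D) simp_all
        ultimately show ?thesis using B'(3) by (intro conjI exI[of _ k]) simp_all
      qed
    qed
  qed
qed

end

context o_minimal_structure
begin

text \<open>
  A point is good if each element of its fibre persists nearby and each interval meeting its fibre in
  at most one point does so nearby. The number of elements of the fibre is locally constant on
  the set of good points, hence constant on each of its finitely many connected pieces. The other
  points form a thin set, where one coordinate is determined by the remaining ones, so that they are
  covered by the statement in lower dimension.
\<close>

lemma uniformly_finite_step:
  assumes UF: "\<And>j. j < m \<Longrightarrow> uniformly_finite j"
  shows "uniformly_finite m"
  unfolding uniformly_finite_def
proof (intro allI impI)
  fix Y assume Y: "definable Y" "depends (Suc m) Y" and fin: "\<forall>s. finite {t. Y (s(m := t))}"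
  have CDj: "convex_decomposable j" if "j < m" for j
    using uniformly_finite_imp_convex_decomposable[OF UF[OF that]] .
  have agr: "Y (x(m := t)) = Y (y(m := t))" if "\<forall>i<m. x i = y i" for x y t
    by (rule dependsD[OF Y(2)]) (use that in \<open>auto simp: less_Suc_eq\<close>)
  define F where "F x = {t. Y (x(m := t))}" for x
  have finF: "finite (F x)" for x using fin unfolding F_def by blast
  have F_agr: "F x = F y" if "\<forall>i<m. x i = y i" for x y unfolding F_def using agr[OF that] by simp
  define meets where "meets c d x \<longleftrightarrow> (\<exists>r. (c < r \<and> r < d) \<and> Y (x(m := r)))" for c d x
  \<comment> \<open>"At most one". The flags tell which of the two bounds is present, so half-lines
    and the whole line are covered without infinite endpoints.\<close>
  define amo where "amo lb ub c d x \<longleftrightarrow> (\<forall>r r'. (Y (x(m := r)) \<and> Y (x(m := r'))) \<and>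
      ((lb \<longrightarrow> c \<le> r \<and> c \<le> r') \<and> (ub \<longrightarrow> r \<le> d \<and> r' \<le> d)) \<longrightarrow> r = r')" for lb ub c d x
  define near where "near P x \<longleftrightarrow> (\<exists>a b. inbox m a b x \<and> (\<forall>y. inbox m a b y \<longrightarrow> P y))"
    for P :: "(nat \<Rightarrow> real) \<Rightarrow> bool" and x
  define good1 where "good1 x \<longleftrightarrow> (\<forall>c d. meets c d x \<longrightarrow> near (meets c d) x)" for x
  define good2 where "good2 lb ub x \<longleftrightarrow> (\<forall>c d. amo lb ub c d x \<longrightarrow> near (amo lb ub c d) x)" for lb ub x
  define good where "good x \<longleftrightarrow> good1 x \<and> (good2 False False x \<and> (good2 False True x \<and>
      (good2 True False x \<and> good2 True True x)))" for x
  have def_good1: "definable good1"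
    unfolding good1_def meets_def near_def inbox_def
    by (rule definableI) (intro env_definable_intros env_definable_app[OF Y(1)])
  have def_good2: "definable (good2 lb ub)" for lb ub
    unfolding good2_def amo_def near_def inbox_def
    by (rule definableI) (intro env_definable_intros env_definable_app[OF Y(1)])
  have def_good: "definable good"
    unfolding good_def by (intro definable_conj def_good1 def_good2)
  have meets_agr: "meets c d x = meets c d y" and amo_agr: "amo lb ub c d x = amo lb ub c d y"
    and near_agr: "near P x = near P y" if "\<forall>i<m. x i = y i" for x y c d lb ub P
    using agr[OF that] that unfolding meets_def amo_def near_def inbox_def by simp_all
  have dep_good: "depends m good"
    unfolding depends_def
  proof (intro allI impI)
    fix x y :: "nat \<Rightarrow> real" assume xy: "\<forall>i<m. x i = y i"
    show "good x = good y"
      unfolding good_def good1_def good2_def meets_agr[OF xy] amo_agr[OF xy] near_agr[OF xy] ..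
  qed
  have def_meets: "definable (meets c d)" and def_amo: "definable (amo lb ub c d)" for c d lb ub
    unfolding meets_def amo_def
    by (rule definableI, intro env_definable_intros env_definable_app[OF Y(1)])+
  have generic_good: "\<exists>x. inbox m a b x \<and> good x" if ab: "\<forall>i<m. a i < b i" for a b
  proof -
    \<comment> \<open>Only the countably many instances with rational endpoints are passed to
      \<open>generic_point\<close>. At the point obtained, persistence is then extended to all real
      endpoints.\<close>
    define H where "H w = (case w of Inl (p :: rat, q :: rat) \<Rightarrow> meets (of_rat p) (of_rat q)
        | Inr (lb, ub, p :: rat, q :: rat) \<Rightarrow> amo lb ub (of_rat p) (of_rat q))" for w
    have "definable (H w)" for w
      unfolding H_def by (auto split: sum.split prod.split intro: def_meets def_amo)
    moreover have "depends m (H w)" for w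
      unfolding depends_def H_def
    proof (intro allI impI)
      fix x y :: "nat \<Rightarrow> real" assume xy: "\<forall>i<m. x i = y i"
      show "(case w of Inl (p, q) \<Rightarrow> meets (of_rat p) (of_rat q)
          | Inr (lb, ub, p, q) \<Rightarrow> amo lb ub (of_rat p) (of_rat q)) x =
        (case w of Inl (p, q) \<Rightarrow> meets (of_rat p) (of_rat q)
          | Inr (lb, ub, p, q) \<Rightarrow> amo lb ub (of_rat p) (of_rat q)) y"
        by (simp split: sum.split prod.split add: meets_agr[OF xy] amo_agr[OF xy])
    qed
    ultimately obtain x where x: "inbox m a b x" "\<forall>k. loc_const_at m (H (from_nat k)) x"
      using generic_point[of "\<lambda>k. H (from_nat k)" m a b] ab by auto
    have H: "near (H w) x" if "H w x" for w
    proof -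
      have "loc_const_at m (H w) x" using x(2)[rule_format, of "to_nat w"] by simp
      then show ?thesis using that unfolding loc_const_at_def near_def by simp
    qed
    have near_mono: "near P' x" if "near P x" "\<And>y. P y \<Longrightarrow> P' y" for P P'
    proof -
      from that(1) obtain a b where "inbox m a b x" "\<forall>y. inbox m a b y \<longrightarrow> P y"
        unfolding near_def by (elim exE conjE)
      then show ?thesis unfolding near_def using that(2) by (intro exI conjI allI impI) auto
    qed
    have "near (meets c d) x" if cd: "meets c d x" for c d
    proof -
      from cd obtain r where r: "c < r" "r < d" "Y (x(m := r))" unfolding meets_def by blast
      obtain p where p: "c < real_of_rat p" "real_of_rat p < r" using of_rat_dense[OF r(1)] by blast
      obtain q where q: "r < real_of_rat q" "real_of_rat q < d" using of_rat_dense[OF r(2)] by blast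
      have "H (Inl (p, q)) x" unfolding H_def meets_def using p q r by auto
      from H[OF this] show ?thesis
      proof (rule near_mono)
        fix y assume "H (Inl (p, q)) y"
        then show "meets c d y" unfolding H_def meets_def using p q by (auto intro: less_trans)
      qed
    qed
    moreover have "near (amo lb ub c d) x" if cd: "amo lb ub c d x" for lb ub c d
    proof -
      \<comment> \<open>For \<open>meets\<close> the rational interval was chosen inside the given
        one. For \<open>amo\<close> it has to be larger, but so little that it contains no further
        point of the finite fibre over \<open>x\<close>.\<close>
      obtain p :: rat where p: "of_rat p < c" "\<forall>r\<in>F x. of_rat p \<le> r \<longrightarrow> c \<le> r"
        using finite_rat_below[OF finF[of x], of c] .
      obtain q :: rat where q: "d < of_rat q" "\<forall>r\<in>F x. r \<le> of_rat q \<longrightarrow> r \<le> d"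
        using finite_rat_above[OF finF[of x], of d] .
      have "H (Inr (lb, ub, p, q)) x"
        using cd p(2) q(2) unfolding H_def amo_def F_def by simp
      from H[OF this] show ?thesis
      proof (rule near_mono)
        fix y assume "H (Inr (lb, ub, p, q)) y"
        then have y: "amo lb ub (of_rat p) (of_rat q) y" unfolding H_def by simp
        show "amo lb ub c d y"
          unfolding amo_def
        proof (intro allI impI)
          fix r r'
          assume "(Y (y(m := r)) \<and> Y (y(m := r'))) \<and> (lb \<longrightarrow> c \<le> r \<and> c \<le> r') \<and> (ub \<longrightarrow> r \<le> d \<and> r' \<le> d)"
          then show "r = r'" using y[unfolded amo_def, rule_format, of r r'] p(1) q(1) by auto
        qed
      qed
    qed
    ultimately have "good x" unfolding good_def good1_def good2_def by blast
    then show ?thesis using x(1) by blast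
  qed
  have near_lower: "near (\<lambda>y. k \<le> card (F y)) x" if x: "good x" "k \<le> card (F x)" for x k
  proof -
    \<comment> \<open>\<open>\<delta> r\<close> is at most the distance from \<open>r\<close> to the
      other points of the fibre, so the intervals of radius \<open>\<delta> r / 2\<close> are
      pairwise disjoint. A nearby fibre meets each of them and thus has at least as many
      points.\<close>
    have "\<forall>r. \<exists>\<delta>. \<delta> > 0 \<and> (\<forall>r'\<in>F x. r' \<noteq> r \<longrightarrow> \<delta> \<le> dist r r')"
      using finite_set_avoid[OF finF[of x]] by blast
    from choice[OF this] obtain \<delta> where
      \<delta>': "\<forall>r. \<delta> r > 0 \<and> (\<forall>r'\<in>F x. r' \<noteq> r \<longrightarrow> \<delta> r \<le> dist r r')" ..
    have \<delta>: "\<And>r. \<delta> r > 0" "\<And>r r'. r' \<in> F x \<Longrightarrow> r' \<noteq> r \<Longrightarrow> \<delta> r \<le> dist r r'"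
      using \<delta>' by simp_all
    have "\<exists>a b. inbox m a b x \<and> (\<forall>y. inbox m a b y \<longrightarrow> (\<forall>r\<in>F x. meets (r - \<delta> r / 2) (r + \<delta> r / 2) y))"
    proof (rule inbox_finite_Int[OF finF])
      fix r assume "r \<in> F x"
      then have "meets (r - \<delta> r / 2) (r + \<delta> r / 2) x"
        unfolding meets_def F_def using \<delta>(1)[of r] by (intro exI[of _ r]) simp
      then show "\<exists>a b. inbox m a b x \<and> (\<forall>y. inbox m a b y \<longrightarrow> meets (r - \<delta> r / 2) (r + \<delta> r / 2) y)"
        using x(1) unfolding good_def good1_def near_def by blast
    qed
    then obtain a b where ab: "inbox m a b x"
      "\<And>y r. inbox m a b y \<Longrightarrow> r \<in> F x \<Longrightarrow> meets (r - \<delta> r / 2) (r + \<delta> r / 2) y" by blast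
    have "k \<le> card (F y)" if y: "inbox m a b y" for y
    proof -
      have "\<forall>r\<in>F x. \<exists>t. t \<in> F y \<and> r - \<delta> r / 2 < t \<and> t < r + \<delta> r / 2"
        using ab(2)[OF y] unfolding meets_def F_def by blast
      from bchoice[OF this] obtain g where
        g: "\<forall>r\<in>F x. g r \<in> F y \<and> r - \<delta> r / 2 < g r \<and> g r < r + \<delta> r / 2" ..
      have "inj_on g (F x)"
      proof (rule inj_onI, rule ccontr)
        fix r r' assume r: "r \<in> F x" "r' \<in> F x" "g r = g r'" "r \<noteq> r'"
        have "\<delta> r \<le> \<bar>r - r'\<bar>" "\<delta> r' \<le> \<bar>r - r'\<bar>"
          using \<delta>(2)[OF r(2), of r] \<delta>(2)[OF r(1), of r'] r(4) by (auto simp: dist_real_def)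
        moreover have "r - \<delta> r / 2 < g r" "g r < r + \<delta> r / 2" "r' - \<delta> r' / 2 < g r'" "g r' < r' + \<delta> r' / 2"
          using g r(1,2) by auto
        ultimately show False using r(3) by linarith
      qed
      then have "card (F x) \<le> card (F y)" using g finF by (intro card_inj_on_le[of g]) auto
      then show ?thesis using x(2) by simp
    qed
    then show ?thesis unfolding near_def using ab(1) by blast
  qed
  \<comment> \<open>The least point of the fibre above \<open>c\<close> is separated from the next
    one by a cut \<open>e\<close>. Up to \<open>e\<close> there is at most one point nearby because
    of \<open>amo\<close>, and from \<open>e\<close> on at most \<open>k\<close> by induction, where
    \<open>e\<close> becomes the new lower bound. The count starts at 1, as goodness does not ensure
    that an empty range stays empty.\<close>
  have near_upper0: "near (\<lambda>y. card (F y \<inter> {r. lb \<longrightarrow> c \<le> r}) \<le> k) x"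
    if "good x" "card (F x \<inter> {r. lb \<longrightarrow> c \<le> r}) \<le> k" "1 \<le> k" for x k lb c
    using that(3,2)
  proof (induction k arbitrary: lb c rule: nat_induct_at_least)
    case base
    have amo_card: "amo lb False c d y \<longleftrightarrow> card (F y \<inter> {r. lb \<longrightarrow> c \<le> r}) \<le> 1" for d y
      using card_le_Suc0_iff_eq[of "F y \<inter> {r. lb \<longrightarrow> c \<le> r}"] finF unfolding amo_def F_def by auto
    have "good2 lb False x" using that(1) unfolding good_def by (cases lb) simp_all
    moreover have "amo lb False c 0 x" unfolding amo_card by (rule base)
    ultimately have "near (amo lb False c 0) x" unfolding good2_def by blast
    then show ?case unfolding amo_card .
  next
    case (Suc k)
    let ?R = "F x \<inter> {r. lb \<longrightarrow> c \<le> r}"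
    have finR: "finite ?R" using finF by simp
    show ?case
    proof (cases "card ?R \<le> k")
      case True
      from Suc.IH[OF this] show ?thesis unfolding near_def by (meson le_Suc_eq)
    next
      case False
      then have card: "card ?R = Suc k" using Suc.prems by simp
      then have ne: "?R \<noteq> {}" by auto
      define r0 where "r0 = Min ?R"
      have r0: "r0 \<in> ?R" "\<And>r. r \<in> ?R \<Longrightarrow> r0 \<le> r"
        unfolding r0_def using Min_in[OF finR ne] Min_le[OF finR] by auto
      have card': "card (?R - {r0}) = k" using card r0(1) finR by simp
      then have ne': "?R - {r0} \<noteq> {}" using Suc.hyps by (metis card.empty not_one_le_zero)
      define r1 where "r1 = Min (?R - {r0})"
      have r1: "r1 \<in> ?R - {r0}" "\<And>r. r \<in> ?R - {r0} \<Longrightarrow> r1 \<le> r"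
        unfolding r1_def using Min_in[OF _ ne'] Min_le[of "?R - {r0}"] finR by auto
      have "r0 < r1" using r0(2)[of r1] r1(1) by auto
      then obtain e where e: "r0 < e" "e < r1" using dense by blast
      have sub: "F x \<inter> {r. True \<longrightarrow> e \<le> r} \<subseteq> ?R - {r0}"
        using e r0(1) by auto
      have "card (F x \<inter> {r. True \<longrightarrow> e \<le> r}) \<le> k"
        using card_mono[OF _ sub] finR card' by simp
      from Suc.IH[OF this] obtain a b where ab: "inbox m a b x"
        "\<And>y. inbox m a b y \<Longrightarrow> card (F y \<inter> {r. True \<longrightarrow> e \<le> r}) \<le> k" unfolding near_def by blast
      have "r = r0" if "r \<in> ?R" "r \<le> e" for r
      proof (rule ccontr)
        assume "r \<noteq> r0"
        then have "r1 \<le> r" using r1(2)[of r] that by blast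
        then show False using e that by linarith
      qed
      then have "amo lb True c e x" unfolding amo_def F_def by blast
      moreover have "good2 lb True x" using that(1) unfolding good_def by (cases lb) simp_all
      ultimately obtain a' b' where ab': "inbox m a' b' x" "\<And>y. inbox m a' b' y \<Longrightarrow> amo lb True c e y"
        unfolding good2_def near_def by blast
      have "card (F y \<inter> {r. lb \<longrightarrow> c \<le> r}) \<le> Suc k" if y: "inbox m a b y" "inbox m a' b' y" for y
      proof -
        let ?A = "F y \<inter> {r. lb \<longrightarrow> c \<le> r} \<inter> {r. r \<le> e}" and ?B = "F y \<inter> {r. True \<longrightarrow> e \<le> r}"
        have "card ?A \<le> Suc 0"
          using ab'(2)[OF y(2)] card_le_Suc0_iff_eq[of ?A] finF unfolding amo_def F_def by auto
        moreover have "card (F y \<inter> {r. lb \<longrightarrow> c \<le> r}) \<le> card (?A \<union> ?B)"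
          by (rule card_mono) (use finF in auto)
        moreover have "card (?A \<union> ?B) \<le> card ?A + card ?B" by (rule card_Un_le)
        ultimately show ?thesis using ab(2)[OF y(1)] by linarith
      qed
      then show ?thesis unfolding near_def
        by (intro exI[of _ "\<lambda>i. max (a i) (a' i)"] exI[of _ "\<lambda>i. min (b i) (b' i)"])
          (simp add: inbox_Int ab(1) ab'(1))
    qed
  qed
  have near_upper: "near (\<lambda>y. card (F y) \<le> k) x" if "good x" "card (F x) \<le> k" "1 \<le> k" for x k
    using near_upper0[OF that(1), of False 0 k] that(2,3) by simp
  have "connected_decomposable 0 m" by (rule connected_decomposable) (simp add: CDj)
  from connected_decomposableE[OF this def_good, unfolded add_0, OF dep_good] obtain \<B> where \<B>: "finite \<B>"
    "\<forall>x. good x \<longleftrightarrow> (\<exists>B\<in>\<B>. B x)" "\<forall>B\<in>\<B>. definable B" "\<forall>B\<in>\<B>. depends m B"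
    "\<forall>B\<in>\<B>. \<forall>s. box_connected m (\<lambda>x. B x \<and> agree 0 x s)" .
  have bound_conn: "\<exists>K. \<forall>x. B x \<longrightarrow> card (F x) \<le> K" if B: "B \<in> \<B>" for B
  proof (cases "\<exists>x. B x")
    case True
    then obtain x where x: "B x" by blast
    \<comment> \<open>With this value \<open>k <= card\<close> fails at \<open>x\<close>, and its
      negation \<open>card <= k - 1\<close> has \<open>1 <= k - 1\<close>, as
      \<open>near_upper\<close> requires even if the fibre over \<open>x\<close> is empty.\<close>
    define k where "k = Suc (Suc (card (F x)))"
    have conn: "box_connected m B" using \<B>(5)[rule_format, OF B] by (simp add: agree_def)
    have "card (F y) \<le> k" if y: "B y" for y
    proof -
      have "(k \<le> card (F x)) = (k \<le> card (F y))"
      proof (rule box_connectedD[OF conn x y])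
        fix z assume "B z"
        then have "\<exists>B\<in>\<B>. B z" using B by (intro bexI)
        then have z: "good z" using \<B>(2) by simp
        have "near (\<lambda>y. (k \<le> card (F y)) = (k \<le> card (F z))) z"
        proof (cases "k \<le> card (F z)")
          case True
          then show ?thesis using near_lower[OF z True] by simp
        next
          case False
          then have "card (F z) \<le> k - 1" "1 \<le> k - 1" unfolding k_def by simp_all
          from near_upper[OF z this] show ?thesis using False unfolding near_def k_def
            by (auto simp: not_le less_Suc_eq_le)
        qed
        then show "\<exists>a b. inbox m a b z \<and> (\<forall>y. B y \<longrightarrow> inbox m a b y \<longrightarrow> (k \<le> card (F y)) = (k \<le> card (F z)))"
          unfolding near_def by auto
      qed
      then show ?thesis unfolding k_def by simp
    qed
    then show ?thesis by blast
  qed simp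
  have thin_bad: "thin m (\<lambda>x. \<not> good x)" unfolding thin_def using generic_good by blast
  have dep_bad: "depends m (\<lambda>x. \<not> good x)" using dep_good unfolding depends_def by simp
  have "\<exists>\<B>. finite \<B> \<and> (\<forall>x. \<not> good x \<longrightarrow> (\<exists>B\<in>\<B>. B x)) \<and>
    (\<forall>B\<in>\<B>. definable B \<and> depends m B \<and> (\<exists>k<m. determined_by_rest m k B))"
    by (rule thin_decomposition[OF CDj definable_not[OF def_good] dep_bad thin_bad])
  then obtain \<D> where \<D>: "finite \<D>" "\<forall>x. \<not> good x \<longrightarrow> (\<exists>B\<in>\<D>. B x)"
    "\<forall>B\<in>\<D>. definable B \<and> depends m B \<and> (\<exists>k<m. determined_by_rest m k B)" by (elim exE conjE)
  have bound_thin: "\<exists>K. \<forall>x. B x \<longrightarrow> card (F x) \<le> K" if "B \<in> \<D>" for B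
  proof -
    obtain k where B: "definable B" "depends m B" "k < m" "determined_by_rest m k B"
      using \<D>(3) \<open>B \<in> \<D>\<close> by blast
    obtain m' where m': "m = Suc m'" using B(3) by (cases m) auto
    \<comment> \<open>Coordinate \<open>k\<close> is removed from the base: over \<open>z\<close>
      there is at most one point of \<open>B\<close>, and the fibre of \<open>Z\<close> is the fibre
      of \<open>Y\<close> over it, or empty. The base of \<open>Z\<close> has one dimension less, so
      the hypothesis on smaller dimensions bounds its fibres.\<close>
    define Z where "Z z \<longleftrightarrow> (\<exists>v. B (ins_coord k v z) \<and> Y (ins_coord k v z))" for z
    have defZ: "definable Z"
      unfolding Z_def ins_coord_def
      by (rule definableI) (intro env_definable_intros env_definable_app[OF B(1)] env_definable_app[OF Y(1)])
    have depZ: "depends (Suc m') Z"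
      unfolding depends_def
    proof (intro allI impI)
      fix x y :: "nat \<Rightarrow> real" assume xy: "\<forall>i<Suc m'. x i = y i"
      have "\<forall>i<Suc m. ins_coord k v x i = ins_coord k v y i" for v
        using xy m' B(3) by (auto simp: ins_coord_def)
      then have "B (ins_coord k v x) = B (ins_coord k v y)" "Y (ins_coord k v x) = Y (ins_coord k v y)" for v
        using dependsD[OF B(2), of "ins_coord k v x" "ins_coord k v y"]
          dependsD[OF Y(2), of "ins_coord k v x" "ins_coord k v y"] by auto
      then show "Z x = Z y" unfolding Z_def by simp
    qed
    have ins_upd: "ins_coord k v (z(m' := t)) = (ins_coord k v z)(m := t)" for v z t
      using B(3) m' by (auto simp: ins_coord_def fun_eq_iff)
    have ZF: "{t. Z (z(m' := t))} = (\<Union>v\<in>{v. B (ins_coord k v z)}. F (ins_coord k v z))" for z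
      unfolding Z_def ins_upd F_def using depends_upd[OF B(2)] by auto
    have uniq: "v = w" if "B (ins_coord k v z)" "B (ins_coord k w z)" for v w z
      using B(4)[unfolded determined_by_rest_def, rule_format, OF that] by (simp add: ins_coord_def)
    have "finite {t. Z (z(m' := t))}" for z
    proof -
      have "finite {v. B (ins_coord k v z)}"
      proof (cases "\<exists>v. B (ins_coord k v z)")
        case True
        then obtain v where "B (ins_coord k v z)" by blast
        then have "{v. B (ins_coord k v z)} \<subseteq> {v}" using uniq by blast
        then show ?thesis by (rule finite_subset) simp
      qed simp
      then show ?thesis unfolding ZF using finF by blast
    qed
    then obtain K where K: "\<And>z. card {t. Z (z(m' := t))} \<le> K" and finZ: "\<And>z. finite {t. Z (z(m' := t))}"
      using UF[of m'] defZ depZ m' unfolding uniformly_finite_def by blast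
    have "card (F x) \<le> K" if "B x" for x
    proof -
      let ?z = "\<lambda>i. if i < k then x i else x (Suc i)"
      have ins: "ins_coord k (x k) ?z = x" by (auto simp: ins_coord_def fun_eq_iff)
      have "F x \<subseteq> {t. Z (?z(m' := t))}" unfolding ZF using that ins by (intro UN_upper[of "x k", THEN subset_trans[rotated]]) simp_all
      then have "card (F x) \<le> card {t. Z (?z(m' := t))}" by (rule card_mono[OF finZ])
      then show ?thesis using K[of ?z] by simp
    qed
    then show ?thesis by blast
  qed
  have "\<forall>B\<in>\<B> \<union> \<D>. \<exists>K. \<forall>x. B x \<longrightarrow> card (F x) \<le> K" using bound_conn bound_thin by (simp add: ball_Un)
  from bchoice[OF this] obtain K where K: "\<forall>B\<in>\<B> \<union> \<D>. \<forall>x. B x \<longrightarrow> card (F x) \<le> K B" ..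
  have "card (F x) \<le> Max (K ` (\<B> \<union> \<D>))" for x
  proof -
    have "\<exists>B\<in>\<B> \<union> \<D>. B x" using \<B>(2) \<D>(2) by (cases "good x") (auto simp: bex_Un)
    then obtain B where B: "B \<in> \<B> \<union> \<D>" "B x" by (elim bexE)
    then have "card (F x) \<le> K B" using K by simp
    also have "\<dots> \<le> Max (K ` (\<B> \<union> \<D>))" using B(1) \<B>(1) \<D>(1) by (intro Max_ge) auto
    finally show ?thesis .
  qed
  then show "\<exists>K. \<forall>s. card {t. Y (s(m := t))} \<le> K" unfolding F_def by blast
qed

theorem uniformly_finite: "uniformly_finite m"
  by (induction m rule: less_induct) (rule uniformly_finite_step)

theorem connected_decomposition:
  assumes "definable A" "depends n A"
  obtains \<B> where "finite \<B>" "\<forall>x. A x \<longleftrightarrow> (\<exists>B\<in>\<B>. B x)" "\<forall>B\<in>\<B>. definable B"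
    "\<forall>B\<in>\<B>. depends n B" "\<forall>B\<in>\<B>. box_connected n B"
proof -
  have "connected_decomposable 0 n"
    by (intro connected_decomposable uniformly_finite_imp_convex_decomposable uniformly_finite)
  then obtain \<B> where "finite \<B>" "\<forall>x. A x \<longleftrightarrow> (\<exists>B\<in>\<B>. B x)" "\<forall>B\<in>\<B>. definable B"
    "\<forall>B\<in>\<B>. depends (0 + n) B" "\<forall>B\<in>\<B>. \<forall>s. box_connected (0 + n) (\<lambda>x. B x \<and> agree 0 x s)"
    using connected_decomposableE[of 0 n A] assms by auto
  then show thesis by (intro that[of \<B>]) (simp_all add: agree_def)
qed

end

section \<open>Refining an encoding\<close>

text \<open>Passes from predicates on all sequences back to points of \<open>Rn n\<close>: a
  predicate of \<open>trunc n x\<close> depends only on the first \<open>n\<close>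
  coordinates.\<close>

definition trunc :: "nat \<Rightarrow> (nat \<Rightarrow> real) \<Rightarrow> nat \<Rightarrow> real" where
  "trunc n x = (\<lambda>i. if i < n then x i else 0)"

lemma trunc_in_Rn: "trunc n x \<in> Rn n"
  by (simp add: trunc_def topspace_Euclidean_space)

lemma trunc_id: "x \<in> Rn n \<Longrightarrow> trunc n x = x"
  by (auto simp: trunc_def topspace_Euclidean_space fun_eq_iff)

lemma Rn_le_iff: "x \<in> Rn n \<Longrightarrow> y \<in> Rn n \<Longrightarrow> x \<le> y \<longleftrightarrow> (\<forall>i<n. x i \<le> y i)"
proof -
  assume "x \<in> Rn n" "y \<in> Rn n"
  then have "x i \<le> y i" if "\<not> i < n" for i using that by (simp add: topspace_Euclidean_space)
  then show ?thesis unfolding le_fun_def by blast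
qed

text \<open>For an upset in the first \<open>n\<close> coordinates this set is its closure. Its
  complement is the union, over the \<open>y\<close> outside \<open>U\<close>, of the open orthants
  of points strictly below \<open>y\<close>.\<close>

lemma closedin_strict_upper:
  "closedin (Euclidean_space n) {x \<in> Rn n. \<forall>y. (\<forall>i<n. x i < y i) \<longrightarrow> U y}"
proof -
  have op: "openin (Euclidean_space n) {x \<in> Rn n. \<forall>i<n. x i < y i}" for y
  proof -
    let ?X = "\<lambda>i. if i < n then {..<y i} else UNIV :: real set"
    have "openin (product_topology (\<lambda>i. euclideanreal) UNIV) (\<Pi>\<^sub>E i\<in>UNIV. ?X i)"
    proof (rule product_topology_basis)
      show "openin euclideanreal (?X i)" for i by simp
      have "{i. ?X i \<noteq> topspace euclideanreal} \<subseteq> {..<n}" by auto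
      then show "finite {i. ?X i \<noteq> topspace euclideanreal}" by (rule finite_subset) simp
    qed
    moreover have "{x \<in> Rn n. \<forall>i<n. x i < y i} = (\<Pi>\<^sub>E i\<in>UNIV. ?X i) \<inter> {x. \<forall>i\<ge>n. x i = 0}"
      by (auto simp: topspace_Euclidean_space PiE_iff) (metis lessThan_iff)
    ultimately show ?thesis unfolding Euclidean_space_def openin_subtopology by blast
  qed
  have "Rn n - {x \<in> Rn n. \<forall>y. (\<forall>i<n. x i < y i) \<longrightarrow> U y} =
      (\<Union>y\<in>{y. \<not> U y}. {x \<in> Rn n. \<forall>i<n. x i < y i})" by auto
  moreover have "openin (Euclidean_space n) (\<Union>y\<in>{y. \<not> U y}. {x \<in> Rn n. \<forall>i<n. x i < y i})"
    using op by (intro openin_Union) auto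
  ultimately show ?thesis unfolding closedin_def by auto
qed

text \<open>
  Membership in a Boolean combination of closed upsets does not change on a small box above a given
  point. Open upsets do not have this property.
\<close>

lemma closed_upset_algebra_right_constant:
  assumes "A \<in> closed_upset_algebra n D" "x \<in> Rn n"
  shows "\<exists>z\<in>Rn n. (\<forall>i<n. x i < z i) \<and> (\<forall>y\<in>Rn n. x \<le> y \<longrightarrow> y \<le> z \<longrightarrow> (y \<in> A \<longleftrightarrow> x \<in> A))"
  using assms(1)
proof induction
  case (generator U)
  \<comment> \<open>A sequence approaching \<open>x\<close> from strictly above. If it stayed in the
    closed set \<open>U\<close>, so would its limit \<open>x\<close>; once some \<open>z k\<close>
    is outside, so is everything below it, because \<open>U\<close> is an upset.\<close>
  define z where "z k = (\<lambda>i. if i < n then x i + inverse (real (Suc k)) else 0)" for k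
  have z: "z k \<in> Rn n" "\<forall>i<n. x i < z k i" for k
    by (auto simp: z_def topspace_Euclidean_space)
  show ?case
  proof (cases "x \<in> U")
    case True
    have "y \<in> U" if "y \<in> Rn n" "x \<le> y" for y
      using generator(2) True that unfolding upset_of_def by blast
    then show ?thesis using z[of 0] True by (intro bexI[of _ "z 0"]) auto
  next
    case False
    have "\<exists>k. z k \<notin> U"
    proof (rule ccontr)
      assume "\<nexists>k. z k \<notin> U"
      then have zU: "\<And>k. z k \<in> U" by blast
      have "(\<lambda>k. z k i) \<longlonglongrightarrow> x i" for i
      proof (cases "i < n")
        case True
        have "(\<lambda>k. x i + inverse (real (Suc k))) \<longlonglongrightarrow> x i + 0"
          by (intro tendsto_add tendsto_const LIMSEQ_inverse_real_of_nat)
        then show ?thesis using True by (simp add: z_def)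
      next
        case False
        then show ?thesis using assms(2) by (simp add: z_def topspace_Euclidean_space)
      qed
      then have "limitin (product_topology (\<lambda>i. euclideanreal) UNIV) z x sequentially"
        by (subst limitin_componentwise) (simp_all add: extensional_def)
      then have "limitin (Euclidean_space n) z x sequentially"
        unfolding Euclidean_space_def limitin_subtopology
        using assms(2) z(1) by (simp add: topspace_Euclidean_space)
      then have "x \<in> U"
        using limitin_closedin[OF _ generator(1), of z x sequentially] zU by simp
      then show False using False by simp
    qed
    then obtain k where k: "z k \<notin> U" ..
    have "y \<notin> U" if "y \<in> Rn n" "y \<le> z k" for y
      using generator(2) k that z(1)[of k] unfolding upset_of_def by blast
    then show ?thesis using z[of k] False by (intro bexI[of _ "z k"]) auto
  qed
next
  case empty
  let ?z = "\<lambda>i. if i < n then x i + 1 else 0"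
  have "?z \<in> Rn n" "\<forall>i<n. x i < ?z i" by (auto simp: topspace_Euclidean_space)
  then show ?case by (intro bexI[of _ ?z]) simp_all
next
  case (union A B)
  obtain z where z: "z \<in> Rn n" "\<forall>i<n. x i < z i" "\<forall>y\<in>Rn n. x \<le> y \<longrightarrow> y \<le> z \<longrightarrow> (y \<in> A \<longleftrightarrow> x \<in> A)"
    using union.IH(1) by (elim bexE conjE)
  obtain z' where z': "z' \<in> Rn n" "\<forall>i<n. x i < z' i" "\<forall>y\<in>Rn n. x \<le> y \<longrightarrow> y \<le> z' \<longrightarrow> (y \<in> B \<longleftrightarrow> x \<in> B)"
    using union.IH(2) by (elim bexE conjE)
  let ?w = "\<lambda>i. min (z i) (z' i)"
  have "?w \<in> Rn n" "\<forall>i<n. x i < ?w i" using z z' by (auto simp: topspace_Euclidean_space)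
  moreover have "y \<in> A \<union> B \<longleftrightarrow> x \<in> A \<union> B" if y: "y \<in> Rn n" "x \<le> y" "y \<le> ?w" for y
  proof -
    have "y \<le> z" "y \<le> z'" using y(3) by (auto simp: le_fun_def)
    then have "y \<in> A \<longleftrightarrow> x \<in> A" "y \<in> B \<longleftrightarrow> x \<in> B"
      using z(3)[rule_format, OF y(1,2)] z'(3)[rule_format, OF y(1,2)] by blast+
    then show ?thesis by simp
  qed
  ultimately show ?case by (intro bexI[of _ ?w] conjI ballI impI) simp_all
next
  case (complement A)
  then obtain z where z: "z \<in> Rn n" "\<forall>i<n. x i < z i" "\<forall>y\<in>Rn n. x \<le> y \<longrightarrow> y \<le> z \<longrightarrow> (y \<in> A \<longleftrightarrow> x \<in> A)"
    by (elim bexE conjE)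
  have "y \<in> Rn n - A \<longleftrightarrow> x \<in> Rn n - A" if y: "y \<in> Rn n" "x \<le> y" "y \<le> z" for y
    using z(3)[rule_format, OF y] y(1) assms(2) by blast
  then show ?case using z(1,2) by (intro bexI[of _ z] conjI ballI impI)
qed

context o_minimal_structure
begin

lemma definable_mem:
  assumes "A \<in> S n" shows "definable (\<lambda>x. trunc n x \<in> A)" "depends n (\<lambda>x. trunc n x \<in> A)"
proof -
  show dep: "depends n (\<lambda>x. trunc n x \<in> A)"
    unfolding depends_def
  proof (intro allI impI)
    fix x y :: "nat \<Rightarrow> real" assume "\<forall>i<n. x i = y i"
    then have "trunc n x = trunc n y" by (auto simp: trunc_def)
    then show "(trunc n x \<in> A) = (trunc n y \<in> A)" by simp
  qed
  interpret B: Sigma_Algebra.algebra "Rn n" "S n" by (rule boolean_algebra)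
  have "A \<subseteq> Rn n" using assms by (rule B.sets_into_space[THEN subset_trans[rotated]]) simp
  then have "{x \<in> Rn n. trunc n x \<in> A} = A" by (auto simp: trunc_id)
  then show "definable (\<lambda>x. trunc n x \<in> A)"
    using assms dep unfolding definable_def dim_definable_def by auto
qed

lemma definable_in_structure:
  assumes "definable P" "depends n P" shows "{x \<in> Rn n. P x} \<in> S n"
proof -
  obtain m where m: "dim_definable m P" using assms(1) unfolding definable_def by blast
  have "dim_definable (n + m) P" by (rule dim_definable_mono[OF _ m]) simp
  from dim_definable_proj[OF this]
  have "dim_definable n (\<lambda>x. \<exists>y. P (\<lambda>i. if n \<le> i then y i else x i))" .
  moreover have "P (\<lambda>i. if n \<le> i then y i else x i) = P x" for x y
    by (rule dependsD[OF assms(2)]) simp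
  ultimately show ?thesis unfolding dim_definable_def by simp
qed

lemma definable_finite_ex:
  "finite \<B> \<Longrightarrow> \<forall>B\<in>\<B>. definable B \<Longrightarrow> definable (\<lambda>x. \<exists>B\<in>\<B>. B x)"
proof (induction \<B> rule: finite_induct)
  case empty
  show ?case using definable_not[OF definable_True] by simp
next
  case (insert B \<B>)
  have "definable (\<lambda>x. \<not> (\<not> B x \<and> \<not> (\<exists>B\<in>\<B>. B x)))"
    using insert by (intro definable_not definable_conj) simp_all
  then show ?case by simp
qed

lemma closed_upset_algebra_in_structure: "A \<in> closed_upset_algebra n (S n) \<Longrightarrow> A \<in> S n"
proof -
  interpret B: Sigma_Algebra.algebra "Rn n" "S n" by (rule boolean_algebra)
  show "A \<in> closed_upset_algebra n (S n) \<Longrightarrow> A \<in> S n"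
    by (induction rule: closed_upset_algebra.induct) (simp_all add: B.compl_sets B.Un)
qed

text \<open>
  The new fibres are the classes \<open>C\<close> of the equivalence relation generated by \<open>Z\<close>. Fibres of \<open>e\<close>
  are locally constant to the right, so each of their connected pieces lies in a single class and
  there are finitely many classes, all of them definable. If \<open>U\<close> is the upset generated by \<open>C\<close>, then
  \<open>C\<close> is the difference of the closures of the upsets \<open>U\<close> and \<open>U - C\<close>.
\<close>

lemma refine_encoding:
  fixes e :: "(nat \<Rightarrow> real) \<Rightarrow> 'q"
  assumes finQ: "finite Q" and po: "partial_order_on Q r" and eQ: "e \<in> Rn n \<rightarrow> Q"
    and mono: "\<And>x y. x \<in> Rn n \<Longrightarrow> y \<in> Rn n \<Longrightarrow> x \<le> y \<Longrightarrow> (e x, e y) \<in> r"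
    and fib: "\<And>q. q \<in> Q \<Longrightarrow> {x \<in> Rn n. e x = q} \<in> closed_upset_algebra n (S n)"
    and Z_def: "Z = {(x, y). x \<in> Rn n \<and> y \<in> Rn n \<and> x \<le> y \<and> e x = e y}"
  obtains P :: "nat set" and e' where "finite P" "e' ` Rn n = P"
    "partial_order_on P ({(e' x, e' y) | x y. (x, y) \<in> Rn_le n}\<^sup>+)"
    "\<forall>p\<in>P. {x \<in> Rn n. e' x = p} \<in> closed_upset_algebra n (S n)"
    "\<forall>x\<in>Rn n. \<forall>y\<in>Rn n. e' x = e' y \<longrightarrow> (x, y) \<in> (Z \<union> Z\<inverse>)\<^sup>*"
proof -
  have antisym_r: "antisym r" and trans_r: "trans r"
    using po unfolding partial_order_on_def preorder_on_def by auto
  define W where "W = (Z \<union> Z\<inverse>)\<^sup>*"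
  have "sym W" unfolding W_def by (rule sym_rtrancl) (rule sym_Un_converse)
  then have W_sym: "(x, y) \<in> W \<Longrightarrow> (y, x) \<in> W" for x y by (rule symD)
  have W_trans: "(x, y) \<in> W \<Longrightarrow> (y, z) \<in> W \<Longrightarrow> (x, z) \<in> W" for x y z
    unfolding W_def by (rule rtrancl_trans)
  have W_cong: "((x, y) \<in> W) = ((x, z) \<in> W)" if "(y, z) \<in> W" for x y z
    using W_trans[of x y z] W_trans[OF _ W_sym[OF that], of x] that by (intro iffI)
  have W_refl: "(x, x) \<in> W" for x unfolding W_def by simp
  have ZW: "(x, y) \<in> W" if "x \<in> Rn n" "y \<in> Rn n" "x \<le> y" "e x = e y" for x y
    unfolding W_def using that by (intro r_into_rtrancl) (simp add: Z_def)
  have We: "e x = e y" and WR: "x \<in> Rn n \<longrightarrow> y \<in> Rn n" if "(x, y) \<in> W" for x y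
    using that unfolding W_def by (induction rule: rtrancl_induct) (auto simp: Z_def)
  have right: "\<exists>z\<in>Rn n. (\<forall>i<n. x i < z i) \<and> (\<forall>y\<in>Rn n. x \<le> y \<longrightarrow> y \<le> z \<longrightarrow> e y = e x)"
    if x: "x \<in> Rn n" for x
  proof -
    have "e x \<in> Q" using eQ x by auto
    from closed_upset_algebra_right_constant[OF fib[OF this] x] obtain z where
      z: "z \<in> Rn n" "\<forall>i<n. x i < z i"
        "\<forall>y\<in>Rn n. x \<le> y \<longrightarrow> y \<le> z \<longrightarrow> (y \<in> {y \<in> Rn n. e y = e x} \<longleftrightarrow> x \<in> {y \<in> Rn n. e y = e x})"
      by (elim bexE conjE)
    have "e y = e x" if y: "y \<in> Rn n" "x \<le> y" "y \<le> z" for y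
      using z(3)[rule_format, OF y] x by blast
    then show ?thesis using z(1,2) by (intro bexI[of _ z] conjI ballI impI)
  qed
  have pieces: "\<exists>\<B>. finite \<B> \<and> (\<forall>x. e (trunc n x) = q \<longleftrightarrow> (\<exists>B\<in>\<B>. B x)) \<and>
      (\<forall>B\<in>\<B>. definable B \<and> depends n B \<and> (\<forall>x y. B x \<longrightarrow> B y \<longrightarrow> (trunc n x, trunc n y) \<in> W))"
    if q: "q \<in> Q" for q
  proof -
    have "{x \<in> Rn n. e x = q} \<in> S n" using closed_upset_algebra_in_structure[OF fib[OF q]] .
    from definable_mem[OF this] have "definable (\<lambda>x. e (trunc n x) = q)" "depends n (\<lambda>x. e (trunc n x) = q)"
      by (simp_all add: trunc_in_Rn)
    from connected_decomposition[OF this] obtain \<B> where \<B>: "finite \<B>"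
      "\<forall>x. e (trunc n x) = q \<longleftrightarrow> (\<exists>B\<in>\<B>. B x)" "\<forall>B\<in>\<B>. definable B" "\<forall>B\<in>\<B>. depends n B"
      "\<forall>B\<in>\<B>. box_connected n B" .
    have "(trunc n x, trunc n y) \<in> W" if B: "B \<in> \<B>" "B x" "B y" for B x y
    proof -
      have eB: "e (trunc n z) = q" if "B z" for z unfolding \<B>(2)[rule_format] using that B(1) by (intro bexI)
      have "((trunc n x, trunc n x) \<in> W) = ((trunc n x, trunc n y) \<in> W)"
      proof (rule box_connectedD[OF \<B>(5)[rule_format, OF B(1)] B(2,3)])
        fix z assume z: "B z"
        obtain w where w: "w \<in> Rn n" "\<forall>i<n. trunc n z i < w i"
          "\<forall>y\<in>Rn n. trunc n z \<le> y \<longrightarrow> y \<le> w \<longrightarrow> e y = e (trunc n z)"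
          using right[OF trunc_in_Rn[of n z]] by (elim bexE conjE)
        have zw: "trunc n z \<le> w"
          using w(2) by (subst Rn_le_iff[OF trunc_in_Rn w(1)]) (auto intro: less_imp_le)
        have ew: "e w = q" using w(3)[rule_format, OF w(1) zw order_refl] eB[OF z] by (rule trans)
        \<comment> \<open>\<open>y\<close> and \<open>z\<close> need not be comparable, but near
          \<open>z\<close> both lie below \<open>w\<close>, in the fibre of \<open>w\<close>. Two
          pairs of \<open>Z\<close> through \<open>w\<close> therefore connect them.\<close>
        have near: "((trunc n x, trunc n y) \<in> W) = ((trunc n x, trunc n z) \<in> W)"
          if y: "B y" "inbox n (\<lambda>i. z i - 1) w y" for y
        proof -
          have "trunc n y \<le> w"
            using y(2) by (subst Rn_le_iff[OF trunc_in_Rn w(1)]) (auto simp: inbox_def trunc_def intro: less_imp_le)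
          then have "(trunc n y, w) \<in> W" using eB[OF y(1)] ew by (intro ZW trunc_in_Rn w(1)) simp_all
          moreover have "(trunc n z, w) \<in> W" using eB[OF z] ew zw by (intro ZW trunc_in_Rn w(1)) simp_all
          ultimately have "(trunc n y, trunc n z) \<in> W" by (rule W_trans[OF _ W_sym])
          then show ?thesis by (rule W_cong)
        qed
        have "inbox n (\<lambda>i. z i - 1) w z" using w(2) by (auto simp: inbox_def trunc_def)
        then show "\<exists>a b. inbox n a b z \<and> (\<forall>y. B y \<longrightarrow> inbox n a b y \<longrightarrow>
            ((trunc n x, trunc n y) \<in> W) = ((trunc n x, trunc n z) \<in> W))"
          by (intro exI[of _ "\<lambda>i. z i - 1"] exI[of _ w] conjI allI impI near)
      qed
      then show ?thesis using W_refl by simp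
    qed
    then have "\<forall>B\<in>\<B>. definable B \<and> depends n B \<and> (\<forall>x y. B x \<longrightarrow> B y \<longrightarrow> (trunc n x, trunc n y) \<in> W)"
      by (intro ballI conjI allI impI bspec[OF \<B>(3)] bspec[OF \<B>(4)])
    with \<B>(1,2) show ?thesis by (intro exI[of _ \<B>] conjI)
  qed
  have "\<forall>q\<in>Q. \<exists>\<B>. finite \<B> \<and> (\<forall>x. e (trunc n x) = q \<longleftrightarrow> (\<exists>B\<in>\<B>. B x)) \<and>
      (\<forall>B\<in>\<B>. definable B \<and> depends n B \<and> (\<forall>x y. B x \<longrightarrow> B y \<longrightarrow> (trunc n x, trunc n y) \<in> W))"
    using pieces by (rule ballI)
  from bchoice[OF this] obtain f where
    f: "\<forall>q\<in>Q. finite (f q) \<and> (\<forall>x. e (trunc n x) = q \<longleftrightarrow> (\<exists>B\<in>f q. B x)) \<and>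
      (\<forall>B\<in>f q. definable B \<and> depends n B \<and> (\<forall>x y. B x \<longrightarrow> B y \<longrightarrow> (trunc n x, trunc n y) \<in> W))" ..
  define \<B> where "\<B> = \<Union>(f ` Q)"
  have finB: "finite \<B>" unfolding \<B>_def using finQ f by simp
  have fB: "definable B \<and> depends n B \<and> (\<forall>x y. B x \<longrightarrow> B y \<longrightarrow> (trunc n x, trunc n y) \<in> W)"
    if "q \<in> Q" "B \<in> f q" for q B
    by (rule bspec[OF conjunct2[OF conjunct2[OF bspec[OF f that(1)]]] that(2)])
  have defB: "definable B" if "B \<in> \<B>" for B
    using that unfolding \<B>_def by (elim UN_E) (drule (1) fB, elim conjE)
  have BW: "(trunc n x, trunc n y) \<in> W" if "B \<in> \<B>" "B x" "B y" for B x y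
    using that unfolding \<B>_def by (elim UN_E) (drule (1) fB, elim conjE, simp)
  have Bcover: "\<exists>B\<in>\<B>. B x" for x
  proof -
    have q: "e (trunc n x) \<in> Q" using eQ trunc_in_Rn by auto
    have "(e (trunc n x) = e (trunc n x)) = (\<exists>B\<in>f (e (trunc n x)). B x)"
      by (rule spec[OF conjunct1[OF conjunct2[OF bspec[OF f q]]]])
    then have "\<exists>B\<in>f (e (trunc n x)). B x" by (rule iffD1[OF _ refl])
    then obtain B where B: "B \<in> f (e (trunc n x))" "B x" by (elim bexE)
    have "B \<in> \<B>" unfolding \<B>_def using q B(1) by (rule UN_I)
    then show ?thesis by (rule bexI[where x = B and P = "\<lambda>B. B x" and A = \<B>, OF B(2)])
  qed
  define cls where "cls x = W `` {x}" for x
  have cls_eq: "cls x = cls y \<longleftrightarrow> (x, y) \<in> W" for x y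
  proof
    assume "cls x = cls y"
    moreover have "y \<in> cls y" unfolding cls_def using W_refl by simp
    ultimately show "(x, y) \<in> W" unfolding cls_def by auto
  next
    assume xy: "(x, y) \<in> W"
    show "cls x = cls y"
    proof (rule Set.set_eqI)
      fix z
      have "((x, z) \<in> W) = ((y, z) \<in> W)"
        by (rule iffI) (erule W_trans[OF W_sym[OF xy]], erule W_trans[OF xy])
      then show "z \<in> cls x \<longleftrightarrow> z \<in> cls y" unfolding cls_def by simp
    qed
  qed
  have "cls ` Rn n \<subseteq> (\<lambda>B. cls (trunc n (SOME y. B y))) ` \<B>"
  proof
    fix C assume "C \<in> cls ` Rn n"
    then obtain x where x: "x \<in> Rn n" "C = cls x" by blast
    obtain B where BB: "B \<in> \<B>" "B x" using Bcover[of x] by (elim bexE)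
    have "B (SOME y. B y)" by (rule someI[of B, OF BB(2)])
    from BW[OF BB this] have "cls x = cls (trunc n (SOME y. B y))" using cls_eq trunc_id[OF x(1)] by simp
    then show "C \<in> (\<lambda>B. cls (trunc n (SOME y. B y))) ` \<B>" using x(2) BB(1) by simp
  qed
  then have fin_cls: "finite (cls ` Rn n)" by (rule finite_subset) (simp add: finB)
  obtain h :: "(nat \<Rightarrow> real) set \<Rightarrow> nat" where h: "inj_on h (cls ` Rn n)"
    using finite_imp_inj_to_nat_seg[OF fin_cls] by (elim exE conjE)
  define e' where "e' x = h (cls x)" for x
  have e'_eq: "e' x = e' y \<longleftrightarrow> (x, y) \<in> W" if "x \<in> Rn n" "y \<in> Rn n" for x y
    unfolding e'_def cls_eq[symmetric] using inj_on_eq_iff[OF h] that by simp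
  have e'_e: "e x = e y" if "x \<in> Rn n" "y \<in> Rn n" "e' x = e' y" for x y
    using that(3) We unfolding e'_eq[OF that(1,2)] by simp
  let ?r = "{(e' x, e' y) | x y. (x, y) \<in> Rn_le n}"
  have order: "partial_order_on (e' ` Rn n) (?r\<^sup>+)"
  proof -
    \<comment> \<open>The image of the order need not be transitive, since consecutive steps may use
      different representatives of a class. As \<open>e\<close> is constant on classes, its values
      still increase along every chain.\<close>
    have step_e: "\<exists>x y. c = e' x \<and> d = e' y \<and> x \<in> Rn n \<and> y \<in> Rn n \<and> (e x, e y) \<in> r" if "(c, d) \<in> ?r\<^sup>+" for c d
      using that
    proof (induction rule: trancl_induct)
      case (base d)
      then show ?case using mono unfolding Rn_le_def by blast
    next
      case (step d f)
      obtain x y where xy: "c = e' x" "d = e' y" "x \<in> Rn n" "y \<in> Rn n" "(e x, e y) \<in> r" using step.IH by blast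
      obtain y' z where yz: "d = e' y'" "f = e' z" "y' \<in> Rn n" "z \<in> Rn n" "(e y', e z) \<in> r"
        using step.hyps(2) mono unfolding Rn_le_def by blast
      have "e y = e y'" using xy yz by (intro e'_e) simp_all
      then have "(e x, e z) \<in> r" using xy(5) yz(5) by (intro transD[OF trans_r, of "e x" "e y" "e z"]) simp_all
      then show ?case using xy yz by blast
    qed
    \<comment> \<open>A cycle forces \<open>e\<close> to be constant along it. Each step then comes
      from a comparable pair with equal values of \<open>e\<close>, that is from \<open>Z\<close>,
      and does not change the class.\<close>
    have anti: "c = d" if "(c, d) \<in> ?r\<^sup>+" "(d, c) \<in> ?r\<^sup>+" for c d
      using that
    proof (induction rule: trancl_induct)
      case (base d)
      then obtain x y where xy: "c = e' x" "d = e' y" "x \<in> Rn n" "y \<in> Rn n" "x \<le> y" unfolding Rn_le_def by blast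
      obtain y' x' where yx: "d = e' y'" "c = e' x'" "y' \<in> Rn n" "x' \<in> Rn n" "(e y', e x') \<in> r"
        using step_e[OF base.prems] by blast
      have "e y = e y'" "e x = e x'" using xy yx by (auto intro!: e'_e)
      then have "e x = e y" using mono[OF xy(3,4,5)] yx(5) by (intro antisymD[OF antisym_r]) simp_all
      with xy show ?case using e'_eq[OF xy(3,4)] ZW[OF xy(3,4,5)] by simp
    next
      case (step d f)
      have "(d, c) \<in> ?r\<^sup>+" using step.hyps(2) step.prems by (rule trancl_into_trancl2)
      then have cd: "c = d" by (rule step.IH)
      have df: "(d, f) \<in> ?r" "(f, d) \<in> ?r\<^sup>+" using step.hyps(2) step.prems cd by simp_all
      then obtain x y where xy: "d = e' x" "f = e' y" "x \<in> Rn n" "y \<in> Rn n" "x \<le> y" unfolding Rn_le_def by blast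
      obtain y' x' where yx: "f = e' y'" "d = e' x'" "y' \<in> Rn n" "x' \<in> Rn n" "(e y', e x') \<in> r"
        using step_e[OF df(2)] by blast
      have "e y = e y'" "e x = e x'" using xy yx by (auto intro!: e'_e)
      then have "e x = e y" using mono[OF xy(3,4,5)] yx(5) by (intro antisymD[OF antisym_r]) simp_all
      with xy cd show ?case using e'_eq[OF xy(3,4)] ZW[OF xy(3,4,5)] by simp
    qed
    have sub: "?r\<^sup>+ \<subseteq> e' ` Rn n \<times> e' ` Rn n"
    proof (rule subrelI)
      fix c d assume "(c, d) \<in> ?r\<^sup>+"
      from step_e[OF this] show "(c, d) \<in> e' ` Rn n \<times> e' ` Rn n" by (elim exE conjE) simp
    qed
    have refl: "(p, p) \<in> ?r\<^sup>+" if p: "p \<in> e' ` Rn n" for p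
    proof -
      obtain x where "x \<in> Rn n" "p = e' x" using p by (elim imageE)
      then have "(p, p) \<in> ?r" unfolding Rn_le_def by (intro CollectI exI[of _ x]) simp
      then show ?thesis by (rule r_into_trancl)
    qed
    show ?thesis
      unfolding partial_order_on_def preorder_on_def refl_on_def
    proof (intro conjI ballI antisymI trans_trancl sub)
      show "c = d" if "(c, d) \<in> ?r\<^sup>+" "(d, c) \<in> ?r\<^sup>+" for c d using that by (rule anti)
    qed (rule refl)
  qed
  have fibre: "{x \<in> Rn n. e' x = p} \<in> closed_upset_algebra n (S n)" if p: "p \<in> e' ` Rn n" for p
  proof -
    obtain x0 where x0: "x0 \<in> Rn n" "p = e' x0" using p by blast
    \<comment> \<open>A piece meeting the class of \<open>x0\<close> is contained in it. The class
      is thus a union of finitely many definable pieces, and so definable.\<close>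
    define \<C> where "\<C> = {B \<in> \<B>. \<exists>y. B y \<and> (x0, trunc n y) \<in> W}"
    define C where "C x \<longleftrightarrow> (\<exists>B\<in>\<C>. B x)" for x
    have C_iff: "C x \<longleftrightarrow> (x0, trunc n x) \<in> W" for x
    proof
      assume "C x"
      then obtain B y where "B \<in> \<B>" "B x" "B y" "(x0, trunc n y) \<in> W" unfolding C_def \<C>_def by auto
      then show "(x0, trunc n x) \<in> W" using W_trans[OF _ BW] by simp
    next
      assume x: "(x0, trunc n x) \<in> W"
      obtain B where "B \<in> \<B>" "B x" using Bcover[of x] by (elim bexE)
      then have "B \<in> \<C>" unfolding \<C>_def using x by (intro CollectI conjI exI)
      then show "C x" unfolding C_def using \<open>B x\<close> by (intro bexI)
    qed
    have defC: "definable C"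
      unfolding C_def[abs_def] using finB defB by (intro definable_finite_ex) (auto simp: \<C>_def)
    have trunc_eq: "trunc n x = trunc n y" if "\<forall>i<n. x i = y i" for x y :: "nat \<Rightarrow> real"
      using that by (auto simp: trunc_def)
    have depC: "depends n C"
      unfolding depends_def
    proof (intro allI impI)
      fix x y :: "nat \<Rightarrow> real" assume "\<forall>i<n. x i = y i"
      then show "C x = C y" unfolding C_iff by (simp only: trunc_eq)
    qed
    define U where "U x \<longleftrightarrow> (\<exists>y. C y \<and> (\<forall>i<n. y i \<le> x i))" for x
    \<comment> \<open>The closure of an upset, described by strict inequalities so that it remains
      definable.\<close>
    define cl where "cl P x \<longleftrightarrow> (\<forall>y. (\<forall>i<n. x i < y i) \<longrightarrow> P y)" for P :: "(nat \<Rightarrow> real) \<Rightarrow> bool" and x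
    have defU: "definable U"
      unfolding U_def by (rule definableI) (intro env_definable_intros env_definable_app[OF defC])
    have def_cl: "definable (cl P)" if "definable P" for P
      unfolding cl_def by (rule definableI) (intro env_definable_intros env_definable_app[OF that])
    have dep_cl: "depends n (cl P)" for P
      unfolding depends_def cl_def by simp
    have U_mono: "U y" if "U x" "\<forall>i<n. x i \<le> y i" for x y
    proof -
      from that(1) obtain c where "C c" "\<forall>i<n. c i \<le> x i" unfolding U_def by (elim exE conjE)
      with that(2) show ?thesis unfolding U_def by (intro exI[of _ c]) (auto intro: order_trans)
    qed
    have CU: "C x \<Longrightarrow> U x" for x unfolding U_def by auto
    \<comment> \<open>\<open>e\<close> is monotone with equal values at \<open>x\<close> and
      \<open>z\<close>, hence the same value at \<open>y\<close>, and the first comparison is a pair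
      of \<open>Z\<close>. This order-convexity makes \<open>V\<close> an upset.\<close>
    have C_conv: "C y" if "C x" "C z" "\<forall>i<n. x i \<le> y i" "\<forall>i<n. y i \<le> z i" for x y z
    proof -
      have le: "trunc n x \<le> trunc n y" "trunc n y \<le> trunc n z"
        using that(3,4) by (auto simp: le_fun_def trunc_def)
      have "e (trunc n x) = e (trunc n z)"
        using We[of x0 "trunc n x"] We[of x0 "trunc n z"] that(1,2) unfolding C_iff by simp
      moreover have "(e (trunc n x), e (trunc n y)) \<in> r" "(e (trunc n y), e (trunc n z)) \<in> r"
        using le by (intro mono trunc_in_Rn; simp)+
      ultimately have "e (trunc n x) = e (trunc n y)"
        by (intro antisymD[OF antisym_r]) simp_all
      then have "(trunc n x, trunc n y) \<in> W" using le by (intro ZW trunc_in_Rn)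
      from W_trans[OF _ this] show ?thesis using that(1) unfolding C_iff .
    qed
    define V where "V x \<longleftrightarrow> U x \<and> \<not> C x" for x
    have defV: "definable V" unfolding V_def[abs_def] by (intro definable_conj definable_not defU defC)
    have V_mono: "V y" if x: "V x" "\<forall>i<n. x i \<le> y i" for x y
    proof -
      have "\<not> C y"
      proof
        assume "C y"
        obtain c where "C c" "\<forall>i<n. c i \<le> x i" using x(1) unfolding V_def U_def by (elim conjE exE)
        then have "C x" using C_conv[of c y x] \<open>C y\<close> x(2) by simp
        then show False using x(1) unfolding V_def by simp
      qed
      then show ?thesis using x U_mono[of x y] unfolding V_def by simp
    qed
    have gen: "{x \<in> Rn n. cl P x} \<in> closed_upset_algebra n (S n)"
      if P: "definable P" "\<And>x y. P x \<Longrightarrow> \<forall>i<n. x i \<le> y i \<Longrightarrow> P y" for P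
    proof (rule closed_upset_algebra.generator)
      show "closedin (Euclidean_space n) {x \<in> Rn n. cl P x}"
        unfolding cl_def by (rule closedin_strict_upper)
      show "upset_of (Rn n) {x \<in> Rn n. cl P x}"
        unfolding upset_of_def cl_def by (auto simp: le_fun_def intro: le_less_trans)
      show "{x \<in> Rn n. cl P x} \<in> S n" by (intro definable_in_structure def_cl dep_cl P)
    qed
    \<comment> \<open>Points strictly above \<open>x\<close> and below \<open>z\<close> belong to
      the class of \<open>x\<close>. If \<open>x\<close> is in \<open>C\<close>, then
      \<open>z\<close> is not in \<open>V\<close>, which excludes \<open>x\<close> from the closure
      of \<open>V\<close>. Conversely, a point strictly above \<open>x\<close> outside
      \<open>V\<close> can be lowered to below \<open>z\<close>; it stays outside the upset
      \<open>V\<close> but lies in \<open>U\<close>, hence in \<open>C\<close>, and so does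
      \<open>x\<close>.\<close>
    have C_cl: "C x \<longleftrightarrow> cl U x \<and> \<not> cl V x" for x
    proof -
      obtain z where z: "z \<in> Rn n" "\<forall>i<n. trunc n x i < z i"
        "\<forall>y\<in>Rn n. trunc n x \<le> y \<longrightarrow> y \<le> z \<longrightarrow> e y = e (trunc n x)" using right[OF trunc_in_Rn[of n x]] by (elim bexE conjE)
      have near: "(trunc n x, trunc n y) \<in> W" if "\<forall>i<n. x i < y i \<and> y i \<le> z i" for y
      proof -
        have "trunc n x \<le> trunc n y" using that by (auto simp: le_fun_def trunc_def intro: less_imp_le)
        moreover have "trunc n y \<le> z"
          using that by (subst Rn_le_iff[OF trunc_in_Rn z(1)]) (simp add: trunc_def)
        ultimately show ?thesis
          using z(3)[rule_format, OF trunc_in_Rn, of y] by (intro ZW trunc_in_Rn) simp_all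
      qed
      have xz: "\<forall>i<n. x i < z i" using z(2) by (simp add: trunc_def)
      show ?thesis
      proof
        assume x: "C x"
        have "cl U x" unfolding cl_def
        proof (intro allI impI)
          fix y assume "\<forall>i<n. x i < y i"
          then show "U y" by (intro U_mono[OF CU[OF x]]) (simp add: less_imp_le)
        qed
        moreover have "(trunc n x, trunc n z) \<in> W" using xz by (intro near) simp
        then have "C z" using W_trans[of x0 "trunc n x" "trunc n z"] x unfolding C_iff by simp
        then have "\<not> V z" unfolding V_def by simp
        then have "\<not> cl V x" unfolding cl_def using xz by (auto intro!: exI[of _ z])
        ultimately show "cl U x \<and> \<not> cl V x" ..
      next
        assume x: "cl U x \<and> \<not> cl V x"
        then obtain y where y: "\<forall>i<n. x i < y i" "\<not> V y" unfolding cl_def by auto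
        let ?w = "\<lambda>i. min (y i) (z i)"
        have w: "\<forall>i<n. x i < ?w i" using xz y(1) by simp
        have "\<not> V ?w" using V_mono[of ?w y] y(2) by auto
        moreover have "U ?w" using conjunct1[OF x, unfolded cl_def, rule_format, of ?w] w by simp
        ultimately have "C ?w" unfolding V_def by simp
        moreover have "(trunc n x, trunc n ?w) \<in> W" using w by (intro near) simp
        ultimately show "C x" unfolding C_iff by (rule W_trans[OF _ W_sym])
      qed
    qed
    have "{x \<in> Rn n. e' x = p} = {x \<in> Rn n. C x}"
      unfolding x0(2) C_iff using e'_eq[OF _ x0(1)] W_sym by (auto simp: trunc_id)
    also have "\<dots> = Rn n - ((Rn n - {x \<in> Rn n. cl U x}) \<union> {x \<in> Rn n. cl V x})"
      unfolding C_cl by auto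
    also have "\<dots> \<in> closed_upset_algebra n (S n)"
      by (intro closed_upset_algebra.complement closed_upset_algebra.union gen defU defV)
        (fact U_mono, fact V_mono)
    finally show ?thesis .
  qed
  show thesis
  proof (rule that[of "e' ` Rn n" e'])
    show "finite (e' ` Rn n)" using finite_imageI[OF fin_cls, of h] unfolding e'_def image_image .
    show "\<forall>x\<in>Rn n. \<forall>y\<in>Rn n. e' x = e' y \<longrightarrow> (x, y) \<in> (Z \<union> Z\<inverse>)\<^sup>*"
      using e'_eq unfolding W_def by simp
    show "\<forall>p\<in>e' ` Rn n. {x \<in> Rn n. e' x = p} \<in> closed_upset_algebra n (S n)"
      using fibre by (rule ballI)
  qed (rule refl, fact order)
qed

end

section \<open>Transport of kernels, cokernels and biproducts\<close>

lemma ex1_unique: "\<exists>!x. P x \<Longrightarrow> P a \<Longrightarrow> P b \<Longrightarrow> a = b"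
  by blast

locale preadditive_category =
  fixes C :: "('o, 'm) cat"
  assumes preadditive: "preadditive C"
begin

lemma category: "category C" using preadditive unfolding preadditive_def by (rule conjunct1)

lemma id_mor: "X \<in> ob C \<Longrightarrow> idm C X \<in> mor C X X"
  using category unfolding category_def by simp

lemma comp_mor: "X \<in> ob C \<Longrightarrow> Y \<in> ob C \<Longrightarrow> Z \<in> ob C \<Longrightarrow> f \<in> mor C X Y \<Longrightarrow> g \<in> mor C Y Z \<Longrightarrow>
    cmp C X Y Z g f \<in> mor C X Z"
  using category unfolding category_def by simp

lemma id_comp: "X \<in> ob C \<Longrightarrow> Y \<in> ob C \<Longrightarrow> f \<in> mor C X Y \<Longrightarrow> cmp C X Y Y (idm C Y) f = f"
  and comp_id: "X \<in> ob C \<Longrightarrow> Y \<in> ob C \<Longrightarrow> f \<in> mor C X Y \<Longrightarrow> cmp C X X Y f (idm C X) = f"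
  using category unfolding category_def by simp_all

lemma assoc: "W \<in> ob C \<Longrightarrow> X \<in> ob C \<Longrightarrow> Y \<in> ob C \<Longrightarrow> Z \<in> ob C \<Longrightarrow>
    f \<in> mor C W X \<Longrightarrow> g \<in> mor C X Y \<Longrightarrow> h \<in> mor C Y Z \<Longrightarrow>
    cmp C W Y Z h (cmp C W X Y g f) = cmp C W X Z (cmp C X Y Z h g) f"
  using category unfolding category_def by (elim conjE) (simp only: Ball_def)

lemma hom_group: "X \<in> ob C \<Longrightarrow> Y \<in> ob C \<Longrightarrow>
    comm_group \<lparr>carrier = mor C X Y, monoid.mult = addm C X Y, one = zerom C X Y\<rparr>"
  using preadditive unfolding preadditive_def by simp

lemma comp_add: "X \<in> ob C \<Longrightarrow> Y \<in> ob C \<Longrightarrow> Z \<in> ob C \<Longrightarrow> f \<in> mor C X Y \<Longrightarrow> f' \<in> mor C X Y \<Longrightarrow> g \<in> mor C Y Z \<Longrightarrow>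
    cmp C X Y Z g (addm C X Y f f') = addm C X Z (cmp C X Y Z g f) (cmp C X Y Z g f')"
  and add_comp: "X \<in> ob C \<Longrightarrow> Y \<in> ob C \<Longrightarrow> Z \<in> ob C \<Longrightarrow> f \<in> mor C X Y \<Longrightarrow> g \<in> mor C Y Z \<Longrightarrow> g' \<in> mor C Y Z \<Longrightarrow>
    cmp C X Y Z (addm C Y Z g g') f = addm C X Z (cmp C X Y Z g f) (cmp C X Y Z g' f)"
  using preadditive unfolding preadditive_def by (elim conjE, simp)+

lemma zero_mor: "X \<in> ob C \<Longrightarrow> Y \<in> ob C \<Longrightarrow> zerom C X Y \<in> mor C X Y"
  and add_mor: "X \<in> ob C \<Longrightarrow> Y \<in> ob C \<Longrightarrow> f \<in> mor C X Y \<Longrightarrow> g \<in> mor C X Y \<Longrightarrow> addm C X Y f g \<in> mor C X Y"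
  and zero_add: "X \<in> ob C \<Longrightarrow> Y \<in> ob C \<Longrightarrow> f \<in> mor C X Y \<Longrightarrow> addm C X Y (zerom C X Y) f = f"
  and add_idem: "X \<in> ob C \<Longrightarrow> Y \<in> ob C \<Longrightarrow> f \<in> mor C X Y \<Longrightarrow> addm C X Y f f = f \<Longrightarrow> f = zerom C X Y"
proof -
  assume XY: "X \<in> ob C" "Y \<in> ob C"
  interpret G: comm_group "\<lparr>carrier = mor C X Y, monoid.mult = addm C X Y, one = zerom C X Y\<rparr>"
    by (rule hom_group[OF XY])
  show "zerom C X Y \<in> mor C X Y" using G.one_closed by simp
  show "addm C X Y f g \<in> mor C X Y" if "f \<in> mor C X Y" "g \<in> mor C X Y"
    using G.m_closed[of f g] that by simp
  show "addm C X Y (zerom C X Y) f = f" if "f \<in> mor C X Y" using G.l_one[of f] that by simp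
  show "f = zerom C X Y" if "f \<in> mor C X Y" "addm C X Y f f = f"
    using G.l_cancel_one[of f f] that by simp
qed

lemma comp_zero: "X \<in> ob C \<Longrightarrow> Y \<in> ob C \<Longrightarrow> Z \<in> ob C \<Longrightarrow> g \<in> mor C Y Z \<Longrightarrow>
    cmp C X Y Z g (zerom C X Y) = zerom C X Z"
  by (rule add_idem) (simp_all add: comp_add[symmetric] comp_mor zero_mor zero_add)

lemma zero_comp: "X \<in> ob C \<Longrightarrow> Y \<in> ob C \<Longrightarrow> Z \<in> ob C \<Longrightarrow> f \<in> mor C X Y \<Longrightarrow>
    cmp C X Y Z (zerom C Y Z) f = zerom C X Z"
  by (rule add_idem) (simp_all add: add_comp[symmetric] comp_mor zero_mor zero_add)

lemma isomorphicE:
  assumes "isomorphic C X Y"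
  obtains f g where "X \<in> ob C" "Y \<in> ob C" "f \<in> mor C X Y" "g \<in> mor C Y X"
    "cmp C X Y X g f = idm C X" "cmp C Y X Y f g = idm C Y"
  using assms unfolding isomorphic_def by (elim conjE bexE)

lemma isomorphicI:
  "X \<in> ob C \<Longrightarrow> Y \<in> ob C \<Longrightarrow> f \<in> mor C X Y \<Longrightarrow> g \<in> mor C Y X \<Longrightarrow>
    cmp C X Y X g f = idm C X \<Longrightarrow> cmp C Y X Y f g = idm C Y \<Longrightarrow> isomorphic C X Y"
  unfolding isomorphic_def by (intro conjI bexI[of _ f] bexI[of _ g])

lemma isomorphic_refl: "X \<in> ob C \<Longrightarrow> isomorphic C X X"
  by (rule isomorphicI[where f = "idm C X" and g = "idm C X"]) (simp_all add: id_mor id_comp)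

lemma isomorphic_trans:
  assumes "isomorphic C X Y" "isomorphic C Y Z" shows "isomorphic C X Z"
proof -
  obtain f g where f: "X \<in> ob C" "Y \<in> ob C" "f \<in> mor C X Y" "g \<in> mor C Y X"
    "cmp C X Y X g f = idm C X" "cmp C Y X Y f g = idm C Y" using isomorphicE[OF assms(1)] .
  obtain h k where h: "Y \<in> ob C" "Z \<in> ob C" "h \<in> mor C Y Z" "k \<in> mor C Z Y"
    "cmp C Y Z Y k h = idm C Y" "cmp C Z Y Z h k = idm C Z" using isomorphicE[OF assms(2)] .
  show ?thesis
  proof (rule isomorphicI[OF f(1) h(2)])
    show "cmp C X Y Z h f \<in> mor C X Z" "cmp C Z Y X g k \<in> mor C Z X" using f h by (simp_all add: comp_mor)
    have "cmp C X Z Y k (cmp C X Y Z h f) = f"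
      using f h by (simp add: assoc[of X Y Z Y] id_comp)
    then show "cmp C X Z X (cmp C Z Y X g k) (cmp C X Y Z h f) = idm C X"
      using f h by (simp add: assoc[of X Z Y X, symmetric] comp_mor)
    have "cmp C Z X Y f (cmp C Z Y X g k) = k"
      using f h by (simp add: assoc[of Z Y X Y] id_comp)
    then show "cmp C Z X Z (cmp C X Y Z h f) (cmp C Z Y X g k) = idm C Z"
      using f h by (simp add: assoc[of Z X Y Z, symmetric] comp_mor)
  qed
qed

lemma kernel_unique:
  assumes XY: "X \<in> ob C" "Y \<in> ob C" and k: "is_kernel C X Y f N k" and k': "is_kernel C X Y f N' k'"
  shows "isomorphic C N N'"
proof -
  note k = k[unfolded is_kernel_def] and k' = k'[unfolded is_kernel_def]
  have N: "N \<in> ob C" "k \<in> mor C N X" "cmp C N X Y f k = zerom C N Y"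
    and N': "N' \<in> ob C" "k' \<in> mor C N' X" "cmp C N' X Y f k' = zerom C N' Y" using k k' by simp_all
  have ex: "\<exists>!h. h \<in> mor C W N \<and> cmp C W N X k h = g" if "W \<in> ob C" "g \<in> mor C W X" "cmp C W X Y f g = zerom C W Y" for W g
    using k that by simp
  have ex': "\<exists>!h. h \<in> mor C W N' \<and> cmp C W N' X k' h = g" if "W \<in> ob C" "g \<in> mor C W X" "cmp C W X Y f g = zerom C W Y" for W g
    using k' that by simp
  obtain h where h: "h \<in> mor C N N'" "cmp C N N' X k' h = k" using ex'[OF N] by blast
  obtain h' where h': "h' \<in> mor C N' N" "cmp C N' N X k h' = k'" using ex[OF N'] by blast
  have "cmp C N N' N h' h = idm C N"
  proof (rule ex1_unique[OF ex[OF N]])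
    show "cmp C N N' N h' h \<in> mor C N N \<and> cmp C N N X k (cmp C N N' N h' h) = k"
      using assoc[OF N(1) N'(1) N(1) XY(1) h(1) h'(1) N(2)] h h' N N' by (simp add: comp_mor)
    show "idm C N \<in> mor C N N \<and> cmp C N N X k (idm C N) = k"
      using N XY by (simp add: id_mor comp_id)
  qed
  moreover have "cmp C N' N N' h h' = idm C N'"
  proof (rule ex1_unique[OF ex'[OF N']])
    show "cmp C N' N N' h h' \<in> mor C N' N' \<and> cmp C N' N' X k' (cmp C N' N N' h h') = k'"
      using assoc[OF N'(1) N(1) N'(1) XY(1) h'(1) h(1) N'(2)] h h' N N' by (simp add: comp_mor)
    show "idm C N' \<in> mor C N' N' \<and> cmp C N' N' X k' (idm C N') = k'"
      using N' XY by (simp add: id_mor comp_id)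
  qed
  ultimately show ?thesis by (intro isomorphicI[OF N(1) N'(1) h(1) h'(1)])
qed

lemma cokernel_unique:
  assumes XY: "X \<in> ob C" "Y \<in> ob C" and k: "is_cokernel C X Y f N k" and k': "is_cokernel C X Y f N' k'"
  shows "isomorphic C N N'"
proof -
  note k = k[unfolded is_cokernel_def] and k' = k'[unfolded is_cokernel_def]
  have N: "N \<in> ob C" "k \<in> mor C Y N" "cmp C X Y N k f = zerom C X N"
    and N': "N' \<in> ob C" "k' \<in> mor C Y N'" "cmp C X Y N' k' f = zerom C X N'" using k k' by simp_all
  have ex: "\<exists>!h. h \<in> mor C N W \<and> cmp C Y N W h k = g" if "W \<in> ob C" "g \<in> mor C Y W" "cmp C X Y W g f = zerom C X W" for W g
    using k that by simp
  have ex': "\<exists>!h. h \<in> mor C N' W \<and> cmp C Y N' W h k' = g" if "W \<in> ob C" "g \<in> mor C Y W" "cmp C X Y W g f = zerom C X W" for W g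
    using k' that by simp
  obtain h where h: "h \<in> mor C N N'" "cmp C Y N N' h k = k'" using ex[OF N'] by blast
  obtain h' where h': "h' \<in> mor C N' N" "cmp C Y N' N h' k' = k" using ex'[OF N] by blast
  have "cmp C N N' N h' h = idm C N"
  proof (rule ex1_unique[OF ex[OF N]])
    show "cmp C N N' N h' h \<in> mor C N N \<and> cmp C Y N N (cmp C N N' N h' h) k = k"
      using assoc[OF XY(2) N(1) N'(1) N(1) N(2) h(1) h'(1)] h h' N N' by (simp add: comp_mor)
    show "idm C N \<in> mor C N N \<and> cmp C Y N N (idm C N) k = k"
      using N XY by (simp add: id_mor id_comp)
  qed
  moreover have "cmp C N' N N' h h' = idm C N'"
  proof (rule ex1_unique[OF ex'[OF N']])
    show "cmp C N' N N' h h' \<in> mor C N' N' \<and> cmp C Y N' N' (cmp C N' N N' h h') k' = k'"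
      using assoc[OF XY(2) N'(1) N(1) N'(1) N'(2) h'(1) h(1)] h h' N N' by (simp add: comp_mor)
    show "idm C N' \<in> mor C N' N' \<and> cmp C Y N' N' (idm C N') k' = k'"
      using N' XY by (simp add: id_mor id_comp)
  qed
  ultimately show ?thesis by (intro isomorphicI[OF N(1) N'(1) h(1) h'(1)])
qed

text \<open>Allows a kernel to be computed after replacing source and target by isomorphic objects;
  the kernel object stays the same. It passes from pulled-back modules to the modules they
  encode.\<close>

lemma kernel_transport:
  assumes ob: "X \<in> ob C" "X' \<in> ob C" "Y \<in> ob C" "Y' \<in> ob C"
    and a: "a \<in> mor C X X'" "a' \<in> mor C X' X" "cmp C X X' X a' a = idm C X" "cmp C X' X X' a a' = idm C X'"
    and b: "b \<in> mor C Y Y'" "b' \<in> mor C Y' Y" "cmp C Y Y' Y b' b = idm C Y"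
    and f: "f \<in> mor C X Y" "f' \<in> mor C X' Y'" "cmp C X X' Y' f' a = cmp C X Y Y' b f"
    and k: "is_kernel C X' Y' f' N k"
  shows "is_kernel C X Y f N (cmp C N X' X a' k)"
proof -
  note k = k[unfolded is_kernel_def]
  have N: "N \<in> ob C" "k \<in> mor C N X'" "cmp C N X' Y' f' k = zerom C N Y'" using k by simp_all
  have ex: "\<exists>!h. h \<in> mor C W N \<and> cmp C W N X' k h = g" if "W \<in> ob C" "g \<in> mor C W X'" "cmp C W X' Y' f' g = zerom C W Y'" for W g
    using k that by simp
  have ak: "cmp C N X' X a' k \<in> mor C N X" using ob a N by (simp add: comp_mor)
  have f_eq: "f = cmp C X Y' Y b' (cmp C X X' Y' f' a)"
    using ob b f by (simp add: assoc[of X Y Y' Y] id_comp)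
  have fg: "cmp C W X Y f g = cmp C W Y' Y b' (cmp C W X' Y' f' (cmp C W X X' a g))"
    if "W \<in> ob C" "g \<in> mor C W X" for W g
    using ob a b f that by (subst f_eq) (simp add: assoc comp_mor)
  have "cmp C N X Y f (cmp C N X' X a' k) = zerom C N Y"
  proof -
    have "cmp C N X X' a (cmp C N X' X a' k) = k" using ob a N by (simp add: assoc id_comp)
    then show ?thesis using fg[OF N(1) ak] N ob b by (simp add: comp_zero)
  qed
  moreover have "\<exists>!h. h \<in> mor C W N \<and> cmp C W N X (cmp C N X' X a' k) h = g"
    if g: "W \<in> ob C" "g \<in> mor C W X" "cmp C W X Y f g = zerom C W Y" for W g
  proof -
    have ag: "cmp C W X X' a g \<in> mor C W X'" using ob a g by (simp add: comp_mor)
    have "cmp C W X' Y' f' (cmp C W X X' a g) = cmp C W X Y' (cmp C X X' Y' f' a) g"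
      using ob a f g by (simp add: assoc)
    also have "\<dots> = cmp C W Y Y' b (cmp C W X Y f g)"
      unfolding f(3) by (rule assoc[symmetric]) (use ob b f g in simp_all)
    also have "\<dots> = zerom C W Y'" using ob b g by (simp add: comp_zero)
    finally have "\<exists>!h. h \<in> mor C W N \<and> cmp C W N X' k h = cmp C W X X' a g" using ex[OF g(1) ag] by simp
    moreover have "(cmp C W N X' k h = cmp C W X X' a g) = (cmp C W N X (cmp C N X' X a' k) h = g)"
      if h: "h \<in> mor C W N" for h
    proof
      assume "cmp C W N X' k h = cmp C W X X' a g"
      then have "cmp C W X' X a' (cmp C W N X' k h) = cmp C W X' X a' (cmp C W X X' a g)" by simp
      then show "cmp C W N X (cmp C N X' X a' k) h = g"
        using ob a N g h by (simp add: assoc id_comp)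
    next
      assume e: "cmp C W N X (cmp C N X' X a' k) h = g"
      have "cmp C W X X' a (cmp C W N X (cmp C N X' X a' k) h) =
          cmp C W N X' (cmp C N X X' a (cmp C N X' X a' k)) h"
        using ob a N g h ak by (simp add: assoc)
      also have "cmp C N X X' a (cmp C N X' X a' k) = k" using ob a N by (simp add: assoc id_comp)
      finally show "cmp C W N X' k h = cmp C W X X' a g" using e by simp
    qed
    ultimately show ?thesis by (metis (no_types, lifting))
  qed
  ultimately show ?thesis unfolding is_kernel_def using N ak by simp
qed

lemma cokernel_transport:
  assumes ob: "X \<in> ob C" "X' \<in> ob C" "Y \<in> ob C" "Y' \<in> ob C"
    and a: "a \<in> mor C X X'" "a' \<in> mor C X' X" "cmp C X' X X' a a' = idm C X'"
    and b: "b \<in> mor C Y Y'" "b' \<in> mor C Y' Y" "cmp C Y Y' Y b' b = idm C Y" "cmp C Y' Y Y' b b' = idm C Y'"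
    and f: "f \<in> mor C X Y" "f' \<in> mor C X' Y'" "cmp C X X' Y' f' a = cmp C X Y Y' b f"
    and k: "is_cokernel C X' Y' f' N k"
  shows "is_cokernel C X Y f N (cmp C Y Y' N k b)"
proof -
  note k = k[unfolded is_cokernel_def]
  have N: "N \<in> ob C" "k \<in> mor C Y' N" "cmp C X' Y' N k f' = zerom C X' N" using k by simp_all
  have ex: "\<exists>!h. h \<in> mor C N W \<and> cmp C Y' N W h k = g" if "W \<in> ob C" "g \<in> mor C Y' W" "cmp C X' Y' W g f' = zerom C X' W" for W g
    using k that by simp
  have kb: "cmp C Y Y' N k b \<in> mor C Y N" using ob b N by (simp add: comp_mor)
  have "cmp C X Y N (cmp C Y Y' N k b) f = cmp C X X' N (cmp C X' Y' N k f') a"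
  proof -
    have "cmp C X Y N (cmp C Y Y' N k b) f = cmp C X Y' N k (cmp C X Y Y' b f)"
      using ob b N f by (simp add: assoc)
    also have "\<dots> = cmp C X Y' N k (cmp C X X' Y' f' a)" using f by simp
    also have "\<dots> = cmp C X X' N (cmp C X' Y' N k f') a" by (rule assoc) (use ob a N f in simp_all)
    finally show ?thesis .
  qed
  then have "cmp C X Y N (cmp C Y Y' N k b) f = zerom C X N" using N ob a by (simp add: zero_comp)
  moreover have "\<exists>!h. h \<in> mor C N W \<and> cmp C Y N W h (cmp C Y Y' N k b) = g"
    if g: "W \<in> ob C" "g \<in> mor C Y W" "cmp C X Y W g f = zerom C X W" for W g
  proof -
    have gb: "cmp C Y' Y W g b' \<in> mor C Y' W" using ob b g by (simp add: comp_mor)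
    have "f' = cmp C X' Y Y' b (cmp C X' X Y f a')"
    proof -
      have "cmp C X' Y Y' b (cmp C X' X Y f a') = cmp C X' X Y' (cmp C X Y Y' b f) a'"
        using ob a b f by (simp add: assoc)
      also have "\<dots> = cmp C X' X Y' (cmp C X X' Y' f' a) a'" using f by simp
      also have "\<dots> = cmp C X' X' Y' f' (cmp C X' X X' a a')"
        by (rule assoc[symmetric]) (use ob a f in simp_all)
      finally show ?thesis using ob a f by (simp add: comp_id)
    qed
    then have "cmp C X' Y' W (cmp C Y' Y W g b') f' =
        cmp C X' Y' W (cmp C Y' Y W g b') (cmp C X' Y Y' b (cmp C X' X Y f a'))" by simp
    also have "\<dots> = cmp C X' Y W (cmp C Y Y' W (cmp C Y' Y W g b') b) (cmp C X' X Y f a')"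
      using ob a b f g gb by (simp add: assoc comp_mor)
    also have "cmp C Y Y' W (cmp C Y' Y W g b') b = cmp C Y Y W g (cmp C Y Y' Y b' b)"
      by (rule assoc[symmetric]) (use ob b g in simp_all)
    also have "\<dots> = g" using ob b g by (simp add: comp_id)
    also have "cmp C X' Y W g (cmp C X' X Y f a') = cmp C X' X W (cmp C X Y W g f) a'"
      using ob a f g by (simp add: assoc)
    also have "\<dots> = zerom C X' W" using ob a g by (simp add: zero_comp)
    finally have "\<exists>!h. h \<in> mor C N W \<and> cmp C Y' N W h k = cmp C Y' Y W g b'" using ex[OF g(1) gb] by simp
    moreover have "(cmp C Y' N W h k = cmp C Y' Y W g b') = (cmp C Y N W h (cmp C Y Y' N k b) = g)"
      if h: "h \<in> mor C N W" for h
    proof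
      assume "cmp C Y' N W h k = cmp C Y' Y W g b'"
      then have "cmp C Y Y' W (cmp C Y' N W h k) b = cmp C Y Y' W (cmp C Y' Y W g b') b" by simp
      also have "cmp C Y Y' W (cmp C Y' Y W g b') b = cmp C Y Y W g (cmp C Y Y' Y b' b)"
        by (rule assoc[symmetric]) (use ob b g in simp_all)
      also have "\<dots> = g" using ob b g by (simp add: comp_id)
      finally show "cmp C Y N W h (cmp C Y Y' N k b) = g" using ob b N g h by (simp add: assoc)
    next
      assume "cmp C Y N W h (cmp C Y Y' N k b) = g"
      then have "cmp C Y' Y W g b' = cmp C Y' Y W (cmp C Y N W h (cmp C Y Y' N k b)) b'" by simp
      also have "\<dots> = cmp C Y' N W h (cmp C Y' Y N (cmp C Y Y' N k b) b')"
        using ob b N g h kb by (simp add: assoc)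
      also have "cmp C Y' Y N (cmp C Y Y' N k b) b' = cmp C Y' Y' N k (cmp C Y' Y Y' b b')"
        by (rule assoc[symmetric]) (use ob b N in simp_all)
      also have "\<dots> = k" using ob b N by (simp add: comp_id)
      finally show "cmp C Y' N W h k = cmp C Y' Y W g b'" by simp
    qed
    ultimately show ?thesis by (metis (no_types, lifting))
  qed
  ultimately show ?thesis unfolding is_cokernel_def using N kb by simp
qed

lemma biproduct_transport:
  assumes "isomorphic C X X'" "isomorphic C Y Y'" and B: "biproduct C X' Y' B"
  shows "biproduct C X Y B"
proof -
  obtain a a' where a: "X \<in> ob C" "X' \<in> ob C" "a \<in> mor C X X'" "a' \<in> mor C X' X"
    "cmp C X X' X a' a = idm C X" "cmp C X' X X' a a' = idm C X'" using isomorphicE[OF assms(1)] .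
  obtain b b' where b: "Y \<in> ob C" "Y' \<in> ob C" "b \<in> mor C Y Y'" "b' \<in> mor C Y' Y"
    "cmp C Y Y' Y b' b = idm C Y" "cmp C Y' Y Y' b b' = idm C Y'" using isomorphicE[OF assms(2)] .
  obtain i j p q where B: "B \<in> ob C" "i \<in> mor C X' B" "j \<in> mor C Y' B" "p \<in> mor C B X'" "q \<in> mor C B Y'"
    "cmp C X' B X' p i = idm C X'" "cmp C Y' B Y' q j = idm C Y'"
    "cmp C Y' B X' p j = zerom C Y' X'" "cmp C X' B Y' q i = zerom C X' Y'"
    "addm C B B (cmp C B X' B i p) (cmp C B Y' B j q) = idm C B"
    using B unfolding biproduct_def by (elim conjE bexE)
  \<comment> \<open>Reassociations: \<open>sandwich\<close> makes two structure maps of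
    \<open>B\<close> adjacent, and \<open>mid\<close> cancels an isomorphism with its inverse
    between them.\<close>
  have sandwich: "cmp C U B V (cmp C B V' V s' t) (cmp C U U' B u s) = cmp C U V' V s' (cmp C U U' V' (cmp C U' B V' t u) s)"
    if "U \<in> ob C" "U' \<in> ob C" "V \<in> ob C" "V' \<in> ob C" "s \<in> mor C U U'" "u \<in> mor C U' B" "t \<in> mor C B V'" "s' \<in> mor C V' V"
    for U U' V V' s u t s'
    using that B(1) by (simp add: assoc comp_mor)
  have mid: "cmp C B U B (cmp C U U' B u s) (cmp C B U' U s' t) = cmp C B U' B u t"
    if "U \<in> ob C" "U' \<in> ob C" "s \<in> mor C U U'" "u \<in> mor C U' B" "t \<in> mor C B U'" "s' \<in> mor C U' U"
      "cmp C U' U U' s s' = idm C U'" for U U' s u t s'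
  proof -
    have "cmp C B U B (cmp C U U' B u s) (cmp C B U' U s' t) = cmp C B U' B (cmp C U' U B (cmp C U U' B u s) s') t"
      using that B(1) by (simp add: assoc comp_mor)
    also have "cmp C U' U B (cmp C U U' B u s) s' = cmp C U' U' B u (cmp C U' U U' s s')"
      by (rule assoc[symmetric]) (use that B(1) in simp_all)
    finally show ?thesis using that B(1) by (simp add: comp_id)
  qed
  show ?thesis
    unfolding biproduct_def
  proof (intro conjI bexI)
    show "cmp C X B X (cmp C B X' X a' p) (cmp C X X' B i a) = idm C X"
      using a B by (simp add: sandwich id_comp)
    show "cmp C Y B Y (cmp C B Y' Y b' q) (cmp C Y Y' B j b) = idm C Y"
      using b B by (simp add: sandwich id_comp)
    show "cmp C Y B X (cmp C B X' X a' p) (cmp C Y Y' B j b) = zerom C Y X"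
      using a b B by (simp add: sandwich zero_comp comp_zero)
    show "cmp C X B Y (cmp C B Y' Y b' q) (cmp C X X' B i a) = zerom C X Y"
      using a b B by (simp add: sandwich zero_comp comp_zero)
    show "addm C B B (cmp C B X B (cmp C X X' B i a) (cmp C B X' X a' p))
        (cmp C B Y B (cmp C Y Y' B j b) (cmp C B Y' Y b' q)) = idm C B"
      using a b B by (simp add: mid)
  qed (use a b B in \<open>simp_all add: comp_mor\<close>)
qed

end

section \<open>Vector spaces on subsets of a type\<close>

lemma Vect_ob: "V \<in> ob (Vect K) \<longleftrightarrow> vectorspace K V"
  by (simp add: Vect_def)

lemma Vect_mor: "f \<in> mor (Vect K) V W \<longleftrightarrow> f \<in> module_hom K V W \<and> f \<in> extensional (carrier V)"
  by (simp add: Vect_def)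

lemma Vect_cmp: "cmp (Vect K) U V W g f = (\<lambda>x\<in>carrier U. g (f x))"
  by (simp add: Vect_def compose_def)

lemma Vect_idm: "idm (Vect K) V = (\<lambda>v\<in>carrier V. v)"
  and Vect_zerom: "zerom (Vect K) V W = (\<lambda>v\<in>carrier V. \<zero>\<^bsub>W\<^esub>)"
  and Vect_addm: "addm (Vect K) V W f g = (\<lambda>v\<in>carrier V. f v \<oplus>\<^bsub>W\<^esub> g v)"
  by (simp_all add: Vect_def)

lemma Vect_mor_closed: "f \<in> mor (Vect K) V W \<Longrightarrow> v \<in> carrier V \<Longrightarrow> f v \<in> carrier W"
  and Vect_mor_add: "f \<in> mor (Vect K) V W \<Longrightarrow> v \<in> carrier V \<Longrightarrow> w \<in> carrier V \<Longrightarrow> f (v \<oplus>\<^bsub>V\<^esub> w) = f v \<oplus>\<^bsub>W\<^esub> f w"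
  and Vect_mor_smult: "f \<in> mor (Vect K) V W \<Longrightarrow> c \<in> carrier K \<Longrightarrow> v \<in> carrier V \<Longrightarrow> f (c \<odot>\<^bsub>V\<^esub> v) = c \<odot>\<^bsub>W\<^esub> f v"
  unfolding Vect_mor module_hom_def by auto

lemma Vect_mor_ext: "f \<in> mor (Vect K) V W \<Longrightarrow> f \<in> extensional (carrier V)"
  unfolding Vect_mor by simp

lemma Vect_morI:
  "(\<And>v. v \<in> carrier V \<Longrightarrow> f v \<in> carrier W) \<Longrightarrow>
   (\<And>v w. v \<in> carrier V \<Longrightarrow> w \<in> carrier V \<Longrightarrow> f (v \<oplus>\<^bsub>V\<^esub> w) = f v \<oplus>\<^bsub>W\<^esub> f w) \<Longrightarrow>
   (\<And>c v. c \<in> carrier K \<Longrightarrow> v \<in> carrier V \<Longrightarrow> f (c \<odot>\<^bsub>V\<^esub> v) = c \<odot>\<^bsub>W\<^esub> f v) \<Longrightarrow>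
   f \<in> extensional (carrier V) \<Longrightarrow> f \<in> mor (Vect K) V W"
  unfolding Vect_mor module_hom_def by auto

lemma Vect_mor_eqI:
  "f \<in> mor (Vect K) V W \<Longrightarrow> g \<in> mor (Vect K) V W' \<Longrightarrow> (\<And>v. v \<in> carrier V \<Longrightarrow> f v = g v) \<Longrightarrow> f = g"
  by (rule extensionalityI[of _ "carrier V"]) (auto dest: Vect_mor_ext)

lemma vectorspace_module: "vectorspace K V \<Longrightarrow> module K V"
  by (simp add: vectorspace_def)

lemma vectorspace_closed:
  assumes "vectorspace K V"
  shows "v \<in> carrier V \<Longrightarrow> w \<in> carrier V \<Longrightarrow> v \<oplus>\<^bsub>V\<^esub> w \<in> carrier V" "\<zero>\<^bsub>V\<^esub> \<in> carrier V"
    "c \<in> carrier K \<Longrightarrow> v \<in> carrier V \<Longrightarrow> c \<odot>\<^bsub>V\<^esub> v \<in> carrier V"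
    "v \<in> carrier V \<Longrightarrow> \<ominus>\<^bsub>V\<^esub> v \<in> carrier V" "v \<in> carrier V \<Longrightarrow> w \<in> carrier V \<Longrightarrow> v \<ominus>\<^bsub>V\<^esub> w \<in> carrier V"
proof -
  interpret V: module K V by (rule vectorspace_module[OF assms])
  show "v \<in> carrier V \<Longrightarrow> w \<in> carrier V \<Longrightarrow> v \<oplus>\<^bsub>V\<^esub> w \<in> carrier V" "\<zero>\<^bsub>V\<^esub> \<in> carrier V"
    "c \<in> carrier K \<Longrightarrow> v \<in> carrier V \<Longrightarrow> c \<odot>\<^bsub>V\<^esub> v \<in> carrier V"
    "v \<in> carrier V \<Longrightarrow> \<ominus>\<^bsub>V\<^esub> v \<in> carrier V" "v \<in> carrier V \<Longrightarrow> w \<in> carrier V \<Longrightarrow> v \<ominus>\<^bsub>V\<^esub> w \<in> carrier V" by simp_all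
qed

lemma Vect_mor_zero:
  assumes "vectorspace K V" "vectorspace K W" "f \<in> mor (Vect K) V W" shows "f \<zero>\<^bsub>V\<^esub> = \<zero>\<^bsub>W\<^esub>"
proof -
  interpret V: module K V by (rule vectorspace_module[OF assms(1)])
  interpret W: module K W by (rule vectorspace_module[OF assms(2)])
  have "f \<zero>\<^bsub>V\<^esub> = f (\<zero>\<^bsub>K\<^esub> \<odot>\<^bsub>V\<^esub> \<zero>\<^bsub>V\<^esub>)" by simp
  also have "\<dots> = \<zero>\<^bsub>K\<^esub> \<odot>\<^bsub>W\<^esub> f \<zero>\<^bsub>V\<^esub>" by (rule Vect_mor_smult[OF assms(3)]) simp_all
  also have "\<dots> = \<zero>\<^bsub>W\<^esub>" using Vect_mor_closed[OF assms(3), of "\<zero>\<^bsub>V\<^esub>"] by simp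
  finally show ?thesis .
qed

lemma Vect_mor_minus:
  assumes "vectorspace K V" "vectorspace K W" "f \<in> mor (Vect K) V W" "v \<in> carrier V" "w \<in> carrier V"
  shows "f (v \<ominus>\<^bsub>V\<^esub> w) = f v \<ominus>\<^bsub>W\<^esub> f w"
proof -
  interpret V: module K V by (rule vectorspace_module[OF assms(1)])
  interpret W: module K W by (rule vectorspace_module[OF assms(2)])
  interpret mod_hom K V W f by unfold_locales (use assms(3) in \<open>simp add: Vect_mor\<close>)
  show ?thesis using assms(4,5) by simp
qed

lemma Vect_comp_mor:
  "f \<in> mor (Vect K) U V \<Longrightarrow> g \<in> mor (Vect K) V W \<Longrightarrow> vectorspace K U \<Longrightarrow> cmp (Vect K) U V W g f \<in> mor (Vect K) U W"
  by (rule Vect_morI)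
    (simp_all add: Vect_cmp Vect_mor_closed Vect_mor_add Vect_mor_smult vectorspace_closed)

lemma Vect_category: "Defs.category (Vect K)"
  unfolding Defs.category_def
proof (intro conjI ballI)
  fix X assume X: "X \<in> ob (Vect K)"
  show "idm (Vect K) X \<in> mor (Vect K) X X"
    by (rule Vect_morI) (use X in \<open>simp_all add: Vect_idm Vect_ob vectorspace_closed\<close>)
next
  fix X Y Z f g
  assume "X \<in> ob (Vect K)" "f \<in> mor (Vect K) X Y" "g \<in> mor (Vect K) Y Z"
  then show "cmp (Vect K) X Y Z g f \<in> mor (Vect K) X Z" by (simp add: Vect_comp_mor Vect_ob)
next
  fix X Y f assume f: "f \<in> mor (Vect K) X Y"
  show "cmp (Vect K) X Y Y (idm (Vect K) Y) f = f" "cmp (Vect K) X X Y f (idm (Vect K) X) = f"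
    by (rule extensionalityI[of _ "carrier X"];
        use f in \<open>simp add: Vect_cmp Vect_idm Vect_mor_closed Vect_mor_ext\<close>)+
next
  fix W X Y Z f g h
  assume "f \<in> mor (Vect K) W X" "g \<in> mor (Vect K) X Y" "h \<in> mor (Vect K) Y Z"
  then show "cmp (Vect K) W Y Z h (cmp (Vect K) W X Y g f) = cmp (Vect K) W X Z (cmp (Vect K) X Y Z h g) f"
    by (intro extensionalityI[of _ "carrier W"]) (simp_all add: Vect_cmp Vect_mor_closed)
qed

lemma Vect_zero_mor: "vectorspace K X \<Longrightarrow> vectorspace K Y \<Longrightarrow> zerom (Vect K) X Y \<in> mor (Vect K) X Y"
proof -
  assume X: "vectorspace K X" and Y: "vectorspace K Y"
  interpret Y: module K Y by (rule vectorspace_module[OF Y])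
  show ?thesis by (rule Vect_morI) (simp_all add: Vect_zerom vectorspace_closed[OF X])
qed

lemma Vect_preadditive:
  fixes K :: "('k, 'z) ring_scheme"
  shows "preadditive (Vect K :: (('k, 'u) module, 'u \<Rightarrow> 'u) cat)"
  unfolding preadditive_def
proof (intro conjI ballI Vect_category)
  fix X Y :: "('k, 'u) module" assume "X \<in> ob (Vect K)" "Y \<in> ob (Vect K)"
  then have X: "vectorspace K X" and Y: "vectorspace K Y" by (simp_all add: Vect_ob)
  interpret Y: module K Y by (rule vectorspace_module[OF Y])
  let ?M = "mor (Vect K) X Y"
  show "comm_group \<lparr>carrier = ?M, monoid.mult = addm (Vect K) X Y, one = zerom (Vect K) X Y\<rparr>"
  proof (rule comm_groupI; simp only: partial_object.simps monoid.simps)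
    fix f g assume f: "f \<in> ?M" and g: "g \<in> ?M"
    show "addm (Vect K) X Y f g \<in> ?M"
      by (rule Vect_morI) (simp_all add: Vect_addm Vect_mor_closed[OF f] Vect_mor_closed[OF g]
          Vect_mor_add[OF f] Vect_mor_add[OF g] Vect_mor_smult[OF f] Vect_mor_smult[OF g]
          vectorspace_closed[OF X] Y.smult_r_distr Y.M.a_ac)
    show "addm (Vect K) X Y f g = addm (Vect K) X Y g f"
      by (rule extensionalityI[of _ "carrier X"])
        (simp_all add: Vect_addm Vect_mor_closed[OF f] Vect_mor_closed[OF g] Y.M.a_comm)
  next
    show "zerom (Vect K) X Y \<in> ?M" by (rule Vect_zero_mor[OF X Y])
  next
    fix f g h assume f: "f \<in> ?M" and g: "g \<in> ?M" and h: "h \<in> ?M"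
    show "addm (Vect K) X Y (addm (Vect K) X Y f g) h = addm (Vect K) X Y f (addm (Vect K) X Y g h)"
      by (rule extensionalityI[of _ "carrier X"])
        (simp_all add: Vect_addm Vect_mor_closed[OF f] Vect_mor_closed[OF g] Vect_mor_closed[OF h] Y.M.a_assoc)
  next
    fix f assume f: "f \<in> ?M"
    show "addm (Vect K) X Y (zerom (Vect K) X Y) f = f"
      by (rule extensionalityI[of _ "carrier X"])
        (simp_all add: Vect_addm Vect_zerom Vect_mor_closed[OF f] Vect_mor_ext[OF f])
    show "\<exists>g\<in>?M. addm (Vect K) X Y g f = zerom (Vect K) X Y"
    proof
      show "(\<lambda>x\<in>carrier X. \<ominus>\<^bsub>Y\<^esub> f x) \<in> ?M"
        by (rule Vect_morI) (simp_all add: Vect_mor_closed[OF f] Vect_mor_add[OF f] Vect_mor_smult[OF f]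
            vectorspace_closed[OF X] Y.M.minus_add Y.smult_r_minus)
      show "addm (Vect K) X Y (\<lambda>x\<in>carrier X. \<ominus>\<^bsub>Y\<^esub> f x) f = zerom (Vect K) X Y"
        by (rule extensionalityI[of _ "carrier X"])
          (simp_all add: Vect_addm Vect_zerom Vect_mor_closed[OF f] Y.M.l_neg)
    qed
  qed
next
  fix X Y Z f f' g g'
  assume f: "f \<in> mor (Vect K) X Y" and f': "f' \<in> mor (Vect K) X Y"
    and g: "g \<in> mor (Vect K) Y Z" and g': "g' \<in> mor (Vect K) Y Z"
  show "cmp (Vect K) X Y Z g (addm (Vect K) X Y f f') =
      addm (Vect K) X Z (cmp (Vect K) X Y Z g f) (cmp (Vect K) X Y Z g f')"
    by (rule extensionalityI[of _ "carrier X"])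
      (simp_all add: Vect_addm Vect_cmp Vect_mor_closed[OF f] Vect_mor_closed[OF f'] Vect_mor_add[OF g])
  show "cmp (Vect K) X Y Z (addm (Vect K) Y Z g g') f =
      addm (Vect K) X Z (cmp (Vect K) X Y Z g f) (cmp (Vect K) X Y Z g' f)"
    by (rule extensionalityI[of _ "carrier X"])
      (simp_all add: Vect_addm Vect_cmp Vect_mor_closed[OF f])
qed

interpretation Vect: preadditive_category "Vect K" for K
  by unfold_locales (rule Vect_preadditive)

text \<open>Generation is expressed by submodules rather than by linear combinations. A submodule of
  a direct sum can then be examined through its preimages in the summands.\<close>

lemma fin_dim_iff:
  assumes V: "vectorspace K V"
  shows "vectorspace.fin_dim K V \<longleftrightarrow>
    (\<exists>A. finite A \<and> A \<subseteq> carrier V \<and> (\<forall>N. submodule K N V \<longrightarrow> A \<subseteq> N \<longrightarrow> carrier V \<subseteq> N))"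
proof -
  interpret V: vectorspace K V by (rule V)
  have "V.module.span A = carrier V \<longleftrightarrow> (\<forall>N. submodule K N V \<longrightarrow> A \<subseteq> N \<longrightarrow> carrier V \<subseteq> N)"
    if A: "A \<subseteq> carrier V" for A
  proof
    assume "V.module.span A = carrier V"
    then show "\<forall>N. submodule K N V \<longrightarrow> A \<subseteq> N \<longrightarrow> carrier V \<subseteq> N"
      using V.module.span_is_subset[of A] by (intro allI impI) simp
  next
    assume "\<forall>N. submodule K N V \<longrightarrow> A \<subseteq> N \<longrightarrow> carrier V \<subseteq> N"
    then have "carrier V \<subseteq> V.module.span A"
      using V.module.span_is_submodule[OF A] V.module.in_own_span[OF A] by simp
    then show "V.module.span A = carrier V" using V.module.span_is_subset2[OF A] by simp
  qed
  then show ?thesis unfolding V.fin_dim_def by (simp cong: conj_cong)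
qed

text \<open>Linear independence in \<open>N\<close> and in \<open>V\<close> agree, so independent
  subsets of \<open>N\<close> have at most \<open>V.dim\<close> elements. Hence a maximal one
  exists, and it generates \<open>N\<close>.\<close>

lemma fin_dim_subspace:
  assumes V: "vectorspace K V" and N: "submodule K N V" and fd: "vectorspace.fin_dim K V"
  shows "vectorspace.fin_dim K (V\<lparr>carrier := N\<rparr>)"
proof -
  interpret V: vectorspace K V by (rule V)
  let ?W = "V\<lparr>carrier := N\<rparr>"
  have "subspace K N V" using V N by (simp add: subspace_def)
  then have "vectorspace K ?W" by (rule V.subspace_is_vs)
  then interpret W: vectorspace K ?W .
  have NV: "N \<subseteq> carrier V" using N by (simp add: submodule_def)
  have ld: "W.module.lin_dep A = V.module.lin_dep A" if "A \<subseteq> N" for A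
    by (rule V.module.span_li_not_depend(2)[OF that N])
  have "\<exists>A. finite A \<and> maximal A (\<lambda>A. A \<subseteq> carrier ?W \<and> \<not> W.module.lin_dep A)"
  proof (rule maximal_exists[where N = V.dim and B = "{}"])
    fix A assume A: "A \<subseteq> carrier ?W \<and> \<not> W.module.lin_dep A"
    then have "A \<subseteq> carrier V" "\<not> V.module.lin_dep A" using NV ld[of A] by auto
    then show "finite A \<and> card A \<le> V.dim" using V.li_le_dim[OF fd] by simp
  next
    show "{} \<subseteq> carrier ?W \<and> \<not> W.module.lin_dep {}" unfolding W.module.lin_dep_def by simp
  qed
  then obtain A where A: "finite A" "maximal A (\<lambda>A. A \<subseteq> carrier ?W \<and> \<not> W.module.lin_dep A)" by blast
  then have "W.module.span A = carrier ?W" by (intro W.max_li_is_gen)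
  moreover have "A \<subseteq> carrier ?W" using A(2) unfolding maximal_def by simp
  ultimately show ?thesis unfolding W.fin_dim_def using A(1) by blast
qed

lemma fin_dim_surj_image:
  assumes "vectorspace K V" "vectorspace K W" "f \<in> mor (Vect K) V W" "f ` carrier V = carrier W"
    "vectorspace.fin_dim K V"
  shows "vectorspace.fin_dim K W"
proof -
  interpret V: vectorspace K V by (rule assms)
  interpret W: vectorspace K W by (rule assms)
  interpret linear_map K V W f
    by unfold_locales (use assms(3) in \<open>simp add: Vect_mor\<close>)
  show ?thesis by (rule surj_fin_dim[OF assms(5,4)])
qed

text \<open>The axioms pass along a surjection respecting the operations. It serves both for
  quotients, with \<open>h\<close> the choice of representatives, and for sums, with
  \<open>h\<close> a coding of pairs.\<close>

lemma vectorspace_surj_image: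
  assumes V: "vectorspace K V" and car: "carrier X = h ` carrier V"
    and add: "\<And>v w. v \<in> carrier V \<Longrightarrow> w \<in> carrier V \<Longrightarrow> h v \<oplus>\<^bsub>X\<^esub> h w = h (v \<oplus>\<^bsub>V\<^esub> w)"
    and smult: "\<And>c v. c \<in> carrier K \<Longrightarrow> v \<in> carrier V \<Longrightarrow> c \<odot>\<^bsub>X\<^esub> h v = h (c \<odot>\<^bsub>V\<^esub> v)"
    and zero: "\<zero>\<^bsub>X\<^esub> = h \<zero>\<^bsub>V\<^esub>"
  shows "vectorspace K X"
proof -
  interpret V: vectorspace K V by (rule V)
  note [simp] = car zero add smult
  show ?thesis
  proof (rule vs_criteria)
    show "field K" by (rule V.field_axioms)
    show "\<forall>v\<in>carrier X. \<exists>neg_v\<in>carrier X. v \<oplus>\<^bsub>X\<^esub> neg_v = \<zero>\<^bsub>X\<^esub>"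
    proof
      fix x assume "x \<in> carrier X"
      then obtain v where v: "v \<in> carrier V" "x = h v" by auto
      then show "\<exists>neg_v\<in>carrier X. x \<oplus>\<^bsub>X\<^esub> neg_v = \<zero>\<^bsub>X\<^esub>"
        by (intro bexI[of _ "h (\<ominus>\<^bsub>V\<^esub> v)"]) (simp_all add: V.M.r_neg)
    qed
  next
    show "\<forall>v w. v \<in> carrier X \<and> w \<in> carrier X \<longrightarrow> v \<oplus>\<^bsub>X\<^esub> w = w \<oplus>\<^bsub>X\<^esub> v"
      by (auto simp: V.M.a_comm)
    show "\<forall>v w x. v \<in> carrier X \<and> w \<in> carrier X \<and> x \<in> carrier X \<longrightarrow>
        (v \<oplus>\<^bsub>X\<^esub> w) \<oplus>\<^bsub>X\<^esub> x = v \<oplus>\<^bsub>X\<^esub> (w \<oplus>\<^bsub>X\<^esub> x)"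
      by (auto simp: V.M.a_assoc)
    show "\<forall>a b v. a \<in> carrier K \<and> b \<in> carrier K \<and> v \<in> carrier X \<longrightarrow> (a \<oplus>\<^bsub>K\<^esub> b) \<odot>\<^bsub>X\<^esub> v = a \<odot>\<^bsub>X\<^esub> v \<oplus>\<^bsub>X\<^esub> b \<odot>\<^bsub>X\<^esub> v"
      by (auto simp: V.smult_l_distr)
    show "\<forall>a v w. a \<in> carrier K \<and> v \<in> carrier X \<and> w \<in> carrier X \<longrightarrow>
        a \<odot>\<^bsub>X\<^esub> (v \<oplus>\<^bsub>X\<^esub> w) = a \<odot>\<^bsub>X\<^esub> v \<oplus>\<^bsub>X\<^esub> a \<odot>\<^bsub>X\<^esub> w"
      by (auto simp: V.smult_r_distr)
    show "\<forall>a b v. a \<in> carrier K \<and> b \<in> carrier K \<and> v \<in> carrier X \<longrightarrow> (a \<otimes>\<^bsub>K\<^esub> b) \<odot>\<^bsub>X\<^esub> v = a \<odot>\<^bsub>X\<^esub> (b \<odot>\<^bsub>X\<^esub> v)"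
      by (auto simp: V.smult_assoc1)
  qed auto
qed

section \<open>Kernels, quotients and direct sums of vector spaces\<close>

definition ker_mod :: "('k, 'u) module \<Rightarrow> ('k, 'u) module \<Rightarrow> ('u \<Rightarrow> 'u) \<Rightarrow> ('k, 'u) module" where
  "ker_mod V W f = V\<lparr>carrier := {v \<in> carrier V. f v = \<zero>\<^bsub>W\<^esub>}\<rparr>"

lemma ker_mod_submodule:
  assumes V: "vectorspace K V" and W: "vectorspace K W" and f: "f \<in> mor (Vect K) V W"
  shows "submodule K {v \<in> carrier V. f v = \<zero>\<^bsub>W\<^esub>} V"
proof -
  interpret W: module K W by (rule vectorspace_module[OF W])
  show ?thesis
    by (rule submodule.intro) (auto simp: vectorspace_module[OF V] vectorspace_closed[OF V] Vect_mor_add[OF f]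
        Vect_mor_smult[OF f] Vect_mor_zero[OF V W f])
qed

lemma ker_mod_vectorspace:
  assumes V: "vectorspace K V" and W: "vectorspace K W" and f: "f \<in> mor (Vect K) V W"
  shows "vectorspace K (ker_mod V W f)"
proof -
  interpret V: vectorspace K V by (rule V)
  show ?thesis unfolding ker_mod_def
    by (rule V.subspace_is_vs, rule subspace.intro, rule V, rule ker_mod_submodule[OF assms])
qed

context abelian_group
begin

lemma minus_add_minus:
  assumes "x \<in> carrier G" "y \<in> carrier G" "z \<in> carrier G"
  shows "(x \<ominus> y) \<oplus> (y \<ominus> z) = x \<ominus> z"
proof -
  have "(x \<ominus> y) \<oplus> (y \<ominus> z) = x \<oplus> (\<ominus> y \<oplus> (y \<oplus> \<ominus> z))"
    unfolding minus_eq using assms by (intro a_assoc) simp_all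
  also have "\<ominus> y \<oplus> (y \<oplus> \<ominus> z) = \<ominus> z" using assms by (intro r_neg1) simp_all
  finally show ?thesis unfolding minus_eq .
qed

lemma minus_swap:
  assumes "x \<in> carrier G" "y \<in> carrier G" shows "\<ominus> (x \<ominus> y) = y \<ominus> x"
proof -
  have "\<ominus> (x \<ominus> y) = \<ominus> x \<oplus> y" unfolding minus_eq using assms by (simp only: minus_add a_inv_closed minus_minus)
  also have "\<dots> = y \<oplus> \<ominus> x" using assms by (intro a_comm) simp_all
  finally show ?thesis unfolding minus_eq .
qed

lemma add_minus_add:
  assumes "x \<in> carrier G" "y \<in> carrier G" "x' \<in> carrier G" "y' \<in> carrier G"
  shows "(x' \<oplus> y') \<ominus> (x \<oplus> y) = (x' \<ominus> x) \<oplus> (y' \<ominus> y)"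
proof -
  have "(x' \<oplus> y') \<ominus> (x \<oplus> y) = (x' \<oplus> y') \<oplus> (\<ominus> x \<oplus> \<ominus> y)"
    unfolding minus_eq using assms by (simp only: minus_add)
  also have "\<dots> = x' \<oplus> (y' \<oplus> (\<ominus> x \<oplus> \<ominus> y))" using assms by (intro a_assoc) simp_all
  also have "y' \<oplus> (\<ominus> x \<oplus> \<ominus> y) = \<ominus> x \<oplus> (y' \<oplus> \<ominus> y)" using assms by (intro a_lcomm) simp_all
  also have "x' \<oplus> (\<ominus> x \<oplus> (y' \<oplus> \<ominus> y)) = (x' \<oplus> \<ominus> x) \<oplus> (y' \<oplus> \<ominus> y)"
    using assms by (intro a_assoc[symmetric]) simp_all
  finally show ?thesis unfolding minus_eq .
qed

end

text \<open>
  The universe need not contain the cosets of a subspace as elements, so a quotient is carried by a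
  set of representatives of the cosets.
\<close>

definition coset_rep :: "('k, 'u) module \<Rightarrow> 'u set \<Rightarrow> 'u \<Rightarrow> 'u" where
  "coset_rep Y I y = (SOME z. z \<in> carrier Y \<and> z \<ominus>\<^bsub>Y\<^esub> y \<in> I)"

definition quot_mod :: "('k, 'u) module \<Rightarrow> 'u set \<Rightarrow> ('k, 'u) module" where
  "quot_mod Y I = \<lparr>carrier = coset_rep Y I ` carrier Y, monoid.mult = (\<lambda>_ _. \<zero>\<^bsub>Y\<^esub>), one = \<zero>\<^bsub>Y\<^esub>,
     zero = coset_rep Y I \<zero>\<^bsub>Y\<^esub>, add = (\<lambda>a b. coset_rep Y I (a \<oplus>\<^bsub>Y\<^esub> b)),
     smult = (\<lambda>c a. coset_rep Y I (c \<odot>\<^bsub>Y\<^esub> a))\<rparr>"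

context
  fixes K :: "('k, 'z) ring_scheme" and Y :: "('k, 'u) module" and I
  assumes Y: "vectorspace K Y" and I: "submodule K I Y"
begin

interpretation Y: vectorspace K Y by (rule Y)
interpretation I: submodule K I Y by (rule I)

lemma diff_in_trans:
  assumes "x \<in> carrier Y" "y \<in> carrier Y" "z \<in> carrier Y" "x \<ominus>\<^bsub>Y\<^esub> y \<in> I" "y \<ominus>\<^bsub>Y\<^esub> z \<in> I"
  shows "x \<ominus>\<^bsub>Y\<^esub> z \<in> I"
proof -
  show ?thesis using I.m_closed[OF assms(4,5)] unfolding Y.M.minus_add_minus[OF assms(1-3)] .
qed

lemma diff_in_sym:
  assumes "x \<in> carrier Y" "y \<in> carrier Y" "x \<ominus>\<^bsub>Y\<^esub> y \<in> I" shows "y \<ominus>\<^bsub>Y\<^esub> x \<in> I"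
proof -
  have "(\<ominus>\<^bsub>K\<^esub> \<one>\<^bsub>K\<^esub>) \<odot>\<^bsub>Y\<^esub> (x \<ominus>\<^bsub>Y\<^esub> y) = \<ominus>\<^bsub>Y\<^esub> (x \<ominus>\<^bsub>Y\<^esub> y)"
    using assms(1,2) by (intro Y.module.smult_minus_1) simp
  also have "\<dots> = y \<ominus>\<^bsub>Y\<^esub> x" by (rule Y.M.minus_swap[OF assms(1,2)])
  finally show ?thesis using I.smult_closed[OF _ assms(3), of "\<ominus>\<^bsub>K\<^esub> \<one>\<^bsub>K\<^esub>"] by simp
qed

lemma coset_rep:
  assumes "y \<in> carrier Y" shows "coset_rep Y I y \<in> carrier Y" "coset_rep Y I y \<ominus>\<^bsub>Y\<^esub> y \<in> I"
proof -
  have "y \<ominus>\<^bsub>Y\<^esub> y \<in> I" using assms by (simp add: Y.M.minus_eq Y.M.r_neg)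
  then have "coset_rep Y I y \<in> carrier Y \<and> coset_rep Y I y \<ominus>\<^bsub>Y\<^esub> y \<in> I"
    unfolding coset_rep_def using assms
    by (intro someI[of "\<lambda>z. z \<in> carrier Y \<and> z \<ominus>\<^bsub>Y\<^esub> y \<in> I" y] conjI)
  then show "coset_rep Y I y \<in> carrier Y" "coset_rep Y I y \<ominus>\<^bsub>Y\<^esub> y \<in> I" by auto
qed

lemma coset_rep_eq_iff:
  assumes x: "x \<in> carrier Y" and y: "y \<in> carrier Y"
  shows "coset_rep Y I x = coset_rep Y I y \<longleftrightarrow> x \<ominus>\<^bsub>Y\<^esub> y \<in> I"
proof
  assume "coset_rep Y I x = coset_rep Y I y"
  then have xy: "coset_rep Y I x \<ominus>\<^bsub>Y\<^esub> y \<in> I" using coset_rep(2)[OF y] by simp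
  show "x \<ominus>\<^bsub>Y\<^esub> y \<in> I"
    by (rule diff_in_trans[OF x coset_rep(1)[OF x] y diff_in_sym[OF coset_rep(1)[OF x] x coset_rep(2)[OF x]] xy])
next
  assume xy: "x \<ominus>\<^bsub>Y\<^esub> y \<in> I"
  have "(z \<ominus>\<^bsub>Y\<^esub> x \<in> I) = (z \<ominus>\<^bsub>Y\<^esub> y \<in> I)" if "z \<in> carrier Y" for z
    by (rule iffI) (erule diff_in_trans[OF that x y _ xy], erule diff_in_trans[OF that y x _ diff_in_sym[OF x y xy]])
  \<comment> \<open>The defining predicates of the two representatives coincide, so the choice
    operator returns the same element for both.\<close>
  then have "(\<lambda>z. z \<in> carrier Y \<and> z \<ominus>\<^bsub>Y\<^esub> x \<in> I) = (\<lambda>z. z \<in> carrier Y \<and> z \<ominus>\<^bsub>Y\<^esub> y \<in> I)"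
    by (intro ext conj_cong refl)
  then show "coset_rep Y I x = coset_rep Y I y" unfolding coset_rep_def by (rule arg_cong)
qed

lemma coset_rep_add:
  assumes "x \<in> carrier Y" "y \<in> carrier Y"
  shows "coset_rep Y I (coset_rep Y I x \<oplus>\<^bsub>Y\<^esub> coset_rep Y I y) = coset_rep Y I (x \<oplus>\<^bsub>Y\<^esub> y)"
proof -
  let ?x = "coset_rep Y I x" and ?y = "coset_rep Y I y"
  have c: "?x \<in> carrier Y" "?y \<in> carrier Y" using assms by (simp_all only: coset_rep)
  have "(?x \<oplus>\<^bsub>Y\<^esub> ?y) \<ominus>\<^bsub>Y\<^esub> (x \<oplus>\<^bsub>Y\<^esub> y) = (?x \<ominus>\<^bsub>Y\<^esub> x) \<oplus>\<^bsub>Y\<^esub> (?y \<ominus>\<^bsub>Y\<^esub> y)"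
    by (rule Y.M.add_minus_add[OF assms c])
  also have "\<dots> \<in> I" by (intro I.m_closed coset_rep(2) assms)
  finally show ?thesis
    by (subst coset_rep_eq_iff[OF Y.M.a_closed[OF c] Y.M.a_closed[OF assms]])
qed

lemma coset_rep_smult:
  assumes "a \<in> carrier K" "y \<in> carrier Y"
  shows "coset_rep Y I (a \<odot>\<^bsub>Y\<^esub> coset_rep Y I y) = coset_rep Y I (a \<odot>\<^bsub>Y\<^esub> y)"
proof -
  let ?y = "coset_rep Y I y"
  have c: "?y \<in> carrier Y" using assms by (simp only: coset_rep)
  have "a \<odot>\<^bsub>Y\<^esub> ?y \<ominus>\<^bsub>Y\<^esub> a \<odot>\<^bsub>Y\<^esub> y = a \<odot>\<^bsub>Y\<^esub> (?y \<ominus>\<^bsub>Y\<^esub> y)"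
    unfolding Y.M.minus_eq using assms c by (simp only: Y.smult_r_distr Y.smult_r_minus Y.M.a_inv_closed)
  also have "\<dots> \<in> I" by (intro I.smult_closed coset_rep(2) assms)
  finally show ?thesis
    by (subst coset_rep_eq_iff[OF Y.smult_closed[OF assms(1) c] Y.smult_closed[OF assms]])
qed

lemma quot_mod_vectorspace: "vectorspace K (quot_mod Y I)"
  by (rule vectorspace_surj_image[OF Y, where h = "coset_rep Y I"])
    (simp_all add: quot_mod_def coset_rep_add coset_rep_smult)

lemma coset_rep_mor: "(\<lambda>y\<in>carrier Y. coset_rep Y I y) \<in> mor (Vect K) Y (quot_mod Y I)"
  by (rule Vect_morI) (simp_all add: quot_mod_def coset_rep_add coset_rep_smult)

lemma coset_rep_eq_zero: "y \<in> carrier Y \<Longrightarrow> coset_rep Y I y = \<zero>\<^bsub>quot_mod Y I\<^esub> \<longleftrightarrow> y \<in> I"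
proof -
  assume y: "y \<in> carrier Y"
  have "\<ominus>\<^bsub>Y\<^esub> \<zero>\<^bsub>Y\<^esub> = \<zero>\<^bsub>Y\<^esub>" by (rule Y.M.minus_equality) simp_all
  then have "y \<ominus>\<^bsub>Y\<^esub> \<zero>\<^bsub>Y\<^esub> = y" using y by (simp add: Y.M.minus_eq)
  then show ?thesis using coset_rep_eq_iff[OF y Y.M.zero_closed] by (simp add: quot_mod_def)
qed

lemma quot_mod_fin_dim: "vectorspace.fin_dim K Y \<Longrightarrow> vectorspace.fin_dim K (quot_mod Y I)"
  by (rule fin_dim_surj_image[OF Y quot_mod_vectorspace coset_rep_mor]) (simp_all add: quot_mod_def)

end

lemma image_submodule:
  assumes X: "vectorspace K X" and Y: "vectorspace K Y" and f: "f \<in> mor (Vect K) X Y"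
  shows "submodule K (f ` carrier X) Y"
proof -
  interpret X: vectorspace K X by (rule X)
  interpret Y: vectorspace K Y by (rule Y)
  interpret mod_hom K X Y f by unfold_locales (use f in \<open>simp add: Vect_mor\<close>)
  show ?thesis using im_is_submodule unfolding im_def .
qed

text \<open>Pairs are not elements of the universe; \<open>\<phi>\<close>, when injective, moves the
  direct sum into it. The multiplicative fields of the record are filled arbitrarily.\<close>

definition sum_mod :: "('u \<times> 'u \<Rightarrow> 'u) \<Rightarrow> ('k, 'u) module \<Rightarrow> ('k, 'u) module \<Rightarrow> ('k, 'u) module" where
  "sum_mod \<phi> V W = (let D = direct_sum V W; g = inv_into UNIV \<phi> in
     \<lparr>carrier = \<phi> ` carrier D, monoid.mult = (\<lambda>_ _. \<phi> \<zero>\<^bsub>D\<^esub>), one = \<phi> \<zero>\<^bsub>D\<^esub>, zero = \<phi> \<zero>\<^bsub>D\<^esub>,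
       add = (\<lambda>a b. \<phi> (g a \<oplus>\<^bsub>D\<^esub> g b)), smult = (\<lambda>c a. \<phi> (c \<odot>\<^bsub>D\<^esub> g a))\<rparr>)"

lemma sum_mod_simps:
  assumes "inj \<phi>"
  shows "carrier (sum_mod \<phi> V W) = \<phi> ` (carrier V \<times> carrier W)"
    "\<zero>\<^bsub>sum_mod \<phi> V W\<^esub> = \<phi> (\<zero>\<^bsub>V\<^esub>, \<zero>\<^bsub>W\<^esub>)"
    "\<phi> (v, w) \<oplus>\<^bsub>sum_mod \<phi> V W\<^esub> \<phi> (v', w') = \<phi> (v \<oplus>\<^bsub>V\<^esub> v', w \<oplus>\<^bsub>W\<^esub> w')"
    "c \<odot>\<^bsub>sum_mod \<phi> V W\<^esub> \<phi> (v, w) = \<phi> (c \<odot>\<^bsub>V\<^esub> v, c \<odot>\<^bsub>W\<^esub> w)"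
  using assms by (simp_all add: sum_mod_def direct_sum_def Let_def)

lemma sum_mod_vectorspace:
  assumes \<phi>: "inj \<phi>" and V: "vectorspace K V" and W: "vectorspace K W"
  shows "vectorspace K (sum_mod \<phi> V W)"
  by (rule vectorspace_surj_image[OF direct_sum_is_vs[OF V W], where h = \<phi>])
    (auto simp: sum_mod_simps[OF \<phi>] direct_sum_def)

text \<open>The images of generators of both summands generate: the preimage of a submodule
  \<open>N\<close> under either inclusion is a submodule containing the respective generators, hence
  everything, and \<open>N\<close> is closed under sums.\<close>

lemma sum_mod_fin_dim:
  assumes \<phi>: "inj \<phi>" and V: "vectorspace K V" and W: "vectorspace K W"
    and fV: "vectorspace.fin_dim K V" and fW: "vectorspace.fin_dim K W"
  shows "vectorspace.fin_dim K (sum_mod \<phi> V W)"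
proof -
  let ?S = "sum_mod \<phi> V W"
  have S: "vectorspace K ?S" by (rule sum_mod_vectorspace[OF \<phi> V W])
  interpret V: module K V by (rule vectorspace_module[OF V])
  interpret W: module K W by (rule vectorspace_module[OF W])
  obtain A where A: "finite A" "A \<subseteq> carrier V" "\<And>N. submodule K N V \<Longrightarrow> A \<subseteq> N \<Longrightarrow> carrier V \<subseteq> N"
    using fV unfolding fin_dim_iff[OF V] by blast
  obtain B where B: "finite B" "B \<subseteq> carrier W" "\<And>N. submodule K N W \<Longrightarrow> B \<subseteq> N \<Longrightarrow> carrier W \<subseteq> N"
    using fW unfolding fin_dim_iff[OF W] by blast
  let ?G = "(\<lambda>v. \<phi> (v, \<zero>\<^bsub>W\<^esub>)) ` A \<union> (\<lambda>w. \<phi> (\<zero>\<^bsub>V\<^esub>, w)) ` B"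
  show ?thesis
    unfolding fin_dim_iff[OF S]
  proof (intro exI[of _ ?G] conjI allI impI)
    show "finite ?G" using A B by simp
    show "?G \<subseteq> carrier ?S" using A(2) B(2) by (auto simp: sum_mod_simps[OF \<phi>])
    fix N assume N: "submodule K N ?S" "?G \<subseteq> N"
    interpret N: submodule K N ?S by (rule N(1))
    have "submodule K {v \<in> carrier V. \<phi> (v, \<zero>\<^bsub>W\<^esub>) \<in> N} V"
    proof unfold_locales
      show "\<zero>\<^bsub>V\<^esub> \<in> {v \<in> carrier V. \<phi> (v, \<zero>\<^bsub>W\<^esub>) \<in> N}"
        using N.zero_closed by (simp add: sum_mod_simps[OF \<phi>])
      show "v \<oplus>\<^bsub>V\<^esub> w \<in> {v \<in> carrier V. \<phi> (v, \<zero>\<^bsub>W\<^esub>) \<in> N}"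
        if "v \<in> {v \<in> carrier V. \<phi> (v, \<zero>\<^bsub>W\<^esub>) \<in> N}" "w \<in> {v \<in> carrier V. \<phi> (v, \<zero>\<^bsub>W\<^esub>) \<in> N}" for v w
        using that N.m_closed[of "\<phi> (v, \<zero>\<^bsub>W\<^esub>)" "\<phi> (w, \<zero>\<^bsub>W\<^esub>)"] by (simp add: sum_mod_simps[OF \<phi>])
      show "c \<odot>\<^bsub>V\<^esub> v \<in> {v \<in> carrier V. \<phi> (v, \<zero>\<^bsub>W\<^esub>) \<in> N}"
        if "c \<in> carrier K" "v \<in> {v \<in> carrier V. \<phi> (v, \<zero>\<^bsub>W\<^esub>) \<in> N}" for c v
        using that N.smult_closed[of c "\<phi> (v, \<zero>\<^bsub>W\<^esub>)"] by (simp add: sum_mod_simps[OF \<phi>])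
    qed (auto simp: vectorspace_module[OF V])
    moreover have "A \<subseteq> {v \<in> carrier V. \<phi> (v, \<zero>\<^bsub>W\<^esub>) \<in> N}" using N(2) A(2) by blast
    ultimately have "carrier V \<subseteq> {v \<in> carrier V. \<phi> (v, \<zero>\<^bsub>W\<^esub>) \<in> N}" by (rule A(3))
    then have VN: "\<phi> (v, \<zero>\<^bsub>W\<^esub>) \<in> N" if "v \<in> carrier V" for v using that by blast
    have "submodule K {w \<in> carrier W. \<phi> (\<zero>\<^bsub>V\<^esub>, w) \<in> N} W"
    proof unfold_locales
      show "\<zero>\<^bsub>W\<^esub> \<in> {w \<in> carrier W. \<phi> (\<zero>\<^bsub>V\<^esub>, w) \<in> N}"
        using N.zero_closed by (simp add: sum_mod_simps[OF \<phi>])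
      show "v \<oplus>\<^bsub>W\<^esub> w \<in> {w \<in> carrier W. \<phi> (\<zero>\<^bsub>V\<^esub>, w) \<in> N}"
        if "v \<in> {w \<in> carrier W. \<phi> (\<zero>\<^bsub>V\<^esub>, w) \<in> N}" "w \<in> {w \<in> carrier W. \<phi> (\<zero>\<^bsub>V\<^esub>, w) \<in> N}" for v w
        using that N.m_closed[of "\<phi> (\<zero>\<^bsub>V\<^esub>, v)" "\<phi> (\<zero>\<^bsub>V\<^esub>, w)"] by (simp add: sum_mod_simps[OF \<phi>])
      show "c \<odot>\<^bsub>W\<^esub> v \<in> {w \<in> carrier W. \<phi> (\<zero>\<^bsub>V\<^esub>, w) \<in> N}"
        if "c \<in> carrier K" "v \<in> {w \<in> carrier W. \<phi> (\<zero>\<^bsub>V\<^esub>, w) \<in> N}" for c v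
        using that N.smult_closed[of c "\<phi> (\<zero>\<^bsub>V\<^esub>, v)"] by (simp add: sum_mod_simps[OF \<phi>])
    qed (auto simp: vectorspace_module[OF W])
    moreover have "B \<subseteq> {w \<in> carrier W. \<phi> (\<zero>\<^bsub>V\<^esub>, w) \<in> N}" using N(2) B(2) by blast
    ultimately have "carrier W \<subseteq> {w \<in> carrier W. \<phi> (\<zero>\<^bsub>V\<^esub>, w) \<in> N}" by (rule B(3))
    then have WN: "\<phi> (\<zero>\<^bsub>V\<^esub>, w) \<in> N" if "w \<in> carrier W" for w using that by blast
    have "\<phi> (v, w) \<in> N" if vw: "v \<in> carrier V" "w \<in> carrier W" for v w
      using N.m_closed[OF VN[OF vw(1)] WN[OF vw(2)]] vw by (simp add: sum_mod_simps[OF \<phi>])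
    then show "carrier ?S \<subseteq> N" by (auto simp: sum_mod_simps[OF \<phi>])
  qed
qed

definition zero_mod :: "('k, 'u) module" where
  "zero_mod = \<lparr>carrier = {undefined}, monoid.mult = (\<lambda>_ _. undefined), one = undefined, zero = undefined,
     add = (\<lambda>_ _. undefined), smult = (\<lambda>_ _. undefined)\<rparr>"

lemma zero_mod_vectorspace: "field K \<Longrightarrow> vectorspace K zero_mod"
  by (rule vs_criteria) (simp_all add: zero_mod_def)

lemma zero_mod_fin_dim: "field K \<Longrightarrow> vectorspace.fin_dim K zero_mod"
  unfolding fin_dim_iff[OF zero_mod_vectorspace]
  by (intro exI[of _ "carrier zero_mod"]) (simp add: zero_mod_def)

text \<open>The induced map is the pointwise inverse of \<open>k\<close> applied to
  \<open>g\<close>; injectivity of \<open>k\<close> yields both its linearity and its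
  uniqueness.\<close>

lemma is_kernel_Vect:
  assumes V: "vectorspace K V" and W: "vectorspace K W" and N: "vectorspace K N"
    and f: "f \<in> mor (Vect K) V W" and k: "k \<in> mor (Vect K) N V"
    and inj: "inj_on k (carrier N)" and im: "k ` carrier N = {v \<in> carrier V. f v = \<zero>\<^bsub>W\<^esub>}"
  shows "is_kernel (Vect K) V W f N k"
  unfolding is_kernel_def
proof (intro conjI ballI impI)
  show "N \<in> ob (Vect K)" "k \<in> mor (Vect K) N V" using N k by (simp_all add: Vect_ob)
  have fk: "f (k x) = \<zero>\<^bsub>W\<^esub>" if "x \<in> carrier N" for x using im that by blast
  show "cmp (Vect K) N V W f k = zerom (Vect K) N W"
    unfolding Vect_cmp Vect_zerom using fk by (intro restrict_ext)
  fix U g assume U: "U \<in> ob (Vect K)" and g: "g \<in> mor (Vect K) U V"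
    and fg: "cmp (Vect K) U V W f g = zerom (Vect K) U W"
  have U: "vectorspace K U" using U by (simp add: Vect_ob)
  have "g x \<in> k ` carrier N" if x: "x \<in> carrier U" for x
  proof -
    have "f (g x) = \<zero>\<^bsub>W\<^esub>" using fun_cong[OF fg, of x] x by (simp add: Vect_cmp Vect_zerom)
    then show ?thesis unfolding im using Vect_mor_closed[OF g x] by simp
  qed
  then have hx: "inv_into (carrier N) k (g x) \<in> carrier N" "k (inv_into (carrier N) k (g x)) = g x"
    if "x \<in> carrier U" for x using that by (simp_all add: inv_into_into f_inv_into_f)
  define h where "h = (\<lambda>x\<in>carrier U. inv_into (carrier N) k (g x))"
  have h: "h x \<in> carrier N" "k (h x) = g x" if "x \<in> carrier U" for x
    unfolding h_def using hx that by simp_all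
  have h_mor: "h \<in> mor (Vect K) U N"
  proof (rule Vect_morI)
    fix v w assume vw: "v \<in> carrier U" "w \<in> carrier U"
    show "h (v \<oplus>\<^bsub>U\<^esub> w) = h v \<oplus>\<^bsub>N\<^esub> h w"
      by (rule inj_onD[OF inj])
        (simp_all add: h vw vectorspace_closed[OF U] vectorspace_closed[OF N] Vect_mor_add[OF k] Vect_mor_add[OF g])
  next
    fix c v assume cv: "c \<in> carrier K" "v \<in> carrier U"
    show "h (c \<odot>\<^bsub>U\<^esub> v) = c \<odot>\<^bsub>N\<^esub> h v"
      by (rule inj_onD[OF inj])
        (simp_all add: h cv vectorspace_closed[OF U] vectorspace_closed[OF N] Vect_mor_smult[OF k] Vect_mor_smult[OF g])
  next
    show "h \<in> extensional (carrier U)" unfolding h_def by simp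
  qed (rule h(1))
  show "\<exists>!h. h \<in> mor (Vect K) U N \<and> cmp (Vect K) U N V k h = g"
  proof (rule ex1I[of _ h], intro conjI h_mor)
    show "cmp (Vect K) U N V k h = g"
      by (rule extensionalityI[of _ "carrier U"]) (simp_all add: Vect_cmp h Vect_mor_ext[OF g])
    fix h' assume h': "h' \<in> mor (Vect K) U N \<and> cmp (Vect K) U N V k h' = g"
    show "h' = h"
    proof (rule Vect_mor_eqI[OF conjunct1[OF h'] h_mor])
      fix x assume x: "x \<in> carrier U"
      have "k (h' x) = g x" using fun_cong[OF conjunct2[OF h'], of x] x by (simp add: Vect_cmp)
      then show "h' x = h x"
        using h[OF x] Vect_mor_closed[OF conjunct1[OF h'] x] by (intro inj_onD[OF inj, of "h' x" "h x"]) simp_all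
    qed
  qed
qed

text \<open>The induced map evaluates \<open>g\<close> at any preimage under \<open>c\<close>. This
  is well defined, since two preimages differ by an element of the image of \<open>f\<close>, where
  \<open>g\<close> vanishes.\<close>

lemma is_cokernel_Vect:
  assumes V: "vectorspace K V" and W: "vectorspace K W" and Q: "vectorspace K Q"
    and f: "f \<in> mor (Vect K) V W" and c: "c \<in> mor (Vect K) W Q"
    and surj: "c ` carrier W = carrier Q" and ker: "{w \<in> carrier W. c w = \<zero>\<^bsub>Q\<^esub>} = f ` carrier V"
  shows "is_cokernel (Vect K) V W f Q c"
  unfolding is_cokernel_def
proof (intro conjI ballI impI)
  show "Q \<in> ob (Vect K)" "c \<in> mor (Vect K) W Q" using Q c by (simp_all add: Vect_ob)
  have cf: "c (f x) = \<zero>\<^bsub>Q\<^esub>" if "x \<in> carrier V" for x using ker that by blast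
  show "cmp (Vect K) V W Q c f = zerom (Vect K) V Q"
    unfolding Vect_cmp Vect_zerom using cf by (intro restrict_ext)
  fix U g assume U: "U \<in> ob (Vect K)" and g: "g \<in> mor (Vect K) W U"
    and gf: "cmp (Vect K) V W U g f = zerom (Vect K) V U"
  have U: "vectorspace K U" using U by (simp add: Vect_ob)
  interpret Q: module K Q by (rule vectorspace_module[OF Q])
  interpret U: module K U by (rule vectorspace_module[OF U])
  have eq: "g w = g w'" if w: "w \<in> carrier W" "w' \<in> carrier W" "c w = c w'" for w w'
  proof -
    have "c (w \<ominus>\<^bsub>W\<^esub> w') = \<zero>\<^bsub>Q\<^esub>"
      using w Vect_mor_minus[OF W Q c w(1,2)] Vect_mor_closed[OF c w(2)] by (simp add: Q.M.minus_eq Q.M.r_neg)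
    then have "w \<ominus>\<^bsub>W\<^esub> w' \<in> f ` carrier V" using ker vectorspace_closed(5)[OF W w(1,2)] by blast
    then obtain v where v: "v \<in> carrier V" "w \<ominus>\<^bsub>W\<^esub> w' = f v" by blast
    have "g (f v) = \<zero>\<^bsub>U\<^esub>" using fun_cong[OF gf, of v] v by (simp add: Vect_cmp Vect_zerom)
    then have "g w \<ominus>\<^bsub>U\<^esub> g w' = \<zero>\<^bsub>U\<^esub>" using Vect_mor_minus[OF W U g w(1,2)] v(2) by simp
    then have "\<ominus>\<^bsub>U\<^esub> (\<ominus>\<^bsub>U\<^esub> g w') = g w"
      unfolding U.M.minus_eq by (rule U.M.minus_equality) (simp_all add: Vect_mor_closed[OF g] w(1,2))
    then show ?thesis by (simp add: Vect_mor_closed[OF g] w(2))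
  qed
  define h where "h = (\<lambda>q\<in>carrier Q. g (inv_into (carrier W) c q))"
  have h: "h (c w) = g w" if w: "w \<in> carrier W" for w
  proof -
    have cw: "c w \<in> c ` carrier W" using w by simp
    then have "c w \<in> carrier Q" using surj by simp
    then have "h (c w) = g (inv_into (carrier W) c (c w))" by (simp add: h_def)
    also have "\<dots> = g w" by (rule eq[OF inv_into_into[OF cw] w f_inv_into_f[OF cw]])
    finally show ?thesis .
  qed
  have Q_cases: "\<exists>w\<in>carrier W. q = c w" if "q \<in> carrier Q" for q using surj that by blast
  have h_mor: "h \<in> mor (Vect K) Q U"
  proof (rule Vect_morI)
    fix q assume "q \<in> carrier Q"
    then obtain w where "w \<in> carrier W" "q = c w" using Q_cases by blast
    then show "h q \<in> carrier U" by (simp add: h Vect_mor_closed[OF g])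
  next
    fix p q assume "p \<in> carrier Q" "q \<in> carrier Q"
    then obtain v w where "v \<in> carrier W" "p = c v" "w \<in> carrier W" "q = c w" using Q_cases by blast
    then show "h (p \<oplus>\<^bsub>Q\<^esub> q) = h p \<oplus>\<^bsub>U\<^esub> h q"
      by (simp add: h Vect_mor_add[OF c, symmetric] Vect_mor_add[OF g] vectorspace_closed[OF W])
  next
    fix a q assume "a \<in> carrier K" "q \<in> carrier Q"
    then obtain w where "w \<in> carrier W" "q = c w" "a \<in> carrier K" using Q_cases by blast
    then show "h (a \<odot>\<^bsub>Q\<^esub> q) = a \<odot>\<^bsub>U\<^esub> h q"
      by (simp add: h Vect_mor_smult[OF c, symmetric] Vect_mor_smult[OF g] vectorspace_closed[OF W])
  qed (simp add: h_def)
  show "\<exists>!h. h \<in> mor (Vect K) Q U \<and> cmp (Vect K) W Q U h c = g"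
  proof (rule ex1I[of _ h], intro conjI h_mor)
    show "cmp (Vect K) W Q U h c = g"
      by (rule extensionalityI[of _ "carrier W"]) (simp_all add: Vect_cmp h Vect_mor_ext[OF g])
    fix h' assume h': "h' \<in> mor (Vect K) Q U \<and> cmp (Vect K) W Q U h' c = g"
    show "h' = h"
    proof (rule Vect_mor_eqI[OF conjunct1[OF h'] h_mor])
      fix q assume "q \<in> carrier Q"
      then obtain w where w: "w \<in> carrier W" "q = c w" using Q_cases by blast
      have "h' (c w) = g w" using fun_cong[OF conjunct2[OF h'], of w] w by (simp add: Vect_cmp)
      then show "h' q = h q" using h w by simp
    qed
  qed
qed

section \<open>Functor categories\<close>

locale diagrams = preadditive_category C for C :: "('o, 'm) cat" +
  fixes P :: "'p set" and r :: "'p rel"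
  assumes rP: "r \<subseteq> P \<times> P"
begin

abbreviation FC :: "(('p, 'o, 'm) diagram, 'p \<Rightarrow> 'm) cat" where "FC \<equiv> functor_cat P r C"

lemma r_in: "(p, q) \<in> r \<Longrightarrow> p \<in> P" "(p, q) \<in> r \<Longrightarrow> q \<in> P"
  using rP by auto

lemma ob_at: "F \<in> ob FC \<Longrightarrow> p \<in> P \<Longrightarrow> obj_at F p \<in> ob C"
  and map_mor: "F \<in> ob FC \<Longrightarrow> (p, q) \<in> r \<Longrightarrow> map_at F p q \<in> mor C (obj_at F p) (obj_at F q)"
  and map_id: "F \<in> ob FC \<Longrightarrow> p \<in> P \<Longrightarrow> map_at F p p = idm C (obj_at F p)"
  by (auto simp: functor_cat_def)

lemma map_comp: "F \<in> ob FC \<Longrightarrow> (p, q) \<in> r \<Longrightarrow> (q, s) \<in> r \<Longrightarrow> map_at F p s =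
    cmp C (obj_at F p) (obj_at F q) (obj_at F s) (map_at F q s) (map_at F p q)"
  by (simp add: functor_cat_def)

lemma obI:
  assumes "\<And>p. p \<in> P \<Longrightarrow> obj_at F p \<in> ob C"
    and "\<And>p q. (p, q) \<in> r \<Longrightarrow> map_at F p q \<in> mor C (obj_at F p) (obj_at F q)"
    and "\<And>p. p \<in> P \<Longrightarrow> map_at F p p = idm C (obj_at F p)"
    and "\<And>p q s. (p, q) \<in> r \<Longrightarrow> (q, s) \<in> r \<Longrightarrow> map_at F p s =
      cmp C (obj_at F p) (obj_at F q) (obj_at F s) (map_at F q s) (map_at F p q)"
  shows "F \<in> ob FC"
  using assms by (auto simp: functor_cat_def)

lemma mor_at: "\<eta> \<in> mor FC F G \<Longrightarrow> p \<in> P \<Longrightarrow> \<eta> p \<in> mor C (obj_at F p) (obj_at G p)"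
  and mor_ext: "\<eta> \<in> mor FC F G \<Longrightarrow> \<eta> \<in> extensional P"
  by (auto simp: functor_cat_def PiE_def)

lemma mor_nat: "\<eta> \<in> mor FC F G \<Longrightarrow> (p, q) \<in> r \<Longrightarrow>
    cmp C (obj_at F p) (obj_at F q) (obj_at G q) (\<eta> q) (map_at F p q) =
    cmp C (obj_at F p) (obj_at G p) (obj_at G q) (map_at G p q) (\<eta> p)"
  by (auto simp: functor_cat_def)

lemma morI:
  assumes "\<And>p. p \<in> P \<Longrightarrow> \<eta> p \<in> mor C (obj_at F p) (obj_at G p)" and "\<eta> \<in> extensional P"
    and "\<And>p q. (p, q) \<in> r \<Longrightarrow> cmp C (obj_at F p) (obj_at F q) (obj_at G q) (\<eta> q) (map_at F p q) =
      cmp C (obj_at F p) (obj_at G p) (obj_at G q) (map_at G p q) (\<eta> p)"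
  shows "\<eta> \<in> mor FC F G"
  using assms by (auto simp: functor_cat_def PiE_def)

lemma mor_eqI: "\<eta> \<in> mor FC F G \<Longrightarrow> \<theta> \<in> mor FC F G' \<Longrightarrow> (\<And>p. p \<in> P \<Longrightarrow> \<eta> p = \<theta> p) \<Longrightarrow> \<eta> = \<theta>"
  by (rule extensionalityI[of _ P]) (auto dest: mor_ext)

lemma FC_simps:
  "cmp FC F G H \<theta> \<eta> = (\<lambda>p\<in>P. cmp C (obj_at F p) (obj_at G p) (obj_at H p) (\<theta> p) (\<eta> p))"
  "idm FC F = (\<lambda>p\<in>P. idm C (obj_at F p))"
  "zerom FC F G = (\<lambda>p\<in>P. zerom C (obj_at F p) (obj_at G p))"
  "addm FC F G \<eta> \<theta> = (\<lambda>p\<in>P. addm C (obj_at F p) (obj_at G p) (\<eta> p) (\<theta> p))"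
  by (simp_all add: functor_cat_def)

lemma preadditive_FC: "preadditive FC"
  unfolding preadditive_def Defs.category_def
proof (intro conjI ballI)
  fix F assume F: "F \<in> ob FC"
  show "idm FC F \<in> mor FC F F"
  proof (rule morI)
    fix p q assume pq: "(p, q) \<in> r"
    then show "cmp C (obj_at F p) (obj_at F q) (obj_at F q) (idm FC F q) (map_at F p q) =
        cmp C (obj_at F p) (obj_at F p) (obj_at F q) (map_at F p q) (idm FC F p)"
      using F r_in[OF pq] by (simp add: FC_simps id_comp comp_id ob_at map_mor)
  qed (use F in \<open>simp_all add: FC_simps ob_at id_mor\<close>)
next
  fix F G H \<eta> \<theta>
  assume ob: "F \<in> ob FC" "G \<in> ob FC" "H \<in> ob FC" and \<eta>: "\<eta> \<in> mor FC F G" and \<theta>: "\<theta> \<in> mor FC G H"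
  show "cmp FC F G H \<theta> \<eta> \<in> mor FC F H"
  proof (rule morI)
    fix p q assume pq: "(p, q) \<in> r"
    note [simp] = r_in[OF pq] ob_at[OF ob(1)] ob_at[OF ob(2)] ob_at[OF ob(3)] mor_at[OF \<eta>] mor_at[OF \<theta>]
      map_mor[OF ob(1) pq] map_mor[OF ob(2) pq] map_mor[OF ob(3) pq]
    let ?F = "obj_at F" and ?G = "obj_at G" and ?H = "obj_at H"
    have "cmp C (?F p) (?F q) (?H q) (cmp C (?F q) (?G q) (?H q) (\<theta> q) (\<eta> q)) (map_at F p q) =
        cmp C (?F p) (?G q) (?H q) (\<theta> q) (cmp C (?F p) (?F q) (?G q) (\<eta> q) (map_at F p q))"
      by (rule assoc[symmetric]) simp_all
    also have "\<dots> = cmp C (?F p) (?G q) (?H q) (\<theta> q) (cmp C (?F p) (?G p) (?G q) (map_at G p q) (\<eta> p))"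
      by (simp only: mor_nat[OF \<eta> pq])
    also have "\<dots> = cmp C (?F p) (?G p) (?H q) (cmp C (?G p) (?G q) (?H q) (\<theta> q) (map_at G p q)) (\<eta> p)"
      by (rule assoc) simp_all
    also have "\<dots> = cmp C (?F p) (?G p) (?H q) (cmp C (?G p) (?H p) (?H q) (map_at H p q) (\<theta> p)) (\<eta> p)"
      by (simp only: mor_nat[OF \<theta> pq])
    also have "\<dots> = cmp C (?F p) (?H p) (?H q) (map_at H p q) (cmp C (?F p) (?G p) (?H p) (\<theta> p) (\<eta> p))"
      by (rule assoc[symmetric]) simp_all
    finally show "cmp C (?F p) (?F q) (?H q) (cmp FC F G H \<theta> \<eta> q) (map_at F p q) =
        cmp C (?F p) (?H p) (?H q) (map_at H p q) (cmp FC F G H \<theta> \<eta> p)"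
      by (simp add: FC_simps)
  qed (use ob \<eta> \<theta> in \<open>simp_all add: FC_simps ob_at mor_at comp_mor\<close>)
next
  fix F G \<eta> assume ob: "F \<in> ob FC" "G \<in> ob FC" and \<eta>: "\<eta> \<in> mor FC F G"
  show "cmp FC F G G (idm FC G) \<eta> = \<eta>" "cmp FC F F G \<eta> (idm FC F) = \<eta>"
    by (rule extensionalityI[of _ P];
        use ob \<eta> mor_ext[OF \<eta>] in \<open>simp add: FC_simps ob_at mor_at id_comp comp_id\<close>)+
next
  fix E F G H \<eta> \<theta> \<kappa>
  assume "E \<in> ob FC" "F \<in> ob FC" "G \<in> ob FC" "H \<in> ob FC"
    "\<eta> \<in> mor FC E F" "\<theta> \<in> mor FC F G" "\<kappa> \<in> mor FC G H"
  then show "cmp FC E G H \<kappa> (cmp FC E F G \<theta> \<eta>) = cmp FC E F H (cmp FC F G H \<kappa> \<theta>) \<eta>"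
    unfolding FC_simps by (intro restrict_ext) (simp add: ob_at mor_at assoc)
next
  fix F G assume ob: "F \<in> ob FC" "G \<in> ob FC"
  let ?M = "mor FC F G" and ?F = "obj_at F" and ?G = "obj_at G"
  note [simp] = ob_at[OF ob(1)] ob_at[OF ob(2)] map_mor[OF ob(1)] map_mor[OF ob(2)] r_in
  have grp: "comm_group \<lparr>carrier = mor C (?F p) (?G p), monoid.mult = addm C (?F p) (?G p), one = zerom C (?F p) (?G p)\<rparr>"
    if "p \<in> P" for p using that by (intro hom_group) simp_all
  show "comm_group \<lparr>carrier = ?M, monoid.mult = addm FC F G, one = zerom FC F G\<rparr>"
  proof (rule comm_groupI; simp only: partial_object.simps monoid.simps)
    fix \<eta> \<theta> assume \<eta>: "\<eta> \<in> ?M" and \<theta>: "\<theta> \<in> ?M"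
    show "addm FC F G \<eta> \<theta> \<in> ?M"
    proof (rule morI)
      fix p q assume pq: "(p, q) \<in> r"
      then show "cmp C (?F p) (?F q) (?G q) (addm FC F G \<eta> \<theta> q) (map_at F p q) =
          cmp C (?F p) (?G p) (?G q) (map_at G p q) (addm FC F G \<eta> \<theta> p)"
        using mor_at[OF \<eta>] mor_at[OF \<theta>] r_in[OF pq]
        by (simp add: FC_simps comp_add add_comp mor_nat[OF \<eta> pq] mor_nat[OF \<theta> pq])
    qed (use mor_at[OF \<eta>] mor_at[OF \<theta>] in \<open>simp_all add: FC_simps add_mor\<close>)
    show "addm FC F G \<eta> \<theta> = addm FC F G \<theta> \<eta>"
      unfolding FC_simps
    proof (rule restrict_ext)
      fix p assume p: "p \<in> P"
      interpret G: comm_group "\<lparr>carrier = mor C (?F p) (?G p), monoid.mult = addm C (?F p) (?G p), one = zerom C (?F p) (?G p)\<rparr>"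
        by (rule grp[OF p])
      show "addm C (?F p) (?G p) (\<eta> p) (\<theta> p) = addm C (?F p) (?G p) (\<theta> p) (\<eta> p)"
        using G.m_comm[of "\<eta> p" "\<theta> p"] mor_at[OF \<eta> p] mor_at[OF \<theta> p] by simp
    qed
  next
    show "zerom FC F G \<in> ?M"
      by (rule morI) (simp_all add: FC_simps zero_mor comp_zero zero_comp)
  next
    fix \<eta> \<theta> \<kappa> assume \<eta>: "\<eta> \<in> ?M" and \<theta>: "\<theta> \<in> ?M" and \<kappa>: "\<kappa> \<in> ?M"
    show "addm FC F G (addm FC F G \<eta> \<theta>) \<kappa> = addm FC F G \<eta> (addm FC F G \<theta> \<kappa>)"
      unfolding FC_simps
    proof (rule restrict_ext)
      fix p assume p: "p \<in> P"
      interpret G: comm_group "\<lparr>carrier = mor C (?F p) (?G p), monoid.mult = addm C (?F p) (?G p), one = zerom C (?F p) (?G p)\<rparr>"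
        by (rule grp[OF p])
      show "addm C (?F p) (?G p) ((\<lambda>p\<in>P. addm C (?F p) (?G p) (\<eta> p) (\<theta> p)) p) (\<kappa> p) =
          addm C (?F p) (?G p) (\<eta> p) ((\<lambda>p\<in>P. addm C (?F p) (?G p) (\<theta> p) (\<kappa> p)) p)"
        using G.m_assoc[of "\<eta> p" "\<theta> p" "\<kappa> p"] mor_at[OF \<eta> p] mor_at[OF \<theta> p] mor_at[OF \<kappa> p] p by simp
    qed
  next
    fix \<eta> assume \<eta>: "\<eta> \<in> ?M"
    show "addm FC F G (zerom FC F G) \<eta> = \<eta>"
      by (rule extensionalityI[of _ P]) (simp_all add: FC_simps zero_add mor_at[OF \<eta>] mor_ext[OF \<eta>])
    have inv_ex: "\<exists>g\<in>mor C (?F p) (?G p). addm C (?F p) (?G p) g (\<eta> p) = zerom C (?F p) (?G p)" if p: "p \<in> P" for p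
    proof -
      interpret G: comm_group "\<lparr>carrier = mor C (?F p) (?G p), monoid.mult = addm C (?F p) (?G p), one = zerom C (?F p) (?G p)\<rparr>"
        by (rule grp[OF p])
      show ?thesis using G.l_inv_ex[of "\<eta> p"] mor_at[OF \<eta> p] by simp
    qed
    then obtain g where g: "\<And>p. p \<in> P \<Longrightarrow> g p \<in> mor C (?F p) (?G p)"
      "\<And>p. p \<in> P \<Longrightarrow> addm C (?F p) (?G p) (g p) (\<eta> p) = zerom C (?F p) (?G p)" by metis
    show "\<exists>\<theta>\<in>?M. addm FC F G \<theta> \<eta> = zerom FC F G"
    proof
      show "(\<lambda>p\<in>P. g p) \<in> ?M"
      proof (rule morI)
        fix p q assume pq: "(p, q) \<in> r"
        note [simp] = r_in[OF pq] mor_at[OF \<eta>] g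
        interpret G: comm_group "\<lparr>carrier = mor C (?F p) (?G q), monoid.mult = addm C (?F p) (?G q), one = zerom C (?F p) (?G q)\<rparr>"
          by (intro hom_group) simp_all
        let ?a = "cmp C (?F p) (?F q) (?G q) (g q) (map_at F p q)"
          and ?b = "cmp C (?F p) (?G p) (?G q) (map_at G p q) (g p)"
          and ?c = "cmp C (?F p) (?G p) (?G q) (map_at G p q) (\<eta> p)"
        have mem: "?a \<in> mor C (?F p) (?G q)" "?b \<in> mor C (?F p) (?G q)" "?c \<in> mor C (?F p) (?G q)"
          using pq by (simp_all add: comp_mor)
        \<comment> \<open>The inverses are chosen separately at each point. Both composites become
          zero when the same composite of \<open>\<eta>\<close> is added, so cancellation in the hom
          group gives naturality.\<close>
        have "addm C (?F p) (?G q) ?a ?c = zerom C (?F p) (?G q)"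
          using pq by (simp add: mor_nat[OF \<eta> pq, symmetric] add_comp[symmetric] zero_comp)
        moreover have "addm C (?F p) (?G q) ?b ?c = zerom C (?F p) (?G q)"
          using pq by (simp add: comp_add[symmetric] comp_zero)
        ultimately have "addm C (?F p) (?G q) ?a ?c = addm C (?F p) (?G q) ?b ?c" by simp
        then have "?a = ?b" using G.right_cancel[of ?c ?a ?b] mem by simp
        then show "cmp C (?F p) (?F q) (?G q) ((\<lambda>p\<in>P. g p) q) (map_at F p q) =
            cmp C (?F p) (?G p) (?G q) (map_at G p q) ((\<lambda>p\<in>P. g p) p)" by simp
      qed (simp_all add: g)
      show "addm FC F G (\<lambda>p\<in>P. g p) \<eta> = zerom FC F G"
        unfolding FC_simps by (rule restrict_ext) (simp add: g)
    qed
  qed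
next
  fix F G H \<eta> \<eta>' \<theta> \<theta>'
  assume h: "F \<in> ob FC" "G \<in> ob FC" "H \<in> ob FC" "\<eta> \<in> mor FC F G" "\<eta>' \<in> mor FC F G" "\<theta> \<in> mor FC G H" "\<theta>' \<in> mor FC G H"
  show "cmp FC F G H \<theta> (addm FC F G \<eta> \<eta>') = addm FC F H (cmp FC F G H \<theta> \<eta>) (cmp FC F G H \<theta> \<eta>')"
    "cmp FC F G H (addm FC G H \<theta> \<theta>') \<eta> = addm FC F H (cmp FC F G H \<theta> \<eta>) (cmp FC F G H \<theta>' \<eta>)"
    unfolding FC_simps by (rule restrict_ext; use h in \<open>simp add: ob_at mor_at comp_add add_comp\<close>)+
qed

text \<open>The factorizations at the single points form a natural transformation because both ways
  around a square agree after composition with the kernel map at \<open>q\<close>, so uniqueness of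
  the factorization at \<open>q\<close> applies.\<close>

lemma kernel_pointwise:
  assumes F: "F \<in> ob FC" and G: "G \<in> ob FC" and K: "K \<in> ob FC" and f: "f \<in> mor FC F G" and k: "k \<in> mor FC K F"
    and ker: "\<And>p. p \<in> P \<Longrightarrow> is_kernel C (obj_at F p) (obj_at G p) (f p) (obj_at K p) (k p)"
  shows "is_kernel FC F G f K k"
  unfolding is_kernel_def
proof (intro conjI ballI impI K k)
  have fk: "cmp C (obj_at K p) (obj_at F p) (obj_at G p) (f p) (k p) = zerom C (obj_at K p) (obj_at G p)" if "p \<in> P" for p
    using ker[OF that] unfolding is_kernel_def by simp
  show "cmp FC K F G f k = zerom FC K G" unfolding FC_simps using fk by (rule restrict_ext)
  fix W g assume W: "W \<in> ob FC" and g: "g \<in> mor FC W F" and fg: "cmp FC W F G f g = zerom FC W G"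
  let ?F = "obj_at F" and ?G = "obj_at G" and ?K = "obj_at K" and ?W = "obj_at W"
  note [simp] = ob_at[OF F] ob_at[OF G] ob_at[OF K] ob_at[OF W] mor_at[OF f] mor_at[OF g] mor_at[OF k]
  have fg': "cmp C (?W p) (?F p) (?G p) (f p) (g p) = zerom C (?W p) (?G p)" if "p \<in> P" for p
    using fun_cong[OF fg, of p] that by (simp add: FC_simps)
  have ex: "\<exists>!h. h \<in> mor C X (?K p) \<and> cmp C X (?K p) (?F p) (k p) h = u"
    if "p \<in> P" "X \<in> ob C" "u \<in> mor C X (?F p)" "cmp C X (?F p) (?G p) (f p) u = zerom C X (?G p)" for p X u
    using ker[OF that(1)] that unfolding is_kernel_def by simp
  have "\<forall>p\<in>P. \<exists>h. h \<in> mor C (?W p) (?K p) \<and> cmp C (?W p) (?K p) (?F p) (k p) h = g p"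
    using ex1_implies_ex[OF ex] fg' by simp
  from bchoice[OF this] obtain h where
    h: "\<forall>p\<in>P. h p \<in> mor C (?W p) (?K p) \<and> cmp C (?W p) (?K p) (?F p) (k p) (h p) = g p" ..
  have h1: "h p \<in> mor C (?W p) (?K p)" and h2: "cmp C (?W p) (?K p) (?F p) (k p) (h p) = g p" if "p \<in> P" for p
    using h that by simp_all
  have h_mor: "(\<lambda>p\<in>P. h p) \<in> mor FC W K"
  proof (rule morI)
    fix p q assume pq: "(p, q) \<in> r"
    note [simp] = r_in[OF pq] map_mor[OF F pq] map_mor[OF G pq] map_mor[OF K pq] map_mor[OF W pq] h1
    let ?u = "cmp C (?W p) (?W q) (?F q) (g q) (map_at W p q)"
    let ?a = "cmp C (?W p) (?W q) (?K q) (h q) (map_at W p q)"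
    let ?b = "cmp C (?W p) (?K p) (?K q) (map_at K p q) (h p)"
    have u: "cmp C (?W p) (?F q) (?G q) (f q) ?u = zerom C (?W p) (?G q)"
    proof -
      have "cmp C (?W p) (?F q) (?G q) (f q) ?u = cmp C (?W p) (?W q) (?G q) (cmp C (?W q) (?F q) (?G q) (f q) (g q)) (map_at W p q)"
        by (rule assoc) simp_all
      then show ?thesis by (simp add: fg' zero_comp)
    qed
    have a: "cmp C (?W p) (?K q) (?F q) (k q) ?a = ?u"
    proof -
      have "cmp C (?W p) (?K q) (?F q) (k q) ?a = cmp C (?W p) (?W q) (?F q) (cmp C (?W q) (?K q) (?F q) (k q) (h q)) (map_at W p q)"
        by (rule assoc) simp_all
      then show ?thesis by (simp add: h2)
    qed
    have b: "cmp C (?W p) (?K q) (?F q) (k q) ?b = ?u"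
    proof -
      have "cmp C (?W p) (?K q) (?F q) (k q) ?b = cmp C (?W p) (?K p) (?F q) (cmp C (?K p) (?K q) (?F q) (k q) (map_at K p q)) (h p)"
        by (rule assoc) simp_all
      also have "\<dots> = cmp C (?W p) (?K p) (?F q) (cmp C (?K p) (?F p) (?F q) (map_at F p q) (k p)) (h p)"
        by (simp only: mor_nat[OF k pq])
      also have "\<dots> = cmp C (?W p) (?F p) (?F q) (map_at F p q) (cmp C (?W p) (?K p) (?F p) (k p) (h p))"
        by (rule assoc[symmetric]) simp_all
      also have "\<dots> = cmp C (?W p) (?F p) (?F q) (map_at F p q) (g p)" by (simp add: h2)
      also have "\<dots> = ?u" by (rule mor_nat[OF g pq, symmetric])
      finally show ?thesis .
    qed
    have "?a = ?b"
      by (rule ex1_unique[OF ex[of q "?W p" ?u]]) (simp_all add: u a b comp_mor)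
    then show "cmp C (?W p) (?W q) (?K q) ((\<lambda>p\<in>P. h p) q) (map_at W p q) =
        cmp C (?W p) (?K p) (?K q) (map_at K p q) ((\<lambda>p\<in>P. h p) p)" by simp
  qed (simp_all add: h1)
  show "\<exists>!h. h \<in> mor FC W K \<and> cmp FC W K F k h = g"
  proof (rule ex1I[of _ "\<lambda>p\<in>P. h p"], intro conjI h_mor)
    show "cmp FC W K F k (\<lambda>p\<in>P. h p) = g"
      by (rule extensionalityI[of _ P]) (simp_all add: FC_simps h2 mor_ext[OF g])
    fix h' assume h': "h' \<in> mor FC W K \<and> cmp FC W K F k h' = g"
    show "h' = (\<lambda>p\<in>P. h p)"
    proof (rule mor_eqI[OF conjunct1[OF h'] h_mor])
      fix p assume p: "p \<in> P"
      have "cmp C (?W p) (?K p) (?F p) (k p) (h' p) = g p"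
        using fun_cong[OF conjunct2[OF h'], of p] p by (simp add: FC_simps)
      then have "h' p = h p"
        by (intro ex1_unique[OF ex[of p "?W p" "g p"], of "h' p" "h p"])
          (simp_all add: p fg' h1 h2 mor_at[OF conjunct1[OF h']])
      then show "h' p = (\<lambda>p\<in>P. h p) p" using p by simp
    qed
  qed
qed

text \<open>Dual to the argument for kernels: naturality now follows from the uniqueness of maps out
  of the cokernel at the source \<open>p\<close> of the square.\<close>

lemma cokernel_pointwise:
  assumes F: "F \<in> ob FC" and G: "G \<in> ob FC" and K: "K \<in> ob FC" and f: "f \<in> mor FC F G" and k: "k \<in> mor FC G K"
    and ker: "\<And>p. p \<in> P \<Longrightarrow> is_cokernel C (obj_at F p) (obj_at G p) (f p) (obj_at K p) (k p)"
  shows "is_cokernel FC F G f K k"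
  unfolding is_cokernel_def
proof (intro conjI ballI impI K k)
  have fk: "cmp C (obj_at F p) (obj_at G p) (obj_at K p) (k p) (f p) = zerom C (obj_at F p) (obj_at K p)" if "p \<in> P" for p
    using ker[OF that] unfolding is_cokernel_def by simp
  show "cmp FC F G K k f = zerom FC F K" unfolding FC_simps using fk by (rule restrict_ext)
  fix W g assume W: "W \<in> ob FC" and g: "g \<in> mor FC G W" and gf: "cmp FC F G W g f = zerom FC F W"
  let ?F = "obj_at F" and ?G = "obj_at G" and ?K = "obj_at K" and ?W = "obj_at W"
  note [simp] = ob_at[OF F] ob_at[OF G] ob_at[OF K] ob_at[OF W] mor_at[OF f] mor_at[OF g] mor_at[OF k]
  have gf': "cmp C (?F p) (?G p) (?W p) (g p) (f p) = zerom C (?F p) (?W p)" if "p \<in> P" for p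
    using fun_cong[OF gf, of p] that by (simp add: FC_simps)
  have ex: "\<exists>!h. h \<in> mor C (?K p) X \<and> cmp C (?G p) (?K p) X h (k p) = u"
    if "p \<in> P" "X \<in> ob C" "u \<in> mor C (?G p) X" "cmp C (?F p) (?G p) X u (f p) = zerom C (?F p) X" for p X u
    using ker[OF that(1)] that unfolding is_cokernel_def by simp
  have "\<forall>p\<in>P. \<exists>h. h \<in> mor C (?K p) (?W p) \<and> cmp C (?G p) (?K p) (?W p) h (k p) = g p"
    using ex1_implies_ex[OF ex] gf' by simp
  from bchoice[OF this] obtain h where
    h: "\<forall>p\<in>P. h p \<in> mor C (?K p) (?W p) \<and> cmp C (?G p) (?K p) (?W p) (h p) (k p) = g p" ..
  have h1: "h p \<in> mor C (?K p) (?W p)" and h2: "cmp C (?G p) (?K p) (?W p) (h p) (k p) = g p" if "p \<in> P" for p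
    using h that by simp_all
  have h_mor: "(\<lambda>p\<in>P. h p) \<in> mor FC K W"
  proof (rule morI)
    fix p q assume pq: "(p, q) \<in> r"
    note [simp] = r_in[OF pq] map_mor[OF F pq] map_mor[OF G pq] map_mor[OF K pq] map_mor[OF W pq] h1
    let ?u = "cmp C (?G p) (?W p) (?W q) (map_at W p q) (g p)"
    let ?a = "cmp C (?K p) (?K q) (?W q) (h q) (map_at K p q)"
    let ?b = "cmp C (?K p) (?W p) (?W q) (map_at W p q) (h p)"
    have u: "cmp C (?F p) (?G p) (?W q) ?u (f p) = zerom C (?F p) (?W q)"
    proof -
      have "cmp C (?F p) (?G p) (?W q) ?u (f p) = cmp C (?F p) (?W p) (?W q) (map_at W p q) (cmp C (?F p) (?G p) (?W p) (g p) (f p))"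
        by (rule assoc[symmetric]) simp_all
      then show ?thesis by (simp add: gf' comp_zero)
    qed
    have a: "cmp C (?G p) (?K p) (?W q) ?a (k p) = ?u"
    proof -
      have "cmp C (?G p) (?K p) (?W q) ?a (k p) = cmp C (?G p) (?K q) (?W q) (h q) (cmp C (?G p) (?K p) (?K q) (map_at K p q) (k p))"
        by (rule assoc[symmetric]) simp_all
      also have "\<dots> = cmp C (?G p) (?K q) (?W q) (h q) (cmp C (?G p) (?G q) (?K q) (k q) (map_at G p q))"
        by (simp only: mor_nat[OF k pq])
      also have "\<dots> = cmp C (?G p) (?G q) (?W q) (cmp C (?G q) (?K q) (?W q) (h q) (k q)) (map_at G p q)"
        by (rule assoc) simp_all
      also have "\<dots> = cmp C (?G p) (?G q) (?W q) (g q) (map_at G p q)" by (simp add: h2)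
      also have "\<dots> = ?u" by (rule mor_nat[OF g pq])
      finally show ?thesis .
    qed
    have b: "cmp C (?G p) (?K p) (?W q) ?b (k p) = ?u"
    proof -
      have "cmp C (?G p) (?K p) (?W q) ?b (k p) = cmp C (?G p) (?W p) (?W q) (map_at W p q) (cmp C (?G p) (?K p) (?W p) (h p) (k p))"
        by (rule assoc[symmetric]) simp_all
      then show ?thesis by (simp add: h2)
    qed
    have "?a = ?b"
      by (rule ex1_unique[OF ex[of p "?W q" ?u]]) (simp_all add: u a b comp_mor)
    then show "cmp C (?K p) (?K q) (?W q) ((\<lambda>p\<in>P. h p) q) (map_at K p q) =
        cmp C (?K p) (?W p) (?W q) (map_at W p q) ((\<lambda>p\<in>P. h p) p)" by simp
  qed (simp_all add: h1)
  show "\<exists>!h. h \<in> mor FC K W \<and> cmp FC G K W h k = g"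
  proof (rule ex1I[of _ "\<lambda>p\<in>P. h p"], intro conjI h_mor)
    show "cmp FC G K W (\<lambda>p\<in>P. h p) k = g"
      by (rule extensionalityI[of _ P]) (simp_all add: FC_simps h2 mor_ext[OF g])
    fix h' assume h': "h' \<in> mor FC K W \<and> cmp FC G K W h' k = g"
    show "h' = (\<lambda>p\<in>P. h p)"
    proof (rule mor_eqI[OF conjunct1[OF h'] h_mor])
      fix p assume p: "p \<in> P"
      have "cmp C (?G p) (?K p) (?W p) (h' p) (k p) = g p"
        using fun_cong[OF conjunct2[OF h'], of p] p by (simp add: FC_simps)
      then have "h' p = h p"
        by (intro ex1_unique[OF ex[of p "?W p" "g p"], of "h' p" "h p"])
          (simp_all add: p gf' h1 h2 mor_at[OF conjunct1[OF h']])
      then show "h' p = (\<lambda>p\<in>P. h p) p" using p by simp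
    qed
  qed
qed

lemma biproduct_pointwise:
  assumes B: "B \<in> ob FC" and i: "i \<in> mor FC F B" and j: "j \<in> mor FC G B" and p: "p \<in> mor FC B F" and q: "q \<in> mor FC B G"
    and eqs: "\<And>x. x \<in> P \<Longrightarrow> cmp C (obj_at F x) (obj_at B x) (obj_at F x) (p x) (i x) = idm C (obj_at F x) \<and>
        cmp C (obj_at G x) (obj_at B x) (obj_at G x) (q x) (j x) = idm C (obj_at G x) \<and>
        cmp C (obj_at G x) (obj_at B x) (obj_at F x) (p x) (j x) = zerom C (obj_at G x) (obj_at F x) \<and>
        cmp C (obj_at F x) (obj_at B x) (obj_at G x) (q x) (i x) = zerom C (obj_at F x) (obj_at G x) \<and>
        addm C (obj_at B x) (obj_at B x) (cmp C (obj_at B x) (obj_at F x) (obj_at B x) (i x) (p x))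
          (cmp C (obj_at B x) (obj_at G x) (obj_at B x) (j x) (q x)) = idm C (obj_at B x)"
  shows "biproduct FC F G B"
  unfolding biproduct_def
  by (intro conjI bexI[OF _ i] bexI[OF _ j] bexI[OF _ p] bexI[OF _ q] B)
    (unfold FC_simps, (rule restrict_ext; simp add: eqs)+)

text \<open>Diagrams are records of total functions. Agreement on \<open>P\<close> leaves their
  other values free, so the diagrams are isomorphic, by identities, but need not be equal.\<close>

lemma diagram_cong:
  assumes G: "G \<in> ob FC" and ob: "\<And>p. p \<in> P \<Longrightarrow> obj_at H p = obj_at G p"
    and map: "\<And>p q. p \<in> P \<Longrightarrow> q \<in> P \<Longrightarrow> map_at H p q = map_at G p q"
  shows "H \<in> ob FC" and "isomorphic FC G H"
proof -
  interpret FC: preadditive_category FC by unfold_locales (rule preadditive_FC)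
  show H: "H \<in> ob FC"
    by (rule obI) (simp_all add: ob map r_in ob_at[OF G] map_mor[OF G] map_id[OF G] map_comp[OF G])
  have id: "cmp C (obj_at G p) (obj_at G p) (obj_at G p) (idm C (obj_at G p)) (idm C (obj_at G p)) = idm C (obj_at G p)"
    if "p \<in> P" for p using ob_at[OF G that] by (simp add: id_comp id_mor)
  have cG: "cmp C (obj_at G p) (obj_at G q) (obj_at G q) (idm C (obj_at G q)) (map_at G p q) =
      cmp C (obj_at G p) (obj_at G p) (obj_at G q) (map_at G p q) (idm C (obj_at G p))" if "(p, q) \<in> r" for p q
    using that by (simp add: id_comp comp_id ob_at[OF G] map_mor[OF G] r_in)
  show "isomorphic FC G H"
  proof (rule FC.isomorphicI[OF G H])
    show "(\<lambda>p\<in>P. idm C (obj_at G p)) \<in> mor FC G H" "(\<lambda>p\<in>P. idm C (obj_at G p)) \<in> mor FC H G"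
      by (rule morI; simp add: ob map r_in cG id_mor ob_at[OF G])+
  qed (unfold FC_simps, (rule restrict_ext; simp add: ob id)+)
qed

end

lemma pullback_simps: "obj_at (pullback e M) p = obj_at M (e p)" "map_at (pullback e M) p q = map_at M (e p) (e q)"
  by (simp_all add: pullback_def)

lemma pullback_ob:
  assumes "M \<in> ob (functor_cat Q s C)" and "\<And>p. p \<in> P \<Longrightarrow> e p \<in> Q" and "\<And>p q. (p, q) \<in> r \<Longrightarrow> (e p, e q) \<in> s"
  shows "pullback e M \<in> ob (functor_cat P r C)"
proof -
  have M: "map_at M p q \<in> mor C (obj_at M p) (obj_at M q)" if "(p, q) \<in> s" for p q
    using assms(1) that by (auto simp: functor_cat_def)
  show ?thesis using assms M unfolding functor_cat_def by (simp add: pullback_simps case_prod_beta)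
qed

lemma pullback_mor:
  assumes "\<eta> \<in> mor (functor_cat Q s C) M N" and "r \<subseteq> P \<times> P"
    and "\<And>p. p \<in> P \<Longrightarrow> e p \<in> Q" and "\<And>p q. (p, q) \<in> r \<Longrightarrow> (e p, e q) \<in> s"
  shows "(\<lambda>p\<in>P. \<eta> (e p)) \<in> mor (functor_cat P r C) (pullback e M) (pullback e N)"
proof -
  have nat: "cmp C (obj_at M p) (obj_at M q) (obj_at N q) (\<eta> q) (map_at M p q) =
      cmp C (obj_at M p) (obj_at N p) (obj_at N q) (map_at N p q) (\<eta> p)" if "(p, q) \<in> s" for p q
    using assms(1) that by (auto simp: functor_cat_def)
  show ?thesis using assms(1-3) nat[OF assms(4)]
    unfolding functor_cat_def by (auto simp: pullback_simps PiE_def subset_eq Pi_def)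
qed

text \<open>An infinite type is equinumerous with its square; this provides the coding of pairs on
  which direct sums are carried.\<close>

lemma pairing_exists:
  assumes "infinite (UNIV :: 'u set)"
  obtains \<phi> :: "'u \<times> 'u \<Rightarrow> 'u" where "inj \<phi>"
proof -
  obtain \<phi> :: "'u \<times> 'u \<Rightarrow> 'u" where "bij_betw \<phi> (UNIV \<times> UNIV) UNIV"
    using card_of_Times_same_infinite[OF assms] unfolding card_of_ordIso[symmetric] by blast
  then show ?thesis by (intro that[of \<phi>]) (simp add: bij_betw_def)
qed

locale vect_diagrams =
  fixes K :: "('k, 'z) ring_scheme" and P :: "'p set" and r :: "'p rel" and universe :: "'u itself"
  assumes K: "field K" and r_sub: "r \<subseteq> P \<times> P" and r_refl: "p \<in> P \<Longrightarrow> (p, p) \<in> r" and r_trans: "trans r"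
begin

sublocale diagrams "Vect K :: (('k, 'u) module, 'u \<Rightarrow> 'u) cat" P r
  by unfold_locales (rule r_sub)

sublocale FC: preadditive_category "FC :: (('p, ('k, 'u) module, 'u \<Rightarrow> 'u) diagram, 'p \<Rightarrow> 'u \<Rightarrow> 'u) cat"
  by unfold_locales (rule preadditive_FC)

lemma vs_at: "F \<in> ob FC \<Longrightarrow> p \<in> P \<Longrightarrow> vectorspace K (obj_at F p)"
  using ob_at[of F p] by (simp add: Vect_ob)

lemma map_id_at: "F \<in> ob FC \<Longrightarrow> p \<in> P \<Longrightarrow> v \<in> carrier (obj_at F p) \<Longrightarrow> map_at F p p v = v"
  by (simp add: map_id Vect_idm)

lemma map_comp_at: "F \<in> ob FC \<Longrightarrow> (p, q) \<in> r \<Longrightarrow> (q, s) \<in> r \<Longrightarrow> v \<in> carrier (obj_at F p) \<Longrightarrow>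
    map_at F p s v = map_at F q s (map_at F p q v)"
  by (simp add: map_comp[of F p q s] Vect_cmp)

lemma mor_nat_at: "\<eta> \<in> mor FC F G \<Longrightarrow> (p, q) \<in> r \<Longrightarrow> v \<in> carrier (obj_at F p) \<Longrightarrow>
    \<eta> q (map_at F p q v) = map_at G p q (\<eta> p v)"
  using fun_cong[OF mor_nat[of \<eta> F G p q], of v] by (simp add: Vect_cmp)

lemma Vect_diagramI:
  assumes ob: "\<And>p. p \<in> P \<Longrightarrow> vectorspace K (obj_at F p)"
    and mor: "\<And>p q. (p, q) \<in> r \<Longrightarrow> map_at F p q \<in> mor (Vect K) (obj_at F p) (obj_at F q)"
    and id: "\<And>p v. p \<in> P \<Longrightarrow> v \<in> carrier (obj_at F p) \<Longrightarrow> map_at F p p v = v"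
    and comp: "\<And>p q s v. (p, q) \<in> r \<Longrightarrow> (q, s) \<in> r \<Longrightarrow> v \<in> carrier (obj_at F p) \<Longrightarrow>
      map_at F p s v = map_at F q s (map_at F p q v)"
  shows "F \<in> ob FC"
proof (rule obI)
  show "map_at F p p = idm (Vect K) (obj_at F p)" if p: "p \<in> P" for p
    by (rule extensionalityI[of _ "carrier (obj_at F p)"])
      (simp_all add: id p Vect_idm Vect_mor_ext[OF mor[OF r_refl[OF p]]])
  show "map_at F p s = cmp (Vect K) (obj_at F p) (obj_at F q) (obj_at F s) (map_at F q s) (map_at F p q)"
    if pq: "(p, q) \<in> r" "(q, s) \<in> r" for p q s
    by (rule extensionalityI[of _ "carrier (obj_at F p)"])
      (simp_all add: comp[OF pq] Vect_cmp Vect_mor_ext[OF mor[OF transD[OF r_trans pq]]])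
qed (simp_all add: ob mor Vect_ob)

lemma Vect_natI:
  assumes "\<And>p. p \<in> P \<Longrightarrow> \<eta> p \<in> mor (Vect K) (obj_at F p) (obj_at G p)" and "\<eta> \<in> extensional P"
    and nat: "\<And>p q v. (p, q) \<in> r \<Longrightarrow> v \<in> carrier (obj_at F p) \<Longrightarrow> \<eta> q (map_at F p q v) = map_at G p q (\<eta> p v)"
  shows "\<eta> \<in> mor FC F G"
  using assms(1,2) by (rule morI) (auto simp: Vect_cmp nat intro: restrict_ext)

section \<open>Kernels and cokernels of diagrams of vector spaces\<close>

definition ker_diag where
  "ker_diag F G f = \<lparr>obj_at = (\<lambda>p. ker_mod (obj_at F p) (obj_at G p) (f p)),
     map_at = (\<lambda>p q. \<lambda>v\<in>carrier (ker_mod (obj_at F p) (obj_at G p) (f p)). map_at F p q v)\<rparr>"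

definition ker_incl where
  "ker_incl F G f = (\<lambda>p\<in>P. \<lambda>v\<in>carrier (ker_mod (obj_at F p) (obj_at G p) (f p)). v)"

context
  fixes F G :: "('p, ('k, 'u) module, 'u \<Rightarrow> 'u) diagram" and f
  assumes F: "F \<in> ob FC" and G: "G \<in> ob FC" and f: "f \<in> mor FC F G"
begin

lemma image_at: "p \<in> P \<Longrightarrow> submodule K (f p ` carrier (obj_at F p)) (obj_at G p)"
  by (rule image_submodule) (simp_all add: vs_at F G mor_at[OF f])

lemma ker_diag_ob: "ker_diag F G f \<in> ob FC"
proof (rule Vect_diagramI)
  show "vectorspace K (obj_at (ker_diag F G f) p)" if "p \<in> P" for p
    using that by (simp add: ker_diag_def ker_mod_vectorspace vs_at F G mor_at[OF f])
  show "map_at (ker_diag F G f) p q \<in> mor (Vect K) (obj_at (ker_diag F G f) p) (obj_at (ker_diag F G f) q)"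
    if pq: "(p, q) \<in> r" for p q
  proof -
    note [simp] = vs_at[OF F] vs_at[OF G] r_in[OF pq] map_mor[OF F pq] map_mor[OF G pq]
    have "f q (map_at F p q v) = \<zero>\<^bsub>obj_at G q\<^esub>" if "v \<in> carrier (obj_at F p)" "f p v = \<zero>\<^bsub>obj_at G p\<^esub>" for v
      using mor_nat_at[OF f pq that(1)] that(2) Vect_mor_zero[OF _ _ map_mor[OF G pq]] by simp
    moreover have "vectorspace K (ker_mod (obj_at F p) (obj_at G p) (f p))"
      by (simp add: ker_mod_vectorspace mor_at[OF f])
    note vectorspace_closed[OF this]
    ultimately show ?thesis
      by (intro Vect_morI) (simp_all add: ker_diag_def ker_mod_def Vect_mor_closed[OF map_mor[OF F pq]]
          Vect_mor_add[OF map_mor[OF F pq]] Vect_mor_smult[OF map_mor[OF F pq]])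
  qed
  show "map_at (ker_diag F G f) p p v = v" if "p \<in> P" "v \<in> carrier (obj_at (ker_diag F G f) p)" for p v
    using that by (simp add: ker_diag_def ker_mod_def map_id_at[OF F])
  show "map_at (ker_diag F G f) p s v = map_at (ker_diag F G f) q s (map_at (ker_diag F G f) p q v)"
    if pq: "(p, q) \<in> r" "(q, s) \<in> r" and v: "v \<in> carrier (obj_at (ker_diag F G f) p)" for p q s v
    using v mor_nat_at[OF f pq(1), of v] Vect_mor_zero[OF _ _ map_mor[OF G pq(1)]]
    by (simp add: ker_diag_def ker_mod_def map_comp_at[OF F pq] vs_at G r_in[OF pq(1)] Vect_mor_closed[OF map_mor[OF F pq(1)]])
qed

lemma ker_incl_mor: "ker_incl F G f \<in> mor FC (ker_diag F G f) F"
proof (rule Vect_natI)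
  show "ker_incl F G f p \<in> mor (Vect K) (obj_at (ker_diag F G f) p) (obj_at F p)" if "p \<in> P" for p
    using vectorspace_closed[OF vs_at[OF ker_diag_ob that]] that
    by (intro Vect_morI) (simp_all add: ker_incl_def ker_diag_def ker_mod_def)
  show "ker_incl F G f q (map_at (ker_diag F G f) p q v) = map_at F p q (ker_incl F G f p v)"
    if pq: "(p, q) \<in> r" and v: "v \<in> carrier (obj_at (ker_diag F G f) p)" for p q v
    using Vect_mor_closed[OF map_mor[OF ker_diag_ob pq] v] v
    by (simp add: ker_incl_def ker_diag_def r_in[OF pq])
qed (simp add: ker_incl_def)

lemma ker_diag_pointwise: "p \<in> P \<Longrightarrow>
    is_kernel (Vect K) (obj_at F p) (obj_at G p) (f p) (obj_at (ker_diag F G f) p) (ker_incl F G f p)"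
  by (rule is_kernel_Vect) (use mor_at[OF ker_incl_mor] vs_at[OF ker_diag_ob] in
      \<open>auto simp: vs_at F G mor_at[OF f] ker_incl_def ker_diag_def ker_mod_def inj_on_def\<close>)

lemma ker_diag_fin_dim:
  "p \<in> P \<Longrightarrow> vectorspace.fin_dim K (obj_at F p) \<Longrightarrow> vectorspace.fin_dim K (obj_at (ker_diag F G f) p)"
  unfolding ker_diag_def ker_mod_def diagram.simps
  by (rule fin_dim_subspace) (simp_all add: vs_at F ker_mod_submodule[OF vs_at[OF F] vs_at[OF G] mor_at[OF f]])

lemma ker_diag_is_kernel: "is_kernel FC F G f (ker_diag F G f) (ker_incl F G f)"
  by (rule kernel_pointwise[OF F G ker_diag_ob f ker_incl_mor ker_diag_pointwise])

end

definition coker_diag where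
  "coker_diag F G f = \<lparr>obj_at = (\<lambda>p. quot_mod (obj_at G p) (f p ` carrier (obj_at F p))),
     map_at = (\<lambda>p q. \<lambda>v\<in>carrier (quot_mod (obj_at G p) (f p ` carrier (obj_at F p))).
       coset_rep (obj_at G q) (f q ` carrier (obj_at F q)) (map_at G p q v))\<rparr>"

definition coker_proj where
  "coker_proj F G f = (\<lambda>p\<in>P. \<lambda>v\<in>carrier (obj_at G p). coset_rep (obj_at G p) (f p ` carrier (obj_at F p)) v)"

context
  fixes F G :: "('p, ('k, 'u) module, 'u \<Rightarrow> 'u) diagram" and f
  assumes F: "F \<in> ob FC" and G: "G \<in> ob FC" and f: "f \<in> mor FC F G"
begin

private abbreviation "im p \<equiv> f p ` carrier (obj_at F p)"
private abbreviation "rep p \<equiv> coset_rep (obj_at G p) (im p)"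

private lemma im: "p \<in> P \<Longrightarrow> submodule K (im p) (obj_at G p)"
  by (rule image_at[OF F G f])

private lemma rep_closed: "p \<in> P \<Longrightarrow> v \<in> carrier (obj_at G p) \<Longrightarrow> rep p v \<in> carrier (obj_at G p)"
  by (rule coset_rep(1)[OF vs_at[OF G] im])

text \<open>A representative differs from \<open>v\<close> by an element of the image at
  \<open>p\<close>, and naturality of \<open>f\<close> carries that element into the image at
  \<open>q\<close>. Hence the maps between quotients do not depend on the chosen
  representatives.\<close>

lemma rep_map:
  assumes pq: "(p, q) \<in> r" and v: "v \<in> carrier (obj_at G p)"
  shows "rep q (map_at G p q (rep p v)) = rep q (map_at G p q v)"
proof -
  note P = r_in[OF pq]
  note map = map_mor[OF G pq]
  have rv: "rep p v \<in> carrier (obj_at G p)" by (rule rep_closed[OF P(1) v])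
  have "rep p v \<ominus>\<^bsub>obj_at G p\<^esub> v \<in> im p" by (rule coset_rep(2)[OF vs_at[OF G P(1)] im[OF P(1)] v])
  then obtain u where u: "u \<in> carrier (obj_at F p)" "rep p v \<ominus>\<^bsub>obj_at G p\<^esub> v = f p u" by blast
  have "map_at G p q (rep p v) \<ominus>\<^bsub>obj_at G q\<^esub> map_at G p q v = map_at G p q (f p u)"
    using Vect_mor_minus[OF vs_at[OF G P(1)] vs_at[OF G P(2)] map rv v] u(2) by simp
  also have "\<dots> = f q (map_at F p q u)" by (rule mor_nat_at[OF f pq u(1), symmetric])
  also have "\<dots> \<in> im q" using Vect_mor_closed[OF map_mor[OF F pq] u(1)] by simp
  finally show ?thesis
    by (subst coset_rep_eq_iff[OF vs_at[OF G P(2)] im[OF P(2)] Vect_mor_closed[OF map rv] Vect_mor_closed[OF map v]])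
qed

lemma coker_proj_at: "p \<in> P \<Longrightarrow> coker_proj F G f p \<in> mor (Vect K) (obj_at G p) (obj_at (coker_diag F G f) p)"
  using coset_rep_mor[OF vs_at[OF G] im] by (simp add: coker_proj_def coker_diag_def)

lemma coker_diag_vs: "p \<in> P \<Longrightarrow> vectorspace K (obj_at (coker_diag F G f) p)"
  using quot_mod_vectorspace[OF vs_at[OF G] im] by (simp add: coker_diag_def)

lemma coker_diag_cases:
  assumes "v \<in> carrier (obj_at (coker_diag F G f) p)"
  obtains w where "w \<in> carrier (obj_at G p)" "v = rep p w"
  using assms by (auto simp: coker_diag_def quot_mod_def)

lemma coker_map_rep:
  assumes pq: "(p, q) \<in> r" and v: "v \<in> carrier (obj_at G p)"
  shows "map_at (coker_diag F G f) p q (rep p v) = rep q (map_at G p q v)"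
  using v rep_map[OF assms] by (simp add: coker_diag_def quot_mod_def)

lemma coker_diag_ob: "coker_diag F G f \<in> ob FC"
proof (rule Vect_diagramI)
  show "map_at (coker_diag F G f) p q \<in> mor (Vect K) (obj_at (coker_diag F G f) p) (obj_at (coker_diag F G f) q)"
    if pq: "(p, q) \<in> r" for p q
  proof -
    note P = r_in[OF pq]
    note proj = coker_proj_at[OF P(1), unfolded coker_proj_def, simplified P if_True restrict_apply]
    have pr: "rep p v = coker_proj F G f p v" if "p \<in> P" "v \<in> carrier (obj_at G p)" for p v
      using that by (simp add: coker_proj_def)
    note map = map_mor[OF G pq]
    note cl = vectorspace_closed[OF vs_at[OF G P(1)]]
    have rep_q: "rep q v \<in> carrier (obj_at (coker_diag F G f) q)" if "v \<in> carrier (obj_at G q)" for v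
      using that by (simp add: coker_diag_def quot_mod_def)
    have add: "rep p v \<oplus>\<^bsub>obj_at (coker_diag F G f) p\<^esub> rep p w = rep p (v \<oplus>\<^bsub>obj_at G p\<^esub> w)"
      if "p \<in> P" "v \<in> carrier (obj_at G p)" "w \<in> carrier (obj_at G p)" for p v w
      using that Vect_mor_add[OF coker_proj_at[OF that(1)] that(2,3)] vectorspace_closed(1)[OF vs_at[OF G that(1)] that(2,3)]
      by (simp add: coker_proj_def)
    have smult: "c \<odot>\<^bsub>obj_at (coker_diag F G f) p\<^esub> rep p v = rep p (c \<odot>\<^bsub>obj_at G p\<^esub> v)"
      if "p \<in> P" "c \<in> carrier K" "v \<in> carrier (obj_at G p)" for p v c
      using that Vect_mor_smult[OF coker_proj_at[OF that(1)] that(2,3)] vectorspace_closed(3)[OF vs_at[OF G that(1)] that(2,3)]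
      by (simp add: coker_proj_def)
    show ?thesis
    proof (rule Vect_morI)
      fix v assume "v \<in> carrier (obj_at (coker_diag F G f) p)"
      then show "map_at (coker_diag F G f) p q v \<in> carrier (obj_at (coker_diag F G f) q)"
        by (rule coker_diag_cases) (simp add: coker_map_rep[OF pq] rep_q Vect_mor_closed[OF map])
    next
      fix v w assume "v \<in> carrier (obj_at (coker_diag F G f) p)" "w \<in> carrier (obj_at (coker_diag F G f) p)"
      then obtain v' w' where "v' \<in> carrier (obj_at G p)" "v = rep p v'" "w' \<in> carrier (obj_at G p)" "w = rep p w'"
        by (elim coker_diag_cases)
      then show "map_at (coker_diag F G f) p q (v \<oplus>\<^bsub>obj_at (coker_diag F G f) p\<^esub> w) =
          map_at (coker_diag F G f) p q v \<oplus>\<^bsub>obj_at (coker_diag F G f) q\<^esub> map_at (coker_diag F G f) p q w"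
        by (simp add: add P cl coker_map_rep[OF pq] Vect_mor_closed[OF map] Vect_mor_add[OF map])
    next
      fix c v assume c: "c \<in> carrier K" and "v \<in> carrier (obj_at (coker_diag F G f) p)"
      then obtain v' where "v' \<in> carrier (obj_at G p)" "v = rep p v'" by (elim coker_diag_cases)
      then show "map_at (coker_diag F G f) p q (c \<odot>\<^bsub>obj_at (coker_diag F G f) p\<^esub> v) =
          c \<odot>\<^bsub>obj_at (coker_diag F G f) q\<^esub> map_at (coker_diag F G f) p q v"
        using c by (simp add: smult P cl coker_map_rep[OF pq] Vect_mor_closed[OF map] Vect_mor_smult[OF map])
    qed (simp add: coker_diag_def)
  qed
  show "map_at (coker_diag F G f) p p v = v" if p: "p \<in> P" and v: "v \<in> carrier (obj_at (coker_diag F G f) p)" for p v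
    using v by (rule coker_diag_cases) (simp add: coker_map_rep[OF r_refl[OF p]] map_id_at[OF G p])
  show "map_at (coker_diag F G f) p s v = map_at (coker_diag F G f) q s (map_at (coker_diag F G f) p q v)"
    if pq: "(p, q) \<in> r" "(q, s) \<in> r" and v: "v \<in> carrier (obj_at (coker_diag F G f) p)" for p q s v
    using v by (rule coker_diag_cases) (simp add: coker_map_rep[OF pq(1)] coker_map_rep[OF pq(2)]
        coker_map_rep[OF transD[OF r_trans pq]] map_comp_at[OF G pq] Vect_mor_closed[OF map_mor[OF G pq(1)]])
qed (rule coker_diag_vs)

lemma coker_proj_mor: "coker_proj F G f \<in> mor FC G (coker_diag F G f)"
  by (rule Vect_natI) (simp_all add: coker_proj_at, simp_all add: coker_proj_def coker_map_rep r_in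
      Vect_mor_closed[OF map_mor[OF G]])

lemma coker_diag_kernel:
  assumes p: "p \<in> P"
  shows "{w \<in> carrier (obj_at G p). coker_proj F G f p w = \<zero>\<^bsub>obj_at (coker_diag F G f) p\<^esub>} = im p"
proof -
  have "im p \<subseteq> carrier (obj_at G p)" using Vect_mor_closed[OF mor_at[OF f p]] by blast
  moreover have "coker_proj F G f p w = \<zero>\<^bsub>obj_at (coker_diag F G f) p\<^esub> \<longleftrightarrow> w \<in> im p" if "w \<in> carrier (obj_at G p)" for w
    using coset_rep_eq_zero[OF vs_at[OF G p] im[OF p] that] that p by (simp add: coker_proj_def coker_diag_def)
  ultimately show ?thesis by blast
qed

lemma coker_diag_pointwise: "p \<in> P \<Longrightarrow>
    is_cokernel (Vect K) (obj_at F p) (obj_at G p) (f p) (obj_at (coker_diag F G f) p) (coker_proj F G f p)"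
  by (rule is_cokernel_Vect) (simp_all add: vs_at F G mor_at[OF f] coker_diag_vs coker_proj_at coker_diag_kernel,
      simp add: coker_proj_def coker_diag_def quot_mod_def)

lemma coker_diag_fin_dim:
  "p \<in> P \<Longrightarrow> vectorspace.fin_dim K (obj_at G p) \<Longrightarrow> vectorspace.fin_dim K (obj_at (coker_diag F G f) p)"
  using quot_mod_fin_dim[OF vs_at[OF G] im] by (simp add: coker_diag_def)

lemma coker_diag_is_cokernel: "is_cokernel FC F G f (coker_diag F G f) (coker_proj F G f)"
  by (rule cokernel_pointwise[OF F G coker_diag_ob f coker_proj_mor coker_diag_pointwise])

end

end

section \<open>Zero object, biproducts, monomorphisms and epimorphisms of diagrams\<close>

definition zero_diag :: "('p, ('k, 'u) module, 'u \<Rightarrow> 'u) diagram" where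
  "zero_diag = \<lparr>obj_at = (\<lambda>_. zero_mod), map_at = (\<lambda>_ _. \<lambda>v\<in>carrier (zero_mod :: ('k, 'u) module). v)\<rparr>"

definition sum_diag :: "('u \<times> 'u \<Rightarrow> 'u) \<Rightarrow> ('p, ('k, 'u) module, 'u \<Rightarrow> 'u) diagram \<Rightarrow>
    ('p, ('k, 'u) module, 'u \<Rightarrow> 'u) diagram \<Rightarrow> ('p, ('k, 'u) module, 'u \<Rightarrow> 'u) diagram" where
  "sum_diag \<phi> F G = \<lparr>obj_at = (\<lambda>p. sum_mod \<phi> (obj_at F p) (obj_at G p)),
     map_at = (\<lambda>p q. \<lambda>z\<in>carrier (sum_mod \<phi> (obj_at F p) (obj_at G p)).
       \<phi> (map_prod (map_at F p q) (map_at G p q) (inv_into UNIV \<phi> z)))\<rparr>"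

context vect_diagrams
begin

lemma zero_diag_ob: "(zero_diag :: ('p, ('k, 'u) module, 'u \<Rightarrow> 'u) diagram) \<in> ob FC" (is "?Z \<in> _")
proof (rule Vect_diagramI)
  show "map_at ?Z p q \<in> mor (Vect K) (obj_at ?Z p) (obj_at ?Z q)" for p q
    using Vect.id_mor[of "zero_mod :: ('k, 'u) module" K]
    by (simp add: zero_diag_def Vect_ob zero_mod_vectorspace[OF K] Vect_idm)
qed (simp_all add: zero_diag_def zero_mod_vectorspace[OF K])

lemma zero_object_zero_diag: "zero_object FC zero_diag"
  unfolding zero_object_def
proof (intro conjI ballI zero_diag_ob)
  fix X :: "('p, ('k, 'u) module, 'u \<Rightarrow> 'u) diagram" assume X: "X \<in> ob FC"
  let ?Z = "zero_diag :: ('p, ('k, 'u) module, 'u \<Rightarrow> 'u) diagram"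
  have "f = g" if f: "f \<in> mor FC zero_diag X" and g: "g \<in> mor FC zero_diag X" for f g
  proof (rule mor_eqI[OF f g])
    fix p assume p: "p \<in> P"
    note vs = vs_at[OF zero_diag_ob p] vs_at[OF X p]
    show "f p = g p"
    proof (rule Vect_mor_eqI[OF mor_at[OF f p] mor_at[OF g p]])
      fix v assume "v \<in> carrier (obj_at ?Z p)"
      then have "v = \<zero>\<^bsub>obj_at ?Z p\<^esub>" by (simp add: zero_diag_def zero_mod_def)
      then show "f p v = g p v"
        using Vect_mor_zero[OF vs mor_at[OF f p]] Vect_mor_zero[OF vs mor_at[OF g p]] by simp
    qed
  qed
  then show "\<exists>!f. f \<in> mor FC zero_diag X"
    using FC.zero_mor[OF zero_diag_ob X] by (intro ex1I[of _ "zerom FC zero_diag X"])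
  have "f = g" if f: "f \<in> mor FC X zero_diag" and g: "g \<in> mor FC X zero_diag" for f g
  proof (rule mor_eqI[OF f g])
    fix p assume p: "p \<in> P"
    show "f p = g p"
    proof (rule Vect_mor_eqI[OF mor_at[OF f p] mor_at[OF g p]])
      fix v assume v: "v \<in> carrier (obj_at X p)"
      show "f p v = g p v"
        using Vect_mor_closed[OF mor_at[OF f p] v] Vect_mor_closed[OF mor_at[OF g p] v]
        by (simp add: zero_diag_def zero_mod_def)
    qed
  qed
  then show "\<exists>!f. f \<in> mor FC X zero_diag"
    using FC.zero_mor[OF X zero_diag_ob] by (intro ex1I[of _ "zerom FC X zero_diag"])
qed

context
  fixes \<phi> :: "'u \<times> 'u \<Rightarrow> 'u" and F G :: "('p, ('k, 'u) module, 'u \<Rightarrow> 'u) diagram"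
  assumes \<phi>: "inj \<phi>" and F: "F \<in> ob FC" and G: "G \<in> ob FC"
begin

lemma sum_diag_simps:
  "carrier (obj_at (sum_diag \<phi> F G) p) = \<phi> ` (carrier (obj_at F p) \<times> carrier (obj_at G p))"
  "\<zero>\<^bsub>obj_at (sum_diag \<phi> F G) p\<^esub> = \<phi> (\<zero>\<^bsub>obj_at F p\<^esub>, \<zero>\<^bsub>obj_at G p\<^esub>)"
  "\<phi> (v, w) \<oplus>\<^bsub>obj_at (sum_diag \<phi> F G) p\<^esub> \<phi> (v', w') = \<phi> (v \<oplus>\<^bsub>obj_at F p\<^esub> v', w \<oplus>\<^bsub>obj_at G p\<^esub> w')"
  "c \<odot>\<^bsub>obj_at (sum_diag \<phi> F G) p\<^esub> \<phi> (v, w) = \<phi> (c \<odot>\<^bsub>obj_at F p\<^esub> v, c \<odot>\<^bsub>obj_at G p\<^esub> w)"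
  "v \<in> carrier (obj_at F p) \<Longrightarrow> w \<in> carrier (obj_at G p) \<Longrightarrow>
    map_at (sum_diag \<phi> F G) p q (\<phi> (v, w)) = \<phi> (map_at F p q v, map_at G p q w)"
  using \<phi> by (simp_all add: sum_diag_def sum_mod_simps)

lemma sum_diag_vs: "p \<in> P \<Longrightarrow> vectorspace K (obj_at (sum_diag \<phi> F G) p)"
  by (simp add: sum_diag_def sum_mod_vectorspace[OF \<phi>] vs_at F G)

lemma sum_diag_ob: "sum_diag \<phi> F G \<in> ob FC"
proof (rule Vect_diagramI)
  show "map_at (sum_diag \<phi> F G) p q \<in> mor (Vect K) (obj_at (sum_diag \<phi> F G) p) (obj_at (sum_diag \<phi> F G) q)"
    if pq: "(p, q) \<in> r" for p q
    by (rule Vect_morI)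
      (auto simp: sum_diag_simps Vect_mor_closed[OF map_mor[OF F pq]] Vect_mor_closed[OF map_mor[OF G pq]]
        Vect_mor_add[OF map_mor[OF F pq]] Vect_mor_add[OF map_mor[OF G pq]]
        Vect_mor_smult[OF map_mor[OF F pq]] Vect_mor_smult[OF map_mor[OF G pq]]
        vectorspace_closed[OF vs_at[OF F r_in(1)[OF pq]]] vectorspace_closed[OF vs_at[OF G r_in(1)[OF pq]]],
        simp add: sum_diag_def sum_mod_simps[OF \<phi>])
  show "map_at (sum_diag \<phi> F G) p p v = v" if "p \<in> P" "v \<in> carrier (obj_at (sum_diag \<phi> F G) p)" for p v
    using that by (auto simp: sum_diag_simps map_id_at F G)
  show "map_at (sum_diag \<phi> F G) p s v = map_at (sum_diag \<phi> F G) q s (map_at (sum_diag \<phi> F G) p q v)"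
    if pq: "(p, q) \<in> r" "(q, s) \<in> r" and v: "v \<in> carrier (obj_at (sum_diag \<phi> F G) p)" for p q s v
    using v by (auto simp: sum_diag_simps map_comp_at[OF F pq] map_comp_at[OF G pq]
        Vect_mor_closed[OF map_mor[OF F pq(1)]] Vect_mor_closed[OF map_mor[OF G pq(1)]])
qed (rule sum_diag_vs)

lemma sum_diag_fin_dim: "p \<in> P \<Longrightarrow> vectorspace.fin_dim K (obj_at F p) \<Longrightarrow> vectorspace.fin_dim K (obj_at G p) \<Longrightarrow>
    vectorspace.fin_dim K (obj_at (sum_diag \<phi> F G) p)"
  by (simp add: sum_diag_def sum_mod_fin_dim[OF \<phi>] vs_at F G)

lemma biproduct_sum_diag: "biproduct FC F G (sum_diag \<phi> F G)"
proof (rule biproduct_pointwise[OF sum_diag_ob])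
  let ?S = "sum_diag \<phi> F G"
  let ?i = "\<lambda>p\<in>P. \<lambda>v\<in>carrier (obj_at F p). \<phi> (v, \<zero>\<^bsub>obj_at G p\<^esub>)"
    and ?j = "\<lambda>p\<in>P. \<lambda>w\<in>carrier (obj_at G p). \<phi> (\<zero>\<^bsub>obj_at F p\<^esub>, w)"
    and ?p = "\<lambda>p\<in>P. \<lambda>z\<in>carrier (obj_at ?S p). fst (inv_into UNIV \<phi> z)"
    and ?q = "\<lambda>p\<in>P. \<lambda>z\<in>carrier (obj_at ?S p). snd (inv_into UNIV \<phi> z)"
  have md: "module K (obj_at F p)" "module K (obj_at G p)" if "p \<in> P" for p
    using vectorspace_module vs_at F G that by blast+
  have zF: "\<zero>\<^bsub>obj_at F p\<^esub> \<oplus>\<^bsub>obj_at F p\<^esub> \<zero>\<^bsub>obj_at F p\<^esub> = \<zero>\<^bsub>obj_at F p\<^esub>"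
    "v \<in> carrier (obj_at F p) \<Longrightarrow> \<zero>\<^bsub>obj_at F p\<^esub> \<oplus>\<^bsub>obj_at F p\<^esub> v = v"
    "v \<in> carrier (obj_at F p) \<Longrightarrow> v \<oplus>\<^bsub>obj_at F p\<^esub> \<zero>\<^bsub>obj_at F p\<^esub> = v"
    "c \<in> carrier K \<Longrightarrow> c \<odot>\<^bsub>obj_at F p\<^esub> \<zero>\<^bsub>obj_at F p\<^esub> = \<zero>\<^bsub>obj_at F p\<^esub>" if "p \<in> P" for p v c
  proof -
    interpret M: module K "obj_at F p" by (rule md(1)[OF that])
    show "\<zero>\<^bsub>obj_at F p\<^esub> \<oplus>\<^bsub>obj_at F p\<^esub> \<zero>\<^bsub>obj_at F p\<^esub> = \<zero>\<^bsub>obj_at F p\<^esub>"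
      "v \<in> carrier (obj_at F p) \<Longrightarrow> \<zero>\<^bsub>obj_at F p\<^esub> \<oplus>\<^bsub>obj_at F p\<^esub> v = v"
      "v \<in> carrier (obj_at F p) \<Longrightarrow> v \<oplus>\<^bsub>obj_at F p\<^esub> \<zero>\<^bsub>obj_at F p\<^esub> = v"
      "c \<in> carrier K \<Longrightarrow> c \<odot>\<^bsub>obj_at F p\<^esub> \<zero>\<^bsub>obj_at F p\<^esub> = \<zero>\<^bsub>obj_at F p\<^esub>" by simp_all
  qed
  have zG: "\<zero>\<^bsub>obj_at G p\<^esub> \<oplus>\<^bsub>obj_at G p\<^esub> \<zero>\<^bsub>obj_at G p\<^esub> = \<zero>\<^bsub>obj_at G p\<^esub>"
    "v \<in> carrier (obj_at G p) \<Longrightarrow> \<zero>\<^bsub>obj_at G p\<^esub> \<oplus>\<^bsub>obj_at G p\<^esub> v = v"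
    "v \<in> carrier (obj_at G p) \<Longrightarrow> v \<oplus>\<^bsub>obj_at G p\<^esub> \<zero>\<^bsub>obj_at G p\<^esub> = v"
    "c \<in> carrier K \<Longrightarrow> c \<odot>\<^bsub>obj_at G p\<^esub> \<zero>\<^bsub>obj_at G p\<^esub> = \<zero>\<^bsub>obj_at G p\<^esub>" if "p \<in> P" for p v c
  proof -
    interpret M: module K "obj_at G p" by (rule md(2)[OF that])
    show "\<zero>\<^bsub>obj_at G p\<^esub> \<oplus>\<^bsub>obj_at G p\<^esub> \<zero>\<^bsub>obj_at G p\<^esub> = \<zero>\<^bsub>obj_at G p\<^esub>"
      "v \<in> carrier (obj_at G p) \<Longrightarrow> \<zero>\<^bsub>obj_at G p\<^esub> \<oplus>\<^bsub>obj_at G p\<^esub> v = v"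
      "v \<in> carrier (obj_at G p) \<Longrightarrow> v \<oplus>\<^bsub>obj_at G p\<^esub> \<zero>\<^bsub>obj_at G p\<^esub> = v"
      "c \<in> carrier K \<Longrightarrow> c \<odot>\<^bsub>obj_at G p\<^esub> \<zero>\<^bsub>obj_at G p\<^esub> = \<zero>\<^bsub>obj_at G p\<^esub>" by simp_all
  qed
  have closed: "\<zero>\<^bsub>obj_at H p\<^esub> \<in> carrier (obj_at H p)"
    "v \<in> carrier (obj_at H p) \<Longrightarrow> w \<in> carrier (obj_at H p) \<Longrightarrow> v \<oplus>\<^bsub>obj_at H p\<^esub> w \<in> carrier (obj_at H p)"
    "c \<in> carrier K \<Longrightarrow> v \<in> carrier (obj_at H p) \<Longrightarrow> c \<odot>\<^bsub>obj_at H p\<^esub> v \<in> carrier (obj_at H p)"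
    if "H \<in> ob FC" "p \<in> P" for H :: "('p, ('k, 'u) module, 'u \<Rightarrow> 'u) diagram" and p v w c
    using vectorspace_closed[OF vs_at[OF that]] by simp_all
  have map_zero: "map_at H p q \<zero>\<^bsub>obj_at H p\<^esub> = \<zero>\<^bsub>obj_at H q\<^esub>" if "H \<in> ob FC" "(p, q) \<in> r"
    for H :: "('p, ('k, 'u) module, 'u \<Rightarrow> 'u) diagram" and p q
    using Vect_mor_zero[OF vs_at vs_at map_mor] that r_in by blast
  have map_closed: "map_at H p q v \<in> carrier (obj_at H q)" if "H \<in> ob FC" "(p, q) \<in> r" "v \<in> carrier (obj_at H p)"
    for H :: "('p, ('k, 'u) module, 'u \<Rightarrow> 'u) diagram" and p q v
    by (rule Vect_mor_closed[OF map_mor[OF that(1,2)] that(3)])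
  note [simp] = zF zG closed[OF F] closed[OF G] sum_diag_simps inv_f_f[OF \<phi>] inj_image_mem_iff[OF \<phi>] inj_eq[OF \<phi>]
    r_in map_zero[OF F] map_zero[OF G] map_closed[OF F] map_closed[OF G]
  show "?i \<in> mor FC F ?S" "?j \<in> mor FC G ?S" by (rule Vect_natI; (rule Vect_morI)?; simp)+
  show "?p \<in> mor FC ?S F" "?q \<in> mor FC ?S G" by (rule Vect_natI; (rule Vect_morI)?; auto)+
  fix x assume x: "x \<in> P"
  then show "cmp (Vect K) (obj_at F x) (obj_at ?S x) (obj_at F x) (?p x) (?i x) = idm (Vect K) (obj_at F x) \<and>
      cmp (Vect K) (obj_at G x) (obj_at ?S x) (obj_at G x) (?q x) (?j x) = idm (Vect K) (obj_at G x) \<and>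
      cmp (Vect K) (obj_at G x) (obj_at ?S x) (obj_at F x) (?p x) (?j x) = zerom (Vect K) (obj_at G x) (obj_at F x) \<and>
      cmp (Vect K) (obj_at F x) (obj_at ?S x) (obj_at G x) (?q x) (?i x) = zerom (Vect K) (obj_at F x) (obj_at G x) \<and>
      addm (Vect K) (obj_at ?S x) (obj_at ?S x) (cmp (Vect K) (obj_at ?S x) (obj_at F x) (obj_at ?S x) (?i x) (?p x))
        (cmp (Vect K) (obj_at ?S x) (obj_at G x) (obj_at ?S x) (?j x) (?q x)) = idm (Vect K) (obj_at ?S x)"
    unfolding Vect_cmp Vect_idm Vect_zerom Vect_addm
    by (intro conjI; intro restrict_ext; auto)
qed

end

text \<open>The inclusion of the kernel diagram and the zero morphism have the same composite with
  \<open>f\<close>, so they coincide, and the kernel is zero at every point.\<close>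

lemma monic_pointwise:
  assumes F: "F \<in> ob FC" and G: "G \<in> ob FC" and f: "monic FC F G f" and p: "p \<in> P"
    and v: "v \<in> carrier (obj_at F p)" "f p v = \<zero>\<^bsub>obj_at G p\<^esub>"
  shows "v = \<zero>\<^bsub>obj_at F p\<^esub>"
proof -
  have f_mor: "f \<in> mor FC F G" using f unfolding monic_def by simp
  have cancel: "g = h" if "W \<in> ob FC" "g \<in> mor FC W F" "h \<in> mor FC W F" "cmp FC W F G f g = cmp FC W F G f h" for W g h
    using f that unfolding monic_def by simp_all
  let ?N = "ker_diag F G f" and ?k = "ker_incl F G f"
  have N: "?N \<in> ob FC" and k: "?k \<in> mor FC ?N F"
    using ker_diag_ob[OF F G f_mor] ker_incl_mor[OF F G f_mor] .
  have "cmp FC ?N F G f ?k = zerom FC ?N G"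
    using ker_diag_is_kernel[OF F G f_mor] unfolding is_kernel_def by simp
  then have "?k = zerom FC ?N F"
    by (intro cancel[OF N k]) (simp_all add: FC.zero_mor FC.comp_zero N F G f_mor)
  from fun_cong[OF fun_cong[OF this, of p], of v] show ?thesis
    using p v by (simp add: FC_simps Vect_zerom ker_incl_def ker_diag_def ker_mod_def)
qed

text \<open>A monomorphism is the kernel of its cokernel. At each point this is linear algebra, once
  injectivity is known there.\<close>

lemma monic_is_kernel:
  assumes F: "F \<in> ob FC" and G: "G \<in> ob FC" and f: "monic FC F G f"
  shows "is_kernel FC G (coker_diag F G f) (coker_proj F G f) F f"
proof -
  have f_mor: "f \<in> mor FC F G" using f unfolding monic_def by simp
  show ?thesis
  proof (rule kernel_pointwise[OF G coker_diag_ob[OF F G f_mor] F coker_proj_mor[OF F G f_mor] f_mor])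
    fix p assume p: "p \<in> P"
    note vs = vs_at[OF F p] vs_at[OF G p] vs_at[OF coker_diag_ob[OF F G f_mor] p]
    have fp: "f p \<in> mor (Vect K) (obj_at F p) (obj_at G p)" by (rule mor_at[OF f_mor p])
    show "is_kernel (Vect K) (obj_at G p) (obj_at (coker_diag F G f) p) (coker_proj F G f p) (obj_at F p) (f p)"
    proof (rule is_kernel_Vect[OF vs(2,3,1) mor_at[OF coker_proj_mor[OF F G f_mor] p] fp])
      show "f p ` carrier (obj_at F p) = {v \<in> carrier (obj_at G p). coker_proj F G f p v = \<zero>\<^bsub>obj_at (coker_diag F G f) p\<^esub>}"
        by (rule coker_diag_kernel[OF F G f_mor p, symmetric])
      show "inj_on (f p) (carrier (obj_at F p))"
      proof (rule inj_onI)
        fix v w assume vw: "v \<in> carrier (obj_at F p)" "w \<in> carrier (obj_at F p)" "f p v = f p w"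
        interpret X: module K "obj_at F p" by (rule vectorspace_module[OF vs(1)])
        interpret Y: module K "obj_at G p" by (rule vectorspace_module[OF vs(2)])
        have "f p (v \<ominus>\<^bsub>obj_at F p\<^esub> w) = \<zero>\<^bsub>obj_at G p\<^esub>"
          using Vect_mor_minus[OF vs(1,2) fp vw(1,2)] Vect_mor_closed[OF fp vw(2)] vw(3) by (simp add: Y.M.minus_eq Y.M.r_neg)
        then have "v \<ominus>\<^bsub>obj_at F p\<^esub> w = \<zero>\<^bsub>obj_at F p\<^esub>"
          by (rule monic_pointwise[OF F G f p vectorspace_closed(5)[OF vs(1) vw(1,2)]])
        then have "\<ominus>\<^bsub>obj_at F p\<^esub> (\<ominus>\<^bsub>obj_at F p\<^esub> w) = v"
          unfolding X.M.minus_eq by (rule X.M.minus_equality) (simp_all add: vw(1,2))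
        then show "v = w" using vw(2) by simp
      qed
    qed
  qed
qed

text \<open>The projection to the cokernel diagram can be cancelled against the zero morphism, so
  every element of the target already lies in the image.\<close>

lemma epic_pointwise:
  assumes F: "F \<in> ob FC" and G: "G \<in> ob FC" and f: "epic FC F G f" and p: "p \<in> P"
  shows "f p ` carrier (obj_at F p) = carrier (obj_at G p)"
proof -
  have f_mor: "f \<in> mor FC F G" using f unfolding epic_def by simp
  have cancel: "g = h" if "W \<in> ob FC" "g \<in> mor FC G W" "h \<in> mor FC G W" "cmp FC F G W g f = cmp FC F G W h f" for W g h
    using f that unfolding epic_def by simp_all
  let ?Q = "coker_diag F G f" and ?c = "coker_proj F G f"
  have Q: "?Q \<in> ob FC" and c: "?c \<in> mor FC G ?Q"
    using coker_diag_ob[OF F G f_mor] coker_proj_mor[OF F G f_mor] .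
  have "cmp FC F G ?Q ?c f = zerom FC F ?Q"
    using coker_diag_is_cokernel[OF F G f_mor] unfolding is_cokernel_def by simp
  then have "?c = zerom FC G ?Q"
    by (intro cancel[OF Q c]) (simp_all add: FC.zero_mor FC.zero_comp Q F G f_mor)
  from fun_cong[OF this, of p] have "?c p v = \<zero>\<^bsub>obj_at ?Q p\<^esub>" if "v \<in> carrier (obj_at G p)" for v
    using p that by (simp add: FC_simps Vect_zerom)
  then show ?thesis using coker_diag_kernel[OF F G f_mor p] by blast
qed

lemma epic_is_cokernel:
  assumes F: "F \<in> ob FC" and G: "G \<in> ob FC" and f: "epic FC F G f"
  shows "is_cokernel FC (ker_diag F G f) F (ker_incl F G f) G f"
proof -
  have f_mor: "f \<in> mor FC F G" using f unfolding epic_def by simp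
  show ?thesis
  proof (rule cokernel_pointwise[OF ker_diag_ob[OF F G f_mor] F G ker_incl_mor[OF F G f_mor] f_mor])
    fix p assume p: "p \<in> P"
    note vs = vs_at[OF F p] vs_at[OF G p] vs_at[OF ker_diag_ob[OF F G f_mor] p]
    show "is_cokernel (Vect K) (obj_at (ker_diag F G f) p) (obj_at F p) (ker_incl F G f p) (obj_at G p) (f p)"
      by (rule is_cokernel_Vect[OF vs(3,1,2) mor_at[OF ker_incl_mor[OF F G f_mor] p] mor_at[OF f_mor p]
            epic_pointwise[OF F G f p]])
        (use p in \<open>simp add: ker_incl_def ker_diag_def ker_mod_def\<close>)
  qed
qed

lemma abelian_FC:
  assumes "infinite (UNIV :: 'u set)"
  shows "abelian_category (FC :: (('p, ('k, 'u) module, 'u \<Rightarrow> 'u) diagram, 'p \<Rightarrow> 'u \<Rightarrow> 'u) cat)"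
proof -
  obtain \<phi> :: "'u \<times> 'u \<Rightarrow> 'u" where \<phi>: "inj \<phi>" using pairing_exists[OF assms] .
  show ?thesis
    unfolding abelian_category_def additive_category_def
  proof (intro conjI ballI allI impI preadditive_FC exI)
    show "zero_object FC (zero_diag :: ('p, ('k, 'u) module, 'u \<Rightarrow> 'u) diagram)" by (rule zero_object_zero_diag)
  next
    fix F G :: "('p, ('k, 'u) module, 'u \<Rightarrow> 'u) diagram" assume F: "F \<in> ob FC" and G: "G \<in> ob FC"
    show "biproduct FC F G (sum_diag \<phi> F G)" by (rule biproduct_sum_diag[OF \<phi> F G])
    fix f
    show "is_kernel FC F G f (ker_diag F G f) (ker_incl F G f)" "is_cokernel FC F G f (coker_diag F G f) (coker_proj F G f)"
      if "f \<in> mor FC F G"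
      by (rule ker_diag_is_kernel[OF F G that] coker_diag_is_cokernel[OF F G that])+
    show "\<exists>Z\<in>ob FC. \<exists>g\<in>mor FC G Z. is_kernel FC G Z g F f" if f: "monic FC F G f"
    proof -
      have f_mor: "f \<in> mor FC F G" using f unfolding monic_def by simp
      show ?thesis using coker_diag_ob[OF F G f_mor] coker_proj_mor[OF F G f_mor] monic_is_kernel[OF F G f] by blast
    qed
    show "\<exists>Z\<in>ob FC. \<exists>g\<in>mor FC Z F. is_cokernel FC Z F g G f" if f: "epic FC F G f"
    proof -
      have f_mor: "f \<in> mor FC F G" using f unfolding epic_def by simp
      show ?thesis using ker_diag_ob[OF F G f_mor] ker_incl_mor[OF F G f_mor] epic_is_cokernel[OF F G f] by blast
    qed
  qed
qed

end

section \<open>Encodable persistence modules\<close>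

lemma partial_order_on_prod:
  assumes "partial_order_on A r" "partial_order_on B s"
  shows "partial_order_on (A \<times> B) {((a, b), (a', b')). (a, a') \<in> r \<and> (b, b') \<in> s}"
  using partial_order_onD[OF assms(1)] partial_order_onD[OF assms(2)]
  unfolding partial_order_on_def preorder_on_def refl_on_def trans_def antisym_def by (auto; blast)

lemma partial_order_vect_diagrams: "field K \<Longrightarrow> partial_order_on P r \<Longrightarrow> vect_diagrams K P r"
  unfolding vect_diagrams_def partial_order_on_def preorder_on_def refl_on_def by simp

lemma Rn_le_vect_diagrams: "field K \<Longrightarrow> vect_diagrams K (Rn n) (Rn_le n)"
  unfolding vect_diagrams_def Rn_le_def trans_def by (auto intro: order_trans)

lemma PerM_subI:
  fixes P :: "nat set" and M' :: "(nat, ('k, 'u) module, 'u \<Rightarrow> 'u) diagram"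
  assumes "finite P" "partial_order_on P r" "\<And>x. x \<in> Rn n \<Longrightarrow> e x \<in> P"
    and "\<And>x y. (x, y) \<in> Rn_le n \<Longrightarrow> (e x, e y) \<in> r" and "\<And>p. p \<in> P \<Longrightarrow> {x \<in> Rn n. e x = p} \<in> \<XX>"
    and "M' \<in> ob (functor_cat P r (Vect K))" "\<And>p. p \<in> P \<Longrightarrow> vectorspace.fin_dim K (obj_at M' p)"
    and "isomorphic (PerM K n) M (pullback e M')"
  shows "M \<in> ob (PerM_sub K n \<XX>)"
proof -
  have "M \<in> ob (PerM K n)" using assms(8) unfolding isomorphic_def by simp
  moreover have "finitely_encodable_by K n P r e M"
    unfolding finitely_encodable_by_def
  proof (intro conjI assms(1,2) bexI[of _ M'] ballI assms(6-8))
    show "monotone_on (Rn n) (\<le>) (\<lambda>p q. (p, q) \<in> r) e"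
      by (rule monotone_onI) (simp add: assms(4) Rn_le_def)
  qed (simp add: assms(3))
  moreover have "\<forall>p\<in>P. {x \<in> Rn n. e x = p} \<in> \<XX>" using assms(5) by simp
  ultimately show ?thesis unfolding PerM_sub_def by auto
qed

lemma PerM_subE:
  fixes M :: "(nat \<Rightarrow> real, 'k, 'u) pers_module"
  assumes "M \<in> ob (PerM_sub K n \<XX>)"
  obtains P :: "nat set" and r e and M' :: "(nat, ('k, 'u) module, 'u \<Rightarrow> 'u) diagram"
  where "finite P" "partial_order_on P r" "\<forall>x\<in>Rn n. e x \<in> P"
    "\<forall>x y. (x, y) \<in> Rn_le n \<longrightarrow> (e x, e y) \<in> r" "\<forall>p\<in>P. {x \<in> Rn n. e x = p} \<in> \<XX>"
    "M' \<in> ob (functor_cat P r (Vect K))" "\<forall>p\<in>P. vectorspace.fin_dim K (obj_at M' p)"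
    "isomorphic (PerM K n) M (pullback e M')"
proof -
  obtain P :: "nat set" and r e where h: "finitely_encodable_by K n P r e M" "\<forall>p\<in>P. {x \<in> Rn n. e x = p} \<in> \<XX>"
    using assms unfolding PerM_sub_def by auto
  have h': "finite P" "partial_order_on P r" "e \<in> Rn n \<rightarrow> P" "monotone_on (Rn n) (\<le>) (\<lambda>p q. (p, q) \<in> r) e"
    using h(1) unfolding finitely_encodable_by_def by simp_all
  obtain M' :: "(nat, ('k, 'u) module, 'u \<Rightarrow> 'u) diagram"
    where M': "M' \<in> ob (functor_cat P r (Vect K))" "\<forall>p\<in>P. vectorspace.fin_dim K (obj_at M' p)"
      "isomorphic (PerM K n) M (pullback e M')"
    using h(1) unfolding finitely_encodable_by_def by (elim conjE bexE)
  have "\<forall>x\<in>Rn n. e x \<in> P" using h'(3) by blast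
  moreover have "\<forall>x y. (x, y) \<in> Rn_le n \<longrightarrow> (e x, e y) \<in> r"
    using monotone_onD[OF h'(4)] by (simp add: Rn_le_def)
  ultimately show ?thesis using h'(1,2) h(2) M' by (intro that)
qed

text \<open>Naturality squares can be pasted, so it is enough to check them on a relation whose
  transitive closure is the order.\<close>

lemma (in vect_diagrams) natural_trancl:
  assumes r: "r = R\<^sup>+" and M: "M \<in> ob FC" and N: "N \<in> ob FC"
    and \<eta>: "\<And>p. p \<in> P \<Longrightarrow> \<eta> p \<in> mor (Vect K) (obj_at M p) (obj_at N p)" "\<eta> \<in> extensional P"
    and nat: "\<And>p q v. (p, q) \<in> R \<Longrightarrow> v \<in> carrier (obj_at M p) \<Longrightarrow> \<eta> q (map_at M p q v) = map_at N p q (\<eta> p v)"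
  shows "\<eta> \<in> mor FC M N"
proof (rule Vect_natI[OF \<eta>])
  fix p q v assume pq: "(p, q) \<in> r" and v: "v \<in> carrier (obj_at M p)"
  have "(p, q) \<in> R\<^sup>+" using pq r by simp
  then show "\<eta> q (map_at M p q v) = map_at N p q (\<eta> p v)"
  proof (induction rule: trancl_induct)
    case (base y)
    then show ?case by (rule nat[OF _ v])
  next
    case (step y z)
    have py: "(p, y) \<in> r" and yz: "(y, z) \<in> r" using step(1,2) r by auto
    have w: "map_at M p y v \<in> carrier (obj_at M y)" by (rule Vect_mor_closed[OF map_mor[OF M py] v])
    have u: "\<eta> p v \<in> carrier (obj_at N p)" by (rule Vect_mor_closed[OF \<eta>(1)[OF r_in(1)[OF py]] v])
    have "\<eta> z (map_at M p z v) = \<eta> z (map_at M y z (map_at M p y v))" by (simp add: map_comp_at[OF M py yz v])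
    also have "\<dots> = map_at N y z (\<eta> y (map_at M p y v))" by (rule nat[OF step(2) w])
    also have "\<dots> = map_at N y z (map_at N p y (\<eta> p v))" by (simp add: step.IH)
    also have "\<dots> = map_at N p z (\<eta> p v)" by (simp add: map_comp_at[OF N py yz u])
    finally show ?case .
  qed
qed

text \<open>
  A common encoding of two modules through which all morphisms between them factor: on the locus
  \<open>Z\<close> of comparable points with the same image, naturality forces the components of a morphism to
  agree.
\<close>

lemma common_encoding:
  fixes K :: "('k, 'z) ring_scheme" and M N :: "(nat \<Rightarrow> real, 'k, 'u) pers_module"
  assumes K: "field K" and S: "o_minimal_structure S"
    and M: "M \<in> ob (PerM_sub K n (closed_upset_algebra n (S n)))"
    and N: "N \<in> ob (PerM_sub K n (closed_upset_algebra n (S n)))"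
  obtains P :: "nat set" and r e and M' N' :: "(nat, ('k, 'u) module, 'u \<Rightarrow> 'u) diagram"
  where "finite P" "partial_order_on P r" "\<forall>x\<in>Rn n. e x \<in> P"
    "\<forall>x y. (x, y) \<in> Rn_le n \<longrightarrow> (e x, e y) \<in> r" "\<forall>p\<in>P. {x \<in> Rn n. e x = p} \<in> closed_upset_algebra n (S n)"
    "M' \<in> ob (functor_cat P r (Vect K))" "\<forall>p\<in>P. vectorspace.fin_dim K (obj_at M' p)"
    "N' \<in> ob (functor_cat P r (Vect K))" "\<forall>p\<in>P. vectorspace.fin_dim K (obj_at N' p)"
    "isomorphic (PerM K n) M (pullback e M')" "isomorphic (PerM K n) N (pullback e N')"
    "\<forall>f\<in>mor (PerM K n) (pullback e M') (pullback e N'). \<exists>f'\<in>mor (functor_cat P r (Vect K)) M' N'.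
       f = (\<lambda>x\<in>Rn n. f' (e x))"
proof -
  let ?X = "closed_upset_algebra n (S n)"
  obtain P1 :: "nat set" and r1 e1 and M1 :: "(nat, ('k, 'u) module, 'u \<Rightarrow> 'u) diagram"
    where 1: "finite P1" "partial_order_on P1 r1" "\<forall>x\<in>Rn n. e1 x \<in> P1"
      "\<forall>x y. (x, y) \<in> Rn_le n \<longrightarrow> (e1 x, e1 y) \<in> r1" "\<forall>p\<in>P1. {x \<in> Rn n. e1 x = p} \<in> ?X"
      "M1 \<in> ob (functor_cat P1 r1 (Vect K))" "\<forall>p\<in>P1. vectorspace.fin_dim K (obj_at M1 p)"
      "isomorphic (PerM K n) M (pullback e1 M1)"
    by (rule PerM_subE[OF M])
  obtain P2 :: "nat set" and r2 e2 and N2 :: "(nat, ('k, 'u) module, 'u \<Rightarrow> 'u) diagram"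
    where 2: "finite P2" "partial_order_on P2 r2" "\<forall>x\<in>Rn n. e2 x \<in> P2"
      "\<forall>x y. (x, y) \<in> Rn_le n \<longrightarrow> (e2 x, e2 y) \<in> r2" "\<forall>p\<in>P2. {x \<in> Rn n. e2 x = p} \<in> ?X"
      "N2 \<in> ob (functor_cat P2 r2 (Vect K))" "\<forall>p\<in>P2. vectorspace.fin_dim K (obj_at N2 p)"
      "isomorphic (PerM K n) N (pullback e2 N2)"
    by (rule PerM_subE[OF N])
  \<comment> \<open>Formed with both encodings at once, so that the structure maps of both modules
    are identities along a pair of \<open>Z\<close>.\<close>
  define Z where "Z = {(x, y). x \<in> Rn n \<and> y \<in> Rn n \<and> x \<le> y \<and> (e1 x, e2 x) = (e1 y, e2 y)}"
  have Int: "A \<inter> B \<in> ?X" if "A \<in> ?X" "B \<in> ?X" "A \<subseteq> Rn n" for A B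
  proof -
    have "Rn n - ((Rn n - A) \<union> (Rn n - B)) \<in> ?X"
      by (intro closed_upset_algebra.complement closed_upset_algebra.union that)
    moreover have "Rn n - ((Rn n - A) \<union> (Rn n - B)) = A \<inter> B" using that(3) by blast
    ultimately show ?thesis by simp
  qed
  have fib: "{x \<in> Rn n. (e1 x, e2 x) = q} \<in> ?X" if q: "q \<in> P1 \<times> P2" for q
  proof -
    have "{x \<in> Rn n. (e1 x, e2 x) = q} = {x \<in> Rn n. e1 x = fst q} \<inter> {x \<in> Rn n. e2 x = snd q}" by auto
    moreover have "{x \<in> Rn n. e1 x = fst q} \<in> ?X" "{x \<in> Rn n. e2 x = snd q} \<in> ?X" using 1(5) 2(5) q by auto
    ultimately show ?thesis using Int by simp
  qed
  obtain P :: "nat set" and e where P: "finite P" "e ` Rn n = P"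
    "partial_order_on P ({(e x, e y) | x y. (x, y) \<in> Rn_le n}\<^sup>+)"
    "\<forall>p\<in>P. {x \<in> Rn n. e x = p} \<in> ?X"
    "\<forall>x\<in>Rn n. \<forall>y\<in>Rn n. e x = e y \<longrightarrow> (x, y) \<in> (Z \<union> Z\<inverse>)\<^sup>*"
  proof (rule o_minimal_structure.refine_encoding[OF S, of "P1 \<times> P2" "{((a, b), (a', b')). (a, a') \<in> r1 \<and> (b, b') \<in> r2}"
        "\<lambda>x. (e1 x, e2 x)" n Z])
    show "partial_order_on (P1 \<times> P2) {((a, b), (a', b')). (a, a') \<in> r1 \<and> (b, b') \<in> r2}"
      by (rule partial_order_on_prod[OF 1(2) 2(2)])
  qed (use 1 2 fib in \<open>simp_all add: Z_def Rn_le_def\<close>)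
  define R where "R = {(e x, e y) | x y. (x, y) \<in> Rn_le n}"
  \<comment> \<open>A representative point for each class. The old encodings are recovered on
    \<open>Rn n\<close> as functions of the class by evaluating them at
    \<open>s (e x)\<close>.\<close>
  define s where "s p = (SOME x. x \<in> Rn n \<and> e x = p)" for p
  have eP: "e x \<in> P" if "x \<in> Rn n" for x using P(2) that by blast
  have s: "s p \<in> Rn n \<and> e (s p) = p" if p: "p \<in> P" for p
  proof -
    obtain x where "x \<in> Rn n \<and> e x = p" using P(2) p by blast
    then show ?thesis unfolding s_def by (rule someI[of "\<lambda>x. x \<in> Rn n \<and> e x = p"])
  qed
  \<comment> \<open>A function that agrees along pairs of \<open>Z\<close> agrees along every zigzag
    of such pairs, so it depends only on the class. This is used for the old encodings and for the
    components of a morphism.\<close>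
  have const: "h (s (e x)) = h x" if x: "x \<in> Rn n" and h: "\<And>y z. (y, z) \<in> Z \<Longrightarrow> h y = h z" for h :: "(nat \<Rightarrow> real) \<Rightarrow> 'c" and x
  proof -
    have "(s (e x), x) \<in> (Z \<union> Z\<inverse>)\<^sup>*" using P(5)[rule_format, of "s (e x)" x] s[OF eP[OF x]] x by simp
    then show ?thesis
    proof (induction rule: converse_rtrancl_induct)
      case base
      show ?case by (rule refl)
    next
      case (step y z)
      then have "h y = h z" using h by (metis Un_iff converse_iff)
      then show ?case using step.IH by simp
    qed
  qed
  have e1: "e1 (s (e x)) = e1 x" and e2: "e2 (s (e x)) = e2 x" if "x \<in> Rn n" for x
    by (rule const[OF that]; simp add: Z_def)+
  have mono1: "(e1 (s p), e1 (s q)) \<in> r1" and mono2: "(e2 (s p), e2 (s q)) \<in> r2" if "(p, q) \<in> R\<^sup>+" for p q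
  proof -
    have t: "trans r1" "trans r2" using partial_order_onD(2) 1(2) 2(2) by auto
    have b: "(e1 (s p), e1 (s q)) \<in> r1 \<and> (e2 (s p), e2 (s q)) \<in> r2" if pq: "(p, q) \<in> R" for p q
    proof -
      obtain x y where xy: "(x, y) \<in> Rn_le n" "p = e x" "q = e y" using pq unfolding R_def by blast
      then have "x \<in> Rn n" "y \<in> Rn n" by (simp_all add: Rn_le_def)
      then show ?thesis using xy 1(4) 2(4) by (simp add: e1 e2)
    qed
    from that have "(e1 (s p), e1 (s q)) \<in> r1 \<and> (e2 (s p), e2 (s q)) \<in> r2"
    proof (induction rule: trancl_induct)
      case (base y)
      then show ?case by (rule b)
    next
      case (step y z)
      then show ?case using b[OF step(2)] transD[OF t(1)] transD[OF t(2)] by blast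
    qed
    then show "(e1 (s p), e1 (s q)) \<in> r1" "(e2 (s p), e2 (s q)) \<in> r2" by simp_all
  qed
  \<comment> \<open>The old modules are pulled back along the maps from classes to the old posets.
    Pulling back further along \<open>e\<close> returns the original pullbacks at all points of
    \<open>Rn n\<close>.\<close>
  let ?M = "pullback (\<lambda>p. e1 (s p)) M1" and ?N = "pullback (\<lambda>p. e2 (s p)) N2"
  interpret V: vect_diagrams K P "R\<^sup>+" "TYPE('u)"
    unfolding R_def by (rule partial_order_vect_diagrams[OF K P(3)])
  interpret D: vect_diagrams K "Rn n" "Rn_le n" "TYPE('u)" by (rule Rn_le_vect_diagrams[OF K])
  interpret V1: vect_diagrams K P1 r1 "TYPE('u)" by (rule partial_order_vect_diagrams[OF K 1(2)])
  interpret V2: vect_diagrams K P2 r2 "TYPE('u)" by (rule partial_order_vect_diagrams[OF K 2(2)])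
  have M': "?M \<in> ob V.FC" using mono1 s 1(3) by (intro pullback_ob[OF 1(6)]) auto
  have N': "?N \<in> ob V.FC" using mono2 s 2(3) by (intro pullback_ob[OF 2(6)]) auto
  have eR: "(e x, e y) \<in> R" if "(x, y) \<in> Rn_le n" for x y using that unfolding R_def by blast
  have simps: "obj_at (pullback e ?M) x = obj_at (pullback e1 M1) x" "map_at (pullback e ?M) x y = map_at (pullback e1 M1) x y"
    "obj_at (pullback e ?N) x = obj_at (pullback e2 N2) x" "map_at (pullback e ?N) x y = map_at (pullback e2 N2) x y"
    if "x \<in> Rn n" "y \<in> Rn n" for x y using that by (simp_all add: pullback_simps e1 e2)
  have iso1: "isomorphic (PerM K n) M (pullback e ?M)"
  proof -
    have "pullback e1 M1 \<in> ob D.FC" using 1(8) unfolding isomorphic_def PerM_def by simp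
    from D.diagram_cong(2)[OF this, of "pullback e ?M"] simps
    have "isomorphic D.FC (pullback e1 M1) (pullback e ?M)" by simp
    with 1(8) show ?thesis unfolding PerM_def by (rule D.FC.isomorphic_trans)
  qed
  have iso2: "isomorphic (PerM K n) N (pullback e ?N)"
  proof -
    have "pullback e2 N2 \<in> ob D.FC" using 2(8) unfolding isomorphic_def PerM_def by simp
    from D.diagram_cong(2)[OF this, of "pullback e ?N"] simps
    have "isomorphic D.FC (pullback e2 N2) (pullback e ?N)" by simp
    with 2(8) show ?thesis unfolding PerM_def by (rule D.FC.isomorphic_trans)
  qed
  have full: "\<exists>f'\<in>mor V.FC ?M ?N. f = (\<lambda>x\<in>Rn n. f' (e x))"
    if f: "f \<in> mor D.FC (pullback e ?M) (pullback e ?N)" for f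
  proof
    have f_at: "f x \<in> mor (Vect K) (obj_at M1 (e1 x)) (obj_at N2 (e2 x))" if "x \<in> Rn n" for x
      using D.mor_at[OF f that] that by (simp add: pullback_simps e1 e2)
    have f_nat: "f y (map_at M1 (e1 x) (e1 y) v) = map_at N2 (e2 x) (e2 y) (f x v)"
      if "(x, y) \<in> Rn_le n" "v \<in> carrier (obj_at M1 (e1 x))" for x y v
      using D.mor_nat_at[OF f that(1), of v] that(2) D.r_in[OF that(1)] by (simp add: pullback_simps e1 e2)
    \<comment> \<open>Along a pair of \<open>Z\<close> the structure maps of both modules start and
      end at the same element of the old posets, so they are identities, and naturality reduces to
      \<open>f x = f y\<close>.\<close>
    have f_Z: "f x = f y" if Z: "(x, y) \<in> Z" for x y
    proof -
      have xy: "(x, y) \<in> Rn_le n" "x \<in> Rn n" "y \<in> Rn n" "e1 y = e1 x" "e2 y = e2 x"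
        using Z by (simp_all add: Z_def Rn_le_def)
      have x: "e1 x \<in> P1" "e2 x \<in> P2" using 1(3) 2(3) xy(2) by simp_all
      show ?thesis
      proof (rule Vect_mor_eqI[OF f_at[OF xy(2)] f_at[OF xy(3), unfolded xy(4,5)]])
        fix v assume v: "v \<in> carrier (obj_at M1 (e1 x))"
        have "f y v = f y (map_at M1 (e1 x) (e1 y) v)" using V1.map_id_at[OF 1(6) x(1) v] by (simp add: xy(4))
        also have "\<dots> = map_at N2 (e2 x) (e2 y) (f x v)" by (rule f_nat[OF xy(1) v])
        also have "\<dots> = f x v"
          using V2.map_id_at[OF 2(6) x(2) Vect_mor_closed[OF f_at[OF xy(2)] v]] by (simp add: xy(5))
        finally show "f x v = f y v" by (rule sym)
      qed
    qed
    have f_s: "f (s (e x)) = f x" if "x \<in> Rn n" for x by (rule const[OF that f_Z])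
    let ?f = "\<lambda>p\<in>P. f (s p)"
    show "f = (\<lambda>x\<in>Rn n. ?f (e x))"
      by (rule extensionalityI[of _ "Rn n"]) (simp_all add: D.mor_ext[OF f] eP f_s)
    show "?f \<in> mor V.FC ?M ?N"
    proof (rule V.natural_trancl[OF refl M' N'])
      show "?f p \<in> mor (Vect K) (obj_at ?M p) (obj_at ?N p)" if "p \<in> P" for p
        using f_at s[OF that] that by (simp add: pullback_simps)
      fix p q v assume pq: "(p, q) \<in> R" and v: "v \<in> carrier (obj_at ?M p)"
      obtain x y where xy: "(x, y) \<in> Rn_le n" "p = e x" "q = e y" using pq unfolding R_def by blast
      note in_Rn = D.r_in[OF xy(1)]
      show "?f q (map_at ?M p q v) = map_at ?N p q (?f p v)"
        using f_nat[OF xy(1), of v] v by (simp add: xy(2,3) pullback_simps e1 e2 f_s eP in_Rn)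
    qed simp
  qed
  have eR': "\<forall>x y. (x, y) \<in> Rn_le n \<longrightarrow> (e x, e y) \<in> R\<^sup>+" using eR by blast
  have eP': "\<forall>x\<in>Rn n. e x \<in> P" using eP by blast
  have fd1: "\<forall>p\<in>P. vectorspace.fin_dim K (obj_at ?M p)" using 1(3,7) s by (simp add: pullback_simps)
  have fd2: "\<forall>p\<in>P. vectorspace.fin_dim K (obj_at ?N p)" using 2(3,7) s by (simp add: pullback_simps)
  have full': "\<forall>f\<in>mor (PerM K n) (pullback e ?M) (pullback e ?N). \<exists>f'\<in>mor V.FC ?M ?N. f = (\<lambda>x\<in>Rn n. f' (e x))"
    unfolding PerM_def using full by (rule ballI)
  show thesis
    by (rule that[OF P(1) P(3)[folded R_def] eP' eR' P(4) M' fd1 N' fd2 iso1 iso2 full'])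
qed

section \<open>The full subcategory of encodable modules\<close>

context
  fixes C :: "('o, 'm) cat" and \<B>
  assumes sub: "\<B> \<subseteq> ob C"
begin

lemma preadditive_full: "preadditive C \<Longrightarrow> preadditive (C\<lparr>ob := \<B>\<rparr>)"
  using sub unfolding preadditive_def Defs.category_def by (simp add: subset_iff)

lemma zero_object_full: "zero_object C Z \<Longrightarrow> Z \<in> \<B> \<Longrightarrow> zero_object (C\<lparr>ob := \<B>\<rparr>) Z"
  using sub unfolding zero_object_def by (simp add: subset_iff)

end

lemma biproduct_full: "biproduct C X Y B \<Longrightarrow> B \<in> \<B> \<Longrightarrow> biproduct (C\<lparr>ob := \<B>\<rparr>) X Y B"
  unfolding biproduct_def by simp

context
  fixes K :: "('k, 'z) ring_scheme" and n :: nat and S :: "nat \<Rightarrow> (nat \<Rightarrow> real) set set"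
  assumes K: "field K" and S: "o_minimal_structure S" and inf: "infinite (UNIV :: 'u set)"
begin

interpretation D: vect_diagrams K "Rn n" "Rn_le n" "TYPE('u)" by (rule Rn_le_vect_diagrams[OF K])

private abbreviation (input) "\<XX> \<equiv> closed_upset_algebra n (S n)"
private abbreviation (input) PM :: "((nat \<Rightarrow> real, 'k, 'u) pers_module, (nat \<Rightarrow> real) \<Rightarrow> 'u \<Rightarrow> 'u) cat" where "PM \<equiv> PerM K n"
private abbreviation (input) PS :: "((nat \<Rightarrow> real, 'k, 'u) pers_module, (nat \<Rightarrow> real) \<Rightarrow> 'u \<Rightarrow> 'u) cat" where "PS \<equiv> PerM_sub K n \<XX>"

lemma PerM_sub_sub: "ob PS \<subseteq> ob PM"
  by (auto simp: PerM_sub_def)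

lemma PerM_sub_full: "PS = PM\<lparr>ob := ob PS\<rparr>"
  by (simp add: PerM_sub_def)

text \<open>Encoded by the poset with one element, whose single fibre is all of \<open>Rn n\<close>,
  the complement of the empty set.\<close>

lemma zero_diag_PerM_sub: "(zero_diag :: (nat \<Rightarrow> real, 'k, 'u) pers_module) \<in> ob PS"
proof -
  have po: "partial_order_on {0::nat} {(0, 0)}"
    by (simp add: partial_order_on_def preorder_on_def refl_on_def trans_def antisym_def)
  interpret V: vect_diagrams K "{0::nat}" "{(0, 0)}" "TYPE('u)" by (rule partial_order_vect_diagrams[OF K po])
  have fib: "Rn n \<in> \<XX>" using closed_upset_algebra.complement[OF closed_upset_algebra.empty, of n "S n"] by simp
  have pb: "pullback (\<lambda>_. 0 :: nat) zero_diag = (zero_diag :: (nat \<Rightarrow> real, 'k, 'u) pers_module)"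
    by (simp add: pullback_def zero_diag_def)
  show ?thesis
  proof (rule PerM_subI[of "{0::nat}" "{(0, 0)}" n "\<lambda>_. 0" \<XX> zero_diag])
    show "isomorphic PM zero_diag (pullback (\<lambda>_. 0 :: nat) zero_diag)"
      unfolding pb PerM_def by (rule D.FC.isomorphic_refl[OF D.zero_diag_ob])
    show "zero_diag \<in> ob V.FC" by (rule V.zero_diag_ob)
    show "vectorspace.fin_dim K (obj_at (zero_diag :: (nat, ('k, 'u) module, 'u \<Rightarrow> 'u) diagram) p)" for p
      by (simp add: zero_diag_def zero_mod_fin_dim[OF K])
  qed (simp_all add: po fib)
qed

text \<open>Over a common encoding the direct sum can be formed on the finite poset, since
  \<open>pullback\<close> commutes with \<open>sum_diag\<close> on the nose.\<close>

lemma additive_PerM_sub: "additive_category PS"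
  unfolding additive_category_def
proof (intro conjI ballI)
  show "preadditive PS"
    using preadditive_full[OF PerM_sub_sub] D.preadditive_FC by (subst PerM_sub_full) (simp add: PerM_def)
  have "zero_object PM zero_diag" unfolding PerM_def by (rule D.zero_object_zero_diag)
  from zero_object_full[OF PerM_sub_sub this zero_diag_PerM_sub]
  have "zero_object PS zero_diag" by (simp only: PerM_sub_full[symmetric])
  then show "\<exists>Z. zero_object PS Z" by (rule exI)
next
  fix M N assume M: "M \<in> ob PS" and N: "N \<in> ob PS"
  obtain \<phi> :: "'u \<times> 'u \<Rightarrow> 'u" where \<phi>: "inj \<phi>" using pairing_exists[OF inf] .
  obtain P :: "nat set" and r e and M' N' :: "(nat, ('k, 'u) module, 'u \<Rightarrow> 'u) diagram"
    where e: "finite P" "partial_order_on P r" "\<forall>x\<in>Rn n. e x \<in> P"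
      "\<forall>x y. (x, y) \<in> Rn_le n \<longrightarrow> (e x, e y) \<in> r" "\<forall>p\<in>P. {x \<in> Rn n. e x = p} \<in> \<XX>"
      and M': "M' \<in> ob (functor_cat P r (Vect K))" "\<forall>p\<in>P. vectorspace.fin_dim K (obj_at M' p)"
      and N': "N' \<in> ob (functor_cat P r (Vect K))" "\<forall>p\<in>P. vectorspace.fin_dim K (obj_at N' p)"
      and iso: "isomorphic PM M (pullback e M')" "isomorphic PM N (pullback e N')"
    by (rule common_encoding[OF K S M N])
  interpret V: vect_diagrams K P r "TYPE('u)" by (rule partial_order_vect_diagrams[OF K e(2)])
  have pb: "pullback e M' \<in> ob D.FC" "pullback e N' \<in> ob D.FC"
    using e(3,4) by (auto intro!: pullback_ob[OF M'(1)] pullback_ob[OF N'(1)])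
  have sum: "pullback e (sum_diag \<phi> M' N') = sum_diag \<phi> (pullback e M') (pullback e N')"
    by (simp add: pullback_def sum_diag_def)
  have "pullback e (sum_diag \<phi> M' N') \<in> ob PS"
  proof (rule PerM_subI[OF e(1,2), of n e \<XX> "sum_diag \<phi> M' N'"])
    show "sum_diag \<phi> M' N' \<in> ob V.FC" by (rule V.sum_diag_ob[OF \<phi> M'(1) N'(1)])
    show "vectorspace.fin_dim K (obj_at (sum_diag \<phi> M' N') p)" if "p \<in> P" for p
      using V.sum_diag_fin_dim[OF \<phi> M'(1) N'(1) that] M'(2) N'(2) that by simp
    show "isomorphic PM (pullback e (sum_diag \<phi> M' N')) (pullback e (sum_diag \<phi> M' N'))"
      unfolding sum PerM_def by (rule D.FC.isomorphic_refl[OF D.sum_diag_ob[OF \<phi> pb]])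
  qed (use e in simp_all)
  moreover have "biproduct PM M N (pullback e (sum_diag \<phi> M' N'))"
    using D.FC.biproduct_transport[OF iso[unfolded PerM_def] D.biproduct_sum_diag[OF \<phi> pb]]
    unfolding sum PerM_def .
  ultimately have "biproduct (PM\<lparr>ob := ob PS\<rparr>) M N (pullback e (sum_diag \<phi> M' N'))" by (intro biproduct_full)
  then have "biproduct PS M N (pullback e (sum_diag \<phi> M' N'))" by (simp only: PerM_sub_full[symmetric])
  then show "\<exists>B. biproduct PS M N B" by (rule exI)
qed

text \<open>Over the common encoding the morphism becomes the pullback of some \<open>f'\<close>.
  Its kernel and cokernel on the finite poset are pointwise finite dimensional, and pulling them
  back preserves their universal property because it can be checked at each point.\<close>

lemma kernel_cokernel_PerM_sub:
  assumes M: "M \<in> ob PS" and N: "N \<in> ob PS" and f: "f \<in> mor PM M N"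
  shows "\<exists>L\<in>ob PS. \<exists>k. is_kernel PM M N f L k" and "\<exists>L\<in>ob PS. \<exists>c. is_cokernel PM M N f L c"
proof -
  obtain P :: "nat set" and r e and M' N' :: "(nat, ('k, 'u) module, 'u \<Rightarrow> 'u) diagram"
    where e: "finite P" "partial_order_on P r" "\<forall>x\<in>Rn n. e x \<in> P"
      "\<forall>x y. (x, y) \<in> Rn_le n \<longrightarrow> (e x, e y) \<in> r" "\<forall>p\<in>P. {x \<in> Rn n. e x = p} \<in> \<XX>"
      and M': "M' \<in> ob (functor_cat P r (Vect K))" "\<forall>p\<in>P. vectorspace.fin_dim K (obj_at M' p)"
      and N': "N' \<in> ob (functor_cat P r (Vect K))" "\<forall>p\<in>P. vectorspace.fin_dim K (obj_at N' p)"
      and iso: "isomorphic PM M (pullback e M')" "isomorphic PM N (pullback e N')"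
      and full: "\<forall>g\<in>mor PM (pullback e M') (pullback e N'). \<exists>f'\<in>mor (functor_cat P r (Vect K)) M' N'.
        g = (\<lambda>x\<in>Rn n. f' (e x))"
    by (rule common_encoding[OF K S M N])
  interpret V: vect_diagrams K P r "TYPE('u)" by (rule partial_order_vect_diagrams[OF K e(2)])
  note full = full[unfolded PerM_def] and f = f[unfolded PerM_def]
  have e_in: "e x \<in> P" if "x \<in> Rn n" for x using e(3) that by simp
  have e_r: "(e x, e y) \<in> r" if "(x, y) \<in> Rn_le n" for x y using e(4) that by simp
  let ?M = "pullback e M'" and ?N = "pullback e N'"
  obtain a a' where a: "M \<in> ob D.FC" "?M \<in> ob D.FC" "a \<in> mor D.FC M ?M" "a' \<in> mor D.FC ?M M"
    "cmp D.FC M ?M M a' a = idm D.FC M" "cmp D.FC ?M M ?M a a' = idm D.FC ?M"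
    using D.FC.isomorphicE[OF iso(1)[unfolded PerM_def]] .
  obtain b b' where b: "N \<in> ob D.FC" "?N \<in> ob D.FC" "b \<in> mor D.FC N ?N" "b' \<in> mor D.FC ?N N"
    "cmp D.FC N ?N N b' b = idm D.FC N" "cmp D.FC ?N N ?N b b' = idm D.FC ?N"
    using D.FC.isomorphicE[OF iso(2)[unfolded PerM_def]] .
  \<comment> \<open>\<open>f\<close> conjugated by the two isomorphisms; only a morphism between the
    pullbacks themselves is known to come from the finite poset.\<close>
  let ?g = "cmp D.FC ?M N ?N b (cmp D.FC ?M M N f a')"
  have g: "?g \<in> mor D.FC ?M ?N" using a b f by (simp add: D.FC.comp_mor)
  have ga: "cmp D.FC M ?M ?N ?g a = cmp D.FC M N ?N b f"
    using a b f by (simp add: D.FC.assoc[symmetric, of M ?M N ?N] D.FC.assoc[symmetric, of M ?M M N]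
        D.FC.comp_mor D.FC.comp_id)
  obtain f' where f': "f' \<in> mor V.FC M' N'" and gf: "?g = (\<lambda>x\<in>Rn n. f' (e x))" using full g by blast
  have sub: "pullback e L \<in> ob PS" if "L \<in> ob V.FC" "\<And>p. p \<in> P \<Longrightarrow> vectorspace.fin_dim K (obj_at L p)" for L
  proof (rule PerM_subI[OF e(1,2), of n e \<XX> L])
    have "pullback e L \<in> ob D.FC" by (rule pullback_ob[OF that(1) e_in e_r])
    then show "isomorphic PM (pullback e L) (pullback e L)" unfolding PerM_def by (rule D.FC.isomorphic_refl)
  qed (use e that in simp_all)
  let ?L = "V.ker_diag M' N' f'" and ?k = "V.ker_incl M' N' f'"
  have L: "?L \<in> ob V.FC" by (rule V.ker_diag_ob[OF M'(1) N'(1) f'])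
  have k: "?k \<in> mor V.FC ?L M'" by (rule V.ker_incl_mor[OF M'(1) N'(1) f'])
  have "is_kernel D.FC ?M ?N ?g (pullback e ?L) (\<lambda>x\<in>Rn n. ?k (e x))"
  proof (rule D.kernel_pointwise[OF a(2) b(2) _ g])
    show "pullback e ?L \<in> ob D.FC" by (rule pullback_ob[OF L e_in e_r])
    show "(\<lambda>x\<in>Rn n. ?k (e x)) \<in> mor D.FC (pullback e ?L) ?M" by (rule pullback_mor[OF k D.r_sub e_in e_r])
    show "is_kernel (Vect K) (obj_at ?M x) (obj_at ?N x) (?g x) (obj_at (pullback e ?L) x) ((\<lambda>x\<in>Rn n. ?k (e x)) x)"
      if "x \<in> Rn n" for x
      using V.ker_diag_pointwise[OF M'(1) N'(1) f' e_in[OF that]] that by (simp add: gf pullback_simps)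
  qed
  from D.FC.kernel_transport[OF a(1,2) b(1,2) a(3-6) b(3-5) f g ga this]
  have "\<exists>k. is_kernel PM M N f (pullback e ?L) k" unfolding PerM_def by blast
  moreover have "pullback e ?L \<in> ob PS"
    using sub[OF L] V.ker_diag_fin_dim[OF M'(1) N'(1) f'] M'(2) by simp
  ultimately show "\<exists>L\<in>ob PS. \<exists>k. is_kernel PM M N f L k" by (rule rev_bexI[rotated])
  let ?L = "V.coker_diag M' N' f'" and ?c = "V.coker_proj M' N' f'"
  have L: "?L \<in> ob V.FC" by (rule V.coker_diag_ob[OF M'(1) N'(1) f'])
  have c: "?c \<in> mor V.FC N' ?L" by (rule V.coker_proj_mor[OF M'(1) N'(1) f'])
  have "is_cokernel D.FC ?M ?N ?g (pullback e ?L) (\<lambda>x\<in>Rn n. ?c (e x))"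
  proof (rule D.cokernel_pointwise[OF a(2) b(2) _ g])
    show "pullback e ?L \<in> ob D.FC" by (rule pullback_ob[OF L e_in e_r])
    show "(\<lambda>x\<in>Rn n. ?c (e x)) \<in> mor D.FC ?N (pullback e ?L)" by (rule pullback_mor[OF c D.r_sub e_in e_r])
    show "is_cokernel (Vect K) (obj_at ?M x) (obj_at ?N x) (?g x) (obj_at (pullback e ?L) x) ((\<lambda>x\<in>Rn n. ?c (e x)) x)"
      if "x \<in> Rn n" for x
      using V.coker_diag_pointwise[OF M'(1) N'(1) f' e_in[OF that]] that by (simp add: gf pullback_simps)
  qed
  from D.FC.cokernel_transport[OF a(1,2) b(1,2) a(3,4,6) b(3-6) f g ga this]
  have "\<exists>c. is_cokernel PM M N f (pullback e ?L) c" unfolding PerM_def by blast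
  moreover have "pullback e ?L \<in> ob PS"
    using sub[OF L] V.coker_diag_fin_dim[OF M'(1) N'(1) f'] N'(2) by simp
  ultimately show "\<exists>L\<in>ob PS. \<exists>c. is_cokernel PM M N f L c" by (rule rev_bexI[rotated])
qed

end

theorem theorem1p1:
  fixes K :: "('k, 'z) ring_scheme" and n :: nat
    and S :: "nat \<Rightarrow> (nat \<Rightarrow> real) set set"
  assumes "n \<ge> 1"
    and "field K"
    and "o_minimal_structure S"
    and "infinite (UNIV :: 'u set)"
  shows "full_abelian_subcategory
    (PerM_sub K n (closed_upset_algebra n (S n)))
    (PerM K n :: ((nat \<Rightarrow> real, 'k, 'u) pers_module, (nat \<Rightarrow> real) \<Rightarrow> 'u \<Rightarrow> 'u) cat)"
proof -
  let ?A = "PerM K n :: ((nat \<Rightarrow> real, 'k, 'u) pers_module, (nat \<Rightarrow> real) \<Rightarrow> 'u \<Rightarrow> 'u) cat"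
  let ?B = "PerM_sub K n (closed_upset_algebra n (S n)) ::
    ((nat \<Rightarrow> real, 'k, 'u) pers_module, (nat \<Rightarrow> real) \<Rightarrow> 'u \<Rightarrow> 'u) cat"
  interpret D: vect_diagrams K "Rn n" "Rn_le n" "TYPE('u)" by (rule Rn_le_vect_diagrams[OF assms(2)])
  note sub = PerM_sub_sub[OF assms(2-4)] and full = PerM_sub_full[OF assms(2-4)]
  have mor: "mor ?B = mor ?A" by (simp add: PerM_sub_def)
  show ?thesis
    unfolding full_abelian_subcategory_def full_subcategory_def
  proof (intro conjI ballI allI impI sub full)
    show "abelian_category ?A" unfolding PerM_def by (rule D.abelian_FC[OF assms(4)])
    show "additive_category ?B" by (rule additive_PerM_sub[OF assms(2-4)])
    fix M N f assume M: "M \<in> ob ?B" and N: "N \<in> ob ?B" and "f \<in> mor ?B M N"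
    then have f: "f \<in> mor ?A M N" by (simp add: mor)
    have ob: "M \<in> ob D.FC" "N \<in> ob D.FC" using M N sub unfolding PerM_def by blast+
    \<comment> \<open>The definition asks about every kernel in the ambient category. All of them
      are isomorphic to the one constructed over the finite poset.\<close>
    show "\<exists>L\<in>ob ?B. isomorphic ?A L' L" if k: "is_kernel ?A M N f L' k" for L' k
      using kernel_cokernel_PerM_sub(1)[OF assms(2-4) M N f] D.FC.kernel_unique[OF ob k[unfolded PerM_def]]
      unfolding PerM_def by blast
    show "\<exists>L\<in>ob ?B. isomorphic ?A L' L" if c: "is_cokernel ?A M N f L' c" for L' c
      using kernel_cokernel_PerM_sub(2)[OF assms(2-4) M N f] D.FC.cokernel_unique[OF ob c[unfolded PerM_def]]
      unfolding PerM_def by blast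
  qed
qed

end
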